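(* Let $\mathcal X,\mathcal Y,\mathcal H,L_1,L_2,\mathcal W,\mathcal H_{2\pi,0},\mathcal W_{2\pi,0},N_1,N_2$ be as in the context. Assume: (H1) $L_1:\mathcal X\to\mathcal Y$ is a homeomorphism. (H2) The spectrum $\sigma(L_2)$ (computed with respect to $\mathcal H_{\mathbb C}$) contains a simple eigenvalue $\nu_0:=\mathrm i\,\omega_0$, $\omega_0>0$, whereas $k\nu_0\notin\sigma(L_2)$ for all integers $k\ge 2$. (H3) The operator $\mathscr Q: w\in\mathcal W_{2\pi,0}\mapsto \omega_0\,w_\tau+L_2(w)\in\mathcal H_{2\pi,0}$ is Fredholm of index $0$. (H4) $N_1,N_2$ are analytic in a neighborhood of the origin: there is $\delta>0$ such that for all $(v,w,\mu)\in \mathcal X\times\mathcal W_{2\pi,0}\times\mathbb R$ with $\|v\|_{\mathcal X}+\|w\|_{\mathcal W_{2\pi,0}}+|\mu|<\delta$ the Taylor series $$N_1(v,w,\mu)=\sum_{k,l,m=0}^\infty R_{klm}v^kw^l\mu^m,\qquad N_2(v,w,\mu)=\sum_{k,l,m=0}^\infty S_{klm}v^kw^l\mu^m$$ are absolutely convergent in $\mathcal Y$ and $\mathcal H_{2\pi,0}$, respectively; moreover, the multilinear operators $R_{klm},S_{klm}$ satisfy $R_{klm}=S_{klm}=0$ whenever $k+l+m\le 1$, and $R_{011}=R_{00m}=S_{00m}=0$ for all $m\ge 2$. Let $v_1,v_1^*,v_2^*$ be as in the context and assume in addition that $$(S_{011}(v_1)\,|\,v_1^* )\neq 0 .$$ Consider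 the system $$L_1(v)=N_1(v,w,\mu)\ \text{ in }\mathcal Y,\qquad \omega\,w_\tau+L_2(w)=N_2(v,w,\mu)\ \text{ in }\mathcal H_{2\pi,0},\tag{E}$$ and the side condition $$(w|v_1^* )=\varepsilon,\qquad (w|v_2^* )=0.\tag{S}$$ Then the following properties are valid. (a) Existence. There are analytic families $$\big(v(\varepsilon),w(\varepsilon),\omega(\varepsilon),\mu(\varepsilon)\big)\in\mathcal X\times\mathcal W_{2\pi,0}\times\mathbb R_+\times\mathbb R$$ satisfying (E) and (S) for all $\varepsilon$ in a neighborhood $\mathcal I(0)\subset\mathbb R$ of $0$ and such that $$\big(v(\varepsilon),\,w(\varepsilon)-\varepsilon v_1,\,\omega(\varepsilon),\,\mu(\varepsilon)\big)\to(0,0,\omega_0,0)\quad\text{as }\varepsilon\to0.$$ (b) Uniqueness. There is a neighborhood $U(0,0,\omega_0,0)\subset\mathcal X\times\mathcal W_{2\pi,0}\times\mathbb R_+\times\mathbb R$ of $(0,0,\omega_0,0)$ such that every (nontrivial) $2\pi$-periodic solution $(z,s)$ to (E) lying in $U$ must coincide, up to a phase shift, with that member of the family in (a) having $\varepsilon\equiv(s|v_1^* )$. (c) Parity. The functions $\omega(\varepsilon)$ and $\mu(\varepsilon)$ are even: $\omega(\varepsilon)=\omega(-\varepsilon)$ and $\mu(\varepsilon)=\mu(-\varepsilon)$ for all $\varepsilon\in\mathcal I(0)$. Consequently, unless $\mu\equiv0$, the bifurcation due to these solutions is either subcritical or supercritical, a two-sided bifurcation being excluded.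
   Context: $\mathcal X,\mathcal Y$ are Banach spaces and $\mathcal H$ is a Hilbert space with scalar product $\langle\cdot,\cdot\rangle$; $B_{\mathbb C}=B+\mathrm i B$ denotes the complexification of a real space $B$, and $\langle\cdot,\cdot\rangle$ is extended to $\mathcal H_{\mathbb C}$ as a complex bilinear form. $L_1:\mathcal X\to\mathcal Y$ is a bounded linear operator; $L_2:\mathsf D[L_2]\subset\mathcal H\to\mathcal H$ is a densely defined, closed linear operator with non-empty resolvent set. $\theta$ is a fixed element of the resolvent set (with the sign convention that $L_2+\theta I$ is boundedly invertible, $I$ being the identity), and $\mathcal W$ is the linear subspace $\mathsf D[L_2]$ of $\mathcal H$, closed under the norm $\|w\|_{\mathcal W}=\|(L_2+\theta I)w\|_{\mathcal H}$. For a $2\pi$-periodic function $w$, $\overline w=\frac1{2\pi}\int_{-\pi}^{\pi}w(t)\,dt$. Define $$\mathcal H_{2\pi,0}=\{w\in L^2(-\pi,\pi;\mathcal H):\ w\ 2\pi\text{-periodic with}\ \overline w=0\},$$ $$\mathcal W_{2\pi,0}=\{w\in L^2(-\pi,\pi;\mathcal W),\ w_t\in L^2(-\pi,\pi;\mathcal H):\ w\ 2\pi\text{-periodic with}\ \overline w=0\},$$ with norms $\|w\|_{\mathcal H_{2\pi,0}}=(\int_{-\pi}^\pi\|w(s)\|_{\mathcal H}^2ds)^{1/2}$ and $\|w\|_{\mathcal W_{2\pi,0}}=(\int_{-\pi}^\pi(\|w(s)\|_{\mathcal W}^2+\|w_s(s)\|_{\mathcal H}^2)ds)^{1/2}$,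 and with $(w_1|w_2)=\int_{-\pi}^\pi\langle w_1(s),w_2(s)\rangle ds$. $N:\mathcal X\times\mathcal W_{2\pi,0}\times\mathbb R\to\mathcal Y\oplus\mathcal H_{2\pi,0}$ is a (nonlinear) map such that $N_1:(v,w,\mu)\in\mathcal X\times\mathcal W_{2\pi,0}\times\mathbb R\mapsto\overline{N(v,w,\mu)}\in\mathcal Y$ and $N_2:=N-N_1:\mathcal X\times\mathcal W_{2\pi,0}\times\mathbb R\to\mathcal H_{2\pi,0}$. "$\nu_0$ is a simple eigenvalue of $L_2$" means that $\mathsf N_{\mathbb C}[L_2-\nu_0I]\cap\mathsf R_{\mathbb C}[L_2-\nu_0I]=\{0\}$ ($\mathsf N$ = null space, $\mathsf R$ = range, in the complexified spaces). $v_0$ is the (unique) normalized eigenvector of $L_2$ corresponding to $\nu_0$. With $L_2^*$ the adjoint of $L_2$, $v_0^*\in\mathsf N_{\mathbb C}[L_2^*-\nu_0I]$ is an element with $\langle v_0^*,v_0\rangle\neq0$, normalized by $\langle v_0^*,v_0\rangle=\pi^{-1}$. Set $$v_1=\Re[v_0e^{-\mathrm i\tau}],\quad v_2=\Im[v_0e^{-\mathrm i\tau}],\quad v_1^*=\Re[v_0^*e^{\mathrm i\tau}],\quad v_2^*=\Im[v_0^*e^{\mathrm i\tau}].$$ $S_{011}$ is the linear operator in the term $S_{011}w\mu$ of the expansion of $N_2$. The bifurcation is called supercritical [resp. subcritical] if the family of solutions exists only for $\mu>0$ [resp. $\mu<0$].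
   Formalization: N is additionally assumed to commute with time translations of w (autonomous problem); without this (c) fails, e.g. H=R², L₂ a rotation generator, N₂=μw+(w|v₁* )²v₁ forces μ(ε)=−ε. In (b), ε is evaluated on the phase-shifted solution. *)

theory Defs
  imports "HOL-Analysis.Analysis"
begin

section \<open>Square integrable periodic functions with values in a Hilbert space\<close>

text \<open>The Hilbert space is not assumed to be separable, whereas the library Bochner integral
  needs a second countable codomain.  Therefore strong (Bochner) measurability is
  spelled out, norms and scalar products are Lebesgue integrals of real functions, and vector-valued
  integrals are Henstock-Kurzweil integrals, which agree with the Bochner integral on Bochner
  integrable functions.\<close>

definition strongly_measurable :: "'a measure \<Rightarrow> ('a \<Rightarrow> 'h::real_normed_vector) \<Rightarrow> bool" where
  "strongly_measurable M f \<longleftrightarrow>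
     (\<exists>s. (\<forall>n. simple_function M (s n)) \<and> (AE t in M. (\<lambda>n. s n t) \<longlonglongrightarrow> f t))"

definition per_sq_integrable :: "(real \<Rightarrow> 'h::real_normed_vector) \<Rightarrow> bool" where
  "per_sq_integrable f \<longleftrightarrow>
     (\<forall>t. f (t + 2 * pi) = f t) \<and> strongly_measurable (lebesgue_on {-pi..pi}) f \<and>
     integrable (lebesgue_on {-pi..pi}) (\<lambda>t. (norm (f t))\<^sup>2)"

definition per_eq :: "(real \<Rightarrow> 'h::real_normed_vector) \<Rightarrow> (real \<Rightarrow> 'h) \<Rightarrow> bool" where
  "per_eq f g \<longleftrightarrow>
     per_sq_integrable f \<and> per_sq_integrable g \<and> (AE t in lebesgue_on {-pi..pi}. f t = g t)"

lemma strongly_measurable_const: "strongly_measurable M (\<lambda>_. c)"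
  unfolding strongly_measurable_def by (rule exI[of _ "\<lambda>_ _. c"]) auto

lemma strongly_measurable_compose2:
  fixes f :: "'s \<Rightarrow> 'a::real_normed_vector" and g :: "'s \<Rightarrow> 'b::real_normed_vector"
    and h :: "'a \<Rightarrow> 'b \<Rightarrow> 'c::real_normed_vector"
  assumes f: "strongly_measurable M f" and g: "strongly_measurable M g"
    and h: "\<And>X Y x y. X \<longlonglongrightarrow> x \<Longrightarrow> Y \<longlonglongrightarrow> y \<Longrightarrow> (\<lambda>n. h (X n) (Y n)) \<longlonglongrightarrow> h x y"
  shows "strongly_measurable M (\<lambda>t. h (f t) (g t))"
proof -
  obtain s where s: "\<forall>n. simple_function M (s n)" "AE t in M. (\<lambda>n. s n t) \<longlonglongrightarrow> f t"
    using f unfolding strongly_measurable_def by auto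
  obtain r where r: "\<forall>n. simple_function M (r n)" "AE t in M. (\<lambda>n. r n t) \<longlonglongrightarrow> g t"
    using g unfolding strongly_measurable_def by auto
  have "AE t in M. (\<lambda>n. h (s n t) (r n t)) \<longlonglongrightarrow> h (f t) (g t)"
    using s(2) r(2) by eventually_elim (rule h)
  moreover have "simple_function M (\<lambda>t. h (s n t) (r n t))" for n
    using simple_function_compose2[of M "s n" "r n" h] s(1) r(1) by auto
  ultimately show ?thesis
    unfolding strongly_measurable_def by (intro exI[of _ "\<lambda>n t. h (s n t) (r n t)"]) auto
qed

lemma strongly_measurable_real:
  fixes f :: "real \<Rightarrow> real"
  assumes "strongly_measurable (lebesgue_on {-pi..pi}) f"
  shows "f \<in> borel_measurable (lebesgue_on {-pi..pi})"
proof -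
  let ?M = "lebesgue_on {-pi..pi}"
  obtain s where s: "\<forall>n. simple_function ?M (s n)" "AE t in ?M. (\<lambda>n. s n t) \<longlonglongrightarrow> f t"
    using assms unfolding strongly_measurable_def by auto
  have m: "s n \<in> borel_measurable ?M" for n
    using s(1) by (auto intro: borel_measurable_simple_function)
  have "(\<lambda>t. lim (\<lambda>n. s n t)) \<in> borel_measurable ?M"
    by (intro borel_measurable_lim_metric m)
  then have 1: "(\<lambda>t. if t \<in> {-pi..pi} then lim (\<lambda>n. s n t) else 0) \<in> borel_measurable lebesgue"
    by (subst borel_measurable_if) auto
  have "AE t in ?M. lim (\<lambda>n. s n t) = f t"
    using s(2) by eventually_elim (rule limI)
  then have "AE t in lebesgue. t \<in> {-pi..pi} \<longrightarrow> lim (\<lambda>n. s n t) = f t"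
    by (subst (asm) AE_restrict_space_iff) auto
  then have "AE t in lebesgue. (if t \<in> {-pi..pi} then lim (\<lambda>n. s n t) else 0)
      = (if t \<in> {-pi..pi} then f t else 0)"
    by eventually_elim auto
  from borel_measurable_AE[OF 1 this] show ?thesis
    by (subst (asm) borel_measurable_if) auto
qed

lemma per_sq_integrable_zero: "per_sq_integrable (\<lambda>_. 0)"
  by (auto simp: per_sq_integrable_def strongly_measurable_const)

lemma per_sq_integrable_scaleR:
  assumes "per_sq_integrable f" shows "per_sq_integrable (\<lambda>t. a *\<^sub>R f t)"
proof -
  have "strongly_measurable (lebesgue_on {-pi..pi}) (\<lambda>t. a *\<^sub>R f t)"
    by (rule strongly_measurable_compose2[of _ f f "\<lambda>x y. a *\<^sub>R x"])
       (use assms in \<open>simp_all add: per_sq_integrable_def tendsto_scaleR\<close>)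
  then show ?thesis
    using assms by (auto simp: per_sq_integrable_def power_mult_distrib)
qed

lemma per_sq_integrable_add:
  assumes f: "per_sq_integrable f" and g: "per_sq_integrable g"
  shows "per_sq_integrable (\<lambda>t. f t + g t)"
proof -
  let ?M = "lebesgue_on {-pi..pi}"
  have s: "strongly_measurable ?M (\<lambda>t. f t + g t)"
    by (rule strongly_measurable_compose2[of _ f g "\<lambda>x y. x + y"])
       (use f g in \<open>simp_all add: per_sq_integrable_def tendsto_add\<close>)
  have m: "(\<lambda>t. (norm (f t + g t))\<^sup>2) \<in> borel_measurable ?M"
    by (rule strongly_measurable_real, rule strongly_measurable_compose2[OF s s, of "\<lambda>x y. (norm x)\<^sup>2"])
       (simp add: tendsto_power tendsto_norm)
  have b: "norm ((norm (f t + g t))\<^sup>2) \<le> norm (2 * (norm (f t))\<^sup>2 + 2 * (norm (g t))\<^sup>2)" for t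
  proof -
    have "(norm (f t + g t))\<^sup>2 \<le> (norm (f t) + norm (g t))\<^sup>2"
      by (intro power_mono norm_triangle_ineq) auto
    also have "\<dots> \<le> 2 * (norm (f t))\<^sup>2 + 2 * (norm (g t))\<^sup>2"
      using sum_squares_bound[of "norm (f t)" "norm (g t)"] by (simp add: power2_sum)
    finally show ?thesis by simp
  qed
  have "integrable ?M (\<lambda>t. 2 * (norm (f t))\<^sup>2 + 2 * (norm (g t))\<^sup>2)"
    using f g by (auto simp: per_sq_integrable_def)
  then have "integrable ?M (\<lambda>t. (norm (f t + g t))\<^sup>2)"
    by (rule Bochner_Integration.integrable_bound[OF _ m]) (use b in auto)
  with s f g show ?thesis by (auto simp: per_sq_integrable_def)
qed

lemma per_sq_integrable_inner:
  fixes f g :: "real \<Rightarrow> 'h::real_inner"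
  assumes f: "per_sq_integrable f" and g: "per_sq_integrable g"
  shows "integrable (lebesgue_on {-pi..pi}) (\<lambda>t. f t \<bullet> g t)"
proof -
  let ?M = "lebesgue_on {-pi..pi}"
  have m: "(\<lambda>t. f t \<bullet> g t) \<in> borel_measurable ?M"
    by (rule strongly_measurable_real, rule strongly_measurable_compose2[of _ f g inner])
       (use f g in \<open>simp_all add: per_sq_integrable_def tendsto_inner\<close>)
  have b: "norm (f t \<bullet> g t) \<le> norm ((norm (f t))\<^sup>2 + (norm (g t))\<^sup>2)" for t
  proof -
    have "\<bar>f t \<bullet> g t\<bar> \<le> norm (f t) * norm (g t)" by (rule Cauchy_Schwarz_ineq2)
    also have "\<dots> \<le> (norm (f t))\<^sup>2 + (norm (g t))\<^sup>2"
      using sum_squares_bound[of "norm (f t)" "norm (g t)"]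
        mult_nonneg_nonneg[OF norm_ge_zero norm_ge_zero, of "f t" "g t"]
      by linarith
    finally show ?thesis by simp
  qed
  have "integrable ?M (\<lambda>t. (norm (f t))\<^sup>2 + (norm (g t))\<^sup>2)"
    using f g by (auto simp: per_sq_integrable_def)
  then show ?thesis
    by (rule Bochner_Integration.integrable_bound[OF _ m]) (use b in auto)
qed

lemma per_sq_integrable_uminus:
  "per_sq_integrable f \<Longrightarrow> per_sq_integrable (\<lambda>t. - f t)"
  using per_sq_integrable_scaleR[of f "-1"] by simp

lemma per_sq_integrable_diff:
  "per_sq_integrable f \<Longrightarrow> per_sq_integrable g \<Longrightarrow> per_sq_integrable (\<lambda>t. f t - g t)"
  using per_sq_integrable_add[OF _ per_sq_integrable_uminus, of f g] by simp

quotient_type (overloaded) 'h per_L2 = "real \<Rightarrow> 'h::real_inner" / partial: per_eq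
proof (rule part_equivpI)
  show "\<exists>x. per_eq x (x :: real \<Rightarrow> 'h)"
    by (rule exI[of _ "\<lambda>_. 0"]) (simp add: per_eq_def per_sq_integrable_zero)
  show "symp (per_eq :: (real \<Rightarrow> 'h) \<Rightarrow> _)"
    by (auto simp: symp_def per_eq_def elim: AE_mp)
  show "transp (per_eq :: (real \<Rightarrow> 'h) \<Rightarrow> _)"
  proof (rule transpI)
    fix f g h :: "real \<Rightarrow> 'h"
    assume 1: "per_eq f g" and 2: "per_eq g h"
    then have "AE t in lebesgue_on {-pi..pi}. f t = g t" "AE t in lebesgue_on {-pi..pi}. g t = h t"
      by (auto simp: per_eq_def)
    then have "AE t in lebesgue_on {-pi..pi}. f t = h t" by eventually_elim simp
    with 1 2 show "per_eq f h" by (auto simp: per_eq_def)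
  qed
qed

lemmas per_eq_intros =
  per_eq_def per_sq_integrable_add per_sq_integrable_zero per_sq_integrable_uminus
  per_sq_integrable_diff per_sq_integrable_scaleR

instantiation per_L2 :: (real_inner) real_vector
begin

lift_definition zero_per_L2 :: "'a per_L2" is "\<lambda>_. 0"
  by (simp add: per_eq_def per_sq_integrable_zero)

lift_definition plus_per_L2 :: "'a per_L2 \<Rightarrow> 'a per_L2 \<Rightarrow> 'a per_L2" is "\<lambda>f g t. f t + g t"
  by (auto simp: per_eq_def per_sq_integrable_add)

lift_definition minus_per_L2 :: "'a per_L2 \<Rightarrow> 'a per_L2 \<Rightarrow> 'a per_L2" is "\<lambda>f g t. f t - g t"
  by (auto simp: per_eq_def per_sq_integrable_diff)

lift_definition uminus_per_L2 :: "'a per_L2 \<Rightarrow> 'a per_L2" is "\<lambda>f t. - f t"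
  by (auto simp: per_eq_def per_sq_integrable_uminus)

lift_definition scaleR_per_L2 :: "real \<Rightarrow> 'a per_L2 \<Rightarrow> 'a per_L2" is "\<lambda>a f t. a *\<^sub>R f t"
  by (auto simp: per_eq_def per_sq_integrable_scaleR)

instance
proof
  fix f g h :: "'a per_L2" and a b :: real
  show "f + g + h = f + (g + h)"
    by transfer (simp add: per_eq_intros add.assoc)
  show "f + g = g + f"
    by transfer (simp add: per_eq_intros add.commute)
  show "0 + f = f"
    by transfer (simp add: per_eq_intros )
  show "- f + f = 0"
    by transfer (simp add: per_eq_intros )
  show "f - g = f + - g"
    by transfer (simp add: per_eq_intros )
  show "a *\<^sub>R (f + g) = a *\<^sub>R f + a *\<^sub>R g"
    by transfer (simp add: per_eq_intros scaleR_add_right)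
  show "(a + b) *\<^sub>R f = a *\<^sub>R f + b *\<^sub>R f"
    by transfer (simp add: per_eq_intros scaleR_add_left)
  show "a *\<^sub>R b *\<^sub>R f = (a * b) *\<^sub>R f"
    by transfer (simp add: per_eq_intros )
  show "1 *\<^sub>R f = f"
    by transfer (simp add: per_eq_intros )
qed

end

instantiation per_L2 :: (real_inner) real_inner
begin

lift_definition inner_per_L2 :: "'a per_L2 \<Rightarrow> 'a per_L2 \<Rightarrow> real"
  is "\<lambda>f g. LINT t|lebesgue_on {-pi..pi}. f t \<bullet> g t"
proof -
  fix f f' g g' :: "real \<Rightarrow> 'a"
  assume a: "per_eq f f'" "per_eq g g'"
  then have "AE t in lebesgue_on {-pi..pi}. f t = f' t" "AE t in lebesgue_on {-pi..pi}. g t = g' t"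
    by (auto simp: per_eq_def)
  then have "AE t in lebesgue_on {-pi..pi}. f t \<bullet> g t = f' t \<bullet> g' t"
    by eventually_elim simp
  with a show "(LINT t|lebesgue_on {-pi..pi}. f t \<bullet> g t) = (LINT t|lebesgue_on {-pi..pi}. f' t \<bullet> g' t)"
    by (intro integral_cong_AE borel_measurable_integrable per_sq_integrable_inner)
       (auto simp: per_eq_def)
qed

definition norm_per_L2 :: "'a per_L2 \<Rightarrow> real" where
  "norm_per_L2 f = sqrt (f \<bullet> f)"

definition dist_per_L2 :: "'a per_L2 \<Rightarrow> 'a per_L2 \<Rightarrow> real" where
  "dist_per_L2 f g = norm (f - g)"

definition sgn_per_L2 :: "'a per_L2 \<Rightarrow> 'a per_L2" where
  "sgn_per_L2 f = f /\<^sub>R norm f"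

definition uniformity_per_L2 :: "('a per_L2 \<times> 'a per_L2) filter" where
  "uniformity_per_L2 = (INF e\<in>{0<..}. principal {(x, y). dist x y < e})"

definition open_per_L2 :: "'a per_L2 set \<Rightarrow> bool" where
  "open_per_L2 U = (\<forall>x\<in>U. eventually (\<lambda>(x', y). x' = x \<longrightarrow> y \<in> U) uniformity)"

instance
proof
  fix f g h :: "'a per_L2" and a :: real and U :: "'a per_L2 set"
  show "dist f g = norm (f - g)" by (simp add: dist_per_L2_def)
  show "sgn f = f /\<^sub>R norm f" by (simp add: sgn_per_L2_def)
  show "uniformity = (INF e\<in>{0<..}. principal {(x, y::'a per_L2). dist x y < e})"
    by (rule uniformity_per_L2_def)
  show "open U = (\<forall>x\<in>U. eventually (\<lambda>(x', y). x' = x \<longrightarrow> y \<in> U) uniformity)"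
    by (rule open_per_L2_def)
  show "f \<bullet> g = g \<bullet> f" by transfer (simp add: inner_commute)
  show "(f + g) \<bullet> h = f \<bullet> h + g \<bullet> h"
    by transfer (simp add: per_eq_def inner_add_left per_sq_integrable_inner)
  show "(a *\<^sub>R f) \<bullet> g = a * (f \<bullet> g)" by transfer simp
  show "0 \<le> f \<bullet> f" by transfer simp
  show "(f \<bullet> f = 0) = (f = 0)"
  proof transfer
    fix f :: "real \<Rightarrow> 'a" assume f: "per_eq f f"
    have "(LINT t|lebesgue_on {-pi..pi}. f t \<bullet> f t) = 0 \<longleftrightarrow> (AE t in lebesgue_on {-pi..pi}. f t \<bullet> f t = 0)"
      using f by (intro integral_nonneg_eq_0_iff_AE per_sq_integrable_inner) (auto simp: per_eq_def)
    then show "((LINT t|lebesgue_on {-pi..pi}. f t \<bullet> f t) = 0) = per_eq f (\<lambda>_. 0)"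
      using f by (simp add: per_eq_def per_sq_integrable_zero)
  qed
  show "norm f = sqrt (f \<bullet> f)" by (rule norm_per_L2_def)
qed

end

definition mean_value :: "'h::real_inner per_L2 \<Rightarrow> 'h" where
  "mean_value w = (1 / (2 * pi)) *\<^sub>R integral {-pi..pi} (rep_per_L2 w)"

definition time_shift :: "real \<Rightarrow> 'h::real_inner per_L2 \<Rightarrow> 'h per_L2" where
  "time_shift s w = abs_per_L2 (\<lambda>t. rep_per_L2 w (t + s))"

text \<open>Testing against smooth \<^emph>\<open>periodic\<close> functions (rather than functions with compact support
  in the open interval) makes this the derivative of the periodic function on the whole line.\<close>

definition has_weak_deriv :: "'h::real_inner per_L2 \<Rightarrow> 'h per_L2 \<Rightarrow> bool" where
  "has_weak_deriv w g \<longleftrightarrow>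
     (\<forall>\<phi>::real \<Rightarrow> real.
        (\<forall>n t. (deriv ^^ n) \<phi> field_differentiable at t) \<and> (\<forall>t. \<phi> (t + 2 * pi) = \<phi> t) \<longrightarrow>
        integral {-pi..pi} (\<lambda>t. deriv \<phi> t *\<^sub>R rep_per_L2 w t)
          = - integral {-pi..pi} (\<lambda>t. \<phi> t *\<^sub>R rep_per_L2 g t))"

definition time_deriv :: "'h::real_inner per_L2 \<Rightarrow> 'h per_L2" where
  "time_deriv w = (THE g. has_weak_deriv w g)"


section \<open>Unbounded operators and their complexification\<close>

text \<open>An unbounded operator is a domain \<open>D\<close> together with a function \<open>L\<close> whose values outside
  \<open>D\<close> are irrelevant.\<close>

definition densely_defined_closed :: "'h::real_inner set \<Rightarrow> ('h \<Rightarrow> 'h) \<Rightarrow> bool" where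
  "densely_defined_closed D L \<longleftrightarrow>
     subspace D \<and> (\<forall>x\<in>D. \<forall>y\<in>D. L (x + y) = L x + L y) \<and> (\<forall>a. \<forall>x\<in>D. L (a *\<^sub>R x) = a *\<^sub>R L x) \<and>
     closure D = UNIV \<and> closed {(x, L x) | x. x \<in> D}"

text \<open>The pair \<open>(x, y)\<close> stands for \<open>x + \<i> y\<close>; the norm of the product type is
  the norm of the complexification.\<close>

definition cscale :: "complex \<Rightarrow> 'h::real_vector \<times> 'h \<Rightarrow> 'h \<times> 'h" where
  "cscale c u = (Re c *\<^sub>R fst u - Im c *\<^sub>R snd u, Re c *\<^sub>R snd u + Im c *\<^sub>R fst u)"

definition cbilinear :: "'h::real_inner \<times> 'h \<Rightarrow> 'h \<times> 'h \<Rightarrow> complex" where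
  "cbilinear u v = Complex (fst u \<bullet> fst v - snd u \<bullet> snd v) (fst u \<bullet> snd v + snd u \<bullet> fst v)"

definition cshifted :: "('h::real_vector \<Rightarrow> 'h) \<Rightarrow> complex \<Rightarrow> 'h \<times> 'h \<Rightarrow> 'h \<times> 'h" where
  "cshifted L z u = (L (fst u), L (snd u)) - cscale z u"

definition cnull :: "'h::real_vector set \<Rightarrow> ('h \<Rightarrow> 'h) \<Rightarrow> complex \<Rightarrow> ('h \<times> 'h) set" where
  "cnull D L z = {u \<in> D \<times> D. cshifted L z u = 0}"

definition crange :: "'h::real_vector set \<Rightarrow> ('h \<Rightarrow> 'h) \<Rightarrow> complex \<Rightarrow> ('h \<times> 'h) set" where
  "crange D L z = cshifted L z ` (D \<times> D)"

definition resolvent_set :: "'h::real_normed_vector set \<Rightarrow> ('h \<Rightarrow> 'h) \<Rightarrow> complex set" where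
  "resolvent_set D L =
     {z. bij_betw (cshifted L z) (D \<times> D) UNIV \<and>
         (\<exists>K. \<forall>u \<in> D \<times> D. norm u \<le> K * norm (cshifted L z u))}"

definition spectrum :: "'h::real_normed_vector set \<Rightarrow> ('h \<Rightarrow> 'h) \<Rightarrow> complex set" where
  "spectrum D L = - resolvent_set D L"

text \<open>Semisimplicity only.  That the null space is one-dimensional is part of the
  uniqueness of the normalized eigenvector in the next definition.\<close>

definition simple_eigenvalue :: "'h::real_vector set \<Rightarrow> ('h \<Rightarrow> 'h) \<Rightarrow> complex \<Rightarrow> bool" where
  "simple_eigenvalue D L z \<longleftrightarrow> cnull D L z \<noteq> {0} \<and> cnull D L z \<inter> crange D L z = {0}"

definition unique_normalized_eigenvector ::
    "'h::real_normed_vector set \<Rightarrow> ('h \<Rightarrow> 'h) \<Rightarrow> complex \<Rightarrow> 'h \<times> 'h \<Rightarrow> bool" where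
  "unique_normalized_eigenvector D L z u \<longleftrightarrow>
     u \<in> cnull D L z \<and> norm u = 1 \<and>
     (\<forall>u' \<in> cnull D L z. norm u' = 1 \<longrightarrow> (\<exists>c. cmod c = 1 \<and> u' = cscale c u))"

definition adjoint_domain :: "'h::real_inner set \<Rightarrow> ('h \<Rightarrow> 'h) \<Rightarrow> 'h set" where
  "adjoint_domain D L = {y. \<exists>z. \<forall>x\<in>D. L x \<bullet> y = x \<bullet> z}"

definition adjoint_op :: "'h::real_inner set \<Rightarrow> ('h \<Rightarrow> 'h) \<Rightarrow> 'h \<Rightarrow> 'h" where
  "adjoint_op D L y = (THE z. \<forall>x\<in>D. L x \<bullet> y = x \<bullet> z)"


section \<open>The spaces of periodic functions with zero mean\<close>

definition H_per0 :: "'h::real_inner per_L2 set" where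
  "H_per0 = {w. mean_value w = 0}"

definition acts_pointwise :: "'h::real_inner set \<Rightarrow> ('h \<Rightarrow> 'h) \<Rightarrow> 'h per_L2 \<Rightarrow> 'h per_L2 \<Rightarrow> bool" where
  "acts_pointwise D L w g \<longleftrightarrow>
     (AE t in lebesgue_on {-pi..pi}. rep_per_L2 w t \<in> D \<and> rep_per_L2 g t = L (rep_per_L2 w t))"

definition lift_op :: "'h::real_inner set \<Rightarrow> ('h \<Rightarrow> 'h) \<Rightarrow> 'h per_L2 \<Rightarrow> 'h per_L2" where
  "lift_op D L w = (THE g. acts_pointwise D L w g)"

text \<open>Since \<open>L + \<theta>\<close> is an isomorphism from the graph-normed domain, square integrability of
  \<open>w\<close> as a function with values in the domain means that \<open>w\<close> and \<open>L \<circ> w\<close> are square integrable.\<close>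

definition W_per0 :: "'h::real_inner set \<Rightarrow> ('h \<Rightarrow> 'h) \<Rightarrow> 'h per_L2 set" where
  "W_per0 D L =
     {w. (\<exists>g. acts_pointwise D L w g) \<and> (\<exists>g. has_weak_deriv w g) \<and> mean_value w = 0}"

text \<open>\<open>\<theta>\<close> may be complex, so the norm of \<open>(L + \<theta>) x\<close> is taken in the complexification.\<close>

definition W_norm :: "('h::real_inner \<Rightarrow> 'h) \<Rightarrow> complex \<Rightarrow> 'h \<Rightarrow> real" where
  "W_norm L \<theta> x = norm (cshifted L (- \<theta>) (x, 0))"

definition W_per0_norm :: "('h::real_inner \<Rightarrow> 'h) \<Rightarrow> complex \<Rightarrow> 'h per_L2 \<Rightarrow> real" where
  "W_per0_norm L \<theta> w =
     sqrt (LINT t|lebesgue_on {-pi..pi}.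
             (W_norm L \<theta> (rep_per_L2 w t))\<^sup>2 + (norm (rep_per_L2 (time_deriv w) t))\<^sup>2)"


section \<open>Operators and analytic maps on a subspace with its own norm\<close>

definition fredholm_of_index ::
    "'a::real_vector set \<Rightarrow> ('a \<Rightarrow> real) \<Rightarrow> 'b::real_normed_vector set \<Rightarrow> ('a \<Rightarrow> 'b) \<Rightarrow> int \<Rightarrow> bool" where
  "fredholm_of_index E nrm F T i \<longleftrightarrow>
     T ` E \<subseteq> F \<and>
     (\<forall>x\<in>E. \<forall>y\<in>E. T (x + y) = T x + T y) \<and> (\<forall>a. \<forall>x\<in>E. T (a *\<^sub>R x) = a *\<^sub>R T x) \<and>
     (\<exists>K. \<forall>x\<in>E. norm (T x) \<le> K * nrm x) \<and>
     closed (T ` E) \<and>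
     (\<exists>A B. finite A \<and> independent A \<and> span A = {x \<in> E. T x = 0} \<and>
            finite B \<and> independent B \<and> span B \<inter> T ` E = {0} \<and> {x + y | x y. x \<in> T ` E \<and> y \<in> span B} = F \<and>
            i = int (card A) - int (card B))"

text \<open>A term \<open>T v\<^sup>k w\<^sup>l \<mu>\<^sup>m\<close> is encoded as
  \<open>\<mu> ^ m *\<^sub>R T (replicate k v) (replicate l w)\<close>: an operator that is also multilinear in \<open>m\<close> real
  arguments is identified with its value at \<open>1, \<dots>, 1\<close> in these arguments.\<close>

definition bounded_multilinear ::
    "nat \<Rightarrow> nat \<Rightarrow> 'w::real_vector set \<Rightarrow> ('w \<Rightarrow> real) \<Rightarrow> 'y::real_normed_vector set \<Rightarrow>
     ('x::real_normed_vector list \<Rightarrow> 'w list \<Rightarrow> 'y) \<Rightarrow> bool" where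
  "bounded_multilinear k l E nrm F T \<longleftrightarrow>
     (\<forall>vs ws. length vs = k \<and> length ws = l \<and> set ws \<subseteq> E \<longrightarrow>
        T vs ws \<in> F \<and>
        (\<forall>i<k. \<forall>a b x y. T (vs[i := a *\<^sub>R x + b *\<^sub>R y]) ws
                          = a *\<^sub>R T (vs[i := x]) ws + b *\<^sub>R T (vs[i := y]) ws) \<and>
        (\<forall>i<l. \<forall>a b. \<forall>x\<in>E. \<forall>y\<in>E. T vs (ws[i := a *\<^sub>R x + b *\<^sub>R y])
                          = a *\<^sub>R T vs (ws[i := x]) + b *\<^sub>R T vs (ws[i := y]))) \<and>
     (\<exists>K. \<forall>vs ws. length vs = k \<and> length ws = l \<and> set ws \<subseteq> E \<longrightarrow>
        norm (T vs ws) \<le> K * prod_list (map norm vs) * prod_list (map nrm ws))"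

definition multilinear_zero ::
    "nat \<Rightarrow> nat \<Rightarrow> 'w set \<Rightarrow> ('x list \<Rightarrow> 'w list \<Rightarrow> 'y::zero) \<Rightarrow> bool" where
  "multilinear_zero k l E T \<longleftrightarrow>
     (\<forall>vs ws. length vs = k \<and> length ws = l \<and> set ws \<subseteq> E \<longrightarrow> T vs ws = 0)"

definition abs_convergent_expansion ::
    "(nat \<Rightarrow> nat \<Rightarrow> nat \<Rightarrow> 'x list \<Rightarrow> 'w list \<Rightarrow> 'y::real_normed_vector) \<Rightarrow> 'x \<Rightarrow> 'w \<Rightarrow> real \<Rightarrow> 'y \<Rightarrow> bool" where
  "abs_convergent_expansion T v w \<mu> y \<longleftrightarrow>
     (\<lambda>(k, l, m). \<mu> ^ m *\<^sub>R T k l m (replicate k v) (replicate l w)) abs_summable_on UNIV \<and>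
     ((\<lambda>(k, l, m). \<mu> ^ m *\<^sub>R T k l m (replicate k v) (replicate l w)) has_sum y) UNIV"

definition analytic_family ::
    "'b::real_vector set \<Rightarrow> ('b \<Rightarrow> real) \<Rightarrow> real set \<Rightarrow> (real \<Rightarrow> 'b) \<Rightarrow> bool" where
  "analytic_family E nrm I f \<longleftrightarrow>
     (\<forall>x0\<in>I. \<exists>a r. r > 0 \<and> (\<forall>n. a n \<in> E) \<and>
        (\<forall>x\<in>I. \<bar>x - x0\<bar> < r \<longrightarrow> f x \<in> E \<and>
           (\<lambda>n. nrm (f x - (\<Sum>k<n. (x - x0) ^ k *\<^sub>R a k))) \<longlonglongrightarrow> 0))"


section \<open>The bifurcation problem\<close>

text \<open>\<open>N v w \<mu>\<close> is given by its components in the direct sum of \<open>'y\<close> and \<^const>\<open>H_per0\<close>,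
  that is, by \<open>N\<^sub>1\<close> (its mean value) and \<open>N\<^sub>2\<close>.\<close>

definition solves_system ::
    "('x \<Rightarrow> 'y) \<Rightarrow> 'h::real_inner set \<Rightarrow> ('h \<Rightarrow> 'h) \<Rightarrow> ('x \<Rightarrow> 'h per_L2 \<Rightarrow> real \<Rightarrow> 'y \<times> 'h per_L2) \<Rightarrow>
     'x \<Rightarrow> 'h per_L2 \<Rightarrow> real \<Rightarrow> real \<Rightarrow> bool" where
  "solves_system L1 D L2 N v w \<omega> \<mu> \<longleftrightarrow>
     L1 v = fst (N v w \<mu>) \<and> \<omega> *\<^sub>R time_deriv w + lift_op D L2 w = snd (N v w \<mu>)"

text \<open>The member of the family for \<open>\<epsilon> = 0\<close> is the trivial solution.\<close>

definition supercritical :: "real set \<Rightarrow> (real \<Rightarrow> real) \<Rightarrow> bool" where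
  "supercritical I \<mu> \<longleftrightarrow> (\<forall>\<epsilon>\<in>I - {0}. \<mu> \<epsilon> > 0)"

definition subcritical :: "real set \<Rightarrow> (real \<Rightarrow> real) \<Rightarrow> bool" where
  "subcritical I \<mu> \<longleftrightarrow> (\<forall>\<epsilon>\<in>I - {0}. \<mu> \<epsilon> < 0)"

end

theory Submission
  imports Defs "HOL-Combinatorics.Multiset_Permutations"
begin

text \<open>The idea is Lyapunov--Schmidt reduction followed by a blow-up.  The Fourier coefficients of
  order \<open>k\<close> of a solution of \<open>\<omega>\<^sub>0 w' + L\<^sub>2 w = 0\<close> lie in the null space of
  \<open>L\<^sub>2 - \<i> k \<omega>\<^sub>0\<close>, so this kernel is spanned by \<open>v\<^sub>1\<close> and its derivative \<open>v\<^sub>2\<close>; the pairings with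
  \<open>v\<^sub>1\<^sup>*\<close> and \<open>v\<^sub>2\<^sup>*\<close> vanish on the range, and index zero shows that they describe the range completely.
  With \<open>v = \<epsilon> v'\<close> and \<open>w = \<epsilon> (v\<^sub>1 + w')\<close> the system divided by \<open>\<epsilon>\<close> has an invertible linear part in
  \<open>(v', w', \<omega> - \<omega>\<^sub>0, \<mu>)\<close>: the pairing with \<open>v\<^sub>2\<^sup>*\<close> determines the frequency, and, by
  transversality, the pairing with \<open>v\<^sub>1\<^sup>*\<close> determines the parameter.  What remains is a contraction on
  power series in \<open>\<epsilon>\<close>, which yields existence, uniqueness and analyticity at
  once.  The hypotheses bound each Taylor coefficient separately; uniform bounds come from Baire's
  theorem and polarization.  A shift by \<open>\<pi>\<close> maps \<open>\<epsilon>\<close> to \<open>-\<epsilon>\<close>, whence the parity.\<close>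

section \<open>Power series with coefficients in a Banach space\<close>

text \<open>The unknown \<open>w\<close> lives in a subset of a type, under a norm that is not the
  norm of that type, whereas contraction and Baire arguments need a Banach space. Hence a solution
  is coordinatized by \<open>(v, Q w, \<epsilon>)\<close> in a product of complete types, and
  \<open>w\<close> is recovered by the bounded map \<open>\<kappa>\<close>, which has the second
  side condition built in. Frequency shift and parameter are not divided by \<epsilon>: each already
  multiplies a term of first order in the amplitude. Analyticity needs no separate argument, because
  functions of \<epsilon> are measured by the sum of the norms of their coefficients with weights
  \<open>\<rho> ^ n\<close>; under this norm products, multilinear substitutions and limits stay
  power series. Uniqueness has its own obstacle: a small solution need not have size comparable to
  \<epsilon>. As the nonlinearity is quadratically small, the equations themselves bound the
  solution by its pairing with \<open>v1s\<close>, and only then may it be rescaled. The state space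
  may be nonseparable, so completeness, integrals and Fourier uniqueness rest on simple
  functions.\<close>

definition psb :: "real \<Rightarrow> (real \<Rightarrow> 'a::real_normed_vector) \<Rightarrow> real \<Rightarrow> bool" where
  "psb \<rho> f c \<longleftrightarrow>
     (\<exists>a. (\<lambda>n. norm (a n) * \<rho> ^ n) summable_on UNIV \<and> (\<Sum>\<^sub>\<infinity>n. norm (a n) * \<rho> ^ n) \<le> c \<and>
          (\<forall>x. \<bar>x\<bar> \<le> \<rho> \<longrightarrow> ((\<lambda>n. x ^ n *\<^sub>R a n) has_sum f x) UNIV))"

text \<open>Terms of equal degree are grouped by Fubini over \<open>J\<close>, and the triangle
  inequality within each group keeps the weighted sum of norms below \<open>c\<close>. An arbitrary
  index set is allowed so that rearrangements of multiple series reduce to this lemma.\<close>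

lemma psb_family:
  fixes z :: "'i \<Rightarrow> 'a::banach"
  assumes \<rho>: "\<rho> > 0" and s: "(\<lambda>i. norm (z i) * \<rho> ^ d i) summable_on I"
    and c: "(\<Sum>\<^sub>\<infinity>i\<in>I. norm (z i) * \<rho> ^ d i) \<le> c"
    and f: "\<And>x. \<bar>x\<bar> \<le> \<rho> \<Longrightarrow> ((\<lambda>i. x ^ d i *\<^sub>R z i) has_sum f x) I"
  shows "psb \<rho> f c"
proof -
  define J where "J n = {i \<in> I. d i = n}" for n
  define a where "a n = (\<Sum>\<^sub>\<infinity>i\<in>J n. z i)" for n
  have img: "I = snd ` (Sigma UNIV J)" and inj: "inj_on snd (Sigma UNIV J)"
    by (auto simp: J_def image_iff inj_on_def)
  have s2: "(\<lambda>p. norm (z (snd p)) * \<rho> ^ d (snd p)) summable_on Sigma UNIV J"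
    using s summable_on_reindex[OF inj, of "\<lambda>i. norm (z i) * \<rho> ^ d i"] img by (simp add: o_def)
  have sJ: "(\<lambda>i. norm (z i) * \<rho> ^ n) summable_on J n" for n
  proof -
    have "(\<lambda>i. norm (z i) * \<rho> ^ d i) summable_on J n"
      by (rule summable_on_subset_banach[OF s]) (auto simp: J_def)
    then show ?thesis by (rule summable_on_cong[THEN iffD1, rotated]) (auto simp: J_def)
  qed
  have zJ: "(\<lambda>i. norm (z i)) summable_on J n" for n
    using summable_on_cmult_left[OF sJ[of n], of "inverse (\<rho> ^ n)"] \<rho>
    by (simp add: field_simps)
  have hz: "(z has_sum a n) (J n)" for n
    unfolding a_def using abs_summable_summable[OF zJ] by simp
  have tot: "((\<lambda>n. \<Sum>\<^sub>\<infinity>i\<in>J n. norm (z i) * \<rho> ^ n) has_sum (\<Sum>\<^sub>\<infinity>i\<in>I. norm (z i) * \<rho> ^ d i)) UNIV"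
  proof (rule has_sum_SigmaD[where B=J and f="\<lambda>p. norm (z (snd p)) * \<rho> ^ d (snd p)"])
    show "((\<lambda>p. norm (z (snd p)) * \<rho> ^ d (snd p)) has_sum (\<Sum>\<^sub>\<infinity>i\<in>I. norm (z i) * \<rho> ^ d i)) (Sigma UNIV J)"
      using has_sum_reindex[OF inj, of "\<lambda>i. norm (z i) * \<rho> ^ d i"] has_sum_infsum[OF s]
      by (simp add: o_def flip: img)
    show "((\<lambda>y. norm (z (snd (n, y))) * \<rho> ^ d (snd (n, y))) has_sum (\<Sum>\<^sub>\<infinity>i\<in>J n. norm (z i) * \<rho> ^ n)) (J n)" for n
    proof -
      have "((\<lambda>i. norm (z i) * \<rho> ^ n) has_sum (\<Sum>\<^sub>\<infinity>i\<in>J n. norm (z i) * \<rho> ^ n)) (J n)"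
        using sJ by simp
      then show ?thesis by (rule has_sum_cong[THEN iffD1, rotated]) (auto simp: J_def)
    qed
  qed
  have le: "norm (a n) * \<rho> ^ n \<le> (\<Sum>\<^sub>\<infinity>i\<in>J n. norm (z i) * \<rho> ^ n)" for n
  proof -
    have "norm (a n) \<le> (\<Sum>\<^sub>\<infinity>i\<in>J n. norm (z i))"
      unfolding a_def by (rule norm_infsum_bound[OF zJ])
    then show ?thesis using \<rho> by (simp add: infsum_cmult_left' mult_right_mono)
  qed
  have sa: "(\<lambda>n. norm (a n) * \<rho> ^ n) summable_on UNIV"
    by (rule summable_on_comparison_test[OF has_sum_imp_summable[OF tot]]) (use le \<rho> in auto)
  show ?thesis
    unfolding psb_def
  proof (intro exI[of _ a] conjI allI impI)
    show "(\<lambda>n. norm (a n) * \<rho> ^ n) summable_on UNIV" by (rule sa)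
    have "(\<Sum>\<^sub>\<infinity>n. norm (a n) * \<rho> ^ n) \<le> (\<Sum>\<^sub>\<infinity>n. \<Sum>\<^sub>\<infinity>i\<in>J n. norm (z i) * \<rho> ^ n)"
      by (rule infsum_mono[OF sa has_sum_imp_summable[OF tot] le])
    also have "\<dots> = (\<Sum>\<^sub>\<infinity>i\<in>I. norm (z i) * \<rho> ^ d i)" using tot by (rule infsumI)
    finally show "(\<Sum>\<^sub>\<infinity>n. norm (a n) * \<rho> ^ n) \<le> c" using c by simp
    fix x :: real assume x: "\<bar>x\<bar> \<le> \<rho>"
    show "((\<lambda>n. x ^ n *\<^sub>R a n) has_sum f x) UNIV"
    proof (rule has_sum_SigmaD[where B=J and f="\<lambda>p. x ^ d (snd p) *\<^sub>R z (snd p)"])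
      show "((\<lambda>p. x ^ d (snd p) *\<^sub>R z (snd p)) has_sum f x) (Sigma UNIV J)"
        using has_sum_reindex[OF inj, of "\<lambda>i. x ^ d i *\<^sub>R z i"] f[OF x] by (simp add: o_def flip: img)
      show "((\<lambda>y. x ^ d (snd (n, y)) *\<^sub>R z (snd (n, y))) has_sum x ^ n *\<^sub>R a n) (J n)" for n
      proof -
        have "((\<lambda>i. x ^ n *\<^sub>R z i) has_sum x ^ n *\<^sub>R a n) (J n)"
          using hz by (rule has_sum_scaleR)
        then show ?thesis by (rule has_sum_cong[THEN iffD1, rotated]) (auto simp: J_def)
      qed
    qed
  qed
qed

lemma norm_power_scaleR_le:
  fixes z :: "'a::real_normed_vector"
  assumes "\<bar>x\<bar> \<le> \<rho>" shows "norm (x ^ n *\<^sub>R z) \<le> norm z * \<rho> ^ n"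
  using mult_right_mono[OF power_mono[OF assms abs_ge_zero, of n] norm_ge_zero[of z]]
  by (simp add: power_abs mult.commute)

lemma psb_coeffs:
  fixes f :: "real \<Rightarrow> 'a::real_normed_vector"
  assumes "psb \<rho> f c"
  obtains a where "(\<lambda>n. norm (a n) * \<rho> ^ n) summable_on UNIV" "(\<Sum>\<^sub>\<infinity>n. norm (a n) * \<rho> ^ n) \<le> c"
    "\<And>x. \<bar>x\<bar> \<le> \<rho> \<Longrightarrow> ((\<lambda>n. x ^ n *\<^sub>R a n) has_sum f x) UNIV"
  using assms unfolding psb_def by blast

lemma psb_mono: "psb \<rho> f c \<Longrightarrow> c \<le> c' \<Longrightarrow> psb \<rho> f c'"
  unfolding psb_def by (meson order_trans)

lemma psb_nonneg:
  fixes f :: "real \<Rightarrow> 'a::real_normed_vector"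
  assumes "psb \<rho> f c" "\<rho> > 0" shows "c \<ge> 0"
proof -
  obtain a :: "nat \<Rightarrow> 'a" where "(\<Sum>\<^sub>\<infinity>n. norm (a n) * \<rho> ^ n) \<le> c"
    using assms(1) unfolding psb_def by blast
  moreover have "0 \<le> (\<Sum>\<^sub>\<infinity>n. norm (a n) * \<rho> ^ n)" by (rule infsum_nonneg) (use assms in auto)
  ultimately show ?thesis by linarith
qed

lemma psb_norm_le:
  fixes f :: "real \<Rightarrow> 'a::banach"
  assumes "psb \<rho> f c" "\<bar>x\<bar> \<le> \<rho>" shows "norm (f x) \<le> c"
proof -
  obtain a where a: "(\<lambda>n. norm (a n) * \<rho> ^ n) summable_on UNIV" "(\<Sum>\<^sub>\<infinity>n. norm (a n) * \<rho> ^ n) \<le> c"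
    and "\<And>x. \<bar>x\<bar> \<le> \<rho> \<Longrightarrow> ((\<lambda>n. x ^ n *\<^sub>R a n) has_sum f x) UNIV"
    using assms(1) by (rule psb_coeffs) blast
  then have f: "((\<lambda>n. x ^ n *\<^sub>R a n) has_sum f x) UNIV" using assms(2) by blast
  have le: "norm (x ^ n *\<^sub>R a n) \<le> norm (a n) * \<rho> ^ n" for n
    by (rule norm_power_scaleR_le[OF assms(2)])
  have "norm (f x) \<le> (\<Sum>\<^sub>\<infinity>n. norm (a n) * \<rho> ^ n)"
    using norm_infsum_le[OF f has_sum_infsum[OF a(1)]] le by simp
  then show ?thesis using a(2) by simp
qed

lemma psb_const: "\<rho> > 0 \<Longrightarrow> norm z \<le> c \<Longrightarrow> psb \<rho> (\<lambda>_. z::'a::banach) c"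
  by (rule psb_family[of \<rho> "\<lambda>_. z" "\<lambda>_. 0" "{0::nat}"]) (auto simp: has_sum_finite_iff)

lemma psb_zero: "\<rho> > 0 \<Longrightarrow> psb \<rho> (\<lambda>_. 0::'a::banach) 0"
  by (rule psb_const) auto

text \<open>The coefficients of all \<open>f i\<close> form one family over
  \<open>I \<times> UNIV\<close>, absolutely summable because the majorants \<open>c i\<close> are;
  regrouping it by degree is \<open>psb_family\<close>.\<close>

lemma psb_infsum:
  fixes f :: "'i \<Rightarrow> real \<Rightarrow> 'a::banach"
  assumes \<rho>: "\<rho> > 0" and f: "\<And>i. i \<in> I \<Longrightarrow> psb \<rho> (f i) (c i)" and c: "c summable_on I"
    and g: "\<And>x. \<bar>x\<bar> \<le> \<rho> \<Longrightarrow> ((\<lambda>i. f i x) has_sum g x) I"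
  shows "psb \<rho> g (\<Sum>\<^sub>\<infinity>i\<in>I. c i)"
proof -
  have "\<forall>i\<in>I. \<exists>a. (\<lambda>n. norm (a n) * \<rho> ^ n) summable_on UNIV \<and> (\<Sum>\<^sub>\<infinity>n. norm (a n) * \<rho> ^ n) \<le> c i \<and>
          (\<forall>x. \<bar>x\<bar> \<le> \<rho> \<longrightarrow> ((\<lambda>n. x ^ n *\<^sub>R a n) has_sum f i x) UNIV)"
    using f unfolding psb_def by blast
  from bchoice[OF this] obtain a where
    "\<forall>i\<in>I. (\<lambda>n. norm (a i n) * \<rho> ^ n) summable_on UNIV \<and> (\<Sum>\<^sub>\<infinity>n. norm (a i n) * \<rho> ^ n) \<le> c i \<and>
          (\<forall>x. \<bar>x\<bar> \<le> \<rho> \<longrightarrow> ((\<lambda>n. x ^ n *\<^sub>R a i n) has_sum f i x) UNIV)" ..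
  then have a: "\<And>i. i \<in> I \<Longrightarrow> (\<lambda>n. norm (a i n) * \<rho> ^ n) summable_on UNIV"
     "\<And>i. i \<in> I \<Longrightarrow> (\<Sum>\<^sub>\<infinity>n. norm (a i n) * \<rho> ^ n) \<le> c i"
     "\<And>i x. i \<in> I \<Longrightarrow> \<bar>x\<bar> \<le> \<rho> \<Longrightarrow> ((\<lambda>n. x ^ n *\<^sub>R a i n) has_sum f i x) UNIV"
    by blast+
  have c0: "c i \<ge> 0" if "i \<in> I" for i using psb_nonneg[OF f[OF that] \<rho>] .
  have i0: "(\<Sum>\<^sub>\<infinity>n. norm (a i n) * \<rho> ^ n) \<ge> 0" for i
    by (rule infsum_nonneg) (use \<rho> in auto)
  have s1: "(\<lambda>i. \<Sum>\<^sub>\<infinity>n. norm (a i n) * \<rho> ^ n) summable_on I"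
    by (rule summable_on_comparison_test[OF c]) (use a(2) i0 in auto)
  have abs: "(\<lambda>p. norm (case p of (i, n) \<Rightarrow> \<rho> ^ n *\<^sub>R a i n)) summable_on (I \<times> UNIV)"
    unfolding Infinite_Sum.abs_summable_on_Sigma_iff
  proof (intro conjI ballI)
    fix i assume "i \<in> I" then show "(\<lambda>y. norm (case (i, y) of (i, n) \<Rightarrow> \<rho> ^ n *\<^sub>R a i n)) summable_on UNIV"
      using a(1)[of i] \<rho> by (simp add: mult.commute)
  next
    show "(\<lambda>x. norm (\<Sum>\<^sub>\<infinity>y. norm (case (x, y) of (i, n) \<Rightarrow> \<rho> ^ n *\<^sub>R a i n))) summable_on I"
      using s1 i0 \<rho> by (simp add: mult.commute)
  qed
  then have s: "(\<lambda>p. norm (a (fst p) (snd p)) * \<rho> ^ snd p) summable_on (I \<times> UNIV)"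
    using \<rho> by (simp add: case_prod_beta mult.commute)
  show ?thesis
  proof (rule psb_family[of \<rho> "\<lambda>p. a (fst p) (snd p)" "\<lambda>p. snd p" "I \<times> UNIV"])
    have "(\<Sum>\<^sub>\<infinity>p\<in>I \<times> UNIV. norm (a (fst p) (snd p)) * \<rho> ^ snd p) = (\<Sum>\<^sub>\<infinity>i\<in>I. \<Sum>\<^sub>\<infinity>n. norm (a i n) * \<rho> ^ n)"
      using infsum_Sigma_banach[OF s] by simp
    also have "\<dots> \<le> (\<Sum>\<^sub>\<infinity>i\<in>I. c i)"
      by (rule infsum_mono[OF s1 c]) (use a(2) in auto)
    finally show "(\<Sum>\<^sub>\<infinity>p\<in>I \<times> UNIV. norm (a (fst p) (snd p)) * \<rho> ^ snd p) \<le> (\<Sum>\<^sub>\<infinity>i\<in>I. c i)" .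
    fix x :: real assume x: "\<bar>x\<bar> \<le> \<rho>"
    have le: "norm (x ^ n *\<^sub>R a i n) \<le> norm (a i n) * \<rho> ^ n" for i n
      by (rule norm_power_scaleR_le[OF x])
    have sx: "(\<lambda>p. x ^ snd p *\<^sub>R a (fst p) (snd p)) summable_on (I \<times> UNIV)"
      by (rule abs_summable_summable, rule summable_on_comparison_test[OF s]) (use le in auto)
    show "((\<lambda>p. x ^ snd p *\<^sub>R a (fst p) (snd p)) has_sum g x) (I \<times> UNIV)"
      by (rule has_sum_SigmaI[OF _ g[OF x] sx]) (use a(3) x in auto)
  qed (use s \<rho> in auto)
qed

lemma psb_add:
  fixes f g :: "real \<Rightarrow> 'a::banach"
  assumes "\<rho> > 0" "psb \<rho> f c" "psb \<rho> g d"
  shows "psb \<rho> (\<lambda>x. f x + g x) (c + d)"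
proof -
  have "psb \<rho> (\<lambda>x. f x + g x) (\<Sum>\<^sub>\<infinity>b\<in>UNIV. if b then c else d)"
    by (rule psb_infsum[where f="\<lambda>b. if b then f else g"])
       (use assms in \<open>auto simp: has_sum_finite_iff UNIV_bool\<close>)
  then show ?thesis by (simp add: UNIV_bool add.commute)
qed

lemma psb_sum:
  fixes f :: "'i \<Rightarrow> real \<Rightarrow> 'a::banach"
  assumes "\<rho> > 0" "finite I" "\<And>i. i \<in> I \<Longrightarrow> psb \<rho> (f i) (c i)"
  shows "psb \<rho> (\<lambda>x. \<Sum>i\<in>I. f i x) (\<Sum>i\<in>I. c i)"
  using psb_infsum[of \<rho> I f c "\<lambda>x. \<Sum>i\<in>I. f i x"] assms by (simp add: has_sum_finite_iff)

lemma psb_shift: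
  fixes f :: "real \<Rightarrow> 'a::banach"
  assumes \<rho>: "\<rho> > 0" and f: "psb \<rho> f c"
  shows "psb \<rho> (\<lambda>x. x ^ k *\<^sub>R f x) (\<rho> ^ k * c)"
proof -
  obtain a where a: "(\<lambda>n. norm (a n) * \<rho> ^ n) summable_on UNIV" "(\<Sum>\<^sub>\<infinity>n. norm (a n) * \<rho> ^ n) \<le> c"
    "\<And>x. \<bar>x\<bar> \<le> \<rho> \<Longrightarrow> ((\<lambda>n. x ^ n *\<^sub>R a n) has_sum f x) UNIV"
    using f by (rule psb_coeffs) blast
  show ?thesis
  proof (rule psb_family[of \<rho> a "\<lambda>n. n + k" UNIV])
    have e: "(\<lambda>n. norm (a n) * \<rho> ^ (n + k)) = (\<lambda>n. \<rho> ^ k * (norm (a n) * \<rho> ^ n))"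
      by (simp add: fun_eq_iff power_add)
    show "(\<lambda>n. norm (a n) * \<rho> ^ (n + k)) summable_on UNIV"
      unfolding e by (rule summable_on_cmult_right[OF a(1)])
    show "(\<Sum>\<^sub>\<infinity>n. norm (a n) * \<rho> ^ (n + k)) \<le> \<rho> ^ k * c"
      unfolding e infsum_cmult_right' using a(2) \<rho> by (intro mult_left_mono) auto
    fix x :: real assume x: "\<bar>x\<bar> \<le> \<rho>"
    show "((\<lambda>n. x ^ (n + k) *\<^sub>R a n) has_sum x ^ k *\<^sub>R f x) UNIV"
      using has_sum_scaleR[OF a(3)[OF x], of "x ^ k"] by (simp add: power_add mult.commute)
  qed (rule \<rho>)
qed

lemma psb_linear:
  fixes f :: "real \<Rightarrow> 'a::banach" and T :: "'a \<Rightarrow> 'b::banach"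
  assumes \<rho>: "\<rho> > 0" and f: "psb \<rho> f c" and T: "linear T" "\<And>x. norm (T x) \<le> K * norm x" "K \<ge> 0"
  shows "psb \<rho> (\<lambda>x. T (f x)) (K * c)"
proof -
  obtain a where a: "(\<lambda>n. norm (a n) * \<rho> ^ n) summable_on UNIV" "(\<Sum>\<^sub>\<infinity>n. norm (a n) * \<rho> ^ n) \<le> c"
    "\<And>x. \<bar>x\<bar> \<le> \<rho> \<Longrightarrow> ((\<lambda>n. x ^ n *\<^sub>R a n) has_sum f x) UNIV"
    using f by (rule psb_coeffs) blast
  have bl: "bounded_linear T"
    by (rule bounded_linear_intro[of _ K]) (use T linear_add linear_scale in \<open>auto simp: mult.commute\<close>)
  have le: "norm (T (a n)) * \<rho> ^ n \<le> K * (norm (a n) * \<rho> ^ n)" for n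
    using mult_right_mono[OF T(2)[of "a n"], of "\<rho> ^ n"] \<rho> by (simp add: mult.assoc)
  have s: "(\<lambda>n. norm (T (a n)) * \<rho> ^ n) summable_on UNIV"
    by (rule summable_on_comparison_test[OF summable_on_cmult_right[OF a(1), of K]]) (use le \<rho> in auto)
  show ?thesis
    unfolding psb_def
  proof (intro exI[of _ "\<lambda>n. T (a n)"] conjI allI impI s)
    have "(\<Sum>\<^sub>\<infinity>n. norm (T (a n)) * \<rho> ^ n) \<le> (\<Sum>\<^sub>\<infinity>n. K * (norm (a n) * \<rho> ^ n))"
      by (rule infsum_mono[OF s summable_on_cmult_right[OF a(1), of K] le])
    also have "\<dots> \<le> K * c"
      unfolding infsum_cmult_right' using a(2) T(3) by (rule mult_left_mono)
    finally show "(\<Sum>\<^sub>\<infinity>n. norm (T (a n)) * \<rho> ^ n) \<le> K * c" .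
    fix x :: real assume "\<bar>x\<bar> \<le> \<rho>"
    from has_sum_bounded_linear[OF bl a(3)[OF this]]
    show "((\<lambda>n. x ^ n *\<^sub>R T (a n)) has_sum T (f x)) UNIV"
      using T(1) by (simp add: o_def linear_scale)
  qed
qed

text \<open>With radius \<open>\<rho> - \<bar>x0\<bar>\<close> the binomial theorem reassembles the
  weights into exactly \<open>\<rho> ^ n\<close>, so the majorant survives without loss.\<close>

lemma psb_recenter:
  fixes f :: "real \<Rightarrow> 'a::banach"
  assumes f: "psb \<rho> f c" and x0: "\<bar>x0\<bar> < \<rho>"
  shows "psb (\<rho> - \<bar>x0\<bar>) (\<lambda>h. f (x0 + h)) c"
proof -
  obtain a where a: "(\<lambda>n. norm (a n) * \<rho> ^ n) summable_on UNIV" "(\<Sum>\<^sub>\<infinity>n. norm (a n) * \<rho> ^ n) \<le> c"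
    "\<And>x. \<bar>x\<bar> \<le> \<rho> \<Longrightarrow> ((\<lambda>n. x ^ n *\<^sub>R a n) has_sum f x) UNIV"
    using f by (rule psb_coeffs) blast
  define \<sigma> where "\<sigma> = \<rho> - \<bar>x0\<bar>"
  have \<sigma>: "\<sigma> > 0" using x0 by (simp add: \<sigma>_def)
  define z where "z p = (real (fst p choose snd p) * x0 ^ (fst p - snd p)) *\<^sub>R a (fst p)" for p
  have binom: "(\<Sum>j\<le>n. real (n choose j) * \<bar>x0\<bar> ^ (n - j) * \<sigma> ^ j) = \<rho> ^ n" for n
  proof -
    have "\<rho> ^ n = (\<sigma> + \<bar>x0\<bar>) ^ n" by (simp add: \<sigma>_def)
    also have "\<dots> = (\<Sum>j\<le>n. real (n choose j) * \<bar>x0\<bar> ^ (n - j) * \<sigma> ^ j)"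
      unfolding binomial_ring by (rule sum.cong) auto
    finally show ?thesis by simp
  qed
  have inner: "((\<lambda>j. norm (z (n, j)) * \<sigma> ^ j) has_sum norm (a n) * \<rho> ^ n) {..n}" for n
  proof -
    have "(\<Sum>j\<le>n. norm (z (n, j)) * \<sigma> ^ j) = norm (a n) * (\<Sum>j\<le>n. real (n choose j) * \<bar>x0\<bar> ^ (n - j) * \<sigma> ^ j)"
      unfolding sum_distrib_left by (rule sum.cong) (auto simp: z_def abs_mult power_abs)
    then show ?thesis by (simp add: has_sum_finite_iff binom)
  qed
  have s: "(\<lambda>p. norm (z p) * \<sigma> ^ snd p) summable_on (SIGMA n:UNIV. {..n})"
  proof (rule summable_on_SigmaI)
    show "((\<lambda>y. norm (z (n, y)) * \<sigma> ^ snd (n, y)) has_sum norm (a n) * \<rho> ^ n) {..n}" for n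
      using inner[of n] by simp
  qed (use a(1) \<sigma> in auto)
  have sv: "((\<lambda>p. norm (z p) * \<sigma> ^ snd p) has_sum (\<Sum>\<^sub>\<infinity>n. norm (a n) * \<rho> ^ n)) (SIGMA n:UNIV. {..n})"
    by (rule has_sum_SigmaI[OF _ has_sum_infsum[OF a(1)] s]) (use inner in auto)
  show ?thesis
    unfolding \<sigma>_def[symmetric]
  proof (rule psb_family[OF \<sigma> s])
    show "(\<Sum>\<^sub>\<infinity>p\<in>(SIGMA n:UNIV. {..n}). norm (z p) * \<sigma> ^ snd p) \<le> c"
      using infsumI[OF sv] a(2) by simp
    fix h :: real assume h: "\<bar>h\<bar> \<le> \<sigma>"
    have le: "norm (h ^ j *\<^sub>R z (n, j)) \<le> norm (z (n, j)) * \<sigma> ^ j" for n j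
      by (rule norm_power_scaleR_le[OF h])
    have sx: "(\<lambda>p. h ^ snd p *\<^sub>R z p) summable_on (SIGMA n:UNIV. {..n})"
      by (rule abs_summable_summable, rule summable_on_comparison_test[OF s]) (use le in auto)
    show "((\<lambda>p. h ^ snd p *\<^sub>R z p) has_sum f (x0 + h)) (SIGMA n:UNIV. {..n})"
    proof (rule has_sum_SigmaI[OF _ a(3) sx])
      show "\<bar>x0 + h\<bar> \<le> \<rho>" using h by (simp add: \<sigma>_def)
      fix n :: nat
      have "(\<Sum>j\<le>n. h ^ j *\<^sub>R z (n, j)) = (\<Sum>j\<le>n. real (n choose j) * h ^ j * x0 ^ (n - j)) *\<^sub>R a n"
        unfolding scaleR_sum_left by (rule sum.cong) (auto simp: z_def mult_ac)
      also have "\<dots> = (x0 + h) ^ n *\<^sub>R a n"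
        by (subst add.commute) (simp add: binomial_ring)
      finally show "((\<lambda>j. h ^ snd (n, j) *\<^sub>R z (n, j)) has_sum (x0 + h) ^ n *\<^sub>R a n) {..n}"
        by (simp add: has_sum_finite_iff)
    qed
  qed
qed

section \<open>Multilinear maps on lists\<close>

text \<open>The constant is carried along the recursion: fixing an argument \<open>v\<close> leaves
  a map with bound \<open>K * norm v\<close>. Inductions on the number of arguments become
  immediate; \<open>mlinI\<close> and \<open>mlin_norm\<close> translate from and to the usual
  product estimate.\<close>

fun mlin :: "nat \<Rightarrow> real \<Rightarrow> ('v::real_normed_vector list \<Rightarrow> 'f::real_normed_vector) \<Rightarrow> bool" where
  "mlin 0 K T \<longleftrightarrow> norm (T []) \<le> K"
| "mlin (Suc k) K T \<longleftrightarrow>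
     (\<forall>vs. length vs = k \<longrightarrow> linear (\<lambda>v. T (v # vs))) \<and> (\<forall>v. mlin k (K * norm v) (\<lambda>vs. T (v # vs)))"

lemma mlin_norm: "mlin k K T \<Longrightarrow> length vs = k \<Longrightarrow> norm (T vs) \<le> K * prod_list (map norm vs)"
proof (induction k arbitrary: K T vs)
  case (Suc k)
  then obtain v ws where vs: "vs = v # ws" "length ws = k" by (cases vs) auto
  then show ?case
    using Suc.IH[of "K * norm v" "\<lambda>vs. T (v # vs)" ws] Suc.prems by (simp add: mult.assoc)
qed simp

lemma mlinI:
  assumes "\<And>us ws. Suc (length us + length ws) = k \<Longrightarrow> linear (\<lambda>v. T (us @ v # ws))"
    and "\<And>vs. length vs = k \<Longrightarrow> norm (T vs) \<le> K * prod_list (map norm vs)"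
  shows "mlin k K T"
  using assms
proof (induction k arbitrary: K T)
  case 0
  then show ?case using 0(2)[of "[]"] by simp
next
  case (Suc k)
  have "linear (\<lambda>v. T (v # vs))" if "length vs = k" for vs
    using Suc.prems(1)[of "[]" vs] that by simp
  moreover have "mlin k (K * norm v) (\<lambda>vs. T (v # vs))" for v
  proof (rule Suc.IH)
    show "linear (\<lambda>x. T (v # us @ x # ws))" if "Suc (length us + length ws) = k" for us ws
      using Suc.prems(1)[of "v # us" ws] that by simp
    show "norm (T (v # vs)) \<le> K * norm v * prod_list (map norm vs)" if "length vs = k" for vs
      using Suc.prems(2)[of "v # vs"] that by (simp add: mult.assoc)
  qed
  ultimately show ?case by simp
qed

lemma mlin_slot: "mlin (Suc (length us + length ws)) K T \<Longrightarrow> linear (\<lambda>v. T (us @ v # ws))"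
proof (induction us arbitrary: K T)
  case (Cons u us)
  then have "mlin (Suc (length us + length ws)) (K * norm u) (\<lambda>vs. T (u # vs))" by simp
  from Cons.IH[OF this] show ?case by simp
qed simp

text \<open>Only the first argument is expanded into its series. Each coefficient
  \<open>a n\<close>, put into the first slot, leaves a map of \<open>k\<close> arguments with
  constant \<open>K * norm (a n)\<close>, to which the induction hypothesis applies; the results are
  summed over \<open>n\<close>.\<close>

lemma psb_mlin:
  fixes T :: "'v::banach list \<Rightarrow> 'f::banach"
  assumes \<rho>: "\<rho> > 0"
  shows "mlin k K T \<Longrightarrow> K \<ge> 0 \<Longrightarrow> length fs = k \<Longrightarrow> list_all2 (psb \<rho>) fs cs \<Longrightarrow>
    psb \<rho> (\<lambda>x. T (map (\<lambda>f. f x) fs)) (K * prod_list cs)"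
proof (induction k arbitrary: K T fs cs)
  case 0
  then show ?case using psb_const[OF \<rho>, of "T []" K] by simp
next
  case (Suc k)
  obtain f fs' where fs: "fs = f # fs'" "length fs' = k" using Suc.prems(3) by (cases fs) auto
  obtain c cs' where cs: "cs = c # cs'" using Suc.prems(4) fs by (cases cs) auto
  have f: "psb \<rho> f c" and fs': "list_all2 (psb \<rho>) fs' cs'" using Suc.prems(4) fs cs by auto
  have "\<forall>c\<in>set cs'. c \<ge> 0"
  proof
    fix c assume "c \<in> set cs'"
    then obtain i where "i < length cs'" "c = cs' ! i" by (auto simp: in_set_conv_nth)
    then show "c \<ge> 0" using fs' psb_nonneg[OF _ \<rho>] by (metis list_all2_conv_all_nth)
  qed
  then have p0: "prod_list cs' \<ge> 0" by (induction cs') auto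
  obtain a where a: "(\<lambda>n. norm (a n) * \<rho> ^ n) summable_on UNIV" "(\<Sum>\<^sub>\<infinity>n. norm (a n) * \<rho> ^ n) \<le> c"
    "\<And>x. \<bar>x\<bar> \<le> \<rho> \<Longrightarrow> ((\<lambda>n. x ^ n *\<^sub>R a n) has_sum f x) UNIV"
    using f by (rule psb_coeffs) blast
  have psn: "psb \<rho> (\<lambda>x. x ^ n *\<^sub>R T (a n # map (\<lambda>f. f x) fs')) (\<rho> ^ n * (K * norm (a n) * prod_list cs'))" for n
    by (rule psb_shift[OF \<rho>], rule Suc.IH) (use Suc.prems fs fs' in auto)
  have e: "\<rho> ^ n * (K * norm (a n) * prod_list cs') = K * prod_list cs' * (norm (a n) * \<rho> ^ n)" for n
    by simp
  have "psb \<rho> (\<lambda>x. T (map (\<lambda>f. f x) fs)) (\<Sum>\<^sub>\<infinity>n. K * prod_list cs' * (norm (a n) * \<rho> ^ n))"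
  proof (rule psb_infsum[OF \<rho> psn[unfolded e] summable_on_cmult_right[OF a(1)]])
    fix x :: real assume x: "\<bar>x\<bar> \<le> \<rho>"
    define ws where "ws = map (\<lambda>f. f x) fs'"
    have lws: "length ws = k" using fs by (simp add: ws_def)
    then have lin: "linear (\<lambda>v. T (v # ws))" using Suc.prems(1) by auto
    have "bounded_linear (\<lambda>v. T (v # ws))"
    proof (rule bounded_linear_intro[of _ "K * prod_list (map norm ws)"])
      show "norm (T (v # ws)) \<le> norm v * (K * prod_list (map norm ws))" for v
        using mlin_norm[OF Suc.prems(1), of "v # ws"] lws by (simp add: mult_ac)
    qed (use lin linear_add linear_scale in \<open>auto simp: linear_iff\<close>)
    from has_sum_bounded_linear[OF this a(3)[OF x]]
    have "((\<lambda>n. x ^ n *\<^sub>R T (a n # ws)) has_sum T (f x # ws)) UNIV"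
      using lin by (simp add: o_def linear_iff)
    then show "((\<lambda>n. x ^ n *\<^sub>R T (a n # map (\<lambda>f. f x) fs')) has_sum T (map (\<lambda>f. f x) fs)) UNIV"
      by (simp add: ws_def fs)
  qed
  moreover have "(\<Sum>\<^sub>\<infinity>n. K * prod_list cs' * (norm (a n) * \<rho> ^ n)) \<le> K * prod_list cs"
    unfolding infsum_cmult_right' using mult_left_mono[OF a(2), of "K * prod_list cs'"] Suc.prems(2) p0
    by (simp add: cs mult_ac)
  ultimately show ?case by (rule psb_mono)
qed

lemma psb_mlin_replicate:
  fixes T :: "'v::banach list \<Rightarrow> 'f::banach"
  assumes "\<rho> > 0" "mlin k K T" "K \<ge> 0" "psb \<rho> f c"
  shows "psb \<rho> (\<lambda>x. T (replicate k (f x))) (K * c ^ k)"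
  using psb_mlin[OF assms(1,2,3), of "replicate k f" "replicate k c"] assms(4)
  by (simp add: list_all2_conv_all_nth)

text \<open>Telescoping: the entries \<open>u\<close> are exchanged for \<open>v\<close> one slot at
  a time. Symmetry of \<open>T\<close> is not involved, hence the sum over positions.\<close>

lemma mlin_replicate_diff:
  assumes "mlin k K T"
  shows "T (replicate k u) - T (replicate k v) =
    (\<Sum>i<k. T (replicate i v @ (u - v) # replicate (k - Suc i) u))"
proof -
  have "T (replicate i v @ (u - v) # replicate (k - Suc i) u) =
     T (replicate i v @ replicate (k - i) u) - T (replicate (Suc i) v @ replicate (k - Suc i) u)" if "i < k" for i
  proof -
    have "linear (\<lambda>w. T (replicate i v @ w # replicate (k - Suc i) u))"
      by (rule mlin_slot[of _ _ K]) (use assms that in simp)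
    from linear_diff[OF this, of u v] show ?thesis
      using that by (simp add: Suc_diff_Suc replicate_app_Cons_same flip: replicate_Suc[of "k - Suc i" u])
  qed
  then have "(\<Sum>i<k. T (replicate i v @ (u - v) # replicate (k - Suc i) u))
    = (\<Sum>i<k. T (replicate i v @ replicate (k - i) u) - T (replicate (Suc i) v @ replicate (k - Suc i) u))"
    by (intro sum.cong) auto
  also have "\<dots> = T (replicate k u) - T (replicate k v)"
    by (subst sum_lessThan_telescope') auto
  finally show ?thesis by simp
qed

lemma psb_mlin_diff:
  fixes T :: "'v::banach list \<Rightarrow> 'f::banach"
  assumes \<rho>: "\<rho> > 0" and T: "mlin k K T" "K \<ge> 0"
    and f: "psb \<rho> f c" and g: "psb \<rho> g c" and d: "psb \<rho> (\<lambda>x. f x - g x) d"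
  shows "psb \<rho> (\<lambda>x. T (replicate k (f x)) - T (replicate k (g x))) (K * (real k * c ^ (k - 1) * d))"
proof -
  have "psb \<rho> (\<lambda>x. \<Sum>i<k. T (replicate i (g x) @ (f x - g x) # replicate (k - Suc i) (f x)))
     (\<Sum>i<k. K * (c ^ (k - 1) * d))"
  proof (rule psb_sum[OF \<rho>])
    fix i assume i: "i \<in> {..<k}"
    have "psb \<rho> (\<lambda>x. T (map (\<lambda>f. f x) (replicate i g @ (\<lambda>x. f x - g x) # replicate (k - Suc i) f)))
       (K * prod_list (replicate i c @ d # replicate (k - Suc i) c))"
      by (rule psb_mlin[OF \<rho> T])
         (use i f g d in \<open>auto intro!: list_all2_appendI simp: list_all2_conv_all_nth[of _ "replicate _ _"]\<close>)
    moreover have "prod_list (replicate i c @ d # replicate (k - Suc i) c) = c ^ (k - 1) * d"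
    proof -
      have "k - 1 = i + (k - Suc i)" using i by auto
      then have "c ^ (k - 1) = c ^ i * c ^ (k - Suc i)" by (simp only: power_add)
      then show ?thesis by (simp add: mult_ac)
    qed
    ultimately show "psb \<rho> (\<lambda>x. T (replicate i (g x) @ (f x - g x) # replicate (k - Suc i) (f x))) (K * (c ^ (k - 1) * d))"
      by (simp only: map_append list.map map_replicate)
  qed simp
  moreover have "(\<Sum>i<k. K * (c ^ (k - 1) * d)) = K * (real k * c ^ (k - 1) * d)" by simp
  ultimately show ?thesis
    by (simp only: mlin_replicate_diff[OF T(1)])
qed

text \<open>The iterates converge in the majorant norm, which is why the fixed point is again a power series.\<close>

lemma psb_fixed_point:
  fixes \<Psi> :: "real \<Rightarrow> 'z::banach \<Rightarrow> 'z"
  assumes \<rho>: "\<rho> > 0"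
    and zero: "psb \<rho> (\<lambda>x. \<Psi> x 0) (r / 2)"
    and lip: "\<And>f g d. psb \<rho> f r \<Longrightarrow> psb \<rho> g r \<Longrightarrow> psb \<rho> (\<lambda>x. f x - g x) d \<Longrightarrow>
                psb \<rho> (\<lambda>x. \<Psi> x (f x) - \<Psi> x (g x)) (d / 2)"
  obtains f where "psb \<rho> f r" "\<And>x. \<bar>x\<bar> \<le> \<rho> \<Longrightarrow> f x = \<Psi> x (f x)"
    "\<And>x z. \<bar>x\<bar> \<le> \<rho> \<Longrightarrow> norm z \<le> r \<Longrightarrow> z = \<Psi> x z \<Longrightarrow> z = f x"
proof -
  have r0: "r \<ge> 0" using psb_nonneg[OF zero \<rho>] by simp
  \<comment> \<open>Constant functions are admissible in \<open>lip\<close>, which yields a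
    pointwise contraction; it serves the limit equation and uniqueness.\<close>
  have lipp: "norm (\<Psi> x z - \<Psi> x z') \<le> norm (z - z') / 2"
    if "\<bar>x\<bar> \<le> \<rho>" "norm z \<le> r" "norm z' \<le> r" for x z z'
    using psb_norm_le[OF lip[OF psb_const[OF \<rho> that(2)] psb_const[OF \<rho> that(3)]
        psb_const[OF \<rho> order_refl]] that(1)] .
  define F where "F n = ((\<lambda>f x. \<Psi> x (f x)) ^^ n) (\<lambda>_. 0)" for n
  have F0: "F 0 = (\<lambda>_. 0)" and FS: "F (Suc n) = (\<lambda>x. \<Psi> x (F n x))" for n
    by (simp_all add: F_def)
  have le1: "r * (1 - 1 / 2 ^ n) \<le> r" for n
    using r0 by (simp add: mult_left_le)
  \<comment> \<open>The increasing bounds \<open>r * (1 - 1 / 2 ^ n)\<close> keep all iterates in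
    the ball where \<open>lip\<close> applies.\<close>
  have step: "psb \<rho> (F n) (r * (1 - 1 / 2 ^ n)) \<and> psb \<rho> (F (Suc n)) (r * (1 - 1 / 2 ^ Suc n)) \<and>
    psb \<rho> (\<lambda>x. F (Suc n) x - F n x) (r / 2 ^ Suc n)" for n
  proof (induction n)
    case 0
    then show ?case using zero psb_zero[OF \<rho>] by (simp add: F0 FS)
  next
    case (Suc n)
    have d: "psb \<rho> (\<lambda>x. F (Suc (Suc n)) x - F (Suc n) x) (r / 2 ^ Suc (Suc n))"
    proof -
      have "psb \<rho> (F (Suc n)) r" "psb \<rho> (F n) r"
        using Suc.IH psb_mono le1 by blast+
      then show ?thesis
        using lip[of "F (Suc n)" "F n" "r / 2 ^ Suc n"] Suc.IH by (simp add: FS mult_ac)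
    qed
    have "psb \<rho> (F (Suc (Suc n))) (r * (1 - 1 / 2 ^ Suc n) + r / 2 ^ Suc (Suc n))"
      using psb_add[OF \<rho> conjunct1[OF conjunct2[OF Suc.IH]] d] by simp
    moreover have "r * (1 - 1 / 2 ^ Suc n) + r / 2 ^ Suc (Suc n) = r * (1 - 1 / 2 ^ Suc (Suc n))"
      by (simp add: field_simps)
    ultimately show ?case using Suc.IH d by simp
  qed
  have Fr: "psb \<rho> (F n) r" for n using step[of n] le1 psb_mono by blast
  define f where "f x = (\<Sum>\<^sub>\<infinity>n. F (Suc n) x - F n x)" for x
  have g2: "((\<lambda>n. r / 2 ^ Suc n) has_sum r) UNIV"
  proof (rule sums_nonneg_imp_has_sum)
    show "(\<lambda>n. r / 2 ^ Suc n) sums r"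
      using sums_mult[OF power_half_series, of r] by (simp add: power_divide)
  qed (use r0 in auto)
  have sn: "(\<lambda>n. norm (F (Suc n) x - F n x)) summable_on UNIV" if "\<bar>x\<bar> \<le> \<rho>" for x
    by (rule summable_on_comparison_test[OF has_sum_imp_summable[OF g2]])
       (use psb_norm_le[OF conjunct2[OF conjunct2[OF step]] that] in auto)
  have hs: "((\<lambda>n. F (Suc n) x - F n x) has_sum f x) UNIV" if "\<bar>x\<bar> \<le> \<rho>" for x
    unfolding f_def using abs_summable_summable[OF sn[OF that]] by simp
  have fr: "psb \<rho> f r"
    using psb_infsum[OF \<rho> _ has_sum_imp_summable[OF g2] hs] step infsumI[OF g2] by simp
  have lim: "(\<lambda>n. F n x) \<longlonglongrightarrow> f x" if "\<bar>x\<bar> \<le> \<rho>" for x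
    using has_sum_imp_sums[OF hs[OF that]] unfolding sums_def sum_lessThan_telescope[of "\<lambda>n. F n x"]
    by (simp add: F0)
  have fx: "f x = \<Psi> x (f x)" if x: "\<bar>x\<bar> \<le> \<rho>" for x
  proof -
    have "(\<lambda>n. \<Psi> x (F n x)) \<longlonglongrightarrow> \<Psi> x (f x)"
    proof (rule Lim_transform_bound[where g="\<lambda>n. F n x - f x", THEN LIM_zero_cancel])
      show "\<forall>\<^sub>F n in sequentially. norm (\<Psi> x (F n x) - \<Psi> x (f x)) \<le> norm (F n x - f x)"
      proof (rule always_eventually, rule allI)
        fix n
        show "norm (\<Psi> x (F n x) - \<Psi> x (f x)) \<le> norm (F n x - f x)"
          using lipp[OF x psb_norm_le[OF Fr x] psb_norm_le[OF fr x], of n] norm_ge_zero[of "F n x - f x"]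
          by linarith
      qed
      show "(\<lambda>n. F n x - f x) \<longlonglongrightarrow> 0" using lim[OF x] by (rule LIM_zero)
    qed
    moreover have "(\<lambda>n. \<Psi> x (F n x)) \<longlonglongrightarrow> f x"
      using LIMSEQ_Suc[OF lim[OF x]] by (simp add: FS)
    ultimately show ?thesis using LIMSEQ_unique by blast
  qed
  show ?thesis
  proof (rule that[OF fr fx])
    fix x z assume x: "\<bar>x\<bar> \<le> \<rho>" and z: "norm z \<le> r" "z = \<Psi> x z"
    have "norm (z - f x) \<le> norm (z - f x) / 2"
      using lipp[OF x z(1) psb_norm_le[OF fr x]] fx[OF x] z(2) by simp
    then show "z = f x" by simp
  qed
qed

section \<open>Consequences of the Baire category theorem\<close>

text \<open>The form relative to a closed set \<open>M\<close> is what the open mapping argument on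
  a closed subspace needs.\<close>

lemma Baire_closed_cover:
  fixes A :: "nat \<Rightarrow> 'a::banach set"
  assumes M: "closed M" "M \<noteq> {}" and A: "\<And>n. closed (A n)" and cov: "M \<subseteq> (\<Union>n. A n)"
  obtains n x r where "x \<in> M" "r > 0" "ball x r \<inter> M \<subseteq> A n"
proof -
  have cm: "completely_metrizable_space (top_of_set M)"
    by (rule completely_metrizable_space_closedin[OF completely_metrizable_space_euclidean, unfolded subtopology_UNIV])
       (use M in auto)
  have "\<exists>n. top_of_set M interior_of (A n \<inter> M) \<noteq> {}"
  proof (rule ccontr)
    assume *: "\<not> ?thesis"
    have "top_of_set M interior_of \<Union>(range (\<lambda>n. A n \<inter> M)) = {}"
    proof (rule Baire_category_alt)
      fix T assume "T \<in> range (\<lambda>n. A n \<inter> M)"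
      then show "closedin (top_of_set M) T \<and> top_of_set M interior_of T = {}"
        using * A by (auto simp: closedin_closed)
    qed (use cm in auto)
    moreover have "\<Union>(range (\<lambda>n. A n \<inter> M)) = M" using cov by auto
    moreover have "top_of_set M interior_of M = M"
      using interior_of_topspace[of "top_of_set M"] by simp
    ultimately show False using M(2) by simp
  qed
  then obtain n x where "x \<in> top_of_set M interior_of (A n \<inter> M)" by blast
  then obtain T where T: "openin (top_of_set M) T" "x \<in> T" "T \<subseteq> A n \<inter> M"
    by (auto simp: interior_of_def)
  then obtain r where "r > 0" "ball x r \<inter> M \<subseteq> T"
    by (meson openin_contains_ball)
  with T that show ?thesis by blast
qed

text \<open>Quantitative open mapping theorem between closed subspaces. Baire puts a ball of
  \<open>G\<close> into the closure of the image of a ball; differences of approximants then solve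
  \<open>T x = y\<close> up to half the norm of \<open>y\<close>, and the successive corrections sum
  geometrically.\<close>

lemma bounded_right_inverse:
  fixes T :: "'a::banach \<Rightarrow> 'b::banach"
  assumes E: "subspace E" "closed E" and G: "subspace G" "closed G"
    and T: "bounded_linear T" and onto: "T ` E = G"
  shows "\<exists>C\<ge>0. \<forall>y\<in>G. \<exists>x\<in>E. T x = y \<and> norm x \<le> C * norm y"
proof -
  interpret T: bounded_linear T by (rule T)
  define A where "A n = closure (T ` (E \<inter> cball 0 (real n)))" for n
  have cov: "G \<subseteq> (\<Union>n. A n)"
  proof
    fix y assume "y \<in> G"
    then obtain x where x: "x \<in> E" "y = T x" using onto by blast
    obtain n where "norm x \<le> real n" using real_arch_simple by blast
    then have "y \<in> A n" unfolding A_def using x by (intro closure_subset[THEN subsetD]) auto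
    then show "y \<in> (\<Union>n. A n)" by blast
  qed
  have ne: "G \<noteq> {}" using subspace_0[OF G(1)] by blast
  have clA: "closed (A n)" for n by (simp add: A_def)
  obtain n y0 r where y0: "y0 \<in> G" "r > 0" "ball y0 r \<inter> G \<subseteq> A n"
    by (rule Baire_closed_cover[OF G(2) ne clA cov])
  \<comment> \<open>This is the bound \<open>2 * real n\<close> for \<open>norm (p - q)\<close>,
    divided by the scale \<open>r / (2 * norm y)\<close> chosen below.\<close>
  define C where "C = 4 * real n / r"
  have C0: "C \<ge> 0" using y0(2) by (simp add: C_def)
  have appr: "\<exists>x\<in>E. norm x \<le> C * norm y \<and> norm (y - T x) \<le> norm y / 2" if y: "y \<in> G" for y
  proof (cases "y = 0")
    case True
    then show ?thesis using subspace_0[OF E(1)] by (intro bexI[of _ 0]) (auto simp: T.zero)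
  next
    case False
    \<comment> \<open>At this scale \<open>y0\<close> and \<open>y0 + s *\<^sub>R y\<close> both lie
      in the ball, so \<open>y\<close> is a difference quotient of two nearly attained
      values.\<close>
    define s where "s = r / (2 * norm y)"
    have s: "s > 0" using False y0(2) by (simp add: s_def)
    have "norm (s *\<^sub>R y) < r" using False y0(2) by (simp add: s_def)
    then have "y0 + s *\<^sub>R y \<in> ball y0 r \<inter> G" "y0 \<in> ball y0 r \<inter> G"
      using y0 y G(1) by (auto simp: dist_norm subspace_add subspace_scale)
    then have "y0 + s *\<^sub>R y \<in> A n" "y0 \<in> A n" using y0(3) by blast+
    moreover have "\<exists>p\<in>E. norm p \<le> real n \<and> norm (T p - z) < s * norm y / 4" if "z \<in> A n" for z
    proof -
      have "0 < s * norm y / 4" using s False by simp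
      with that obtain w where "w \<in> T ` (E \<inter> cball 0 (real n))" "dist w z < s * norm y / 4"
        unfolding A_def closure_approachable by blast
      then show ?thesis by (auto simp: dist_norm)
    qed
    ultimately obtain p q where p: "p \<in> E" "norm p \<le> real n" "norm (T p - (y0 + s *\<^sub>R y)) < s * norm y / 4"
      and q: "q \<in> E" "norm q \<le> real n" "norm (T q - y0) < s * norm y / 4"
      by blast
    define x where "x = (1 / s) *\<^sub>R (p - q)"
    have "s *\<^sub>R (y - T x) = (T q - y0) - (T p - (y0 + s *\<^sub>R y))"
      using s by (simp add: x_def T.scaleR T.diff algebra_simps)
    then have "s * norm (y - T x) = norm ((T q - y0) - (T p - (y0 + s *\<^sub>R y)))"
      using s by (metis abs_of_pos norm_scaleR)
    also have "\<dots> \<le> s * norm y / 2"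
      using norm_triangle_ineq4[of "T q - y0" "T p - (y0 + s *\<^sub>R y)"] p(3) q(3) by simp
    finally have 1: "norm (y - T x) \<le> norm y / 2" using s by simp
    have "norm (p - q) \<le> 2 * real n" using norm_triangle_ineq4[of p q] p q by simp
    moreover have "norm x = norm (p - q) / s" using s by (simp add: x_def)
    ultimately have "norm x \<le> 2 * real n / s" using s by (simp add: divide_right_mono)
    also have "\<dots> = C * norm y" using y0(2) False by (simp add: C_def s_def field_simps)
    finally have 2: "norm x \<le> C * norm y" .
    have "x \<in> E" unfolding x_def using E(1) p q by (intro subspace_scale subspace_diff) auto
    with 1 2 show ?thesis by blast
  qed
  then obtain h where h: "\<And>y. y \<in> G \<Longrightarrow> h y \<in> E" "\<And>y. y \<in> G \<Longrightarrow> norm (h y) \<le> C * norm y"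
    "\<And>y. y \<in> G \<Longrightarrow> norm (y - T (h y)) \<le> norm y / 2" by metis
  have "\<exists>x\<in>E. T x = y \<and> norm x \<le> (C * 2) * norm y" if y: "y \<in> G" for y
  proof -
    \<comment> \<open>\<open>Y k\<close> is the residual after \<open>k\<close> corrections; it is
      halved each time, so the corrections \<open>h (Y k)\<close> are absolutely summable.\<close>
    define Y where "Y k = ((\<lambda>y. y - T (h y)) ^^ k) y" for k
    have YS: "Y (Suc k) = Y k - T (h (Y k))" for k by (simp add: Y_def)
    have YG: "Y k \<in> G" for k
    proof (induction k)
      case (Suc k)
      then show ?case unfolding YS using h(1) onto G(1) by (intro subspace_diff) auto
    qed (simp add: Y_def y)
    have Yn: "norm (Y k) \<le> norm y * (1 / 2) ^ k" for k
    proof (induction k)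
      case (Suc k)
      then show ?case unfolding YS using h(3)[OF YG[of k]] by simp
    qed (simp add: Y_def)
    have hn: "norm (h (Y k)) \<le> C * norm y * (1 / 2) ^ k" for k
      using h(2)[OF YG[of k]] mult_left_mono[OF Yn[of k] C0] by (simp add: mult.assoc)
    have geo: "(\<lambda>k. C * norm y * (1 / 2) ^ k) sums (C * norm y * 2)"
      using sums_mult[OF geometric_sums[of "1 / 2 :: real"], of "C * norm y"] by simp
    have sm: "summable (\<lambda>k. norm (h (Y k)))"
      by (rule summable_comparison_test'[OF sums_summable[OF geo]]) (use hn in auto)
    define x where "x = (\<Sum>k. h (Y k))"
    have sx: "(\<lambda>k. h (Y k)) sums x" unfolding x_def using summable_norm_cancel[OF sm] by (rule summable_sums)
    have xE: "x \<in> E"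
      by (rule closed_sequentially[OF E(2) _ sx[unfolded sums_def]]) (intro subspace_sum[OF E(1)] h(1) YG)
    have "norm x \<le> (\<Sum>k. norm (h (Y k)))" unfolding x_def by (rule summable_norm[OF sm])
    also have "\<dots> \<le> C * norm y * 2"
      using suminf_le[OF hn sm sums_summable[OF geo]] sums_unique[OF geo] by simp
    finally have nx: "norm x \<le> C * 2 * norm y" by (simp add: mult_ac)
    have "(\<lambda>k. T (h (Y k))) sums T x" by (rule T.sums[OF sx])
    moreover have "(\<lambda>k. T (h (Y k))) sums y"
    proof -
      have "(\<Sum>k<n. T (h (Y k))) = y - Y n" for n
      proof (induction n)
        case 0 then show ?case by (simp add: Y_def)
      qed (simp add: YS)
      moreover have "Y \<longlonglongrightarrow> 0"
      proof (rule Lim_null_comparison)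
        show "(\<lambda>k. norm y * (1 / 2) ^ k) \<longlonglongrightarrow> 0"
          by (rule tendsto_mult_right_zero[OF LIMSEQ_power_zero]) simp
      qed (use Yn in auto)
      then have "(\<lambda>n. y - Y n) \<longlonglongrightarrow> y - 0" by (intro tendsto_diff tendsto_const)
      ultimately show ?thesis by (simp add: sums_def)
    qed
    ultimately have "T x = y" by (rule sums_unique2)
    with xE nx show ?thesis by blast
  qed
  moreover have "C * 2 \<ge> 0" using C0 by simp
  ultimately show ?thesis by blast
qed

section \<open>Polarization\<close>

text \<open>By homogeneity every slot may be rescaled to norm \<open>s\<close>, at the price of one
  division by \<open>s\<close> per slot.\<close>

lemma mlin_bound:
  assumes "mlin k K T" and "s > 0"
    and "\<And>hs. length hs = k \<Longrightarrow> (\<And>h. h \<in> set hs \<Longrightarrow> norm h \<le> s) \<Longrightarrow> norm (T hs) \<le> B"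
  shows "mlin k (B / s ^ k) T"
  using assms
proof (induction k arbitrary: K T B)
  case 0
  then show ?case using 0(3)[of "[]"] by simp
next
  case (Suc k)
  have "mlin k (B * norm v / s / s ^ k) (\<lambda>vs. T (v # vs))" for v
  proof (rule Suc.IH[OF _ Suc.prems(2)])
    show "mlin k (K * norm v) (\<lambda>vs. T (v # vs))" using Suc.prems(1) by simp
    fix hs :: "'a list" assume hs: "length hs = k" "\<And>h. h \<in> set hs \<Longrightarrow> norm h \<le> s"
    have lin: "linear (\<lambda>v. T (v # hs))" using Suc.prems(1) hs(1) by simp
    show "norm (T (v # hs)) \<le> B * norm v / s"
    proof (cases "v = 0")
      case True
      then show ?thesis using linear_0[OF lin] by simp
    next
      case False
      have "norm (T ((s / norm v) *\<^sub>R v # hs)) \<le> B"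
        by (rule Suc.prems(3)) (use hs Suc.prems(2) False in auto)
      then have "(s / norm v) * norm (T (v # hs)) \<le> B"
        using linear_scale[OF lin, of "s / norm v" v] Suc.prems(2) by simp
      then show ?thesis using False Suc.prems(2) by (simp add: field_simps)
    qed
  qed
  then show ?case using Suc.prems(1) by (simp add: mult_ac)
qed

lemma mlin_expand:
  assumes "finite A" "mlin k K T"
  shows "T (replicate k (\<Sum>a\<in>A. g a)) = (\<Sum>xs | set xs \<subseteq> A \<and> length xs = k. T (map g xs))"
  using assms(2)
proof (induction k arbitrary: K T)
  case 0
  have "{xs. set xs \<subseteq> A \<and> length xs = 0} = {[]}" by auto
  then show ?case by simp
next
  case (Suc k)
  define X where "X = {xs. set xs \<subseteq> A \<and> length xs = k}"
  have e: "{xs. set xs \<subseteq> A \<and> length xs = Suc k} = (\<lambda>(a, xs). a # xs) ` (A \<times> X)"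
    unfolding X_def by (auto simp: length_Suc_conv image_iff)
  have "T (replicate (Suc k) (\<Sum>a\<in>A. g a)) = (\<Sum>a\<in>A. T (g a # replicate k (\<Sum>a\<in>A. g a)))"
    using linear_sum[of "\<lambda>v. T (v # replicate k (\<Sum>a\<in>A. g a))"] Suc.prems by simp
  also have "\<dots> = (\<Sum>a\<in>A. \<Sum>xs\<in>X. T (g a # map g xs))"
  proof (rule sum.cong[OF refl])
    fix a
    have "mlin k (K * norm (g a)) (\<lambda>vs. T (g a # vs))" using Suc.prems by simp
    from Suc.IH[OF this] show "T (g a # replicate k (\<Sum>a\<in>A. g a)) = (\<Sum>xs\<in>X. T (g a # map g xs))"
      by (simp add: X_def)
  qed
  also have "\<dots> = (\<Sum>p\<in>A \<times> X. T (map g (fst p # snd p)))"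
    by (simp add: sum.cartesian_product case_prod_beta)
  also have "\<dots> = (\<Sum>xs | set xs \<subseteq> A \<and> length xs = Suc k. T (map g xs))"
    unfolding e by (subst sum.reindex) (auto simp: inj_on_def case_prod_beta)
  finally show ?case .
qed

text \<open>Even and odd sets between \<open>B\<close> and \<open>U\<close> are equinumerous unless
  \<open>B = U\<close>; the summand \<open>card U\<close> in the exponent normalizes the sign of the
  surviving term.\<close>

lemma alternating_supersets:
  assumes "finite U" "B \<subseteq> U"
  shows "(\<Sum>S | S \<subseteq> U \<and> B \<subseteq> S. (- 1) ^ (card U + card S)) = (if B = U then 1 else (0::real))"
proof (cases "B = U")
  case True
  then have "{S. S \<subseteq> U \<and> B \<subseteq> S} = {U}" by auto
  then show ?thesis using True by (simp flip: mult_2)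
next
  case False
  define X where "X = {S. S \<subseteq> U \<and> B \<subseteq> S}"
  have fX: "finite X" unfolding X_def using assms(1) by simp
  have "(\<Sum>S\<in>X. (- 1) ^ card S :: real) = (\<Sum>S\<in>X. if even (card S) then 1 else - 1)"
    by (intro sum.cong) auto
  also have "\<dots> = real (card (X \<inter> {S. even (card S)})) - real (card (X \<inter> - {S. even (card S)}))"
    using fX by (simp add: sum.If_cases)
  also have "X \<inter> {S. even (card S)} = {S. S \<subseteq> U \<and> B \<subseteq> S \<and> even (card S)}"
    by (auto simp: X_def)
  also have "X \<inter> - {S. even (card S)} = {S. S \<subseteq> U \<and> B \<subseteq> S \<and> odd (card S)}"
    by (auto simp: X_def)
  also have "real (card {S. S \<subseteq> U \<and> B \<subseteq> S \<and> even (card S)}) - real (card {S. S \<subseteq> U \<and> B \<subseteq> S \<and> odd (card S)}) = 0"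
    using card_subsupersets_even_odd[of U B] assms False by auto
  finally have "(\<Sum>S\<in>X. (- 1) ^ card S :: real) = 0" .
  then show ?thesis using False
    unfolding X_def[symmetric] power_add sum_distrib_left[symmetric] by simp
qed

text \<open>Each diagonal is expanded into words of length \<open>k\<close> over the letters up to
  \<open>k\<close>, where the letter \<open>k\<close> stands for the base point \<open>p\<close>.
  The alternating sum kills every word that misses a letter below \<open>k\<close>; a word that uses
  all of them is a permutation and leaves no room for \<open>p\<close>. Hence the base point is
  arbitrary, as the application of Baire's theorem requires.\<close>

lemma polarization:
  fixes T :: "'v::real_normed_vector list \<Rightarrow> 'f::real_normed_vector"
  assumes T: "mlin k K T"
  shows "(\<Sum>S\<in>Pow {..<k}. (- 1) ^ (k + card S) *\<^sub>R T (replicate k (p + (\<Sum>i\<in>S. h i))))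
       = (\<Sum>xs\<in>permutations_of_set {..<k}. T (map h xs))"
proof -
  define g where "g i = (if i < k then h i else p)" for i
  define X where "X = {xs. set xs \<subseteq> {..k} \<and> length xs = k}"
  have fX: "finite X" unfolding X_def by (rule finite_lists_length_eq) simp
  have S: "T (replicate k (p + (\<Sum>i\<in>S. h i))) = (\<Sum>xs\<in>X. if set xs - {k} \<subseteq> S then T (map g xs) else 0)"
    if "S \<subseteq> {..<k}" for S
  proof -
    have "p + (\<Sum>i\<in>S. h i) = (\<Sum>i\<in>insert k S. g i)"
      using that finite_subset[OF that] by (subst sum.insert) (auto simp: g_def intro!: sum.cong)
    then have "T (replicate k (p + (\<Sum>i\<in>S. h i))) = (\<Sum>xs | set xs \<subseteq> insert k S \<and> length xs = k. T (map g xs))"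
      using mlin_expand[OF _ T, of "insert k S" g] finite_subset[OF that] by simp
    also have "{xs. set xs \<subseteq> insert k S \<and> length xs = k} = {xs\<in>X. set xs - {k} \<subseteq> S}"
      using that by (auto simp: X_def)
    finally show ?thesis by (simp add: sum.inter_filter[OF fX])
  qed
  have "(\<Sum>S\<in>Pow {..<k}. (- 1) ^ (k + card S) *\<^sub>R T (replicate k (p + (\<Sum>i\<in>S. h i))))
    = (\<Sum>S\<in>Pow {..<k}. \<Sum>xs\<in>X. (if set xs - {k} \<subseteq> S then (- 1) ^ (k + card S) else 0) *\<^sub>R T (map g xs))"
    by (rule sum.cong) (auto simp: S scaleR_sum_right if_distrib intro!: sum.cong)
  also have "\<dots> = (\<Sum>xs\<in>X. (\<Sum>S\<in>Pow {..<k}. if set xs - {k} \<subseteq> S then (- 1) ^ (k + card S) else 0) *\<^sub>R T (map g xs))"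
    by (subst sum.swap) (simp add: scaleR_sum_left)
  also have "\<dots> = (\<Sum>xs\<in>X. (if set xs - {k} = {..<k} then 1 else 0) *\<^sub>R T (map g xs))"
  proof (rule sum.cong[OF refl])
    fix xs assume "xs \<in> X"
    then have "set xs - {k} \<subseteq> {..<k}" by (auto simp: X_def)
    from alternating_supersets[OF _ this]
    have alt: "(\<Sum>S | S \<subseteq> {..<k} \<and> set xs - {k} \<subseteq> S. (- 1) ^ (k + card S)) = (if set xs - {k} = {..<k} then 1 else (0::real))"
      by simp
    have e: "{S. S \<subseteq> {..<k} \<and> set xs - {k} \<subseteq> S} = {S \<in> Pow {..<k}. set xs - {k} \<subseteq> S}" by auto
    have flt: "(\<Sum>S\<in>{S \<in> Pow {..<k}. set xs - {k} \<subseteq> S}. (- 1) ^ (k + card S))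
      = (\<Sum>S\<in>Pow {..<k}. if set xs - {k} \<subseteq> S then (- 1) ^ (k + card S) else (0::real))"
      by (rule sum.inter_filter) simp
    have "(\<Sum>S\<in>Pow {..<k}. if set xs - {k} \<subseteq> S then (- 1) ^ (k + card S) else 0)
      = (if set xs - {k} = {..<k} then 1 else (0::real))"
      by (simp only: alt[unfolded e] flt[symmetric])
    then show "(\<Sum>S\<in>Pow {..<k}. if set xs - {k} \<subseteq> S then (- 1) ^ (k + card S) else 0) *\<^sub>R T (map g xs)
      = (if set xs - {k} = {..<k} then 1 else 0) *\<^sub>R T (map g xs)" by simp
  qed
  also have "\<dots> = (\<Sum>xs\<in>{xs\<in>X. set xs - {k} = {..<k}}. T (map g xs))"
    by (subst sum.inter_filter[OF fX]) (auto intro!: sum.cong)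
  also have "{xs\<in>X. set xs - {k} = {..<k}} = permutations_of_set {..<k}"
  proof (intro set_eqI iffI)
    fix xs assume "xs \<in> {xs\<in>X. set xs - {k} = {..<k}}"
    then have xs: "set xs - {k} = {..<k}" "length xs = k" by (auto simp: X_def)
    have "card (set xs) \<le> card (set xs - {k})" using card_length[of xs] xs by simp
    then have "set xs = set xs - {k}"
      using card_Diff1_less[of "set xs" k] by fastforce
    then show "xs \<in> permutations_of_set {..<k}"
      using xs by (simp add: permutations_of_set_def card_distinct)
  next
    fix xs assume xs: "xs \<in> permutations_of_set {..<k}"
    have l: "length xs = k" using length_finite_permutations_of_set[OF xs] by simp
    have e: "set xs = {..<k}" using xs by (simp add: permutations_of_set_def)
    have "{..<k} \<subseteq> {..k}" "{..<k} - {k} = {..<k}" by auto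
    then show "xs \<in> {xs\<in>X. set xs - {k} = {..<k}}" unfolding X_def mem_Collect_eq e l by simp
  qed
  also have "(\<Sum>xs\<in>permutations_of_set {..<k}. T (map g xs)) = (\<Sum>xs\<in>permutations_of_set {..<k}. T (map h xs))"
    by (intro sum.cong arg_cong[of _ _ T] map_cong) (auto simp: permutations_of_set_def g_def)
  finally show ?thesis .
qed

text \<open>The expansions involve diagonal values only, which symmetrization preserves, while
  polarization controls only the symmetric part. The given multilinear maps, which need not be
  symmetric, are therefore replaced by these.\<close>

definition symmetrized :: "nat \<Rightarrow> ('v list \<Rightarrow> 'f::real_normed_vector) \<Rightarrow> 'v list \<Rightarrow> 'f" where
  "symmetrized k T hs = (1 / fact k) *\<^sub>R (\<Sum>xs\<in>permutations_of_set {..<k}. T (map ((!) hs) xs))"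

lemma symmetrized_replicate: "symmetrized k T (replicate k p) = T (replicate k p)"
proof -
  have "map ((!) (replicate k p)) xs = replicate k p" if "xs \<in> permutations_of_set {..<k}" for xs
    using that length_finite_permutations_of_set[OF that]
    by (intro replicate_eqI) (auto simp: permutations_of_set_def)
  then have "symmetrized k T (replicate k p) = (1 / fact k) *\<^sub>R (\<Sum>xs\<in>permutations_of_set {..<k}. T (replicate k p))"
    unfolding symmetrized_def by (metis (no_types, lifting) sum.cong)
  also have "\<dots> = T (replicate k p)" by (simp add: sum_constant_scaleR)
  finally show ?thesis .
qed

lemma mlin_symmetrized:
  fixes T :: "'v::real_normed_vector list \<Rightarrow> 'f::real_normed_vector"
  assumes T: "mlin k K T"
  shows "mlin k K (symmetrized k T)"
proof (rule mlinI)
  fix us ws :: "'v list" assume l: "Suc (length us + length ws) = k"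
  \<comment> \<open>A permutation hits the position of \<open>v\<close> exactly once, so the
    permuted list carries \<open>v\<close> in a single slot of \<open>T\<close>.\<close>
  have "linear (\<lambda>v. T (map ((!) (us @ v # ws)) xs))" if xs: "xs \<in> permutations_of_set {..<k}" for xs
  proof -
    let ?n = "length us"
    have "?n \<in> set xs" "distinct xs" using xs l by (auto simp: permutations_of_set_def)
    then obtain as bs where ab: "xs = as @ ?n # bs" "?n \<notin> set as" "?n \<notin> set bs"
      by (auto dest!: split_list)
    have nth: "(us @ v # ws) ! i = (us @ w # ws) ! i" if "i \<noteq> ?n" for i v w
      using that by (auto simp: nth_append nth_Cons')
    have mm: "map ((!) (us @ v # ws)) as = map ((!) (us @ 0 # ws)) as" "map ((!) (us @ v # ws)) bs = map ((!) (us @ 0 # ws)) bs" for v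
      by (intro map_cong refl nth; use ab in blast)+
    have m: "map ((!) (us @ v # ws)) xs = map ((!) (us @ 0 # ws)) as @ v # map ((!) (us @ 0 # ws)) bs" for v
      by (simp only: ab(1) map_append list.map mm[of v] nth_append_length)
    have "length xs = k" using length_finite_permutations_of_set[OF xs] by simp
    then show ?thesis unfolding m by (intro mlin_slot[of _ _ K]) (use T ab in simp)
  qed
  then show "linear (\<lambda>v. symmetrized k T (us @ v # ws))"
    unfolding symmetrized_def linear_iff
    by (simp add: scaleR_right_distrib sum.distrib scaleR_sum_right mult.commute)
next
  fix hs :: "'v list" assume l: "length hs = k"
  have "norm (T (map ((!) hs) xs)) \<le> K * prod_list (map norm hs)" if xs: "xs \<in> permutations_of_set {..<k}" for xs
  proof -
    have lx: "length xs = k" using length_finite_permutations_of_set[OF xs] by simp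
    have "prod_list (map norm (map ((!) hs) xs)) = (\<Prod>i\<in>set xs. norm (hs ! i))"
      using xs by (subst prod.distinct_set_conv_list) (auto simp: permutations_of_set_def o_def)
    also have "\<dots> = prod_list (map norm hs)"
      using xs l by (simp add: permutations_of_set_def prod.list_conv_set_nth atLeast0LessThan)
    finally show ?thesis using mlin_norm[OF T, of "map ((!) hs) xs"] lx by simp
  qed
  then have "norm (\<Sum>xs\<in>permutations_of_set {..<k}. T (map ((!) hs) xs)) \<le> fact k * (K * prod_list (map norm hs))"
    using sum_norm_bound[of "permutations_of_set {..<k}" "\<lambda>xs. T (map ((!) hs) xs)"] by simp
  then show "norm (symmetrized k T hs) \<le> K * prod_list (map norm hs)"
    by (simp add: symmetrized_def field_simps)
qed

lemma continuous_mlin_replicate: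
  assumes "mlin k K T"
  shows "continuous_on UNIV (\<lambda>p. T (replicate k p))"
proof -
  have "((\<lambda>u. T (replicate k u) - T (replicate k v)) \<longlongrightarrow> 0) (at v)" for v
    unfolding mlin_replicate_diff[OF assms]
  proof (rule tendsto_null_sum)
    fix i assume i: "i \<in> {..<k}"
    show "((\<lambda>u. T (replicate i v @ (u - v) # replicate (k - Suc i) u)) \<longlongrightarrow> 0) (at v)"
    proof (rule Lim_null_comparison)
      show "\<forall>\<^sub>F u in at v. norm (T (replicate i v @ (u - v) # replicate (k - Suc i) u))
         \<le> K * (norm v ^ i * (norm (u - v) * norm u ^ (k - Suc i)))"
        by (rule always_eventually, rule allI, rule order_trans[OF mlin_norm[OF assms]])
           (use i in auto)
      show "((\<lambda>u. K * (norm v ^ i * (norm (u - v) * norm u ^ (k - Suc i)))) \<longlongrightarrow> 0) (at v)"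
        by (rule tendsto_eq_intros refl | simp)+
    qed
  qed
  then show ?thesis
    by (simp add: continuous_on_def LIM_zero_cancel)
qed

text \<open>One term of the exponential series at \<open>Suc k\<close> is at most the whole
  sum.\<close>

lemma Suc_power_le_exp: "real (Suc k) ^ k \<le> exp 1 * exp 1 ^ k * fact k"
proof -
  have "real (Suc k) ^ k / fact k \<le> exp (real (Suc k))"
    using sum_le_suminf[OF sums_summable[OF exp_converges[of "real (Suc k)"]], of "{k}"]
      sums_unique[OF exp_converges[of "real (Suc k)"]]
    by (simp add: divide_inverse mult.commute)
  also have "exp (real (Suc k)) = exp 1 * exp 1 ^ k"
    using exp_of_nat_mult[of k "1::real"] by (simp add: exp_add)
  finally show ?thesis by (simp add: field_simps)
qed

lemma mlin_replicate_scale: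
  "mlin k K T \<Longrightarrow> T (replicate k (c *\<^sub>R v)) = c ^ k *\<^sub>R T (replicate k v)"
proof (induction k arbitrary: K T)
  case (Suc k)
  have "linear (\<lambda>w. T (w # replicate k (c *\<^sub>R v)))" "mlin k (K * norm v) (\<lambda>vs. T (v # vs))"
    using Suc.prems by auto
  then show ?case using linear_scale Suc.IH by fastforce
qed simp

lemma mlin_mono: "mlin k K T \<Longrightarrow> K \<le> K' \<Longrightarrow> mlin k K' T"
proof (induction k arbitrary: K K' T)
  case (Suc k)
  have "mlin k (K' * norm v) (\<lambda>vs. T (v # vs))" for v
    by (rule Suc.IH[of "K * norm v"]) (use Suc.prems in \<open>auto intro: mult_right_mono\<close>)
  then show ?case using Suc.prems by simp
qed simp

text \<open>Pointwise boundedness on a ball gives, by Baire, a uniform bound on the diagonals near some point; polarization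
  around that point transfers it to the symmetrized maps, at the cost \<open>k\<^sup>k / k! \<le> e\<^sup>k\<close>.\<close>

lemma uniform_symmetrization:
  fixes U :: "'i \<Rightarrow> 'v::banach list \<Rightarrow> 'f::real_normed_vector"
  assumes U: "\<And>i. mlin (k i) (K i) (U i)" and \<delta>: "\<delta> > 0"
    and bdd: "\<And>p. norm p < \<delta> \<Longrightarrow> \<exists>B. \<forall>i. norm (U i (replicate (k i) p)) \<le> B"
  obtains M C where "M > 0" "C > 0" "\<And>i. mlin (k i) (M * C ^ k i) (symmetrized (k i) (U i))"
proof -
  \<comment> \<open>The bound has the form \<open>N * N ^ k\<close> instead of \<open>N\<close> to
    absorb dilations: boundedness is known only on the ball of radius \<delta>, and homogeneity then
    makes these closed sets cover the whole space.\<close>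
  define A where "A n = {p. \<forall>i. norm (U i (replicate (k i) p)) \<le> real (Suc n) * real (Suc n) ^ k i}" for n
  have clA: "closed (A n)" for n
    unfolding A_def
    by (intro closed_Collect_all closed_Collect_le continuous_on_norm continuous_mlin_replicate[OF U] continuous_on_const)
  have cov: "(UNIV :: 'v set) \<subseteq> (\<Union>n. A n)"
  proof
    fix p :: 'v
    obtain n1 where n1: "norm p / \<delta> < real n1" using reals_Archimedean2 by blast
    have n1p: "real n1 > 0" using n1 \<delta> by (smt (verit) divide_nonneg_pos norm_ge_zero)
    have "norm ((1 / real n1) *\<^sub>R p) < \<delta>" using n1 n1p \<delta> by (simp add: field_simps)
    then obtain B where B: "\<And>i. norm (U i (replicate (k i) ((1 / real n1) *\<^sub>R p))) \<le> B" using bdd by blast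
    obtain n2 where n2: "B < real n2" using reals_Archimedean2 by blast
    have "norm (U i (replicate (k i) p)) \<le> real (Suc (n1 + n2)) * real (Suc (n1 + n2)) ^ k i" for i
    proof -
      have "p = real n1 *\<^sub>R ((1 / real n1) *\<^sub>R p)" using n1p by simp
      then have "U i (replicate (k i) p) = real n1 ^ k i *\<^sub>R U i (replicate (k i) ((1 / real n1) *\<^sub>R p))"
        using mlin_replicate_scale[OF U[of i]] by metis
      then have "norm (U i (replicate (k i) p)) = real n1 ^ k i * norm (U i (replicate (k i) ((1 / real n1) *\<^sub>R p)))"
        by simp
      also have "\<dots> \<le> real (Suc (n1 + n2)) ^ k i * real (Suc (n1 + n2))"
        using B[of i] n2 by (intro mult_mono power_mono) auto
      finally show ?thesis by (simp add: mult.commute)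
    qed
    then show "p \<in> (\<Union>n. A n)" unfolding A_def by blast
  qed
  obtain n p r where r: "r > 0" "ball p r \<inter> UNIV \<subseteq> A n"
    by (rule Baire_closed_cover[OF closed_UNIV UNIV_not_empty clA cov])
  define N where "N = real (Suc n)"
  have N: "N > 0" by (simp add: N_def)
  have A: "norm (U i (replicate (k i) q)) \<le> N * N ^ k i" if "norm (q - p) < r" for i q
    using r(2) that by (auto simp: A_def N_def dist_norm norm_minus_commute)
  show ?thesis
  proof
    show "N * exp 1 > 0" "2 * N * exp 1 / r > 0" using N r by auto
    fix i
    let ?k = "k i"
    \<comment> \<open>With increments of this size \<open>p\<close> plus any subsum of them stays
      strictly within distance \<open>r\<close> of \<open>p\<close>; the successor also covers
      degree zero.\<close>
    define s where "s = r / real (Suc ?k)"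
    have s: "s > 0" using r by (simp add: s_def)
    have "mlin ?k (2 ^ ?k * (N * N ^ ?k) / fact ?k / s ^ ?k) (symmetrized ?k (U i))"
    proof (rule mlin_bound[OF mlin_symmetrized[OF U] s])
      fix hs :: "'v list" assume hs: "length hs = ?k" "\<And>h. h \<in> set hs \<Longrightarrow> norm h \<le> s"
      have "norm (\<Sum>S\<in>Pow {..<?k}. (- 1) ^ (?k + card S) *\<^sub>R U i (replicate ?k (p + (\<Sum>j\<in>S. hs ! j))))
         \<le> real (card (Pow {..<?k})) * (N * N ^ ?k)"
      proof (rule sum_norm_bound)
        fix S assume S: "S \<in> Pow {..<?k}"
        have "norm (\<Sum>j\<in>S. hs ! j) \<le> real (card S) * s"
          by (rule sum_norm_bound) (use S hs in auto)
        also have "\<dots> \<le> real ?k * s"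
          using S s card_mono[of "{..<?k}" S] by (intro mult_right_mono) auto
        also have "\<dots> < r" using r by (simp add: s_def field_simps)
        finally show "norm ((- 1) ^ (?k + card S) *\<^sub>R U i (replicate ?k (p + (\<Sum>j\<in>S. hs ! j)))) \<le> N * N ^ ?k"
          using A by simp
      qed
      then show "norm (symmetrized ?k (U i) hs) \<le> 2 ^ ?k * (N * N ^ ?k) / fact ?k"
        unfolding polarization[OF U] symmetrized_def by (simp add: card_Pow divide_right_mono)
    qed
    moreover have "2 ^ ?k * (N * N ^ ?k) / fact ?k / s ^ ?k \<le> N * exp 1 * (2 * N * exp 1 / r) ^ ?k"
    proof -
      have "2 ^ ?k * (N * N ^ ?k) / fact ?k / s ^ ?k = (N * (2 * N / r) ^ ?k / fact ?k) * real (Suc ?k) ^ ?k"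
        using r by (simp add: s_def field_simps power_mult_distrib)
      also have "\<dots> \<le> (N * (2 * N / r) ^ ?k / fact ?k) * (exp 1 * exp 1 ^ ?k * fact ?k)"
        using N r by (intro mult_left_mono Suc_power_le_exp) auto
      also have "\<dots> = N * exp 1 * (2 * N * exp 1 / r) ^ ?k"
        by (simp add: power_mult_distrib power_divide)
      finally show ?thesis .
    qed
    ultimately show "mlin ?k (N * exp 1 * (2 * N * exp 1 / r) ^ ?k) (symmetrized ?k (U i))"
      by (rule mlin_mono)
  qed
qed

section \<open>Representatives of square integrable functions\<close>

abbreviation "circle_measure \<equiv> lebesgue_on {-pi..pi}"

lemma per_sq_rep: "per_sq_integrable (rep_per_L2 w)"
  using Quotient3_rel_rep[OF Quotient3_per_L2, of w w] by (simp add: per_eq_def)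

lemma rep_abs_per_L2:
  assumes "per_sq_integrable f"
  shows "AE t in circle_measure. rep_per_L2 (abs_per_L2 f) t = f t"
  using rep_abs_rsp_left[OF Quotient3_per_L2, of f f] assms by (simp add: per_eq_def)

lemma abs_rep_per_L2: "abs_per_L2 (rep_per_L2 w) = w"
  by (rule Quotient3_abs_rep[OF Quotient3_per_L2])

lemma abs_per_L2_eqI:
  assumes "per_sq_integrable f" "per_sq_integrable g" "AE t in circle_measure. f t = g t"
  shows "abs_per_L2 f = abs_per_L2 g"
  using Quotient3_rel_abs[OF Quotient3_per_L2, of f g] assms by (simp add: per_eq_def)

lemma per_L2_eqI: "AE t in circle_measure. rep_per_L2 w t = rep_per_L2 u t \<Longrightarrow> w = u"
  by (metis abs_per_L2_eqI abs_rep_per_L2 per_sq_rep)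

lemma rep_add: "AE t in circle_measure. rep_per_L2 (w + u) t = rep_per_L2 w t + rep_per_L2 u t"
proof -
  have "w + u = abs_per_L2 (\<lambda>t. rep_per_L2 w t + rep_per_L2 u t)"
    by (simp add: plus_per_L2_def map_fun_def)
  then show ?thesis using rep_abs_per_L2[OF per_sq_integrable_add[OF per_sq_rep per_sq_rep]] by simp
qed

lemma rep_diff: "AE t in circle_measure. rep_per_L2 (w - u) t = rep_per_L2 w t - rep_per_L2 u t"
proof -
  have "w - u = abs_per_L2 (\<lambda>t. rep_per_L2 w t - rep_per_L2 u t)"
    by (simp add: minus_per_L2_def map_fun_def)
  then show ?thesis using rep_abs_per_L2[OF per_sq_integrable_diff[OF per_sq_rep per_sq_rep]] by simp
qed

lemma rep_scaleR: "AE t in circle_measure. rep_per_L2 (a *\<^sub>R w) t = a *\<^sub>R rep_per_L2 w t"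
proof -
  have "a *\<^sub>R w = abs_per_L2 (\<lambda>t. a *\<^sub>R rep_per_L2 w t)"
    by (simp add: scaleR_per_L2_def map_fun_def)
  then show ?thesis using rep_abs_per_L2[OF per_sq_integrable_scaleR[OF per_sq_rep]] by simp
qed

lemma inner_per_L2_rep: "w \<bullet> u = (LINT t|circle_measure. rep_per_L2 w t \<bullet> rep_per_L2 u t)"
  by (simp add: inner_per_L2_def map_fun_def)

lemma norm_per_L2_rep: "(norm w)\<^sup>2 = (LINT t|circle_measure. (norm (rep_per_L2 w t))\<^sup>2)"
  by (simp add: power2_norm_eq_inner inner_per_L2_rep)

lemma inner_per_L2_AE:
  assumes f: "per_sq_integrable f" "AE t in circle_measure. rep_per_L2 w t = f t"
    and g: "per_sq_integrable g" "AE t in circle_measure. rep_per_L2 u t = g t"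
  shows "w \<bullet> u = (LINT t|circle_measure. f t \<bullet> g t)"
  unfolding inner_per_L2_rep
proof (rule integral_cong_AE)
  show "(\<lambda>t. rep_per_L2 w t \<bullet> rep_per_L2 u t) \<in> borel_measurable circle_measure"
    by (intro borel_measurable_integrable per_sq_integrable_inner per_sq_rep)
  show "(\<lambda>t. f t \<bullet> g t) \<in> borel_measurable circle_measure"
    by (intro borel_measurable_integrable per_sq_integrable_inner f g)
  show "AE t in circle_measure. rep_per_L2 w t \<bullet> rep_per_L2 u t = f t \<bullet> g t"
    using f(2) g(2) by eventually_elim simp
qed

lemma finite_circle_measure: "finite_measure circle_measure"
  by (rule finite_measure_lebesgue_on) simp

lemma strongly_measurable_norm:
  fixes f :: "real \<Rightarrow> 'h::real_normed_vector"
  assumes "strongly_measurable circle_measure f"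
  shows "(\<lambda>t. norm (f t)) \<in> borel_measurable circle_measure"
  by (rule strongly_measurable_real, rule strongly_measurable_compose2[OF assms assms, of "\<lambda>x y. norm x"])
     (simp add: tendsto_norm)

lemma strongly_measurable_simple:
  "simple_function M s \<Longrightarrow> strongly_measurable M s"
  unfolding strongly_measurable_def by (rule exI[of _ "\<lambda>_. s"]) auto

lemma strongly_measurable_borel:
  fixes f :: "'a \<Rightarrow> real"
  assumes "f \<in> borel_measurable M" shows "strongly_measurable M f"
proof -
  obtain F where "\<forall>i. simple_function M (F i)" "\<forall>x\<in>space M. (\<lambda>i. F i x) \<longlonglongrightarrow> f x"
    using borel_measurable_implies_sequence_metric[OF assms, of 0] by blast
  then show ?thesis unfolding strongly_measurable_def by (intro exI[of _ F] conjI AE_I2) auto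
qed

lemma strongly_measurable_cong_AE:
  assumes "strongly_measurable M f" "AE x in M. f x = g x"
  shows "strongly_measurable M g"
proof -
  obtain s where s: "\<forall>n. simple_function M (s n)" "AE t in M. (\<lambda>n. s n t) \<longlonglongrightarrow> f t"
    using assms unfolding strongly_measurable_def by auto
  have "AE t in M. (\<lambda>n. s n t) \<longlonglongrightarrow> g t" using s(2) assms(2) by eventually_elim simp
  with s(1) show ?thesis unfolding strongly_measurable_def by blast
qed

lemma strongly_measurable_scaleR:
  fixes f :: "'a \<Rightarrow> 'h::real_normed_vector"
  assumes "\<phi> \<in> borel_measurable M" "strongly_measurable M f"
  shows "strongly_measurable M (\<lambda>t. \<phi> t *\<^sub>R f t)"
  by (rule strongly_measurable_compose2[OF strongly_measurable_borel[OF assms(1)] assms(2)])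
     (rule tendsto_scaleR)

text \<open>A simple approximant is set to zero wherever it exceeds twice a dominated real
  approximant of \<open>norm f\<close>. Where \<open>f\<close> is nonzero this truncation eventually
  stops acting, since the threshold tends to \<open>2 * norm (f x)\<close>; where \<open>f\<close>
  vanishes it forces the value zero.\<close>

lemma dominated_simple_approximation:
  fixes f :: "'a \<Rightarrow> 'h::real_normed_vector"
  assumes f: "strongly_measurable M f" and nf: "(\<lambda>x. norm (f x)) \<in> borel_measurable M"
  obtains s where "\<And>n. simple_function M (s n)" "AE x in M. (\<lambda>n. s n x) \<longlonglongrightarrow> f x"
    "\<And>n x. x \<in> space M \<Longrightarrow> norm (s n x) \<le> 4 * norm (f x)"
proof -
  obtain r where r: "\<forall>n. simple_function M (r n)" "AE t in M. (\<lambda>n. r n t) \<longlonglongrightarrow> f t"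
    using f unfolding strongly_measurable_def by auto
  obtain q where q: "\<forall>i. simple_function M (q i)" "\<forall>x\<in>space M. (\<lambda>i. q i x) \<longlonglongrightarrow> norm (f x)"
     "\<forall>i. \<forall>x\<in>space M. \<bar>q i x\<bar> \<le> 2 * norm (f x)"
    using borel_measurable_implies_sequence_metric[OF nf, of 0] by (auto simp: dist_real_def)
  define s where "s n x = (if norm (r n x) \<le> 2 * \<bar>q n x\<bar> then r n x else 0)" for n x
  show ?thesis
  proof
    show "simple_function M (s n)" for n
      using simple_function_compose2[of M "r n" "q n" "\<lambda>a b. if norm a \<le> 2 * \<bar>b\<bar> then a else 0"] r(1) q(1)
      unfolding s_def[abs_def] by simp
    show "norm (s n x) \<le> 4 * norm (f x)" if "x \<in> space M" for n x
    proof -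
      have "\<bar>q n x\<bar> \<le> 2 * norm (f x)" using q(3) that by blast
      then show ?thesis by (simp add: s_def)
    qed
    have "AE x in M. x \<in> space M" by (rule AE_space)
    with r(2) show "AE x in M. (\<lambda>n. s n x) \<longlonglongrightarrow> f x"
    proof eventually_elim
      case (elim x)
      show ?case
      proof (cases "f x = 0")
        case True
        then have "q n x = 0" for n using q(3) elim(2) by force
        then have "s n x = 0" for n by (simp add: s_def)
        then show ?thesis using True by simp
      next
        case False
        have "(\<lambda>n. 2 * \<bar>q n x\<bar> - norm (r n x)) \<longlonglongrightarrow> 2 * \<bar>norm (f x)\<bar> - norm (f x)"
          using q(2) elim by (intro tendsto_intros) auto
        moreover have "2 * \<bar>norm (f x)\<bar> - norm (f x) > 0" using False by simp
        ultimately have "\<forall>\<^sub>F n in sequentially. 2 * \<bar>q n x\<bar> - norm (r n x) > 0"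
          by (rule order_tendstoD)
        then have "\<forall>\<^sub>F n in sequentially. s n x = r n x"
          by eventually_elim (simp add: s_def)
        then show ?thesis using elim(1) by (simp add: tendsto_cong)
      qed
    qed
  qed
qed

section \<open>Henstock-Kurzweil integrals of Bochner integrable functions\<close>

lemma has_integral_simple:
  fixes s :: "real \<Rightarrow> 'h::real_normed_vector"
  assumes "simple_function circle_measure s"
  shows "s integrable_on {-pi..pi}"
proof -
  let ?I = "{-pi..pi}"
  have fin: "finite (s ` ?I)" using assms by (auto simp: simple_function_def)
  have meas: "s -` {y} \<inter> ?I \<in> sets circle_measure" for y
    using simple_functionD(2)[OF assms, of "{y}"] by simp
  have "(\<lambda>t. \<Sum>y\<in>s ` ?I. indicat_real (s -` {y} \<inter> ?I) t *\<^sub>R y) integrable_on ?I"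
  proof (intro integrable_sum fin)
    fix y assume "y \<in> s ` ?I"
    have "integrable circle_measure (indicat_real (s -` {y} \<inter> ?I))"
      using meas finite_measure.emeasure_finite[OF finite_circle_measure]
      by (intro integrable_real_indicator) (simp_all add: less_top[symmetric])
    then have "indicat_real (s -` {y} \<inter> ?I) integrable_on ?I"
      by (intro integrable_on_lebesgue_on) auto
    then show "(\<lambda>t. indicat_real (s -` {y} \<inter> ?I) t *\<^sub>R y) integrable_on ?I"
      by (auto simp: integrable_on_def intro: has_integral_scaleR_left)
  qed
  then show ?thesis
  proof (rule integrable_eq)
    fix t assume t: "t \<in> ?I"
    have "(\<Sum>y\<in>s ` ?I. indicat_real (s -` {y} \<inter> ?I) t *\<^sub>R y) = (\<Sum>y\<in>s ` ?I. if y = s t then y else 0)"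
      using t by (intro sum.cong) (auto simp: indicator_def)
    then show "(\<Sum>y\<in>s ` ?I. indicat_real (s -` {y} \<inter> ?I) t *\<^sub>R y) = s t"
      using fin t by (simp add: sum.delta)
  qed
qed

text \<open>Over a fine tagged division the Riemann sums of \<open>f\<close> and \<open>g n\<close>
  differ by at most the Riemann sum of the norm of the difference, and that is close to
  \<open>e n\<close>. Integrability of \<open>f\<close> is thus a conclusion.\<close>

lemma has_integral_approx:
  fixes f :: "real \<Rightarrow> 'h::real_normed_vector"
  assumes g: "\<And>n. (g n has_integral J n) {a..b}" and J: "J \<longlonglongrightarrow> j"
    and d: "\<And>n. ((\<lambda>t. norm (f t - g n t)) has_integral e n) {a..b}" and e: "e \<longlonglongrightarrow> 0"
  shows "(f has_integral j) {a..b}"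
proof -
  have "\<exists>\<gamma>. gauge \<gamma> \<and> (\<forall>p. p tagged_division_of (cbox a b) \<and> \<gamma> fine p \<longrightarrow>
          norm ((\<Sum>(x, k)\<in>p. measure lborel k *\<^sub>R f x) - j) < \<epsilon>)" if \<epsilon>: "\<epsilon> > 0" for \<epsilon>
  proof -
    have "\<epsilon> / 5 > 0" using \<epsilon> by simp
    from eventually_happens'[OF trivial_limit_sequentially eventually_conj[OF order_tendstoD(2)[OF e this] tendstoD[OF J this]]]
    obtain n where n: "e n < \<epsilon> / 5" "norm (J n - j) < \<epsilon> / 5"
      by (auto simp: dist_norm)
    obtain \<gamma>1 where \<gamma>1: "gauge \<gamma>1" "\<And>p. p tagged_division_of (cbox a b) \<Longrightarrow> \<gamma>1 fine p \<Longrightarrow>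
          norm ((\<Sum>(x, k)\<in>p. measure lborel k *\<^sub>R g n x) - J n) < \<epsilon> / 5"
      by (rule has_integralD[OF g[of n, folded box_real(2)] \<open>\<epsilon> / 5 > 0\<close>], rule that) blast+
    obtain \<gamma>2 where \<gamma>2: "gauge \<gamma>2" "\<And>p. p tagged_division_of (cbox a b) \<Longrightarrow> \<gamma>2 fine p \<Longrightarrow>
          norm ((\<Sum>(x, k)\<in>p. measure lborel k *\<^sub>R norm (f x - g n x)) - e n) < \<epsilon> / 5"
      by (rule has_integralD[OF d[of n, folded box_real(2)] \<open>\<epsilon> / 5 > 0\<close>], rule that) blast+
    show ?thesis
    proof (intro exI[of _ "\<lambda>x. \<gamma>1 x \<inter> \<gamma>2 x"] conjI allI impI)
      show "gauge (\<lambda>x. \<gamma>1 x \<inter> \<gamma>2 x)" using \<gamma>1 \<gamma>2 by (simp add: gauge_Int)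
      fix p assume p: "p tagged_division_of (cbox a b) \<and> (\<lambda>x. \<gamma>1 x \<inter> \<gamma>2 x) fine p"
      define Sf Sg Sd where "Sf = (\<Sum>(x, k)\<in>p. measure lborel k *\<^sub>R f x)"
        and "Sg = (\<Sum>(x, k)\<in>p. measure lborel k *\<^sub>R g n x)"
        and "Sd = (\<Sum>(x, k)\<in>p. measure lborel k *\<^sub>R norm (f x - g n x))"
      have "Sf - Sg = (\<Sum>(x, k)\<in>p. measure lborel k *\<^sub>R (f x - g n x))"
        unfolding Sf_def Sg_def sum_subtractf[symmetric] by (rule sum.cong) (auto simp: scaleR_diff_right)
      also have "norm \<dots> \<le> Sd"
        unfolding Sd_def by (rule sum_norm_le) auto
      finally have 1: "norm (Sf - Sg) \<le> Sd" .
      have 2: "norm (Sg - J n) < \<epsilon> / 5" "norm (Sd - e n) < \<epsilon> / 5"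
        unfolding Sg_def Sd_def using \<gamma>1(2) \<gamma>2(2) p by (simp_all only: fine_Int)
      have "norm (Sf - j) \<le> norm (Sf - Sg) + norm (Sg - J n) + norm (J n - j)"
        using norm_triangle_ineq[of "Sf - J n" "J n - j"] norm_triangle_ineq[of "Sf - Sg" "Sg - J n"] by simp
      moreover have "Sd < 2 * \<epsilon> / 5" using 2(2) n(1) unfolding real_norm_def by linarith
      ultimately show "norm ((\<Sum>(x, k)\<in>p. measure lborel k *\<^sub>R f x) - j) < \<epsilon>"
        unfolding Sf_def[symmetric] using 1 2(1) n(2) \<epsilon> by linarith
    qed
  qed
  then show ?thesis unfolding box_real(2)[symmetric] has_integral by blast
qed

text \<open>Bochner integrability implies Henstock-Kurzweil integrability: dominated simple
  functions approximate \<open>f\<close> in mean, and their integrals converge by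
  completeness.\<close>

lemma strongly_measurable_integrable_on:
  fixes f :: "real \<Rightarrow> 'h::{real_inner, complete_space}"
  assumes f: "strongly_measurable circle_measure f" and n: "integrable circle_measure (\<lambda>t. norm (f t))"
  shows "f integrable_on {-pi..pi}"
proof -
  obtain s where s: "\<And>n. simple_function circle_measure (s n)" "AE x in circle_measure. (\<lambda>n. s n x) \<longlonglongrightarrow> f x"
    "\<And>n x. x \<in> space circle_measure \<Longrightarrow> norm (s n x) \<le> 4 * norm (f x)"
    using dominated_simple_approximation[OF f borel_measurable_integrable[OF n]] by blast
  have meas: "(\<lambda>t. norm (f t - s n t)) \<in> borel_measurable circle_measure" for n
    by (intro strongly_measurable_norm strongly_measurable_compose2[OF f strongly_measurable_simple[OF s(1)], of "\<lambda>x y. x - y"] tendsto_diff)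
  have measm: "(\<lambda>t. norm (s m t - s n t)) \<in> borel_measurable circle_measure" for n m
    by (intro strongly_measurable_norm strongly_measurable_compose2[OF strongly_measurable_simple[OF s(1)] strongly_measurable_simple[OF s(1)], of "\<lambda>x y. x - y"] tendsto_diff)
  have bd: "norm (norm (f t - s n t)) \<le> norm (5 * norm (f t))" if "t \<in> space circle_measure" for n t
    using s(3)[OF that, of n] norm_triangle_ineq4[of "f t" "s n t"] by simp
  have int: "integrable circle_measure (\<lambda>t. norm (f t - s n t))" for n
    by (rule Bochner_Integration.integrable_bound[OF _ meas, of "\<lambda>t. 5 * norm (f t)"]) (use n bd in \<open>auto intro!: AE_I2\<close>)
  define e where "e n = (LINT t|circle_measure. norm (f t - s n t))" for n
  have hd: "((\<lambda>t. norm (f t - s n t)) has_integral e n) {-pi..pi}" for n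
    unfolding e_def using has_integral_integral_lebesgue_on[OF int, of n] by simp
  have e0: "e \<longlonglongrightarrow> 0"
  proof -
    have "(\<lambda>n. LINT t|circle_measure. norm (f t - s n t)) \<longlonglongrightarrow> (LINT t|circle_measure. 0)"
    proof (rule integral_dominated_convergence)
      show "AE x in circle_measure. (\<lambda>i. norm (f x - s i x)) \<longlonglongrightarrow> 0"
        using s(2)
      proof eventually_elim
        case (elim x)
        have "(\<lambda>i. norm (f x - s i x)) \<longlonglongrightarrow> norm (f x - f x)" by (intro tendsto_intros elim)
        then show ?case by simp
      qed
      show "integrable circle_measure (\<lambda>t. 5 * norm (f t))" using n by simp
      show "AE x in circle_measure. norm (norm (f x - s i x)) \<le> 5 * norm (f x)" for i
        using bd by (intro AE_I2) auto
    qed (use meas in auto)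
    then show ?thesis by (simp add: e_def[abs_def])
  qed
  define J where "J n = integral {-pi..pi} (s n)" for n
  have hJ: "(s n has_integral J n) {-pi..pi}" for n
    unfolding J_def using has_integral_simple[OF s(1)] by (rule integrable_integral)
  \<comment> \<open>Pairing with the vector \<open>J m - J n\<close> itself reduces the norm
    estimate to a comparison of real integrals.\<close>
  have JJ: "norm (J m - J n) \<le> e m + e n" for m n
  proof -
    have "((\<lambda>t. (s m t - s n t) \<bullet> (J m - J n)) has_integral (J m - J n) \<bullet> (J m - J n)) {-pi..pi}"
      using has_integral_linear[OF has_integral_diff[OF hJ[of m] hJ[of n]] bounded_linear_inner_left[of "J m - J n"]]
      by (simp add: o_def)
    moreover have "((\<lambda>t. (norm (f t - s m t) + norm (f t - s n t)) * norm (J m - J n)) has_integral (e m + e n) * norm (J m - J n)) {-pi..pi}"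
      by (intro has_integral_mult_left has_integral_add hd)
    moreover have "(s m t - s n t) \<bullet> (J m - J n) \<le> (norm (f t - s m t) + norm (f t - s n t)) * norm (J m - J n)" for t
    proof -
      have "norm (s m t - s n t) \<le> norm (f t - s m t) + norm (f t - s n t)"
        using norm_triangle_ineq4[of "f t - s n t" "f t - s m t"] by (simp add: algebra_simps)
      from order_trans[OF norm_cauchy_schwarz mult_right_mono[OF this norm_ge_zero]] show ?thesis .
    qed
    ultimately have "(J m - J n) \<bullet> (J m - J n) \<le> (e m + e n) * norm (J m - J n)"
      by (rule has_integral_le)
    then have "norm (J m - J n) * norm (J m - J n) \<le> (e m + e n) * norm (J m - J n)"
      by (simp add: power2_norm_eq_inner[symmetric] power2_eq_square)
    moreover have "e k \<ge> 0" for k unfolding e_def by simp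
    ultimately show ?thesis
    proof (cases "J m = J n")
      case False
      then show ?thesis using mult_right_le_imp_le[OF \<open>norm (J m - J n) * norm (J m - J n) \<le> (e m + e n) * norm (J m - J n)\<close>]
        by simp
    qed simp
  qed
  have "Cauchy J"
  proof (rule CauchyI)
    fix \<epsilon> :: real assume "\<epsilon> > 0"
    then have "\<epsilon> / 2 > 0" by simp
    from LIMSEQ_D[OF e0 this] obtain N where N: "\<And>n. n \<ge> N \<Longrightarrow> \<bar>e n\<bar> < \<epsilon> / 2" by auto
    show "\<exists>M. \<forall>m\<ge>M. \<forall>n\<ge>M. norm (J m - J n) < \<epsilon>"
    proof (intro exI[of _ N] allI impI)
      fix m n assume "N \<le> m" "N \<le> n"
      then show "norm (J m - J n) < \<epsilon>" using N[of m] N[of n] JJ[of m n] by linarith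
    qed
  qed
  then obtain j where "J \<longlonglongrightarrow> j" using Cauchy_convergent convergentD by blast
  from has_integral_approx[OF hJ this hd e0] show ?thesis by (rule has_integral_integrable)
qed

section \<open>Completeness\<close>

text \<open>Representative of \<open>t\<close> modulo \<open>2 * pi\<close> in the period closed on
  the left and open on the right. It extends functions from one period and realizes rotations of the
  circle as maps of the period into itself.\<close>

definition wrap :: "real \<Rightarrow> real" where
  "wrap t = t - 2 * pi * of_int \<lfloor>(t + pi) / (2 * pi)\<rfloor>"

lemma wrap_periodic: "wrap (t + 2 * pi) = wrap t"
proof -
  have "(t + 2 * pi + pi) / (2 * pi) = (t + pi) / (2 * pi) + 1" by (simp add: field_simps)
  then show ?thesis by (simp add: wrap_def algebra_simps)
qed

lemma wrap_id: "-pi \<le> t \<Longrightarrow> t < pi \<Longrightarrow> wrap t = t"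
proof -
  assume "-pi \<le> t" "t < pi"
  then have "\<lfloor>(t + pi) / (2 * pi)\<rfloor> = 0" by (intro floor_eq_iff[THEN iffD2]) (auto simp: field_simps)
  then show ?thesis by (simp add: wrap_def)
qed

lemma AE_circle_not_pi: "AE t in circle_measure. t \<in> {-pi..<pi}"
proof -
  have "AE t in lebesgue. t \<noteq> pi"
    by (rule AE_I'[of "{pi}"]) (auto simp: negligible_iff_null_sets[symmetric])
  then have "AE t in circle_measure. t \<noteq> pi" by (subst AE_restrict_space_iff) auto
  moreover have "AE t in circle_measure. t \<in> space circle_measure" by (rule AE_space)
  ultimately show ?thesis by eventually_elim auto
qed

lemma AE_wrap: "AE t in circle_measure. f (wrap t) = f t"
  using AE_circle_not_pi by eventually_elim (simp add: wrap_id)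

lemma per_sq_wrap:
  fixes f :: "real \<Rightarrow> 'h::real_normed_vector"
  assumes f: "strongly_measurable circle_measure f" and n: "integrable circle_measure (\<lambda>t. (norm (f t))\<^sup>2)"
  shows "per_sq_integrable (\<lambda>t. f (wrap t))"
proof -
  have s: "strongly_measurable circle_measure (\<lambda>t. f (wrap t))"
    by (rule strongly_measurable_cong_AE[OF f]) (use AE_wrap[of f] in \<open>auto simp: eq_commute\<close>)
  have "integrable circle_measure (\<lambda>t. (norm (f (wrap t)))\<^sup>2)"
  proof (rule integrable_cong_AE_imp[OF n])
    show "(\<lambda>t. (norm (f (wrap t)))\<^sup>2) \<in> borel_measurable circle_measure"
      using strongly_measurable_norm[OF s] by simp
    show "AE t in circle_measure. (norm (f t))\<^sup>2 = (norm (f (wrap t)))\<^sup>2"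
      using AE_wrap[of f] by eventually_elim simp
  qed
  with s show ?thesis by (simp add: per_sq_integrable_def wrap_periodic)
qed

text \<open>Periodic extension of the restriction to one period; the value at \<open>pi\<close> is
  overwritten by the one at \<open>-pi\<close>, which affects a null set only.\<close>

definition of_circle :: "(real \<Rightarrow> 'h::real_inner) \<Rightarrow> 'h per_L2" where
  "of_circle f = abs_per_L2 (\<lambda>t. f (wrap t))"

lemma rep_of_circle:
  assumes "strongly_measurable circle_measure f" "integrable circle_measure (\<lambda>t. (norm (f t))\<^sup>2)"
  shows "AE t in circle_measure. rep_per_L2 (of_circle f) t = f t"
  using rep_abs_per_L2[OF per_sq_wrap[OF assms]] AE_wrap[of f]
  unfolding of_circle_def by eventually_elim simp

lemma integrable_simple_norm2:
  fixes s :: "real \<Rightarrow> 'h::real_normed_vector"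
  assumes s: "simple_function circle_measure s"
  shows "integrable circle_measure (\<lambda>t. (norm (s t))\<^sup>2)"
proof -
  have m: "(\<lambda>t. (norm (s t))\<^sup>2) \<in> borel_measurable circle_measure"
    using strongly_measurable_norm[OF strongly_measurable_simple[OF s]] by simp
  have "finite ((\<lambda>t. (norm (s t))\<^sup>2) ` {-pi..pi})"
    using finite_imageI[of "s ` {-pi..pi}" "\<lambda>y. (norm y)\<^sup>2"] s by (simp add: simple_function_def image_image)
  then obtain B where "\<And>t. t \<in> {-pi..pi} \<Longrightarrow> (norm (s t))\<^sup>2 \<le> B"
    using finite_imp_bounded[of "(\<lambda>t. (norm (s t))\<^sup>2) ` {-pi..pi}"] by (force simp: bounded_iff)
  then show ?thesis
    by (intro finite_measure.integrable_const_bound[OF finite_circle_measure, of _ B] m AE_I2) auto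
qed

lemma rep_of_circle_simple:
  "simple_function circle_measure s \<Longrightarrow> AE t in circle_measure. rep_per_L2 (of_circle s) t = s t"
  by (rule rep_of_circle[OF strongly_measurable_simple integrable_simple_norm2])

lemma norm_diff_AE:
  assumes "AE t in circle_measure. rep_per_L2 w t = f t" "AE t in circle_measure. rep_per_L2 u t = g t"
    and m: "(\<lambda>t. norm (f t - g t)) \<in> borel_measurable circle_measure"
  shows "(norm (w - u))\<^sup>2 = (LINT t|circle_measure. (norm (f t - g t))\<^sup>2)"
    and "integrable circle_measure (\<lambda>t. (norm (f t - g t))\<^sup>2)"
proof -
  have ae: "AE t in circle_measure. (norm (rep_per_L2 (w - u) t))\<^sup>2 = (norm (f t - g t))\<^sup>2"
    using assms(1,2) rep_diff[of w u] by eventually_elim simp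
  have i: "integrable circle_measure (\<lambda>t. (norm (rep_per_L2 (w - u) t))\<^sup>2)"
    using per_sq_rep[of "w - u"] by (simp add: per_sq_integrable_def)
  have m2: "(\<lambda>t. (norm (f t - g t))\<^sup>2) \<in> borel_measurable circle_measure" using m by simp
  show "(norm (w - u))\<^sup>2 = (LINT t|circle_measure. (norm (f t - g t))\<^sup>2)"
    unfolding norm_per_L2_rep by (rule integral_cong_AE[OF borel_measurable_integrable[OF i] m2 ae])
  show "integrable circle_measure (\<lambda>t. (norm (f t - g t))\<^sup>2)"
    by (rule integrable_cong_AE_imp[OF i m2 ae])
qed

lemma strongly_measurable_diff_norm:
  fixes f g :: "real \<Rightarrow> 'h::real_normed_vector"
  assumes "strongly_measurable circle_measure f" "strongly_measurable circle_measure g"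
  shows "(\<lambda>t. norm (f t - g t)) \<in> borel_measurable circle_measure"
  by (intro strongly_measurable_norm strongly_measurable_compose2[OF assms, of "\<lambda>x y. x - y"] tendsto_diff)

lemma simple_dense:
  fixes w :: "'h::real_inner per_L2"
  assumes "\<epsilon> > 0"
  obtains s where "simple_function circle_measure s" "norm (w - of_circle s) < \<epsilon>"
proof -
  let ?f = "rep_per_L2 w"
  have f: "strongly_measurable circle_measure ?f" "integrable circle_measure (\<lambda>t. (norm (?f t))\<^sup>2)"
    using per_sq_rep[of w] by (auto simp: per_sq_integrable_def)
  obtain s where s: "\<And>n. simple_function circle_measure (s n)" "AE x in circle_measure. (\<lambda>n. s n x) \<longlonglongrightarrow> ?f x"
    "\<And>n x. x \<in> space circle_measure \<Longrightarrow> norm (s n x) \<le> 4 * norm (?f x)"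
    using dominated_simple_approximation[OF f(1) strongly_measurable_norm[OF f(1)]] by blast
  have m: "(\<lambda>t. norm (?f t - s n t)) \<in> borel_measurable circle_measure" for n
    by (rule strongly_measurable_diff_norm[OF f(1) strongly_measurable_simple[OF s(1)]])
  have e: "(norm (w - of_circle (s n)))\<^sup>2 = (LINT t|circle_measure. (norm (?f t - s n t))\<^sup>2)" for n
    by (rule norm_diff_AE(1)[OF _ rep_of_circle_simple[OF s(1)] m]) simp
  have "(\<lambda>n. LINT t|circle_measure. (norm (?f t - s n t))\<^sup>2) \<longlonglongrightarrow> (LINT t|circle_measure. 0)"
  proof (rule integral_dominated_convergence)
    show "AE x in circle_measure. (\<lambda>i. (norm (?f x - s i x))\<^sup>2) \<longlonglongrightarrow> 0"
      using s(2)
    proof eventually_elim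
      case (elim x)
      have "(\<lambda>i. (norm (?f x - s i x))\<^sup>2) \<longlonglongrightarrow> (norm (?f x - ?f x))\<^sup>2" by (intro tendsto_intros elim)
      then show ?case by simp
    qed
    show "integrable circle_measure (\<lambda>t. 25 * (norm (?f t))\<^sup>2)" using f(2) by simp
    show "AE x in circle_measure. norm ((norm (?f x - s i x))\<^sup>2) \<le> 25 * (norm (?f x))\<^sup>2" for i
    proof (rule AE_I2)
      fix x assume "x \<in> space circle_measure"
      from s(3)[OF this, of i] have "norm (?f x - s i x) \<le> 5 * norm (?f x)"
        using norm_triangle_ineq4[of "?f x" "s i x"] by simp
      from power_mono[OF this, of 2] show "norm ((norm (?f x - s i x))\<^sup>2) \<le> 25 * (norm (?f x))\<^sup>2"
        by (simp add: power_mult_distrib)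
    qed
  qed (use m in auto)
  then have "(\<lambda>n. (norm (w - of_circle (s n)))\<^sup>2) \<longlonglongrightarrow> 0" by (simp add: e)
  from order_tendstoD(2)[OF this, of "\<epsilon>\<^sup>2"] assms obtain n where "(norm (w - of_circle (s n)))\<^sup>2 < \<epsilon>\<^sup>2"
    by (auto simp: eventually_sequentially)
  then have "norm (w - of_circle (s n)) < \<epsilon>" using assms by (simp add: power_less_imp_less_base)
  with s(1) that show ?thesis by blast
qed

text \<open>Riesz-Fischer argument: the increments are summable almost everywhere, which gives a
  pointwise limit, strongly measurable by construction; Fatou's lemma turns it into a limit in
  norm.\<close>

lemma per_L2_rapidly_Cauchy:
  fixes g :: "nat \<Rightarrow> real \<Rightarrow> 'h::{real_inner, complete_space}"
  assumes s: "\<And>n. simple_function circle_measure (g n)"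
    and d: "\<And>m n. m \<ge> n \<Longrightarrow> norm (of_circle (g m) - of_circle (g n)) \<le> C / 2 ^ n"
  shows "convergent (\<lambda>n. of_circle (g n))"
proof -
  have sm: "strongly_measurable circle_measure (g n)" for n by (rule strongly_measurable_simple[OF s])
  have m: "(\<lambda>t. norm (g k t - g n t)) \<in> borel_measurable circle_measure" for n k
    by (rule strongly_measurable_diff_norm[OF sm sm])
  note e = norm_diff_AE[OF rep_of_circle_simple[OF s] rep_of_circle_simple[OF s] m]
  define u where "u n t = norm (g (Suc n) t - g n t)" for n t
  have um: "u n \<in> borel_measurable circle_measure" for n unfolding u_def using m by simp
  \<comment> \<open>This trades the bound of order \<open>1 / 4 ^ n\<close> on the integral of the
    square for one of order \<open>1 / 2 ^ n\<close> on the integral itself, the period having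
    finite measure.\<close>
  have amgm: "u n t \<le> 2 ^ n * (u n t)\<^sup>2 + 1 / 2 ^ n" for n t
  proof -
    have "0 \<le> (2 ^ n * u n t - 1)\<^sup>2" "0 \<le> 2 ^ n * u n t" by (simp_all add: u_def)
    then have "2 ^ n * u n t \<le> (2 ^ n * u n t)\<^sup>2 + 1"
      by (simp add: power2_eq_square algebra_simps)
    then have "2 ^ n * u n t / 2 ^ n \<le> ((2 ^ n * u n t)\<^sup>2 + 1) / 2 ^ n" by (rule divide_right_mono) simp
    then show ?thesis by (simp add: power_mult_distrib add_divide_distrib power2_eq_square mult_ac)
  qed
  have i2: "integrable circle_measure (\<lambda>t. 2 ^ n * (u n t)\<^sup>2 + 1 / 2 ^ n)" for n
    using e(2)[of "Suc n" n] finite_measure.integrable_const[OF finite_circle_measure] unfolding u_def by auto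
  have ui: "integrable circle_measure (u n)" for n
    by (rule Bochner_Integration.integrable_bound[OF i2 um]) (use amgm in \<open>auto intro!: AE_I2 simp: u_def\<close>)
  have ub: "(LINT t|circle_measure. u n t) \<le> (C\<^sup>2 + 2 * pi) / 2 ^ n" for n
  proof -
    have "(LINT t|circle_measure. u n t) \<le> (LINT t|circle_measure. 2 ^ n * (u n t)\<^sup>2 + 1 / 2 ^ n)"
      by (rule integral_mono[OF ui i2 amgm])
    also have "\<dots> = 2 ^ n * (norm (of_circle (g (Suc n)) - of_circle (g n)))\<^sup>2 + 2 * pi / 2 ^ n"
      using e[of "Suc n" n] finite_measure.integrable_const[OF finite_circle_measure]
      by (simp add: u_def measure_restrict_space)
    also have "\<dots> \<le> 2 ^ n * (C / 2 ^ n)\<^sup>2 + 2 * pi / 2 ^ n"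
      using d[of n "Suc n"] by (intro add_mono mult_left_mono power_mono) auto
    also have "\<dots> = (C\<^sup>2 + 2 * pi) / 2 ^ n" by (simp add: power_divide power2_eq_square field_simps)
    finally show ?thesis .
  qed
  have su: "summable (\<lambda>n. LINT t|circle_measure. u n t)"
  proof (rule summable_comparison_test')
    have "summable (\<lambda>n. (C\<^sup>2 + 2 * pi) * (1 / 2) ^ n)" by (intro summable_mult summable_geometric) simp
    then show "summable (\<lambda>n. (C\<^sup>2 + 2 * pi) / 2 ^ n)" by (simp add: power_divide)
    show "norm (LINT t|circle_measure. u n t) \<le> (C\<^sup>2 + 2 * pi) / 2 ^ n" if "n \<ge> 0" for n
      using ub[of n] by (simp add: u_def)
  qed
  have AEs: "AE t in circle_measure. summable (\<lambda>n. u n t)"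
  proof -
    have "(\<integral>\<^sup>+t. (\<Sum>n. ennreal (u n t)) \<partial>circle_measure) = (\<Sum>n. \<integral>\<^sup>+t. ennreal (u n t) \<partial>circle_measure)"
      by (rule nn_integral_suminf) (use um in auto)
    also have "\<dots> = (\<Sum>n. ennreal (LINT t|circle_measure. u n t))"
      by (intro suminf_cong nn_integral_eq_integral ui) (auto simp: u_def)
    also have "\<dots> = ennreal (\<Sum>n. LINT t|circle_measure. u n t)"
      by (rule suminf_ennreal2[OF _ su]) (auto simp: u_def)
    finally have "(\<integral>\<^sup>+t. (\<Sum>n. ennreal (u n t)) \<partial>circle_measure) \<noteq> \<infinity>" by simp
    then have "AE t in circle_measure. (\<Sum>n. ennreal (u n t)) \<noteq> \<infinity>"
      by (intro nn_integral_noteq_infinite) (use um in auto)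
    then show ?thesis by eventually_elim (auto intro!: summable_suminf_not_top simp: u_def)
  qed
  define f where "f t = lim (\<lambda>n. g n t)" for t
  have AEl: "AE t in circle_measure. (\<lambda>n. g n t) \<longlonglongrightarrow> f t"
    using AEs
  proof eventually_elim
    case (elim t)
    have "Cauchy (\<lambda>n. g n t)"
    proof (rule metric_CauchyI)
      fix \<epsilon> :: real assume "\<epsilon> > 0"
      then obtain N where N: "\<And>m n. m \<ge> N \<Longrightarrow> norm (\<Sum>k=m..<n. u k t) < \<epsilon>"
        using elim unfolding summable_Cauchy by blast
      have tel: "norm (g n t - g m t) \<le> (\<Sum>k=m..<n. u k t)" if "m \<le> n" for m n
      proof -
        have "g n t - g m t = (\<Sum>k=m..<n. g (Suc k) t - g k t)" using sum_Suc_diff'[OF that, of "\<lambda>k. g k t"] by simp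
        then show ?thesis by (simp add: u_def norm_sum)
      qed
      have "dist (g m t) (g n t) < \<epsilon>" if "m \<ge> N" "n \<ge> N" for m n
      proof (cases "m \<le> n")
        case True
        then show ?thesis using tel[of m n] N[OF that(1), of n] by (simp add: dist_norm norm_minus_commute)
      next
        case False
        then show ?thesis using tel[of n m] N[OF that(2), of m] by (simp add: dist_norm)
      qed
      then show "\<exists>M. \<forall>m\<ge>M. \<forall>n\<ge>M. dist (g m t) (g n t) < \<epsilon>" by blast
    qed
    then show ?case unfolding f_def using Cauchy_convergent convergent_LIMSEQ_iff by blast
  qed
  have fm: "strongly_measurable circle_measure f"
    unfolding strongly_measurable_def using s AEl by blast
  have mf: "(\<lambda>t. norm (f t - g n t)) \<in> borel_measurable circle_measure" for n
    by (rule strongly_measurable_diff_norm[OF fm sm])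
  have fatou: "(\<integral>\<^sup>+t. ennreal ((norm (f t - g n t))\<^sup>2) \<partial>circle_measure) \<le> ennreal ((C / 2 ^ n)\<^sup>2)" for n
  proof -
    have "AE t in circle_measure. ennreal ((norm (f t - g n t))\<^sup>2) = liminf (\<lambda>k. ennreal ((norm (g k t - g n t))\<^sup>2))"
      using AEl
    proof eventually_elim
      case (elim t)
      have "(\<lambda>k. ennreal ((norm (g k t - g n t))\<^sup>2)) \<longlonglongrightarrow> ennreal ((norm (f t - g n t))\<^sup>2)"
        by (intro tendsto_ennrealI tendsto_intros elim)
      from lim_imp_Liminf[OF trivial_limit_sequentially this] show ?case by (rule sym)
    qed
    then have "(\<integral>\<^sup>+t. ennreal ((norm (f t - g n t))\<^sup>2) \<partial>circle_measure)
      = (\<integral>\<^sup>+t. liminf (\<lambda>k. ennreal ((norm (g k t - g n t))\<^sup>2)) \<partial>circle_measure)"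
      by (rule nn_integral_cong_AE)
    also have "\<dots> \<le> liminf (\<lambda>k. \<integral>\<^sup>+t. ennreal ((norm (g k t - g n t))\<^sup>2) \<partial>circle_measure)"
      by (rule nn_integral_liminf) (use m in auto)
    also have "\<dots> \<le> limsup (\<lambda>k. \<integral>\<^sup>+t. ennreal ((norm (g k t - g n t))\<^sup>2) \<partial>circle_measure)"
      by (rule Liminf_le_Limsup) simp
    also have "\<dots> \<le> ennreal ((C / 2 ^ n)\<^sup>2)"
    proof (rule Limsup_bounded, rule eventually_sequentiallyI)
      fix k assume k: "k \<ge> n"
      have "(\<integral>\<^sup>+t. ennreal ((norm (g k t - g n t))\<^sup>2) \<partial>circle_measure) = ennreal ((norm (of_circle (g k) - of_circle (g n)))\<^sup>2)"
        unfolding e(1) by (rule nn_integral_eq_integral[OF e(2)]) auto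
      also have "\<dots> \<le> ennreal ((C / 2 ^ n)\<^sup>2)"
        using d[OF k] by (intro ennreal_leI power_mono) auto
      finally show "(\<integral>\<^sup>+t. ennreal ((norm (g k t - g n t))\<^sup>2) \<partial>circle_measure) \<le> ennreal ((C / 2 ^ n)\<^sup>2)" .
    qed
    finally show ?thesis .
  qed
  have intf: "integrable circle_measure (\<lambda>t. (norm (f t - g n t))\<^sup>2)" for n
  proof (rule integrableI_bounded)
    show "(\<lambda>t. (norm (f t - g n t))\<^sup>2) \<in> borel_measurable circle_measure" using mf by simp
    show "(\<integral>\<^sup>+t. ennreal (norm ((norm (f t - g n t))\<^sup>2)) \<partial>circle_measure) < \<infinity>"
      using fatou[of n] by (simp add: order_le_less_trans[OF _ ennreal_less_top])
  qed
  have smd: "strongly_measurable circle_measure (\<lambda>t. f t - g 0 t)"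
    by (rule strongly_measurable_compose2[OF fm sm, of "\<lambda>x y. x - y"]) (rule tendsto_diff)
  \<comment> \<open>Square integrability is known for the difference of \<open>f\<close> and
    \<open>g 0\<close>, by Fatou, so the limit is assembled from that difference and
    \<open>g 0\<close>.\<close>
  define F where "F = of_circle (\<lambda>t. f t - g 0 t) + of_circle (g 0)"
  have repF: "AE t in circle_measure. rep_per_L2 F t = f t"
    using rep_of_circle[OF smd intf] rep_of_circle_simple[OF s[of 0]]
      rep_add[of "of_circle (\<lambda>t. f t - g 0 t)" "of_circle (g 0)"]
    unfolding F_def by eventually_elim simp
  have bnd: "norm (F - of_circle (g n)) \<le> \<bar>C\<bar> / 2 ^ n" for n
  proof -
    have "ennreal ((norm (F - of_circle (g n)))\<^sup>2) = (\<integral>\<^sup>+t. ennreal ((norm (f t - g n t))\<^sup>2) \<partial>circle_measure)"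
      unfolding norm_diff_AE(1)[OF repF rep_of_circle_simple[OF s] mf]
      by (rule nn_integral_eq_integral[symmetric, OF intf]) auto
    also have "\<dots> \<le> ennreal ((C / 2 ^ n)\<^sup>2)" by (rule fatou)
    finally have "(norm (F - of_circle (g n)))\<^sup>2 \<le> (\<bar>C\<bar> / 2 ^ n)\<^sup>2" by (simp add: power_divide)
    then show ?thesis by (rule power2_le_imp_le) simp
  qed
  have b0: "(\<lambda>n. \<bar>C\<bar> / 2 ^ n) \<longlonglongrightarrow> 0"
  proof -
    have "(\<lambda>n. \<bar>C\<bar> * (1 / 2) ^ n) \<longlonglongrightarrow> 0" by (rule tendsto_mult_right_zero[OF LIMSEQ_power_zero]) simp
    then show ?thesis by (simp add: power_divide)
  qed
  have "(\<lambda>n. of_circle (g n) - F) \<longlonglongrightarrow> 0"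
    by (rule Lim_null_comparison[OF _ b0], rule always_eventually, rule allI, subst norm_minus_commute, rule bnd)
  from LIM_zero_cancel[OF this] show ?thesis unfolding convergent_def ..
qed

instance per_L2 :: ("{real_inner, complete_space}") complete_space
proof
  fix X :: "nat \<Rightarrow> 'a per_L2" assume X: "Cauchy X"
  have "\<exists>N. \<forall>m\<ge>N. \<forall>k\<ge>N. norm (X m - X k) < 1 / 2 ^ n" for n
    using X[unfolded Cauchy_iff] by simp
  then obtain N where N: "\<And>n m k. m \<ge> N n \<Longrightarrow> k \<ge> N n \<Longrightarrow> norm (X m - X k) < 1 / 2 ^ n" by metis
  \<comment> \<open>Summing the thresholds up to \<open>n\<close> and adding \<open>n\<close> makes
    the sequence strictly increasing while \<open>r n \<ge> N n\<close>.\<close>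
  define r where "r n = n + (\<Sum>i\<le>n. N i)" for n
  have r: "strict_mono r" by (rule strict_mono_Suc_iff[THEN iffD2]) (simp add: r_def)
  have rN: "r n \<ge> N n" for n unfolding r_def by (simp add: member_le_sum[of n "{..n}" N] trans_le_add2)
  \<comment> \<open>Nearby simple functions replace the members of the subsequence, so that
    \<open>per_L2_rapidly_Cauchy\<close> applies; the errors tend to zero.\<close>
  have "\<exists>s. simple_function circle_measure s \<and> norm (X (r n) - of_circle s) < 1 / 2 ^ n" for n
    by (rule simple_dense[of "1 / 2 ^ n" "X (r n)"]) auto
  then obtain g where g: "\<And>n. simple_function circle_measure (g n)" "\<And>n. norm (X (r n) - of_circle (g n)) < 1 / 2 ^ n"
    by metis
  have "convergent (\<lambda>n. of_circle (g n))"
  proof (rule per_L2_rapidly_Cauchy[OF g(1)])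
    fix m n :: nat assume mn: "m \<ge> n"
    have "r m \<ge> N n" using rN[of n] strict_mono_leD[OF r mn] by simp
    then have 1: "norm (X (r m) - X (r n)) < 1 / 2 ^ n" using N rN by blast
    have 2: "norm (X (r m) - of_circle (g m)) \<le> 1 / 2 ^ n"
      using g(2)[of m] power_increasing[OF mn, of "2::real"] by (smt (verit) frac_le zero_less_power)
    have "of_circle (g m) - of_circle (g n) = (X (r m) - X (r n)) + (X (r n) - of_circle (g n)) - (X (r m) - of_circle (g m))"
      by simp
    then show "norm (of_circle (g m) - of_circle (g n)) \<le> 3 / 2 ^ n"
      using 1 2 g(2)[of n] norm_triangle_ineq4[of "(X (r m) - X (r n)) + (X (r n) - of_circle (g n))" "X (r m) - of_circle (g m)"]
        norm_triangle_ineq[of "X (r m) - X (r n)" "X (r n) - of_circle (g n)"] by simp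
  qed
  then obtain F where F: "(\<lambda>n. of_circle (g n)) \<longlonglongrightarrow> F" by (auto simp: convergent_def)
  have "(\<lambda>n. X (r n) - of_circle (g n)) \<longlonglongrightarrow> 0"
  proof (rule Lim_null_comparison)
    show "\<forall>\<^sub>F n in sequentially. norm (X (r n) - of_circle (g n)) \<le> (1 / 2) ^ n"
      using g(2) by (intro always_eventually allI less_imp_le) (simp add: power_divide)
  qed (rule LIMSEQ_power_zero, simp)
  from tendsto_add[OF this F] have "(X \<circ> r) \<longlonglongrightarrow> F" by (simp add: o_def)
  then show "convergent X"
    unfolding convergent_def using Cauchy_converges_subseq[OF X r] by (intro exI)
qed

instance per_L2 :: ("{real_inner, complete_space}") banach ..

section \<open>Fourier coefficients\<close>

definition periodic_continuous :: "(real \<Rightarrow> real) \<Rightarrow> bool" where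
  "periodic_continuous \<phi> \<longleftrightarrow> continuous_on UNIV \<phi> \<and> (\<forall>t. \<phi> (t + 2 * pi) = \<phi> t)"

text \<open>Elementary tensor of a scalar function and a vector. Pairings with these express
  vector-valued integrals, mean values and weak derivatives by scalar products alone.\<close>

definition tens :: "(real \<Rightarrow> real) \<Rightarrow> 'h::real_inner \<Rightarrow> 'h per_L2" where
  "tens \<phi> h = abs_per_L2 (\<lambda>t. \<phi> t *\<^sub>R h)"

lemma periodic_continuous_on: "periodic_continuous \<phi> \<Longrightarrow> continuous_on S \<phi>"
  unfolding periodic_continuous_def using continuous_on_subset by blast

lemma periodic_continuous_measurable:
  "periodic_continuous \<phi> \<Longrightarrow> \<phi> \<in> borel_measurable circle_measure"
  by (rule continuous_imp_measurable_on_sets_lebesgue) (auto intro: periodic_continuous_on)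

lemma per_sq_tens:
  assumes "periodic_continuous \<phi>" shows "per_sq_integrable (\<lambda>t. \<phi> t *\<^sub>R h)"
  unfolding per_sq_integrable_def
proof (intro conjI allI)
  show "strongly_measurable circle_measure (\<lambda>t. \<phi> t *\<^sub>R h)"
    by (rule strongly_measurable_scaleR[OF periodic_continuous_measurable[OF assms] strongly_measurable_const])
  show "integrable circle_measure (\<lambda>t. (norm (\<phi> t *\<^sub>R h))\<^sup>2)"
    by (rule continuous_imp_integrable_real) (intro continuous_intros periodic_continuous_on[OF assms])
qed (use assms in \<open>simp add: periodic_continuous_def\<close>)

lemma rep_tens: "periodic_continuous \<phi> \<Longrightarrow> AE t in circle_measure. rep_per_L2 (tens \<phi> h) t = \<phi> t *\<^sub>R h"
  unfolding tens_def by (rule rep_abs_per_L2[OF per_sq_tens])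

lemma inner_tens:
  assumes "periodic_continuous \<phi>"
  shows "w \<bullet> tens \<phi> h = (LINT t|circle_measure. rep_per_L2 w t \<bullet> (\<phi> t *\<^sub>R h))"
  by (rule inner_per_L2_AE[OF per_sq_rep _ per_sq_tens[OF assms] rep_tens[OF assms]]) simp

lemma integrable_on_rep:
  fixes w :: "'h::{real_inner, complete_space} per_L2"
  assumes \<phi>: "periodic_continuous \<phi>"
  shows "(\<lambda>t. \<phi> t *\<^sub>R rep_per_L2 w t) integrable_on {-pi..pi}"
proof (rule strongly_measurable_integrable_on)
  have w: "strongly_measurable circle_measure (rep_per_L2 w)" "integrable circle_measure (\<lambda>t. (norm (rep_per_L2 w t))\<^sup>2)"
    using per_sq_rep[of w] by (auto simp: per_sq_integrable_def)
  show s: "strongly_measurable circle_measure (\<lambda>t. \<phi> t *\<^sub>R rep_per_L2 w t)"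
    by (rule strongly_measurable_scaleR[OF periodic_continuous_measurable[OF \<phi>] w(1)])
  have "integrable circle_measure (\<lambda>t. (\<phi> t)\<^sup>2)"
    by (rule continuous_imp_integrable_real) (intro continuous_intros periodic_continuous_on[OF \<phi>])
  with w(2) have i: "integrable circle_measure (\<lambda>t. (\<phi> t)\<^sup>2 + (norm (rep_per_L2 w t))\<^sup>2)" by simp
  have b: "\<bar>a\<bar> * c \<le> a\<^sup>2 + c\<^sup>2" if "c \<ge> 0" for a c :: real
    using sum_squares_bound[of "\<bar>a\<bar>" c] mult_nonneg_nonneg[OF abs_ge_zero[of a] that] by simp
  show "integrable circle_measure (\<lambda>t. norm (\<phi> t *\<^sub>R rep_per_L2 w t))"
    by (rule Bochner_Integration.integrable_bound[OF i strongly_measurable_norm[OF s]])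
       (use b in \<open>auto intro!: AE_I2\<close>)
qed

text \<open>Bridge from Henstock-Kurzweil integrals of vectors to scalar products of square
  integrable functions.\<close>

lemma integral_rep_inner:
  fixes w :: "'h::{real_inner, complete_space} per_L2"
  assumes \<phi>: "periodic_continuous \<phi>"
  shows "integral {-pi..pi} (\<lambda>t. \<phi> t *\<^sub>R rep_per_L2 w t) \<bullet> h = w \<bullet> tens \<phi> h"
proof -
  have "((\<lambda>t. (\<phi> t *\<^sub>R rep_per_L2 w t) \<bullet> h) has_integral integral {-pi..pi} (\<lambda>t. \<phi> t *\<^sub>R rep_per_L2 w t) \<bullet> h) {-pi..pi}"
    using has_integral_linear[OF integrable_integral[OF integrable_on_rep[OF \<phi>, of w]] bounded_linear_inner_left[of h]]
    by (simp add: o_def)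
  moreover have "integrable circle_measure (\<lambda>t. rep_per_L2 w t \<bullet> (\<phi> t *\<^sub>R h))"
    by (rule per_sq_integrable_inner[OF per_sq_rep per_sq_tens[OF \<phi>]])
  then have "((\<lambda>t. rep_per_L2 w t \<bullet> (\<phi> t *\<^sub>R h)) has_integral (w \<bullet> tens \<phi> h)) {-pi..pi}"
    unfolding inner_tens[OF \<phi>] by (rule has_integral_integral_lebesgue_on) simp
  ultimately show ?thesis
    by (auto intro: has_integral_unique)
qed

lemma mean_value_inner:
  fixes w :: "'h::{real_inner, complete_space} per_L2"
  shows "mean_value w \<bullet> h = (1 / (2 * pi)) * (w \<bullet> tens (\<lambda>_. 1) h)"
  using integral_rep_inner[of "\<lambda>_. 1" w h] by (simp add: mean_value_def periodic_continuous_def)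

text \<open>A closed set on which the integrand is positive must be null, as the integral over it
  vanishes; inner regularity by closed sets passes this to the whole set of positivity. The other
  sign is the same argument for \<open>- u\<close>.\<close>

lemma eq_zero_if_integrals_zero:
  fixes u :: "real \<Rightarrow> real"
  assumes u: "integrable circle_measure u"
    and z: "\<And>K. closed K \<Longrightarrow> K \<subseteq> {-pi..pi} \<Longrightarrow> (LINT t|circle_measure. u t * indicat_real K t) = 0"
  shows "AE t in circle_measure. u t = 0"
proof -
  have pos: "AE t in circle_measure. \<not> v t > 0"
    if v: "integrable circle_measure v" and zv: "\<And>K. closed K \<Longrightarrow> K \<subseteq> {-pi..pi} \<Longrightarrow> (LINT t|circle_measure. v t * indicat_real K t) = 0"
    for v :: "real \<Rightarrow> real"
  proof -
    define A where "A = {t \<in> {-pi..pi}. v t > 0}"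
    have "{t \<in> space circle_measure. v t > 0} \<in> sets circle_measure"
      by (rule borel_measurable_less[OF _ borel_measurable_integrable[OF v]]) simp
    then have A: "A \<in> sets lebesgue"
      unfolding A_def by (subst (asm) sets_restrict_space_iff) auto
    have small: "emeasure lebesgue A \<le> ennreal e" if "e > 0" for e :: real
    proof -
      obtain T where T: "closed T" "T \<subseteq> A" "emeasure lebesgue (A - T) < ennreal e"
        using sets_lebesgue_inner_closed[OF A \<open>e > 0\<close>] by metis
      have TI: "T \<subseteq> {-pi..pi}" and Tp: "\<And>t. t \<in> T \<Longrightarrow> v t > 0" using T(2) by (auto simp: A_def)
      have Tm: "T \<in> sets circle_measure" using T(1) TI by (subst sets_restrict_space_iff) auto
      have "integrable circle_measure (\<lambda>t. v t * indicat_real T t)"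
        by (rule integrable_real_mult_indicator[OF Tm v])
      then have "(LINT t|circle_measure. v t * indicat_real T t) = 0 \<longleftrightarrow> (AE t in circle_measure. v t * indicat_real T t = 0)"
        by (rule integral_nonneg_eq_0_iff_AE) (auto simp: indicator_def less_imp_le[OF Tp])
      then have "AE t in circle_measure. v t * indicat_real T t = 0" using zv[OF T(1) TI] by blast
      then have "AE t in circle_measure. t \<notin> T"
        by eventually_elim (use Tp in \<open>force simp: indicator_def\<close>)
      then have "AE t in lebesgue. t \<in> {-pi..pi} \<longrightarrow> t \<notin> T" by (subst (asm) AE_restrict_space_iff) auto
      then have "AE t in lebesgue. t \<notin> T" by eventually_elim (use TI in auto)
      then have "emeasure lebesgue T = 0"
        using T(1) by (subst (asm) AE_iff_measurable[of T]) auto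
      moreover have "emeasure lebesgue A \<le> emeasure lebesgue T + emeasure lebesgue (A - T)"
        using T(1,2) A emeasure_subadditive[of T lebesgue "A - T"] by (simp add: Un_absorb1 sets.Diff)
      ultimately show ?thesis using T(3) by simp
    qed
    have "emeasure lebesgue A \<le> 0"
    proof (rule ennreal_le_epsilon)
      fix e :: real assume "0 < e"
      from small[OF this] show "emeasure lebesgue A \<le> 0 + ennreal e" by (simp only: add_0_left)
    qed
    then have "A \<in> null_sets lebesgue" using A by auto
    then have "AE t in lebesgue. t \<notin> A" by (rule AE_not_in)
    then have "AE t in lebesgue. t \<in> {-pi..pi} \<longrightarrow> \<not> v t > 0" by eventually_elim (auto simp: A_def)
    then show ?thesis by (subst AE_restrict_space_iff) auto
  qed
  have "AE t in circle_measure. \<not> u t > 0" by (rule pos[OF u z])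
  moreover have "AE t in circle_measure. \<not> - u t > 0"
    by (rule pos) (use u z in auto)
  ultimately show ?thesis by eventually_elim auto
qed

text \<open>Integer frequencies, because the product formulas produce the frequency
  \<open>k - l\<close>.\<close>

inductive trig_poly :: "(real \<Rightarrow> real) \<Rightarrow> bool" where
  "trig_poly (\<lambda>t. cos (of_int k * t))"
| "trig_poly (\<lambda>t. sin (of_int k * t))"
| "trig_poly f \<Longrightarrow> trig_poly g \<Longrightarrow> trig_poly (\<lambda>t. f t + g t)"
| "trig_poly f \<Longrightarrow> trig_poly (\<lambda>t. c * f t)"

lemma trig_poly_const: "trig_poly (\<lambda>t. c)"
  using trig_poly.intros(4)[OF trig_poly.intros(1)[of 0], of c] by simp

lemma trig_poly_diff: "trig_poly f \<Longrightarrow> trig_poly g \<Longrightarrow> trig_poly (\<lambda>t. f t - g t)"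
  using trig_poly.intros(3)[OF _ trig_poly.intros(4)[of g "-1"], of f] by simp

lemma trig_poly_mult:
  assumes "trig_poly f" "trig_poly g" shows "trig_poly (\<lambda>t. f t * g t)"
proof -
  have cosc: "trig_poly (\<lambda>t. cos (of_int k * t) * cos (of_int l * t))"
    and coss: "trig_poly (\<lambda>t. cos (of_int k * t) * sin (of_int l * t))"
    and sins: "trig_poly (\<lambda>t. sin (of_int k * t) * sin (of_int l * t))" for k l :: int
  proof -
    note c = trig_poly.intros(4)[OF trig_poly.intros(1), of "1/2"]
    note s = trig_poly.intros(4)[OF trig_poly.intros(2), of "1/2"]
    show "trig_poly (\<lambda>t. cos (of_int k * t) * cos (of_int l * t))"
      using trig_poly.intros(3)[OF c[of "k - l"] c[of "k + l"]]
      by (simp add: cos_times_cos algebra_simps add_divide_distrib)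
    show "trig_poly (\<lambda>t. cos (of_int k * t) * sin (of_int l * t))"
      using trig_poly_diff[OF s[of "k + l"] s[of "k - l"]]
      by (simp add: cos_times_sin algebra_simps diff_divide_distrib)
    show "trig_poly (\<lambda>t. sin (of_int k * t) * sin (of_int l * t))"
      using trig_poly_diff[OF c[of "k - l"] c[of "k + l"]]
      by (simp add: sin_times_sin algebra_simps diff_divide_distrib)
  qed
  have 1: "trig_poly (\<lambda>t. cos (of_int k * t) * g t)" for k :: int
    using assms(2)
    by induction (use cosc coss trig_poly.intros(3,4) in \<open>force simp: distrib_left mult.left_commute\<close>)+
  have 2: "trig_poly (\<lambda>t. sin (of_int k * t) * g t)" for k :: int
    using assms(2)
  proof induction
    case (1 l)
    show ?case using coss[of l k] by (simp add: mult.commute)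
  next
    case (3 f g)
    then show ?case using trig_poly.intros(3) by (simp add: distrib_left)
  next
    case (4 f c)
    then show ?case using trig_poly.intros(4)[OF 4(2), of c] by (simp add: mult.left_commute)
  qed (rule sins)
  show ?thesis
    using assms(1)
  proof induction
    case (3 f g)
    then show ?case using trig_poly.intros(3) by (simp add: distrib_right)
  next
    case (4 f c)
    then show ?case using trig_poly.intros(4)[OF 4(2), of c] by (simp add: mult.assoc)
  qed (rule 1 2)+
qed

lemma trig_poly_polynomial:
  fixes p :: "complex \<Rightarrow> real"
  assumes "real_polynomial_function p" shows "trig_poly (\<lambda>t. p (cis t))"
  using assms
proof induction
  case (linear f)
  interpret bounded_linear f by (rule linear)
  have "f (cis t) = f 1 * cos (of_int 1 * t) + f \<i> * sin (of_int 1 * t)" for t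
  proof -
    have "cis t = cos t *\<^sub>R 1 + sin t *\<^sub>R \<i>" by (simp add: complex_eq_iff)
    then have "f (cis t) = cos t *\<^sub>R f 1 + sin t *\<^sub>R f \<i>" by (metis add scaleR)
    then show ?thesis by (simp add: mult.commute)
  qed
  moreover have "trig_poly (\<lambda>t. f 1 * cos (of_int 1 * t) + f \<i> * sin (of_int 1 * t))"
    by (intro trig_poly.intros)
  ultimately show ?case by simp
next
  case (const c)
  show ?case by (rule trig_poly_const)
qed (auto intro: trig_poly.intros(3) trig_poly_mult)

lemma trig_poly_continuous: "trig_poly f \<Longrightarrow> continuous_on S f"
  by (induction rule: trig_poly.induct) (auto intro!: continuous_intros)

lemma integrable_mult_continuous:
  fixes u :: "real \<Rightarrow> real"
  assumes u: "integrable circle_measure u" and f: "continuous_on {-pi..pi} f"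
  shows "integrable circle_measure (\<lambda>t. u t * f t)"
proof -
  have "compact (f ` {-pi..pi})" using f by (intro compact_continuous_image) auto
  from compact_imp_bounded[OF this] obtain B where "\<forall>x\<in>f ` {-pi..pi}. norm x \<le> B"
    unfolding bounded_iff ..
  then have B: "\<bar>f t\<bar> \<le> B" if "t \<in> {-pi..pi}" for t using that by auto
  have m: "(\<lambda>t. u t * f t) \<in> borel_measurable circle_measure"
    by (intro borel_measurable_times borel_measurable_integrable[OF u] continuous_imp_measurable_on_sets_lebesgue[OF f]) simp
  show ?thesis
  proof (rule Bochner_Integration.integrable_bound[OF integrable_mult_right[of B, OF u] m], rule AE_I2)
    fix t assume "t \<in> space circle_measure"
    then have "\<bar>f t\<bar> \<le> \<bar>B\<bar>" using B[of t] by simp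
    from mult_right_mono[OF this abs_ge_zero[of "u t"]]
    show "norm (u t * f t) \<le> norm (B * u t)" by (simp add: abs_mult mult.commute)
  qed
qed

text \<open>Stone-Weierstrass on the unit circle extends the orthogonality from trigonometric
  polynomials to continuous functions of \<open>cis t\<close>, and these approximate indicators of
  closed sets boundedly and pointwise.\<close>

lemma fourier_uniqueness_real:
  fixes u :: "real \<Rightarrow> real"
  assumes u: "integrable circle_measure u"
    and c: "\<And>k::nat. (LINT t|circle_measure. u t * cos (real k * t)) = 0"
    and s: "\<And>k::nat. (LINT t|circle_measure. u t * sin (real k * t)) = 0"
  shows "AE t in circle_measure. u t = 0"
proof (rule eq_zero_if_integrals_zero[OF u])
  note iu = integrable_mult_continuous[OF u]
  have tp: "(LINT t|circle_measure. u t * f t) = 0" if "trig_poly f" for f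
    using that
  proof induction
    case (1 k)
    show ?case
    proof (cases "k \<ge> 0")
      case True
      then show ?thesis using c[of "nat k"] by simp
    next
      case False
      then show ?thesis using c[of "nat (- k)"] by simp
    qed
  next
    case (2 k)
    show ?case
    proof (cases "k \<ge> 0")
      case True
      then show ?thesis using s[of "nat k"] by simp
    next
      case False
      then show ?thesis using s[of "nat (- k)"] by simp
    qed
  next
    case (3 f g)
    then show ?case
      using iu[OF trig_poly_continuous[OF 3(1)]] iu[OF trig_poly_continuous[OF 3(2)]]
      by (simp add: distrib_left)
  next
    case (4 f c)
    have "(LINT t|circle_measure. c * (u t * f t)) = 0" using 4 by simp
    then show ?case by (simp add: mult.left_commute)
  qed
  have circ: "(LINT t|circle_measure. u t * F (cis t)) = 0" if F: "continuous_on UNIV F" for F :: "complex \<Rightarrow> real"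
  proof -
    have cF: "continuous_on {-pi..pi} (\<lambda>t. F (cis t))"
      by (rule continuous_on_compose2[OF F]) (auto intro!: continuous_intros)
    define B where "B = (LINT t|circle_measure. \<bar>u t\<bar>)"
    have B: "B \<ge> 0" by (simp add: B_def)
    have "\<bar>LINT t|circle_measure. u t * F (cis t)\<bar> \<le> e * (B + 1)" if "e > 0" for e
    proof -
      obtain p where p: "real_polynomial_function p" "\<And>z. z \<in> sphere 0 1 \<Longrightarrow> \<bar>F z - p z\<bar> < e"
        using Stone_Weierstrass_real_polynomial_function[OF compact_sphere continuous_on_subset[OF F] \<open>e > 0\<close>] by blast
      note tpp = trig_poly_polynomial[OF p(1)]
      have "(LINT t|circle_measure. u t * F (cis t)) = (LINT t|circle_measure. u t * (F (cis t) - p (cis t)))"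
        using tp[OF tpp] iu[OF cF] iu[OF trig_poly_continuous[OF tpp]] by (simp add: right_diff_distrib)
      also have "\<bar>\<dots>\<bar> \<le> (LINT t|circle_measure. \<bar>u t * (F (cis t) - p (cis t))\<bar>)"
        by (rule integral_abs_bound)
      also have "\<dots> \<le> (LINT t|circle_measure. e * \<bar>u t\<bar>)"
      proof (rule integral_mono)
        show "integrable circle_measure (\<lambda>t. \<bar>u t * (F (cis t) - p (cis t))\<bar>)"
          by (intro integrable_abs iu continuous_intros cF trig_poly_continuous[OF tpp])
        show "\<bar>u t * (F (cis t) - p (cis t))\<bar> \<le> e * \<bar>u t\<bar>" for t
          using mult_left_mono[OF less_imp_le[OF p(2)[of "cis t"]], of "\<bar>u t\<bar>"] by (simp add: abs_mult mult.commute)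
      qed (use u in auto)
      also have "\<dots> = e * B" by (simp add: B_def)
      also have "\<dots> \<le> e * (B + 1)" using that by simp
      finally show ?thesis .
    qed
    from this[of "d / (B + 1)" for d] B have "\<bar>LINT t|circle_measure. u t * F (cis t)\<bar> \<le> d" if "d > 0" for d
      using that by (metis add_nonneg_pos divide_pos_pos less_numeral_extra(1) nonzero_eq_divide_eq order_less_irrefl)
    then show ?thesis using field_le_epsilon[of "\<bar>LINT t|circle_measure. u t * F (cis t)\<bar>" 0] by simp
  qed
  fix K :: "real set" assume K: "closed K" "K \<subseteq> {-pi..pi}"
  show "(LINT t|circle_measure. u t * indicat_real K t) = 0"
  proof (cases "K = {}")
    case False
    define C where "C = cis ` K"
    have "compact K" using K by (meson bounded_closed_interval bounded_subset compact_eq_bounded_closed)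
    then have "compact C" unfolding C_def by (intro compact_continuous_image continuous_intros)
    then have C: "closed C" "C \<noteq> {}" using False by (auto simp: C_def compact_imp_closed)
    \<comment> \<open>These equal one on \<open>C\<close> and vanish at distance
      \<open>1 / n\<close> from it, so they tend to the indicator of \<open>C\<close>.\<close>
    define F where "F n z = max 0 (1 - real n * infdist z C)" for n z
    have F: "continuous_on UNIV (F n)" for n unfolding F_def by (intro continuous_intros)
    \<comment> \<open>\<open>cis\<close> identifies \<open>-pi\<close> with \<open>pi\<close>; both
      end points are left out, a null set.\<close>
    have K': "cis t \<in> C \<longleftrightarrow> t \<in> K" if "t \<in> {-pi<..<pi}" for t
    proof
      assume "cis t \<in> C"
      then obtain r where r: "r \<in> K" "cis t = cis r" by (auto simp: C_def)
      then have "cos t = cos r" "sin t = sin r" by (auto simp: complex_eq_iff)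
      then obtain n :: int where n: "t = r + 2 * pi * n"
        using sin_cos_eq_iff[of t r] by (auto simp: mult_ac)
      have "r \<in> {-pi..pi}" using r K by auto
      then have "\<bar>2 * pi * n\<bar> < 2 * pi" using n that by auto
      then have "n = 0" by (simp add: abs_mult)
      then show "t \<in> K" using n r by simp
    qed (auto simp: C_def)
    have ae: "AE t in circle_measure. t \<in> {-pi<..<pi}"
    proof -
      have "AE t in lebesgue. t \<noteq> -pi"
        by (rule AE_I'[of "{-pi}"]) (auto simp: negligible_iff_null_sets[symmetric])
      then have "AE t in circle_measure. t \<noteq> -pi" by (subst AE_restrict_space_iff) auto
      then show ?thesis using AE_circle_not_pi by eventually_elim auto
    qed
    have "(\<lambda>n. LINT t|circle_measure. u t * F n (cis t)) \<longlonglongrightarrow> (LINT t|circle_measure. u t * indicat_real K t)"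
    proof (rule integral_dominated_convergence)
      show "(\<lambda>t. u t * indicat_real K t) \<in> borel_measurable circle_measure"
        using K by (intro borel_measurable_times borel_measurable_integrable[OF u] borel_measurable_indicator)
          (auto simp: sets_restrict_space_iff)
      show "(\<lambda>t. u t * F n (cis t)) \<in> borel_measurable circle_measure" for n
        by (intro borel_measurable_integrable iu continuous_on_compose2[OF F]) (auto intro!: continuous_intros)
      show "integrable circle_measure (\<lambda>t. \<bar>u t\<bar>)" using u by simp
      show "AE t in circle_measure. norm (u t * F n (cis t)) \<le> \<bar>u t\<bar>" for n
        by (intro AE_I2) (auto simp: F_def abs_mult infdist_nonneg mult_left_le)
      show "AE t in circle_measure. (\<lambda>n. u t * F n (cis t)) \<longlonglongrightarrow> u t * indicat_real K t"
        using ae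
      proof eventually_elim
        case (elim t)
        have "(\<lambda>n. F n (cis t)) \<longlonglongrightarrow> indicat_real K t"
        proof (cases "t \<in> K")
          case True
          then have "infdist (cis t) C = 0" using K'[OF elim] by simp
          then show ?thesis using True by (simp add: F_def)
        next
          case False
          then have "infdist (cis t) C > 0" using K'[OF elim] C by (simp add: infdist_pos_not_in_closed)
          then obtain N where N: "1 < real N * infdist (cis t) C" using reals_Archimedean3 by blast
          have "F n (cis t) = 0" if "n \<ge> N" for n
          proof -
            have "real N * infdist (cis t) C \<le> real n * infdist (cis t) C"
              using that by (intro mult_right_mono) (auto simp: infdist_nonneg)
            then show ?thesis using N by (simp add: F_def)
          qed
          then have "(\<lambda>n. F n (cis t)) \<longlonglongrightarrow> 0"
            by (intro tendsto_eventually) (auto simp: eventually_sequentially)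
          then show ?thesis using False by simp
        qed
        then show ?case by (intro tendsto_mult tendsto_const)
      qed
    qed
    then show ?thesis using circ[OF F] by (simp add: LIMSEQ_const_iff)
  qed simp
qed

lemma periodic_continuous_cos: "periodic_continuous (\<lambda>t. cos (real k * t))"
  and periodic_continuous_sin: "periodic_continuous (\<lambda>t. sin (real k * t))"
proof -
  have "real k * (t + 2 * pi) = real k * t + 2 * real k * pi" for t by (simp add: algebra_simps)
  then show "periodic_continuous (\<lambda>t. cos (real k * t))" "periodic_continuous (\<lambda>t. sin (real k * t))"
    unfolding periodic_continuous_def by (simp_all add: cos_add sin_add cos_2npi sin_2npi continuous_intros)
qed

text \<open>The exceptional null set depends on the test vector, and there may be no countable dense
  set of test vectors. But a simple function takes finitely many values, so orthogonality to simple
  functions follows, and these are dense.\<close>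

lemma fourier_uniqueness:
  fixes w :: "'h::real_inner per_L2"
  assumes c: "\<And>(k::nat) h. w \<bullet> tens (\<lambda>t. cos (real k * t)) h = 0"
    and s: "\<And>(k::nat) h. w \<bullet> tens (\<lambda>t. sin (real k * t)) h = 0"
  shows "w = 0"
proof -
  note pc = periodic_continuous_cos periodic_continuous_sin
  have AE0: "AE t in circle_measure. rep_per_L2 w t \<bullet> h = 0" for h
  proof (rule fourier_uniqueness_real)
    show "integrable circle_measure (\<lambda>t. rep_per_L2 w t \<bullet> h)"
      using per_sq_integrable_inner[OF per_sq_rep[of w] per_sq_tens[of "\<lambda>_. 1" h]] by (simp add: periodic_continuous_def)
    show "(LINT t|circle_measure. rep_per_L2 w t \<bullet> h * cos (real k * t)) = 0" for k :: nat
      using c[of k h] inner_tens[OF pc(1), of w k h] by (simp add: mult.commute)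
    show "(LINT t|circle_measure. rep_per_L2 w t \<bullet> h * sin (real k * t)) = 0" for k :: nat
      using s[of k h] inner_tens[OF pc(2), of w k h] by (simp add: mult.commute)
  qed
  have orth: "w \<bullet> of_circle \<sigma> = 0" if \<sigma>: "simple_function circle_measure \<sigma>" for \<sigma>
  proof -
    have fin: "finite (\<sigma> ` {-pi..pi})" using \<sigma> by (simp add: simple_function_def)
    have "AE t in circle_measure. \<forall>y\<in>\<sigma> ` {-pi..pi}. rep_per_L2 w t \<bullet> y = 0"
      using AE0 by (intro AE_finite_allI[OF fin])
    moreover have "AE t in circle_measure. t \<in> space circle_measure" by (rule AE_space)
    ultimately have "AE t in circle_measure. rep_per_L2 w t \<bullet> rep_per_L2 (of_circle \<sigma>) t = 0"
      using rep_of_circle_simple[OF \<sigma>] by eventually_elim auto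
    then show ?thesis unfolding inner_per_L2_rep by (rule integral_eq_zero_AE)
  qed
  show ?thesis
  proof (rule ccontr)
    assume "w \<noteq> 0"
    then obtain \<sigma> where \<sigma>: "simple_function circle_measure \<sigma>" "norm (w - of_circle \<sigma>) < norm w"
      using simple_dense[of "norm w" w] by auto
    have "norm w * norm w = w \<bullet> (w - of_circle \<sigma>)"
      using orth[OF \<sigma>(1)] by (simp add: inner_diff_right power2_norm_eq_inner flip: power2_eq_square)
    also have "\<dots> \<le> norm w * norm (w - of_circle \<sigma>)" by (rule norm_cauchy_schwarz)
    also have "\<dots> < norm w * norm w" using \<sigma>(2) \<open>w \<noteq> 0\<close> by (intro mult_strict_left_mono) auto
    finally show False by simp
  qed
qed

section \<open>Translations\<close>

lemma periodic_int:
  fixes f :: "real \<Rightarrow> 'a"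
  assumes "\<And>t. f (t + 2 * pi) = f t"
  shows "f (t + 2 * pi * of_int n) = f t"
proof (induction n arbitrary: t rule: int_induct[where k=0])
  case (step1 i)
  have "t + 2 * pi * of_int (i + 1) = (t + 2 * pi * of_int i) + 2 * pi" by (simp add: algebra_simps)
  then show ?case using step1 assms by metis
next
  case (step2 i)
  have "t + 2 * pi * of_int i = (t + 2 * pi * of_int (i - 1)) + 2 * pi" by (simp add: algebra_simps)
  then show ?case using step2 assms by metis
qed simp

lemma periodic_wrap:
  fixes f :: "real \<Rightarrow> 'a"
  assumes "\<And>t. f (t + 2 * pi) = f t"
  shows "f (wrap t) = f t"
  using periodic_int[of f, OF assms, of t "- \<lfloor>(t + pi) / (2 * pi)\<rfloor>"] by (simp add: wrap_def)

lemma wrap_range: "wrap t \<in> {-pi..<pi}"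
proof -
  define n where "n = \<lfloor>(t + pi) / (2 * pi)\<rfloor>"
  have "of_int n \<le> (t + pi) / (2 * pi)" "(t + pi) / (2 * pi) < of_int n + 1"
    unfolding n_def by linarith+
  then have "of_int n * (2 * pi) \<le> t + pi" "t + pi < (of_int n + 1) * (2 * pi)"
    by (simp_all add: pos_le_divide_eq pos_divide_less_eq)
  moreover have "wrap t = t - of_int n * (2 * pi)" by (simp add: wrap_def n_def mult.commute)
  ultimately show ?thesis by (simp add: algebra_simps)
qed

text \<open>A rotation by \<open>s\<close> cuts the set in two: \<open>A1\<close> is reached without
  wrapping, \<open>A2\<close> after subtracting one period. Each piece is an ordinary translate, and
  the two translates are disjoint.\<close>

lemma wrap_add_vimage:
  assumes s: "0 \<le> s" "s < 2 * pi" and A: "A \<in> sets lebesgue" "A \<subseteq> {-pi..pi}"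
  defines "P \<equiv> (\<lambda>t. wrap (t + s)) -` A \<inter> {-pi..pi}"
  shows "P \<in> sets lebesgue" "emeasure lebesgue P = emeasure lebesgue A"
proof -
  define A1 where "A1 = A \<inter> {-pi + s..<pi}"
  define A2 where "A2 = A \<inter> {-pi..<-pi + s}"
  have lm: "A1 \<in> lmeasurable" "A2 \<in> lmeasurable"
    unfolding A1_def A2_def using A(1)
    by (auto intro!: bounded_set_imp_lmeasurable bounded_Int)
  define B1 where "B1 = (+) (- s) ` A1"
  define B2 where "B2 = (+) (2 * pi - s) ` A2"
  have lmB: "B1 \<in> lmeasurable" "B2 \<in> lmeasurable"
    unfolding B1_def B2_def by (rule measurable_translation[OF lm(1)], rule measurable_translation[OF lm(2)])
  have eB: "emeasure lebesgue B1 = emeasure lebesgue A1" "emeasure lebesgue B2 = emeasure lebesgue A2"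
    using lm lmB measure_translation[of "- s" A1] measure_translation[of "2 * pi - s" A2]
    by (simp_all add: emeasure_eq_measure2 B1_def B2_def)
  have w1: "wrap (t + s) = t + s" if "-pi \<le> t" "t + s < pi" for t
    using that s by (intro wrap_id) auto
  have w2: "wrap (t + s) = t + s - 2 * pi" if "pi \<le> t + s" "t < pi" for t
    using wrap_periodic[of "t + s - 2 * pi"] wrap_id[of "t + s - 2 * pi"] that s by simp
  have B: "B1 \<union> B2 = P - {pi}"
  proof (intro set_eqI iffI)
    fix t assume "t \<in> B1 \<union> B2"
    then show "t \<in> P - {pi}"
    proof
      assume "t \<in> B1"
      then have "t + s \<in> A1" by (auto simp: B1_def)
      then show ?thesis using w1[of t] s by (auto simp: A1_def P_def)
    next
      assume "t \<in> B2"
      then have "t + s - 2 * pi \<in> A2" by (auto simp: B2_def algebra_simps)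
      then show ?thesis using w2[of t] s by (auto simp: A2_def P_def)
    qed
  next
    fix t assume "t \<in> P - {pi}"
    then have t: "wrap (t + s) \<in> A" "-pi \<le> t" "t < pi" by (auto simp: P_def)
    show "t \<in> B1 \<union> B2"
    proof (cases "t + s < pi")
      case True
      then have "t + s \<in> A1" using t w1[of t] by (auto simp: A1_def)
      then have "t \<in> B1" unfolding B1_def by (rule rev_image_eqI) simp
      then show ?thesis ..
    next
      case False
      then have "t + s - 2 * pi \<in> A2" using t w2[of t] by (auto simp: A2_def)
      then have "t \<in> B2" unfolding B2_def by (rule rev_image_eqI) simp
      then show ?thesis ..
    qed
  qed
  have npi: "{pi} \<in> null_sets lebesgue" "P \<inter> {pi} \<in> null_sets lebesgue"
    by (auto simp: negligible_iff_null_sets[symmetric] intro: negligible_subset)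
  have Pe: "P = (B1 \<union> B2) \<union> (P \<inter> {pi})" unfolding B by auto
  show "P \<in> sets lebesgue" using lmB npi by (subst Pe) auto
  have "emeasure lebesgue P = emeasure lebesgue (B1 \<union> B2)"
    by (subst Pe, rule emeasure_Un_null_set) (use lmB npi in auto)
  also have "\<dots> = emeasure lebesgue B1 + emeasure lebesgue B2"
    by (rule plus_emeasure[symmetric]) (use lmB in \<open>auto simp: B1_def B2_def A1_def A2_def\<close>)
  also have "\<dots> = emeasure lebesgue (A1 \<union> A2)"
    unfolding eB by (rule plus_emeasure) (use lm in \<open>auto simp: A1_def A2_def\<close>)
  also have "A1 \<union> A2 = A - {pi}" using A(2) s by (auto simp: A1_def A2_def)
  also have "emeasure lebesgue (A - {pi}) = emeasure lebesgue A"
    by (rule emeasure_Diff_null_set[OF npi(1) A(1)])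
  finally show "emeasure lebesgue P = emeasure lebesgue A" .
qed

lemma wrap_add_reduce: "\<exists>s'. 0 \<le> s' \<and> s' < 2 * pi \<and> (\<forall>t. wrap (t + s) = wrap (t + s'))"
proof (intro exI conjI allI)
  define n where "n = \<lfloor>s / (2 * pi)\<rfloor>"
  have "of_int n \<le> s / (2 * pi)" "s / (2 * pi) < of_int n + 1" unfolding n_def by linarith+
  then show "0 \<le> s - 2 * pi * of_int n" "s - 2 * pi * of_int n < 2 * pi" by (simp_all add: field_simps)
  show "wrap (t + s) = wrap (t + (s - 2 * pi * of_int n))" for t
    using periodic_int[of wrap, OF wrap_periodic, of "t + s" "- n"] by (simp add: algebra_simps)
qed

text \<open>Rotation invariance of the measure on one period; the statements about time shifts of
  periodic functions are changes of variables along this map.\<close>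

lemma measurable_wrap_add: "(\<lambda>t. wrap (t + s)) \<in> measurable circle_measure circle_measure"
  and distr_wrap_add: "distr circle_measure circle_measure (\<lambda>t. wrap (t + s)) = circle_measure"
proof -
  obtain s' where s': "0 \<le> s'" "s' < 2 * pi" "\<And>t. wrap (t + s) = wrap (t + s')"
    using wrap_add_reduce by blast
  have P: "(\<lambda>t. wrap (t + s)) -` A \<inter> {-pi..pi} \<in> sets lebesgue"
     "emeasure lebesgue ((\<lambda>t. wrap (t + s)) -` A \<inter> {-pi..pi}) = emeasure lebesgue A"
     if "A \<in> sets circle_measure" for A
    unfolding s'(3) using that wrap_add_vimage[OF s'(1,2), of A] by (simp_all add: sets_restrict_space_iff)
  show m: "(\<lambda>t. wrap (t + s)) \<in> measurable circle_measure circle_measure"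
  proof (rule measurableI)
    show "wrap (x + s) \<in> space circle_measure" for x using wrap_range[of "x + s"] by auto
    show "(\<lambda>t. wrap (t + s)) -` A \<inter> space circle_measure \<in> sets circle_measure" if "A \<in> sets circle_measure" for A
      using P(1)[OF that] by (simp add: sets_restrict_space_iff)
  qed
  show "distr circle_measure circle_measure (\<lambda>t. wrap (t + s)) = circle_measure"
  proof (rule measure_eqI)
    fix A assume "A \<in> sets (distr circle_measure circle_measure (\<lambda>t. wrap (t + s)))"
    then have A: "A \<in> sets circle_measure" by simp
    have "emeasure circle_measure A = emeasure lebesgue A"
      using A by (subst emeasure_restrict_space) (auto simp: sets_restrict_space_iff)
    then show "emeasure (distr circle_measure circle_measure (\<lambda>t. wrap (t + s))) A = emeasure circle_measure A"
      using P[OF A] by (simp add: emeasure_distr[OF m A] emeasure_restrict_space)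
  qed simp
qed

lemma AE_shift:
  assumes "AE t in circle_measure. P t" "\<And>t. P (t + 2 * pi) = P t"
  shows "AE t in circle_measure. P (t + s)"
  using AE_distrD[OF measurable_wrap_add[of s], unfolded distr_wrap_add, OF assms(1)]
  unfolding periodic_wrap[of P, OF assms(2)] .

lemma integral_shift:
  fixes f :: "real \<Rightarrow> real"
  assumes "f \<in> borel_measurable circle_measure" "\<And>t. f (t + 2 * pi) = f t"
  shows "(LINT t|circle_measure. f (t + s)) = (LINT t|circle_measure. f t)"
  using integral_distr[OF measurable_wrap_add[of s] assms(1)]
  by (simp add: distr_wrap_add periodic_wrap[of f, OF assms(2)])

lemma integrable_shift:
  fixes f :: "real \<Rightarrow> real"
  assumes "integrable circle_measure f" "\<And>t. f (t + 2 * pi) = f t"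
  shows "integrable circle_measure (\<lambda>t. f (t + s))"
  using integrable_distr[OF measurable_wrap_add[of s], of f] assms(1)
  by (simp add: distr_wrap_add periodic_wrap[of f, OF assms(2)])

lemma strongly_measurable_shift:
  fixes f :: "real \<Rightarrow> 'h::real_normed_vector"
  assumes "strongly_measurable circle_measure f" "\<And>t. f (t + 2 * pi) = f t"
  shows "strongly_measurable circle_measure (\<lambda>t. f (t + s))"
proof -
  obtain \<sigma> where \<sigma>: "\<forall>n. simple_function circle_measure (\<sigma> n)" "AE t in circle_measure. (\<lambda>n. \<sigma> n t) \<longlonglongrightarrow> f t"
    using assms(1) unfolding strongly_measurable_def by auto
  have "AE t in circle_measure. (\<lambda>n. \<sigma> n (wrap (t + s))) \<longlonglongrightarrow> f (wrap (t + s))"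
    by (rule AE_distrD[OF measurable_wrap_add[of s], unfolded distr_wrap_add, OF \<sigma>(2)])
  then have "AE t in circle_measure. (\<lambda>n. \<sigma> n (wrap (t + s))) \<longlonglongrightarrow> f (t + s)"
    by (simp add: periodic_wrap[of f, OF assms(2)])
  moreover have "simple_function circle_measure (\<lambda>t. \<sigma> n (wrap (t + s)))" for n
    by (rule simple_function_comp[OF measurable_wrap_add]) (use \<sigma>(1) in blast)
  ultimately show ?thesis
    unfolding strongly_measurable_def by (intro exI[of _ "\<lambda>n t. \<sigma> n (wrap (t + s))"]) auto
qed

lemma per_sq_shift:
  fixes f :: "real \<Rightarrow> 'h::real_normed_vector"
  assumes "per_sq_integrable f" shows "per_sq_integrable (\<lambda>t. f (t + s))"
proof -
  have p: "f (t + 2 * pi) = f t" for t using assms by (simp add: per_sq_integrable_def)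
  then have p': "f (t + 2 * pi + s) = f (t + s)" for t by (metis add.commute add.left_commute)
  show ?thesis
    using assms p' strongly_measurable_shift[of f, OF _ p] integrable_shift[of "\<lambda>t. (norm (f t))\<^sup>2" s]
    by (simp add: per_sq_integrable_def)
qed

lemma rep_periodic: "rep_per_L2 w (t + 2 * pi) = rep_per_L2 w t"
  using per_sq_rep[of w] by (simp add: per_sq_integrable_def)

lemma rep_time_shift: "AE t in circle_measure. rep_per_L2 (time_shift s w) t = rep_per_L2 w (t + s)"
  unfolding time_shift_def by (rule rep_abs_per_L2[OF per_sq_shift[OF per_sq_rep]])

lemma time_shift_time_shift: "time_shift a (time_shift b w) = time_shift (a + b) w"
proof (rule per_L2_eqI)
  have "AE t in circle_measure. rep_per_L2 (time_shift b w) (t + a) = rep_per_L2 w (t + a + b)"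
    by (rule AE_shift[OF rep_time_shift])
       (simp add: rep_periodic, metis add.assoc add.commute rep_periodic)
  with rep_time_shift[of a "time_shift b w"] rep_time_shift[of "a + b" w]
  show "AE t in circle_measure. rep_per_L2 (time_shift a (time_shift b w)) t = rep_per_L2 (time_shift (a + b) w) t"
    by eventually_elim (simp add: add.assoc)
qed

lemma time_shift_0: "time_shift 0 w = w"
  by (simp add: time_shift_def abs_rep_per_L2)

lemma inner_time_shift: "time_shift s w \<bullet> time_shift s u = w \<bullet> u"
proof -
  have "time_shift s w \<bullet> time_shift s u = (LINT t|circle_measure. rep_per_L2 w (t + s) \<bullet> rep_per_L2 u (t + s))"
    by (rule inner_per_L2_AE) (intro per_sq_shift per_sq_rep rep_time_shift)+
  also have "\<dots> = (LINT t|circle_measure. rep_per_L2 w t \<bullet> rep_per_L2 u t)"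
    by (rule integral_shift[of "\<lambda>t. rep_per_L2 w t \<bullet> rep_per_L2 u t"])
       (auto simp: rep_periodic intro!: borel_measurable_integrable per_sq_integrable_inner per_sq_rep)
  finally show ?thesis by (simp add: inner_per_L2_rep)
qed

lemma inner_time_shift_left: "time_shift s w \<bullet> u = w \<bullet> time_shift (- s) u"
  using inner_time_shift[of s w "time_shift (- s) u"] by (simp add: time_shift_time_shift time_shift_0)

lemma time_shift_add: "time_shift s (w + u) = time_shift s w + time_shift s u"
proof (rule per_L2_eqI)
  have "AE t in circle_measure. rep_per_L2 (w + u) (t + s) = rep_per_L2 w (t + s) + rep_per_L2 u (t + s)"
    by (rule AE_shift[OF rep_add]) (simp add: rep_periodic)
  with rep_time_shift[of s "w + u"] rep_time_shift[of s w] rep_time_shift[of s u] rep_add[of "time_shift s w" "time_shift s u"]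
  show "AE t in circle_measure. rep_per_L2 (time_shift s (w + u)) t = rep_per_L2 (time_shift s w + time_shift s u) t"
    by eventually_elim simp
qed

lemma time_shift_scaleR: "time_shift s (a *\<^sub>R w) = a *\<^sub>R time_shift s w"
proof (rule per_L2_eqI)
  have "AE t in circle_measure. rep_per_L2 (a *\<^sub>R w) (t + s) = a *\<^sub>R rep_per_L2 w (t + s)"
    by (rule AE_shift[OF rep_scaleR]) (simp add: rep_periodic)
  with rep_time_shift[of s "a *\<^sub>R w"] rep_time_shift[of s w] rep_scaleR[of a "time_shift s w"]
  show "AE t in circle_measure. rep_per_L2 (time_shift s (a *\<^sub>R w)) t = rep_per_L2 (a *\<^sub>R time_shift s w) t"
    by eventually_elim simp
qed

lemma norm_time_shift: "norm (time_shift s w) = norm w"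
  by (simp add: norm_eq_sqrt_inner inner_time_shift)

lemma periodic_continuous_shift:
  assumes "periodic_continuous \<phi>" shows "periodic_continuous (\<lambda>t. \<phi> (t + s))"
proof -
  have "\<phi> (t + 2 * pi + s) = \<phi> (t + s)" for t
    using assms unfolding periodic_continuous_def by (metis add.commute add.left_commute)
  moreover have "continuous_on UNIV (\<lambda>t. \<phi> (t + s))"
    by (rule continuous_on_compose2[OF periodic_continuous_on[OF assms, of UNIV]]) (auto intro!: continuous_intros)
  ultimately show ?thesis by (simp add: periodic_continuous_def)
qed

lemma time_shift_tens:
  assumes \<phi>: "periodic_continuous \<phi>"
  shows "time_shift s (tens \<phi> h) = tens (\<lambda>t. \<phi> (t + s)) h"
proof (rule per_L2_eqI)
  have "AE t in circle_measure. rep_per_L2 (tens \<phi> h) (t + s) = \<phi> (t + s) *\<^sub>R h"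
    by (rule AE_shift[OF rep_tens[OF \<phi>]]) (use \<phi> in \<open>simp add: rep_periodic periodic_continuous_def\<close>)
  with rep_time_shift[of s "tens \<phi> h"] rep_tens[OF periodic_continuous_shift[OF \<phi>], of s h]
  show "AE t in circle_measure. rep_per_L2 (time_shift s (tens \<phi> h)) t = rep_per_L2 (tens (\<lambda>t. \<phi> (t + s)) h) t"
    by eventually_elim simp
qed

section \<open>Weak derivatives\<close>

definition smooth_periodic :: "(real \<Rightarrow> real) \<Rightarrow> bool" where
  "smooth_periodic \<phi> \<longleftrightarrow> (\<forall>n t. (deriv ^^ n) \<phi> field_differentiable at t) \<and> (\<forall>t. \<phi> (t + 2 * pi) = \<phi> t)"

lemma deriv_shift:
  fixes \<phi> :: "real \<Rightarrow> real"
  assumes "\<And>t. \<phi> field_differentiable at t"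
  shows "deriv (\<lambda>t. \<phi> (t + s)) = (\<lambda>t. deriv \<phi> (t + s))" "(\<lambda>t. \<phi> (t + s)) field_differentiable at t"
proof -
  have "((\<lambda>t. \<phi> (t + s)) has_field_derivative deriv \<phi> (t + s)) (at t)" for t
    using DERIV_deriv_iff_field_differentiable[THEN iffD2, OF assms, of "t + s"] unfolding DERIV_shift .
  then show "deriv (\<lambda>t. \<phi> (t + s)) = (\<lambda>t. deriv \<phi> (t + s))" "(\<lambda>t. \<phi> (t + s)) field_differentiable at t"
    by (auto intro!: DERIV_imp_deriv simp: field_differentiable_def fun_eq_iff)
qed

lemma smooth_periodic_shift:
  assumes "smooth_periodic \<phi>"
  shows "smooth_periodic (\<lambda>t. \<phi> (t + s))" "deriv (\<lambda>t. \<phi> (t + s)) = (\<lambda>t. deriv \<phi> (t + s))"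
proof -
  have d: "(deriv ^^ n) \<phi> field_differentiable at t" for n t using assms by (simp add: smooth_periodic_def)
  have e: "(deriv ^^ n) (\<lambda>t. \<phi> (t + s)) = (\<lambda>t. (deriv ^^ n) \<phi> (t + s))" for n
    by (induction n) (simp_all add: deriv_shift(1)[OF d])
  have "\<phi> (t + 2 * pi + s) = \<phi> (t + s)" for t
    using assms unfolding smooth_periodic_def by (metis add.commute add.left_commute)
  then show "smooth_periodic (\<lambda>t. \<phi> (t + s))"
    unfolding smooth_periodic_def e using deriv_shift(2)[OF d] by auto
  show "deriv (\<lambda>t. \<phi> (t + s)) = (\<lambda>t. deriv \<phi> (t + s))" using e[of 1] by simp
qed

lemma smooth_periodic_continuous:
  assumes "smooth_periodic \<phi>"
  shows "periodic_continuous \<phi>" "periodic_continuous (deriv \<phi>)"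
proof -
  have d: "(deriv ^^ n) \<phi> field_differentiable at t" for n t using assms by (simp add: smooth_periodic_def)
  have c: "continuous_on UNIV ((deriv ^^ n) \<phi>)" for n
    using d field_differentiable_imp_continuous_at continuous_at_imp_continuous_on by blast
  have p: "(\<lambda>t. \<phi> (t + 2 * pi)) = \<phi>" using assms by (simp add: smooth_periodic_def)
  then show "periodic_continuous \<phi>" using c[of 0] by (simp add: periodic_continuous_def fun_eq_iff)
  have "deriv \<phi> = (\<lambda>t. deriv \<phi> (t + 2 * pi))"
    using smooth_periodic_shift(2)[OF assms, of "2 * pi"] by (simp only: p)
  then show "periodic_continuous (deriv \<phi>)" using c[of 1] by (simp add: periodic_continuous_def) metis
qed

lemma smooth_periodic_trig:
  "smooth_periodic (\<lambda>t. a * cos (real k * t) + b * sin (real k * t))"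
  "deriv (\<lambda>t. a * cos (real k * t) + b * sin (real k * t)) = (\<lambda>t. (real k * b) * cos (real k * t) + (- real k * a) * sin (real k * t))"
proof -
  have D: "((\<lambda>t. a * cos (real k * t) + b * sin (real k * t)) has_field_derivative
     (real k * b) * cos (real k * t) + (- real k * a) * sin (real k * t)) (at t)" for a b t
    by (auto intro!: derivative_eq_intros simp: algebra_simps)
  then show d: "deriv (\<lambda>t. a * cos (real k * t) + b * sin (real k * t)) = (\<lambda>t. (real k * b) * cos (real k * t) + (- real k * a) * sin (real k * t))" for a b
    by (intro ext DERIV_imp_deriv)
  have "\<exists>a' b'. (deriv ^^ n) (\<lambda>t. a * cos (real k * t) + b * sin (real k * t)) = (\<lambda>t. a' * cos (real k * t) + b' * sin (real k * t))" for n
  proof (induction n)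
    case (Suc n)
    then obtain a' b' where "(deriv ^^ n) (\<lambda>t. a * cos (real k * t) + b * sin (real k * t)) = (\<lambda>t. a' * cos (real k * t) + b' * sin (real k * t))"
      by blast
    then have "(deriv ^^ Suc n) (\<lambda>t. a * cos (real k * t) + b * sin (real k * t)) = (\<lambda>t. (real k * b') * cos (real k * t) + (- real k * a') * sin (real k * t))"
      using d[of a' b'] by simp
    then show ?case by blast
  qed auto
  then have "(deriv ^^ n) (\<lambda>t. a * cos (real k * t) + b * sin (real k * t)) field_differentiable at t" for n t
    using D unfolding field_differentiable_def by metis
  then show "smooth_periodic (\<lambda>t. a * cos (real k * t) + b * sin (real k * t))"
    using periodic_continuous_cos[of k] periodic_continuous_sin[of k]
    by (simp add: smooth_periodic_def periodic_continuous_def)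
qed

text \<open>In this form the weak derivative is visibly linear, closed under limits and compatible
  with time shifts.\<close>

lemma has_weak_deriv_iff:
  fixes w g :: "'h::{real_inner, complete_space} per_L2"
  shows "has_weak_deriv w g \<longleftrightarrow> (\<forall>\<phi>. smooth_periodic \<phi> \<longrightarrow> (\<forall>h. w \<bullet> tens (deriv \<phi>) h = - (g \<bullet> tens \<phi> h)))"
proof -
  have "integral {-pi..pi} (\<lambda>t. deriv \<phi> t *\<^sub>R rep_per_L2 w t) = - integral {-pi..pi} (\<lambda>t. \<phi> t *\<^sub>R rep_per_L2 g t)
    \<longleftrightarrow> (\<forall>h. w \<bullet> tens (deriv \<phi>) h = - (g \<bullet> tens \<phi> h))" if "smooth_periodic \<phi>" for \<phi>
  proof -
    note c = smooth_periodic_continuous[OF that]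
    have "x = - y \<longleftrightarrow> (\<forall>h. x \<bullet> h = - (y \<bullet> h))" for x y :: 'h
      by (metis inner_minus_left vector_eq_rdot)
    then show ?thesis by (simp add: integral_rep_inner[OF c(1)] integral_rep_inner[OF c(2)])
  qed
  then show ?thesis unfolding has_weak_deriv_def smooth_periodic_def[symmetric] by blast
qed

lemma has_weak_derivD:
  fixes w g :: "'h::{real_inner, complete_space} per_L2"
  shows "has_weak_deriv w g \<Longrightarrow> smooth_periodic \<phi> \<Longrightarrow> w \<bullet> tens (deriv \<phi>) h = - (g \<bullet> tens \<phi> h)"
  by (simp add: has_weak_deriv_iff)

text \<open>Trigonometric functions are admissible test functions, and their pairings determine an
  element.\<close>

lemma has_weak_deriv_unique:
  fixes w g g' :: "'h::{real_inner, complete_space} per_L2"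
  assumes "has_weak_deriv w g" "has_weak_deriv w g'"
  shows "g = g'"
proof -
  have "(g - g') \<bullet> tens (\<lambda>t. a * cos (real k * t) + b * sin (real k * t)) h = 0" for k h a b
    using has_weak_derivD[OF assms(1) smooth_periodic_trig(1)[of a k b], of h] has_weak_derivD[OF assms(2) smooth_periodic_trig(1)[of a k b], of h]
    by (simp add: inner_diff_left)
  from this[of 1 _ 0] this[of 0 _ 1] have "g - g' = 0" by (intro fourier_uniqueness) simp_all
  then show ?thesis by simp
qed

lemma time_deriv_eq:
  fixes w g :: "'h::{real_inner, complete_space} per_L2"
  shows "has_weak_deriv w g \<Longrightarrow> time_deriv w = g"
  unfolding time_deriv_def using has_weak_deriv_unique by blast

lemma has_weak_deriv_add:
  fixes w g :: "'h::{real_inner, complete_space} per_L2"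
  shows "has_weak_deriv w g \<Longrightarrow> has_weak_deriv w' g' \<Longrightarrow> has_weak_deriv (w + w') (g + g')"
  by (simp add: has_weak_deriv_iff inner_add_left)

lemma has_weak_deriv_scaleR:
  fixes w g :: "'h::{real_inner, complete_space} per_L2"
  shows "has_weak_deriv w g \<Longrightarrow> has_weak_deriv (a *\<^sub>R w) (a *\<^sub>R g)"
  by (simp add: has_weak_deriv_iff)

lemma has_weak_deriv_limit:
  fixes w g :: "'h::{real_inner, complete_space} per_L2"
  assumes "\<And>n. has_weak_deriv (W n) (G n)" "W \<longlonglongrightarrow> w" "G \<longlonglongrightarrow> g"
  shows "has_weak_deriv w g"
  unfolding has_weak_deriv_iff
proof (intro allI impI)
  fix \<phi> h assume \<phi>: "smooth_periodic \<phi>"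
  have "(\<lambda>n. W n \<bullet> tens (deriv \<phi>) h) \<longlonglongrightarrow> w \<bullet> tens (deriv \<phi>) h" by (intro tendsto_intros assms)
  moreover have "(\<lambda>n. - (G n \<bullet> tens \<phi> h)) \<longlonglongrightarrow> - (g \<bullet> tens \<phi> h)" by (intro tendsto_intros assms)
  ultimately show "w \<bullet> tens (deriv \<phi>) h = - (g \<bullet> tens \<phi> h)"
    using has_weak_derivD[OF assms(1) \<phi>] LIMSEQ_unique by simp
qed

lemma has_weak_deriv_time_shift:
  fixes w g :: "'h::{real_inner, complete_space} per_L2"
  assumes "has_weak_deriv w g" shows "has_weak_deriv (time_shift s w) (time_shift s g)"
  unfolding has_weak_deriv_iff
proof (intro allI impI)
  fix \<phi> h assume \<phi>: "smooth_periodic \<phi>"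
  show "time_shift s w \<bullet> tens (deriv \<phi>) h = - (time_shift s g \<bullet> tens \<phi> h)"
    using has_weak_derivD[OF assms smooth_periodic_shift(1)[OF \<phi>, of "- s"], of h]
    unfolding smooth_periodic_shift(2)[OF \<phi>] inner_time_shift_left
      time_shift_tens[OF smooth_periodic_continuous(1)[OF \<phi>]] time_shift_tens[OF smooth_periodic_continuous(2)[OF \<phi>]] .
qed

lemma mean_value_zero_iff:
  fixes w :: "'h::{real_inner, complete_space} per_L2"
  shows "mean_value w = 0 \<longleftrightarrow> (\<forall>h. w \<bullet> tens (\<lambda>_. 1) h = 0)"
proof -
  have "mean_value w = 0 \<longleftrightarrow> (\<forall>h. mean_value w \<bullet> h = 0)" by (metis inner_eq_zero_iff inner_zero_left)
  then show ?thesis by (simp add: mean_value_inner)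
qed

text \<open>The constant one is a test function with vanishing derivative.\<close>

lemma mean_value_weak_deriv:
  fixes w g :: "'h::{real_inner, complete_space} per_L2"
  assumes "has_weak_deriv w g" shows "mean_value g = 0"
proof -
  have t0: "tens (\<lambda>t. 0) h = 0" for h :: 'h
    by (simp add: tens_def zero_per_L2_def)
  have s: "smooth_periodic (\<lambda>_. 1)" using smooth_periodic_trig(1)[of 1 0 0] by simp
  have d: "deriv (\<lambda>_. 1 :: real) = (\<lambda>_. 0)" by (simp add: fun_eq_iff)
  show ?thesis
    unfolding mean_value_zero_iff using has_weak_derivD[OF assms s] unfolding d t0 by simp
qed

lemma mean_value_time_shift:
  fixes w :: "'h::{real_inner, complete_space} per_L2"
  shows "mean_value w = 0 \<Longrightarrow> mean_value (time_shift s w) = 0"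
  by (simp add: mean_value_zero_iff inner_time_shift_left time_shift_tens periodic_continuous_def)

section \<open>Closed operators acting pointwise\<close>

text \<open>Riemann sums are linear combinations of values, hence lie in \<open>G\<close>, and the
  integral is their limit.\<close>

lemma has_integral_in_closed_subspace:
  fixes f :: "real \<Rightarrow> 'a::real_normed_vector"
  assumes f: "(f has_integral z) {a..b}" and G: "subspace G" "closed G" and mem: "\<And>t. f t \<in> G"
  shows "z \<in> G"
proof -
  have "\<exists>y\<in>G. dist y z < \<epsilon>" if \<epsilon>: "\<epsilon> > 0" for \<epsilon>
  proof -
    obtain \<gamma> where \<gamma>: "gauge \<gamma>" "\<And>p. p tagged_division_of (cbox a b) \<Longrightarrow> \<gamma> fine p \<Longrightarrow>
          norm ((\<Sum>(x, k)\<in>p. measure lborel k *\<^sub>R f x) - z) < \<epsilon>"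
      by (rule has_integralD[OF f[folded box_real(2)] \<epsilon>], rule that) blast+
    obtain p where p: "p tagged_division_of (cbox a b)" "\<gamma> fine p"
      using fine_division_exists[OF \<gamma>(1)] by blast
    have "(\<Sum>(x, k)\<in>p. measure lborel k *\<^sub>R f x) \<in> G"
      by (rule subspace_sum[OF G(1)]) (auto intro: subspace_scale[OF G(1)] mem)
    with \<gamma>(2)[OF p] show ?thesis by (auto simp: dist_norm)
  qed
  then have "z \<in> closure G" by (simp add: closure_approachable)
  then show ?thesis using G(2) by simp
qed

lemma vector_eqI_inner: "(\<And>h. x \<bullet> h = y \<bullet> h) \<Longrightarrow> x = y"
  by (metis vector_eq_rdot)

locale closed_operator =
  fixes D :: "'h::{real_inner, complete_space} set" and L :: "'h \<Rightarrow> 'h"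
  assumes dc: "densely_defined_closed D L"
begin

lemma subspace_D: "subspace D" and dense_D: "closure D = UNIV"
  and L_add: "x \<in> D \<Longrightarrow> y \<in> D \<Longrightarrow> L (x + y) = L x + L y"
  and L_scaleR: "x \<in> D \<Longrightarrow> L (a *\<^sub>R x) = a *\<^sub>R L x"
  using dc by (auto simp: densely_defined_closed_def)

lemma L_0: "L 0 = 0" using L_scaleR[OF subspace_0[OF subspace_D], of 0] by simp

definition graph :: "('h \<times> 'h) set" where "graph = {(x, L x) | x. x \<in> D}"

lemma closed_graph: "closed graph" using dc by (simp add: densely_defined_closed_def graph_def)

lemma graph_iff: "(x, y) \<in> graph \<longleftrightarrow> x \<in> D \<and> y = L x" by (auto simp: graph_def)

lemma subspace_graph: "subspace graph"
proof (rule subspaceI)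
  show "0 \<in> graph" by (simp add: zero_prod_def graph_iff subspace_0[OF subspace_D] L_0)
next
  fix p q assume "p \<in> graph" "q \<in> graph"
  then show "p + q \<in> graph"
    by (cases p; cases q) (auto simp: graph_iff L_add subspace_add[OF subspace_D])
next
  fix c p assume "p \<in> graph"
  then show "c *\<^sub>R p \<in> graph"
    by (cases p) (auto simp: graph_iff L_scaleR subspace_scale[OF subspace_D])
qed

abbreviation "acts \<equiv> acts_pointwise D L"

lemma acts_iff: "acts w g \<longleftrightarrow> (AE t in circle_measure. (rep_per_L2 w t, rep_per_L2 g t) \<in> graph)"
  by (simp add: acts_pointwise_def graph_iff)

lemma acts_unique: "acts w g \<Longrightarrow> acts w g' \<Longrightarrow> g = g'"
proof (rule per_L2_eqI)
  assume "acts w g" "acts w g'"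
  then show "AE t in circle_measure. rep_per_L2 g t = rep_per_L2 g' t"
    unfolding acts_iff by eventually_elim (simp add: graph_iff)
qed

lemma lift_op_eq: "acts w g \<Longrightarrow> lift_op D L w = g"
  unfolding lift_op_def using acts_unique by blast

lemma acts_add:
  assumes "acts w g" "acts w' g'" shows "acts (w + w') (g + g')"
  using assms rep_add[of w w'] rep_add[of g g'] unfolding acts_iff
proof eventually_elim
  case (elim t)
  then show ?case using subspace_add[OF subspace_graph elim(1,2)] by simp
qed

lemma acts_scaleR:
  assumes "acts w g" shows "acts (a *\<^sub>R w) (a *\<^sub>R g)"
  using assms rep_scaleR[of a w] rep_scaleR[of a g] unfolding acts_iff
proof eventually_elim
  case (elim t)
  then show ?case using subspace_scale[OF subspace_graph elim(1), of a] by simp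
qed

lemma acts_time_shift:
  assumes "acts w g" shows "acts (time_shift s w) (time_shift s g)"
proof -
  have "AE t in circle_measure. (rep_per_L2 w (t + s), rep_per_L2 g (t + s)) \<in> graph"
    by (rule AE_shift[OF assms[unfolded acts_iff]]) (simp add: rep_periodic)
  with rep_time_shift[of s w] rep_time_shift[of s g]
  show ?thesis unfolding acts_iff by eventually_elim simp
qed

lemma acts_tens:
  assumes "periodic_continuous \<phi>" "x \<in> D" shows "acts (tens \<phi> x) (tens \<phi> (L x))"
  using rep_tens[OF assms(1), of x] rep_tens[OF assms(1), of "L x"] unfolding acts_iff
  by eventually_elim (simp add: graph_iff L_scaleR assms(2) subspace_scale[OF subspace_D])

lemma acts_inner_tens:
  assumes a: "acts w g" and yz: "\<And>x. x \<in> D \<Longrightarrow> L x \<bullet> y = x \<bullet> z" and \<phi>: "periodic_continuous \<phi>"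
  shows "g \<bullet> tens \<phi> y = w \<bullet> tens \<phi> z"
  unfolding inner_tens[OF \<phi>]
proof (rule integral_cong_AE)
  show "(\<lambda>t. rep_per_L2 g t \<bullet> \<phi> t *\<^sub>R y) \<in> borel_measurable circle_measure"
    "(\<lambda>t. rep_per_L2 w t \<bullet> \<phi> t *\<^sub>R z) \<in> borel_measurable circle_measure"
    by (intro borel_measurable_integrable per_sq_integrable_inner per_sq_rep per_sq_tens \<phi>)+
  show "AE t in circle_measure. rep_per_L2 g t \<bullet> \<phi> t *\<^sub>R y = rep_per_L2 w t \<bullet> \<phi> t *\<^sub>R z"
    using a unfolding acts_iff by eventually_elim (simp add: graph_iff yz)
qed

text \<open>The squared distance of the pair \<open>(w, g)\<close> to the closed graph is bounded by
  the squared approximation errors, so its integral is zero. This avoids passing to an almost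
  everywhere convergent subsequence.\<close>

lemma acts_limit:
  assumes a: "\<And>n. acts (W n) (G n)" and W: "W \<longlonglongrightarrow> w" and G: "G \<longlonglongrightarrow> g"
  shows "acts w g"
proof -
  define f where "f t = (infdist (rep_per_L2 w t, rep_per_L2 g t) graph)\<^sup>2" for t
  have sm: "strongly_measurable circle_measure (rep_per_L2 v)" for v :: "'h per_L2"
    using per_sq_rep[of v] by (simp add: per_sq_integrable_def)
  have m: "f \<in> borel_measurable circle_measure"
    unfolding f_def
    by (rule strongly_measurable_real, rule strongly_measurable_compose2[OF sm sm, of "\<lambda>x y. (infdist (x, y) graph)\<^sup>2"])
       (intro tendsto_intros tendsto_Pair)
  have i: "integrable circle_measure (\<lambda>t. (norm (rep_per_L2 v t))\<^sup>2)" for v :: "'h per_L2"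
    using per_sq_rep[of v] by (simp add: per_sq_integrable_def)
  have ae: "AE t in circle_measure. f t \<le> (norm (rep_per_L2 (w - W n) t))\<^sup>2 + (norm (rep_per_L2 (g - G n) t))\<^sup>2" for n
    using a[of n] rep_diff[of w "W n"] rep_diff[of g "G n"] unfolding acts_iff
  proof eventually_elim
    case (elim t)
    have "infdist (rep_per_L2 w t, rep_per_L2 g t) graph \<le> dist (rep_per_L2 w t, rep_per_L2 g t) (rep_per_L2 (W n) t, rep_per_L2 (G n) t)"
      by (rule infdist_le[OF elim(1)])
    from power_mono[OF this infdist_nonneg, of 2] show ?case
      using elim(2,3) by (simp add: f_def dist_norm norm_Pair)
  qed
  have fi: "integrable circle_measure f"
    by (rule Bochner_Integration.integrable_bound[OF Bochner_Integration.integrable_add[OF i i] m, of "w - W 0" "g - G 0"])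
       (use ae[of 0] in \<open>eventually_elim, simp add: f_def\<close>)
  have le: "(LINT t|circle_measure. f t) \<le> (norm (w - W n))\<^sup>2 + (norm (g - G n))\<^sup>2" for n
  proof -
    have "(LINT t|circle_measure. f t) \<le> (LINT t|circle_measure. (norm (rep_per_L2 (w - W n) t))\<^sup>2 + (norm (rep_per_L2 (g - G n) t))\<^sup>2)"
      by (rule integral_mono_AE[OF fi _ ae]) (intro Bochner_Integration.integrable_add i)
    then show ?thesis by (simp add: norm_per_L2_rep i)
  qed
  have "(\<lambda>n. (norm (w - W n))\<^sup>2 + (norm (g - G n))\<^sup>2) \<longlonglongrightarrow> (norm (w - w))\<^sup>2 + (norm (g - g))\<^sup>2"
    by (intro tendsto_intros W G)
  then have "(\<lambda>n. (norm (w - W n))\<^sup>2 + (norm (g - G n))\<^sup>2) \<longlonglongrightarrow> 0" by simp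
  then have "(LINT t|circle_measure. f t) \<le> 0"
    by (rule LIMSEQ_le_const) (use le in blast)
  moreover have "(LINT t|circle_measure. f t) \<ge> 0" by (simp add: f_def)
  ultimately have "(LINT t|circle_measure. f t) = 0" by simp
  moreover have "AE t in circle_measure. 0 \<le> f t" by (simp add: f_def)
  ultimately have "AE t in circle_measure. f t = 0"
    using integral_nonneg_eq_0_iff_AE[OF fi] by blast
  then show ?thesis
    unfolding acts_iff
  proof eventually_elim
    case (elim t)
    have "graph \<noteq> {}" using subspace_0[OF subspace_graph] by blast
    then show ?case using elim closed_graph by (simp add: f_def in_closed_iff_infdist_zero)
  qed
qed

text \<open>Hille's theorem: the graph, being a closed subspace, contains the integral of a
  graph-valued function, so the operator may be taken under the integral.\<close>

lemma acts_integral: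
  assumes a: "acts w g" and \<phi>: "periodic_continuous \<phi>"
  shows "integral {-pi..pi} (\<lambda>t. \<phi> t *\<^sub>R rep_per_L2 w t) \<in> D"
    "L (integral {-pi..pi} (\<lambda>t. \<phi> t *\<^sub>R rep_per_L2 w t)) = integral {-pi..pi} (\<lambda>t. \<phi> t *\<^sub>R rep_per_L2 g t)"
proof -
  define F where "F t = (\<phi> t *\<^sub>R rep_per_L2 w t, \<phi> t *\<^sub>R rep_per_L2 g t)" for t
  define I where "I v = integral {-pi..pi} (\<lambda>t. \<phi> t *\<^sub>R rep_per_L2 v t)" for v :: "'h per_L2"
  have hi: "((\<lambda>t. \<phi> t *\<^sub>R rep_per_L2 v t) has_integral I v) {-pi..pi}" for v :: "'h per_L2"
    unfolding I_def by (rule integrable_integral[OF integrable_on_rep[OF \<phi>]])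
  have "bounded_linear (\<lambda>x::'h. (x, 0::'h))" "bounded_linear (\<lambda>x::'h. (0::'h, x))"
    by (auto intro!: bounded_linear_intro[of _ 1])
  from has_integral_add[OF has_integral_linear[OF hi[of w] this(1)] has_integral_linear[OF hi[of g] this(2)]]
  have F: "(F has_integral (I w, I g)) {-pi..pi}" by (simp add: o_def F_def[abs_def])
  have "AE t in lebesgue. t \<in> {-pi..pi} \<longrightarrow> (rep_per_L2 w t, rep_per_L2 g t) \<in> graph"
    using a unfolding acts_iff by (subst (asm) AE_restrict_space_iff) auto
  then obtain S where S: "{t \<in> space lebesgue. \<not> (t \<in> {-pi..pi} \<longrightarrow> (rep_per_L2 w t, rep_per_L2 g t) \<in> graph)} \<subseteq> S"
    "emeasure lebesgue S = 0" "S \<in> sets lebesgue" by (rule AE_E)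
  have neg: "negligible S" using S by (simp add: negligible_iff_null_sets null_setsI)
  \<comment> \<open>Values off the graph occur on a null set only; they are replaced by zero because
    \<open>has_integral_in_closed_subspace\<close> asks for membership at every point.\<close>
  define F' where "F' t = (if t \<in> {-pi..pi} - S then F t else 0)" for t
  have "(F' has_integral (I w, I g)) {-pi..pi}"
    by (rule has_integral_spike[OF neg _ F]) (simp add: F'_def)
  moreover have "F' t \<in> graph" for t
  proof (cases "t \<in> {-pi..pi} - S")
    case True
    then have "(rep_per_L2 w t, rep_per_L2 g t) \<in> graph" using S(1) by auto
    then have "\<phi> t *\<^sub>R (rep_per_L2 w t, rep_per_L2 g t) \<in> graph" by (rule subspace_scale[OF subspace_graph])
    then show ?thesis using True by (simp add: F'_def F_def)
  next
    case False
    then have "F' t = 0" unfolding F'_def by (rule if_not_P)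
    then show ?thesis using subspace_0[OF subspace_graph] by simp
  qed
  ultimately have "(I w, I g) \<in> graph"
    by (rule has_integral_in_closed_subspace[OF _ subspace_graph closed_graph])
  then show "integral {-pi..pi} (\<lambda>t. \<phi> t *\<^sub>R rep_per_L2 w t) \<in> D"
    "L (integral {-pi..pi} (\<lambda>t. \<phi> t *\<^sub>R rep_per_L2 w t)) = integral {-pi..pi} (\<lambda>t. \<phi> t *\<^sub>R rep_per_L2 g t)"
    by (simp_all add: graph_iff I_def)
qed

text \<open>Density of \<open>D\<close> determines the adjoint value, so the description in
  \<open>adjoint_op\<close> denotes it.\<close>

lemma adjoint_op_eq:
  assumes "y \<in> adjoint_domain D L" "x \<in> D" shows "L x \<bullet> y = x \<bullet> adjoint_op D L y"
proof -
  obtain z where z: "\<forall>x\<in>D. L x \<bullet> y = x \<bullet> z" using assms(1) by (auto simp: adjoint_domain_def)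
  have "z' = z" if z': "\<forall>x\<in>D. L x \<bullet> y = x \<bullet> z'" for z'
  proof -
    have "D \<subseteq> {x. x \<bullet> (z' - z) = 0}" using z z' by (auto simp: inner_diff_right)
    moreover have "closed {x. x \<bullet> (z' - z) = 0}" by (intro closed_Collect_eq continuous_intros)
    ultimately have "closure D \<subseteq> {x. x \<bullet> (z' - z) = 0}" by (rule closure_minimal)
    then have "z' - z \<in> {x. x \<bullet> (z' - z) = 0}" unfolding dense_D by (rule subsetD) simp
    then have "(z' - z) \<bullet> (z' - z) = 0" by (simp only: mem_Collect_eq)
    then show ?thesis unfolding inner_eq_zero_iff by simp
  qed
  with z have "adjoint_op D L y = z" unfolding adjoint_op_def by (intro the_equality) blast+
  then show ?thesis using z assms(2) by simp
qed

subsection \<open>The space of periodic functions in the domain\<close>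

abbreviation "W \<equiv> W_per0 D L"
abbreviation "lft \<equiv> lift_op D L"

lemma W_I: "acts w g \<Longrightarrow> has_weak_deriv w d \<Longrightarrow> mean_value w = 0 \<Longrightarrow> w \<in> W"
  by (auto simp: W_per0_def)

lemma W_D:
  assumes "w \<in> W"
  shows "acts w (lft w)" "has_weak_deriv w (time_deriv w)" "mean_value w = 0"
  using assms lift_op_eq time_deriv_eq by (force simp: W_per0_def)+

lemma subspace_H_per0: "subspace (H_per0 :: 'h per_L2 set)"
  by (rule subspaceI) (simp_all add: H_per0_def mean_value_zero_iff inner_add_left)

lemma W_add:
  assumes "w \<in> W" "u \<in> W"
  shows "w + u \<in> W" "lft (w + u) = lft w + lft u" "time_deriv (w + u) = time_deriv w + time_deriv u"
proof -
  note a = acts_add[OF W_D(1)[OF assms(1)] W_D(1)[OF assms(2)]]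
  note d = has_weak_deriv_add[OF W_D(2)[OF assms(1)] W_D(2)[OF assms(2)]]
  have "mean_value (w + u) = 0"
    using W_D(3)[OF assms(1)] W_D(3)[OF assms(2)] subspace_add[OF subspace_H_per0, of w u] by (simp add: H_per0_def)
  with a d show "w + u \<in> W" by (rule W_I)
  show "lft (w + u) = lft w + lft u" by (rule lift_op_eq[OF a])
  show "time_deriv (w + u) = time_deriv w + time_deriv u" by (rule time_deriv_eq[OF d])
qed

lemma W_scaleR:
  assumes "w \<in> W"
  shows "c *\<^sub>R w \<in> W" "lft (c *\<^sub>R w) = c *\<^sub>R lft w" "time_deriv (c *\<^sub>R w) = c *\<^sub>R time_deriv w"
proof -
  note a = acts_scaleR[OF W_D(1)[OF assms(1)], of c]
  note d = has_weak_deriv_scaleR[OF W_D(2)[OF assms(1)], of c]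
  have "mean_value (c *\<^sub>R w) = 0"
    using W_D(3)[OF assms(1)] subspace_scale[OF subspace_H_per0, of w c] by (simp add: H_per0_def)
  with a d show "c *\<^sub>R w \<in> W" by (rule W_I)
  show "lft (c *\<^sub>R w) = c *\<^sub>R lft w" by (rule lift_op_eq[OF a])
  show "time_deriv (c *\<^sub>R w) = c *\<^sub>R time_deriv w" by (rule time_deriv_eq[OF d])
qed

lemma W_time_shift:
  assumes "w \<in> W"
  shows "time_shift s w \<in> W" "lft (time_shift s w) = time_shift s (lft w)"
    "time_deriv (time_shift s w) = time_shift s (time_deriv w)"
proof -
  note a = acts_time_shift[OF W_D(1)[OF assms(1)], of s]
  note d = has_weak_deriv_time_shift[OF W_D(2)[OF assms(1)], of s]
  show "time_shift s w \<in> W" by (rule W_I[OF a d mean_value_time_shift[OF W_D(3)[OF assms]]])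
  show "lft (time_shift s w) = time_shift s (lft w)" by (rule lift_op_eq[OF a])
  show "time_deriv (time_shift s w) = time_shift s (time_deriv w)" by (rule time_deriv_eq[OF d])
qed

lemma zero_W: "0 \<in> W"
proof (rule W_I[of 0 0 0])
  have "AE t in circle_measure. rep_per_L2 (0 :: 'h per_L2) t = 0"
    using rep_scaleR[of 0 "0 :: 'h per_L2"] by simp
  then show "acts 0 0" unfolding acts_iff
    by eventually_elim (use subspace_0[OF subspace_graph] in \<open>simp add: zero_prod_def\<close>)
  show "has_weak_deriv (0 :: 'h per_L2) 0" by (simp add: has_weak_deriv_iff)
  show "mean_value (0 :: 'h per_L2) = 0" by (simp add: mean_value_zero_iff)
qed

lemma subspace_W: "subspace W"
  by (rule subspaceI) (auto intro: zero_W W_add W_scaleR)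

text \<open>Real and imaginary part of \<open>(L + \<theta>) x\<close> are
  \<open>L x + Re \<theta> *\<^sub>R x\<close> and \<open>Im \<theta> *\<^sub>R x\<close>;
  integrating their squares turns the norm into three norms of square integrable functions.\<close>

lemma W_norm_sq:
  assumes "w \<in> W"
  shows "(W_per0_norm L \<theta> w)\<^sup>2
    = (norm (lft w + Re \<theta> *\<^sub>R w))\<^sup>2 + (norm (Im \<theta> *\<^sub>R w))\<^sup>2 + (norm (time_deriv w))\<^sup>2"
    and "W_per0_norm L \<theta> w \<ge> 0"
proof -
  have i: "integrable circle_measure (\<lambda>t. (norm (rep_per_L2 v t))\<^sup>2)" for v :: "'h per_L2"
    using per_sq_rep[of v] by (simp add: per_sq_integrable_def)
  define F where "F t = (norm (rep_per_L2 (lft w + Re \<theta> *\<^sub>R w) t))\<^sup>2 + (norm (rep_per_L2 (Im \<theta> *\<^sub>R w) t))\<^sup>2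
        + (norm (rep_per_L2 (time_deriv w) t))\<^sup>2" for t
  have Fi: "integrable circle_measure F" unfolding F_def by (intro Bochner_Integration.integrable_add i)
  have ae: "AE t in circle_measure. F t = (W_norm L \<theta> (rep_per_L2 w t))\<^sup>2 + (norm (rep_per_L2 (time_deriv w) t))\<^sup>2"
    using W_D(1)[OF assms, unfolded acts_iff] rep_add[of "lft w" "Re \<theta> *\<^sub>R w"] rep_scaleR[of "Re \<theta>" w] rep_scaleR[of "Im \<theta>" w]
  proof eventually_elim
    case (elim t)
    then show ?case
      by (simp add: F_def W_norm_def cshifted_def cscale_def graph_iff L_0 norm_Pair)
  qed
  have "(LINT t|circle_measure. (W_norm L \<theta> (rep_per_L2 w t))\<^sup>2 + (norm (rep_per_L2 (time_deriv w) t))\<^sup>2) = (LINT t|circle_measure. F t)"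
  proof (cases "(\<lambda>t. (W_norm L \<theta> (rep_per_L2 w t))\<^sup>2 + (norm (rep_per_L2 (time_deriv w) t))\<^sup>2) \<in> borel_measurable circle_measure")
    case True
    show ?thesis
      by (rule integral_cong_AE[OF True borel_measurable_integrable[OF Fi]]) (use ae in \<open>eventually_elim, simp\<close>)
  next
    \<comment> \<open>This case is contradictory: the integrand agrees almost everywhere with the
      measurable \<open>F\<close>, and Lebesgue measure is complete.\<close>
    case False
    have "(\<lambda>t. if t \<in> {-pi..pi} then F t else 0) \<in> borel_measurable lebesgue"
      using borel_measurable_integrable[OF Fi] by (subst borel_measurable_if) auto
    moreover have "AE t in lebesgue. (if t \<in> {-pi..pi} then F t else 0)
      = (if t \<in> {-pi..pi} then (W_norm L \<theta> (rep_per_L2 w t))\<^sup>2 + (norm (rep_per_L2 (time_deriv w) t))\<^sup>2 else 0)"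
      using ae by (subst (asm) AE_restrict_space_iff) (auto elim!: eventually_mono)
    ultimately have "(\<lambda>t. if t \<in> {-pi..pi} then (W_norm L \<theta> (rep_per_L2 w t))\<^sup>2 + (norm (rep_per_L2 (time_deriv w) t))\<^sup>2 else 0) \<in> borel_measurable lebesgue"
      by (rule borel_measurable_AE)
    then have "(\<lambda>t. (W_norm L \<theta> (rep_per_L2 w t))\<^sup>2 + (norm (rep_per_L2 (time_deriv w) t))\<^sup>2) \<in> borel_measurable circle_measure"
      by (subst (asm) borel_measurable_if) auto
    with False show ?thesis by blast
  qed
  also have "\<dots> = (norm (lft w + Re \<theta> *\<^sub>R w))\<^sup>2 + (norm (Im \<theta> *\<^sub>R w))\<^sup>2 + (norm (time_deriv w))\<^sup>2"
    unfolding F_def norm_per_L2_rep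
    by (subst Bochner_Integration.integral_add; (intro Bochner_Integration.integrable_add i)?)
       (subst Bochner_Integration.integral_add; (intro i)?; simp)
  finally show "(W_per0_norm L \<theta> w)\<^sup>2
    = (norm (lft w + Re \<theta> *\<^sub>R w))\<^sup>2 + (norm (Im \<theta> *\<^sub>R w))\<^sup>2 + (norm (time_deriv w))\<^sup>2"
    unfolding W_per0_norm_def by (simp add: real_sqrt_pow2)
  show "W_per0_norm L \<theta> w \<ge> 0" unfolding W_per0_norm_def by (intro real_sqrt_ge_zero Bochner_Integration.integral_nonneg) simp
qed

lemma W_norm_upper:
  assumes "w \<in> W"
  shows "W_per0_norm L \<theta> w \<le> norm (lft w) + (\<bar>Re \<theta>\<bar> + \<bar>Im \<theta>\<bar>) * norm w + norm (time_deriv w)"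
proof (rule power2_le_imp_le)
  have sq: "a\<^sup>2 + b\<^sup>2 + c\<^sup>2 \<le> (a + b + c)\<^sup>2" if "a \<ge> 0" "b \<ge> 0" "c \<ge> 0" for a b c :: real
    using that by (simp add: power2_eq_square algebra_simps)
  have "(W_per0_norm L \<theta> w)\<^sup>2 \<le> (norm (lft w + Re \<theta> *\<^sub>R w) + norm (Im \<theta> *\<^sub>R w) + norm (time_deriv w))\<^sup>2"
    unfolding W_norm_sq[OF assms] by (rule sq) auto
  also have "\<dots> \<le> (norm (lft w) + (\<bar>Re \<theta>\<bar> + \<bar>Im \<theta>\<bar>) * norm w + norm (time_deriv w))\<^sup>2"
    using norm_triangle_ineq[of "lft w" "Re \<theta> *\<^sub>R w"] by (intro power_mono) (auto simp: algebra_simps)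
  finally show "(W_per0_norm L \<theta> w)\<^sup>2 \<le> (norm (lft w) + (\<bar>Re \<theta>\<bar> + \<bar>Im \<theta>\<bar>) * norm w + norm (time_deriv w))\<^sup>2" .
qed simp

text \<open>The resolvent estimate holds at almost every time and is integrated. The factor
  \<open>1 + \<bar>Re \<theta>\<bar>\<close> pays for passing from
  \<open>lft w + Re \<theta> *\<^sub>R w\<close> to \<open>lft w\<close>.\<close>

lemma W_norm_lower:
  assumes \<theta>: "- \<theta> \<in> resolvent_set D L"
  obtains K where "K > 0" "\<And>w. w \<in> W \<Longrightarrow> norm w \<le> K * W_per0_norm L \<theta> w"
    "\<And>w. w \<in> W \<Longrightarrow> norm (lft w) \<le> K * W_per0_norm L \<theta> w"
    "\<And>w. w \<in> W \<Longrightarrow> norm (time_deriv w) \<le> K * W_per0_norm L \<theta> w"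
proof -
  obtain K0 where K0: "\<And>u. u \<in> D \<times> D \<Longrightarrow> norm u \<le> K0 * norm (cshifted L (- \<theta>) u)"
    using \<theta> by (auto simp: resolvent_set_def)
  define K where "K = \<bar>K0\<bar> + 1"
  have K: "K \<ge> 1" by (simp add: K_def)
  have i: "integrable circle_measure (\<lambda>t. (norm (rep_per_L2 v t))\<^sup>2)" for v :: "'h per_L2"
    using per_sq_rep[of v] by (simp add: per_sq_integrable_def)
  have w: "norm w \<le> K * W_per0_norm L \<theta> w" if "w \<in> W" for w
  proof (rule power2_le_imp_le)
    have ae: "AE t in circle_measure. (norm (rep_per_L2 w t))\<^sup>2 \<le> K\<^sup>2 * ((norm (rep_per_L2 (lft w + Re \<theta> *\<^sub>R w) t))\<^sup>2 + (norm (rep_per_L2 (Im \<theta> *\<^sub>R w) t))\<^sup>2)"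
      using W_D(1)[OF that, unfolded acts_iff] rep_add[of "lft w" "Re \<theta> *\<^sub>R w"] rep_scaleR[of "Re \<theta>" w] rep_scaleR[of "Im \<theta>" w]
    proof eventually_elim
      case (elim t)
      have "norm (rep_per_L2 w t) \<le> K0 * norm (cshifted L (- \<theta>) (rep_per_L2 w t, 0))"
        using K0[of "(rep_per_L2 w t, 0)"] elim(1) subspace_0[OF subspace_D] by (simp add: graph_iff norm_Pair)
      also have "\<dots> \<le> K * norm (cshifted L (- \<theta>) (rep_per_L2 w t, 0))"
        by (rule mult_right_mono) (auto simp: K_def)
      finally have "(norm (rep_per_L2 w t))\<^sup>2 \<le> (K * norm (cshifted L (- \<theta>) (rep_per_L2 w t, 0)))\<^sup>2"
        by (rule power_mono) simp
      then show ?case using elim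
        by (simp add: cshifted_def cscale_def graph_iff L_0 norm_Pair power_mult_distrib)
    qed
    have "(norm w)\<^sup>2 \<le> K\<^sup>2 * ((norm (lft w + Re \<theta> *\<^sub>R w))\<^sup>2 + (norm (Im \<theta> *\<^sub>R w))\<^sup>2)"
      unfolding norm_per_L2_rep
      using integral_mono_AE[OF i _ ae] by (simp add: i)
    also have "\<dots> \<le> K\<^sup>2 * (W_per0_norm L \<theta> w)\<^sup>2"
      unfolding W_norm_sq[OF that] by (intro mult_left_mono) auto
    finally show "(norm w)\<^sup>2 \<le> (K * W_per0_norm L \<theta> w)\<^sup>2" by (simp add: power_mult_distrib)
    show "0 \<le> K * W_per0_norm L \<theta> w" using K W_norm_sq(2)[OF that] by simp
  qed
  have a: "norm (lft w + Re \<theta> *\<^sub>R w) \<le> W_per0_norm L \<theta> w" and t: "norm (time_deriv w) \<le> W_per0_norm L \<theta> w" if "w \<in> W" for w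
    by (rule power2_le_imp_le[OF _ W_norm_sq(2)[OF that]], simp add: W_norm_sq(1)[OF that])+
  show ?thesis
  proof (rule that[of "K * (1 + \<bar>Re \<theta>\<bar>)"])
    show "K * (1 + \<bar>Re \<theta>\<bar>) > 0" using K by (intro mult_pos_pos) auto
    fix w assume wW: "w \<in> W"
    note n0 = W_norm_sq(2)[OF wW, of \<theta>]
    have "K * W_per0_norm L \<theta> w \<le> K * (1 + \<bar>Re \<theta>\<bar>) * W_per0_norm L \<theta> w"
      using n0 K by (intro mult_right_mono) auto
    then show "norm w \<le> K * (1 + \<bar>Re \<theta>\<bar>) * W_per0_norm L \<theta> w" using w[OF wW] by simp
    have k1: "W_per0_norm L \<theta> w \<le> K * W_per0_norm L \<theta> w" using n0 K by (simp add: mult_le_cancel_right1)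
    have "norm (lft w) \<le> norm (lft w + Re \<theta> *\<^sub>R w) + \<bar>Re \<theta>\<bar> * norm w"
      using norm_triangle_ineq4[of "lft w + Re \<theta> *\<^sub>R w" "Re \<theta> *\<^sub>R w"] by simp
    also have "\<dots> \<le> K * W_per0_norm L \<theta> w + \<bar>Re \<theta>\<bar> * (K * W_per0_norm L \<theta> w)"
      using a[OF wW] k1 w[OF wW] by (intro add_mono mult_left_mono) auto
    finally show "norm (lft w) \<le> K * (1 + \<bar>Re \<theta>\<bar>) * W_per0_norm L \<theta> w" by (simp add: algebra_simps)
    show "norm (time_deriv w) \<le> K * (1 + \<bar>Re \<theta>\<bar>) * W_per0_norm L \<theta> w"
      using t[OF wW] k1 \<open>K * W_per0_norm L \<theta> w \<le> K * (1 + \<bar>Re \<theta>\<bar>) * W_per0_norm L \<theta> w\<close> by linarith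
  qed
qed

end

section \<open>The linearization\<close>

lemma tens_eqI:
  assumes "AE t in circle_measure. rep_per_L2 w t = \<phi> t *\<^sub>R h" "periodic_continuous \<phi>"
  shows "w = tens \<phi> h"
  by (rule per_L2_eqI) (use assms(1) rep_tens[OF assms(2), of h] in \<open>eventually_elim, simp\<close>)

lemma tens_add: "periodic_continuous \<phi> \<Longrightarrow> tens \<phi> (x + y) = tens \<phi> x + tens \<phi> y"
proof (rule sym, rule tens_eqI)
  assume \<phi>: "periodic_continuous \<phi>"
  show "AE t in circle_measure. rep_per_L2 (tens \<phi> x + tens \<phi> y) t = \<phi> t *\<^sub>R (x + y)"
    using rep_add[of "tens \<phi> x" "tens \<phi> y"] rep_tens[OF \<phi>, of x] rep_tens[OF \<phi>, of y]
    by eventually_elim (simp add: scaleR_add_right)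
qed

lemma tens_scaleR: "periodic_continuous \<phi> \<Longrightarrow> tens \<phi> (c *\<^sub>R x) = c *\<^sub>R tens \<phi> x"
proof (rule sym, rule tens_eqI)
  assume \<phi>: "periodic_continuous \<phi>"
  show "AE t in circle_measure. rep_per_L2 (c *\<^sub>R tens \<phi> x) t = \<phi> t *\<^sub>R (c *\<^sub>R x)"
    using rep_scaleR[of c "tens \<phi> x"] rep_tens[OF \<phi>, of x]
    by eventually_elim simp
qed

lemma periodic_continuous_comb:
  "periodic_continuous \<phi> \<Longrightarrow> periodic_continuous \<psi> \<Longrightarrow> periodic_continuous (\<lambda>t. c * \<phi> t + d * \<psi> t)"
  by (auto simp: periodic_continuous_def intro!: continuous_intros)

lemma tens_comb:
  assumes "periodic_continuous \<phi>" "periodic_continuous \<psi>"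
  shows "tens (\<lambda>t. c * \<phi> t + d * \<psi> t) x = c *\<^sub>R tens \<phi> x + d *\<^sub>R tens \<psi> x"
proof (rule sym, rule tens_eqI[OF _ periodic_continuous_comb[OF assms]])
  show "AE t in circle_measure. rep_per_L2 (c *\<^sub>R tens \<phi> x + d *\<^sub>R tens \<psi> x) t = (c * \<phi> t + d * \<psi> t) *\<^sub>R x"
    using rep_add[of "c *\<^sub>R tens \<phi> x" "d *\<^sub>R tens \<psi> x"] rep_scaleR[of c "tens \<phi> x"] rep_scaleR[of d "tens \<psi> x"]
      rep_tens[OF assms(1), of x] rep_tens[OF assms(2), of x]
    by eventually_elim (simp add: scaleR_add_left)
qed

lemma abs_per_L2_tens:
  assumes "periodic_continuous \<phi>" "periodic_continuous \<psi>"
  shows "abs_per_L2 (\<lambda>t. \<phi> t *\<^sub>R x + \<psi> t *\<^sub>R y) = tens \<phi> x + tens \<psi> y"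
proof (rule per_L2_eqI)
  have "per_sq_integrable (\<lambda>t. \<phi> t *\<^sub>R x + \<psi> t *\<^sub>R y)"
    by (intro per_sq_integrable_add per_sq_tens assms)
  from rep_abs_per_L2[OF this] rep_add[of "tens \<phi> x" "tens \<psi> y"] rep_tens[OF assms(1), of x] rep_tens[OF assms(2), of y]
  show "AE t in circle_measure. rep_per_L2 (abs_per_L2 (\<lambda>t. \<phi> t *\<^sub>R x + \<psi> t *\<^sub>R y)) t = rep_per_L2 (tens \<phi> x + tens \<psi> y) t"
    by eventually_elim simp
qed

lemma inner_tens_tens:
  assumes "periodic_continuous \<phi>" "periodic_continuous \<psi>"
  shows "tens \<phi> x \<bullet> tens \<psi> y = (LINT t|circle_measure. \<phi> t * \<psi> t) * (x \<bullet> y)"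
proof -
  have "tens \<phi> x \<bullet> tens \<psi> y = (LINT t|circle_measure. (\<phi> t * \<psi> t) * (x \<bullet> y))"
    unfolding inner_per_L2_AE[OF per_sq_tens[OF assms(1)] rep_tens[OF assms(1)] per_sq_tens[OF assms(2)] rep_tens[OF assms(2)]]
    by (rule Bochner_Integration.integral_cong) (auto simp: mult_ac)
  then show ?thesis by simp
qed

lemma LINT_eq_FTC:
  fixes f F :: "real \<Rightarrow> real"
  assumes "continuous_on {-pi..pi} f" "\<And>t. (F has_real_derivative f t) (at t)"
  shows "(LINT t|circle_measure. f t) = F pi - F (- pi)"
proof -
  have "(f has_integral F pi - F (- pi)) {-pi..pi}"
    by (rule fundamental_theorem_of_calculus)
       (use assms(2) in \<open>auto simp: has_real_derivative_iff_has_vector_derivative[symmetric] intro: has_field_derivative_at_within\<close>)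
  moreover have "(f has_integral (LINT t|circle_measure. f t)) {-pi..pi}"
    by (rule has_integral_integral_lebesgue_on[OF continuous_imp_integrable_real[OF assms(1)]]) simp
  ultimately show ?thesis by (rule has_integral_unique[symmetric])
qed

lemma trig_integrals:
  "(LINT t|circle_measure. cos t * cos t) = pi" "(LINT t|circle_measure. sin t * sin t) = pi"
  "(LINT t|circle_measure. cos t * sin t) = 0" "(LINT t|circle_measure. sin t * cos t) = 0"
  "(LINT t|circle_measure. cos t) = 0" "(LINT t|circle_measure. sin t) = 0"
  "(LINT t|circle_measure. (1::real)) = 2 * pi"
proof -
  have cc: "((\<lambda>t. (t + sin t * cos t) / 2) has_real_derivative cos t * cos t) (at t)" for t
  proof -
    have "((\<lambda>t. (t + sin t * cos t) / 2) has_real_derivative (1 + (cos t * cos t - sin t * sin t)) / 2) (at t)"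
      by (auto intro!: derivative_eq_intros)
    moreover have "(1 + (cos t * cos t - sin t * sin t)) / 2 = cos t * cos t"
      using sin_cos_squared_add[of t] by (simp add: power2_eq_square)
    ultimately show ?thesis by simp
  qed
  have ss: "((\<lambda>t. (t - sin t * cos t) / 2) has_real_derivative sin t * sin t) (at t)" for t
  proof -
    have "((\<lambda>t. (t - sin t * cos t) / 2) has_real_derivative (1 - (cos t * cos t - sin t * sin t)) / 2) (at t)"
      by (auto intro!: derivative_eq_intros)
    moreover have "(1 - (cos t * cos t - sin t * sin t)) / 2 = sin t * sin t"
      using sin_cos_squared_add[of t] by (simp add: power2_eq_square)
    ultimately show ?thesis by simp
  qed
  have cs: "((\<lambda>t. sin t * sin t / 2) has_real_derivative cos t * sin t) (at t)" for t :: real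
    by (auto intro!: derivative_eq_intros)
  have sc: "((\<lambda>t. sin t * sin t / 2) has_real_derivative sin t * cos t) (at t)" for t :: real
    by (auto intro!: derivative_eq_intros)
  have s: "((\<lambda>t. - cos t) has_real_derivative sin t) (at t)" for t :: real
    by (auto intro!: derivative_eq_intros)
  show "(LINT t|circle_measure. cos t * cos t) = pi"
    by (subst LINT_eq_FTC[OF _ cc]) (auto intro!: continuous_intros)
  show "(LINT t|circle_measure. sin t * sin t) = pi"
    by (subst LINT_eq_FTC[OF _ ss]) (auto intro!: continuous_intros)
  show "(LINT t|circle_measure. cos t * sin t) = 0"
    by (subst LINT_eq_FTC[OF _ cs]) (auto intro!: continuous_intros)
  show "(LINT t|circle_measure. sin t * cos t) = 0"
    by (subst LINT_eq_FTC[OF _ sc]) (auto intro!: continuous_intros)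
  show "(LINT t|circle_measure. cos t) = 0"
    by (subst LINT_eq_FTC[OF _ DERIV_sin]) (auto intro!: continuous_intros)
  show "(LINT t|circle_measure. sin t) = 0"
    by (subst LINT_eq_FTC[OF _ s]) (auto intro!: continuous_intros)
  show "(LINT t|circle_measure. (1::real)) = 2 * pi"
    by (subst LINT_eq_FTC[OF _ DERIV_ident]) auto
qed

lemma has_weak_deriv_tens:
  fixes h :: "'h::{real_inner, complete_space}"
  assumes \<phi>: "smooth_periodic \<phi>" shows "has_weak_deriv (tens \<phi> h) (tens (deriv \<phi>) h)"
  unfolding has_weak_deriv_iff
proof (intro allI impI)
  fix \<psi> and k :: 'h assume \<psi>: "smooth_periodic \<psi>"
  note c = smooth_periodic_continuous[OF \<phi>] smooth_periodic_continuous[OF \<psi>]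
  have d: "(\<xi> has_real_derivative deriv \<xi> t) (at t)" if "smooth_periodic \<xi>" for \<xi> t
  proof -
    have "(deriv ^^ 0) \<xi> field_differentiable at t" using that unfolding smooth_periodic_def by blast
    then show ?thesis by (simp add: DERIV_deriv_iff_field_differentiable)
  qed
  have p: "\<phi> pi = \<phi> (- pi)" "\<psi> pi = \<psi> (- pi)"
    using \<phi> \<psi> unfolding smooth_periodic_def by (metis add.commute minus_add_cancel mult_2)+
  have i: "integrable circle_measure (\<lambda>t. \<phi> t * deriv \<psi> t)" "integrable circle_measure (\<lambda>t. deriv \<phi> t * \<psi> t)"
    by (intro continuous_imp_integrable_real continuous_intros c[THEN periodic_continuous_on])+
  have "(LINT t|circle_measure. \<phi> t * deriv \<psi> t + deriv \<phi> t * \<psi> t) = \<phi> pi * \<psi> pi - \<phi> (- pi) * \<psi> (- pi)"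
    by (rule LINT_eq_FTC[where F="\<lambda>t. \<phi> t * \<psi> t"])
       (auto intro!: continuous_intros c[THEN periodic_continuous_on] derivative_eq_intros d \<phi> \<psi>)
  then have "(LINT t|circle_measure. \<phi> t * deriv \<psi> t) = - (LINT t|circle_measure. deriv \<phi> t * \<psi> t)"
    using i p by simp
  then show "tens \<phi> h \<bullet> tens (deriv \<psi>) k = - (tens (deriv \<phi>) h \<bullet> tens \<psi> k)"
    by (simp add: inner_tens_tens c)
qed

lemma weak_deriv_trig:
  fixes w d :: "'h::{real_inner, complete_space} per_L2"
  assumes "has_weak_deriv w d"
  shows "d \<bullet> tens (\<lambda>t. cos (real k * t)) h = real k * (w \<bullet> tens (\<lambda>t. sin (real k * t)) h)"
    "d \<bullet> tens (\<lambda>t. sin (real k * t)) h = - real k * (w \<bullet> tens (\<lambda>t. cos (real k * t)) h)"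
  using has_weak_derivD[OF assms smooth_periodic_trig(1)[of 1 k 0], of h] has_weak_derivD[OF assms smooth_periodic_trig(1)[of 0 k 1], of h]
  unfolding smooth_periodic_trig(2) tens_comb[OF periodic_continuous_cos periodic_continuous_sin]
  by (simp_all add: inner_add_right)

lemma periodic_continuous_trig: "periodic_continuous cos" "periodic_continuous sin" "periodic_continuous (\<lambda>_. c)"
  using periodic_continuous_cos[of 1] periodic_continuous_sin[of 1] by (simp_all add: periodic_continuous_def)

lemma smooth_cos: "smooth_periodic cos" "deriv cos = (\<lambda>t::real. - sin t)"
  and smooth_sin: "smooth_periodic sin" "deriv sin = (cos :: real \<Rightarrow> real)"
  using smooth_periodic_trig[of 1 1 0] smooth_periodic_trig[of 0 1 1] by simp_all

lemma tens_uminus_sin: "tens (\<lambda>t. - sin t) h = - tens sin h"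
  using tens_comb[OF periodic_continuous_trig(2,2), of "-1" 0 h] by simp

text \<open>The pairs \<open>(a, b)\<close> and \<open>(as, bs)\<close> are the eigenvector \<open>a + \<i> b\<close> of \<open>L\<close> and the eigenvector \<open>as + \<i> bs\<close> of its adjoint.\<close>

locale hopf = closed_operator D L for D :: "'h::{real_inner, complete_space} set" and L +
  fixes a b as bs :: 'h and \<omega> :: real and nrm :: "'h per_L2 \<Rightarrow> real"
  assumes \<omega>: "\<omega> > 0"
    and eig: "a \<in> D" "b \<in> D" "L a = - \<omega> *\<^sub>R b" "L b = \<omega> *\<^sub>R a"
    and adj: "\<And>x. x \<in> D \<Longrightarrow> L x \<bullet> as = x \<bullet> (- \<omega> *\<^sub>R bs)" "\<And>x. x \<in> D \<Longrightarrow> L x \<bullet> bs = x \<bullet> (\<omega> *\<^sub>R as)"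
    and normalized: "a \<bullet> as - b \<bullet> bs = 1 / pi" "a \<bullet> bs + b \<bullet> as = 0"
    and simple: "\<And>x y. x \<in> D \<Longrightarrow> y \<in> D \<Longrightarrow> L x = - \<omega> *\<^sub>R y \<Longrightarrow> L y = \<omega> *\<^sub>R x \<Longrightarrow>
        \<exists>c d. x = c *\<^sub>R a - d *\<^sub>R b \<and> y = c *\<^sub>R b + d *\<^sub>R a"
    and nonres: "\<And>(k::nat) x y. k \<ge> 2 \<Longrightarrow> x \<in> D \<Longrightarrow> y \<in> D \<Longrightarrow> L x = - (\<omega> * real k) *\<^sub>R y \<Longrightarrow>
        L y = (\<omega> * real k) *\<^sub>R x \<Longrightarrow> x = 0 \<and> y = 0"
    and fredholm: "fredholm_of_index (W_per0 D L) nrm H_per0 (\<lambda>w. \<omega> *\<^sub>R time_deriv w + lift_op D L w) 0"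
begin

text \<open>These four are the real and imaginary parts of
  \<open>(a + \<i> b) exp (- \<i> t)\<close> and of
  \<open>(as + \<i> bs) exp (\<i> t)\<close>.\<close>

definition "v1 = tens cos a + tens sin b"
definition "v2 = tens cos b - tens sin a"
definition "v1s = tens cos as - tens sin bs"
definition "v2s = tens cos bs + tens sin as"
definition "Q w = \<omega> *\<^sub>R time_deriv w + lft w"

lemmas pc = periodic_continuous_trig

lemma biorthogonal: "v1 \<bullet> v1s = 1" "v1 \<bullet> v2s = 0" "v2 \<bullet> v1s = 0" "v2 \<bullet> v2s = -1"
proof -
  have "a \<bullet> as * pi - b \<bullet> bs * pi = 1" using normalized(1) by (simp add: field_simps)
  moreover have "a \<bullet> bs * pi + b \<bullet> as * pi = 0" using normalized(2) by (simp flip: distrib_right)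
  ultimately show "v1 \<bullet> v1s = 1" "v1 \<bullet> v2s = 0" "v2 \<bullet> v1s = 0" "v2 \<bullet> v2s = -1"
    by (simp_all add: v1_def v2_def v1s_def v2s_def inner_add_left inner_add_right inner_diff_left inner_diff_right
        inner_tens_tens pc trig_integrals mult.commute)
qed

lemma deriv_v1: "has_weak_deriv v1 v2" and deriv_v2: "has_weak_deriv v2 (- v1)"
proof -
  have c: "has_weak_deriv (tens cos h) (- tens sin h)" and s: "has_weak_deriv (tens sin h) (tens cos h)" for h :: 'h
    using has_weak_deriv_tens[OF smooth_cos(1), of h] has_weak_deriv_tens[OF smooth_sin(1), of h]
    by (simp_all add: smooth_cos(2) smooth_sin(2) tens_uminus_sin)
  show "has_weak_deriv v1 v2"
    using has_weak_deriv_add[OF c[of a] s[of b]] by (simp add: v1_def v2_def)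
  show "has_weak_deriv v2 (- v1)"
    using has_weak_deriv_add[OF c[of b] has_weak_deriv_scaleR[OF s[of a], of "-1"]]
    by (simp add: v1_def v2_def algebra_simps)
qed

lemma acts_v1: "acts v1 (- \<omega> *\<^sub>R v2)" and acts_v2: "acts v2 (\<omega> *\<^sub>R v1)"
proof -
  have "acts v1 (tens cos (L a) + tens sin (L b))"
    unfolding v1_def by (intro acts_add acts_tens pc eig)
  then show "acts v1 (- \<omega> *\<^sub>R v2)"
    unfolding eig(3,4) tens_scaleR[OF pc(1)] tens_scaleR[OF pc(2)] by (simp add: v2_def scaleR_diff_right)
  have "acts v2 (tens cos (L b) + (-1) *\<^sub>R tens sin (L a))"
    using acts_add[OF acts_tens[OF pc(1) eig(2)] acts_scaleR[OF acts_tens[OF pc(2) eig(1)], of "-1"]] by (simp add: v2_def)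
  then show "acts v2 (\<omega> *\<^sub>R v1)"
    unfolding eig(3,4) tens_scaleR[OF pc(1)] tens_scaleR[OF pc(2)] by (simp add: v1_def scaleR_add_right)
qed

lemma v1_W: "v1 \<in> W" and v2_W: "v2 \<in> W"
proof -
  have m2: "mean_value v2 = 0" by (rule mean_value_weak_deriv[OF deriv_v1])
  have "has_weak_deriv ((-1) *\<^sub>R v2) ((-1) *\<^sub>R (- v1))" by (rule has_weak_deriv_scaleR[OF deriv_v2])
  then have m1: "mean_value v1 = 0" by (intro mean_value_weak_deriv) simp
  show "v1 \<in> W" by (rule W_I[OF acts_v1 deriv_v1 m1])
  show "v2 \<in> W" by (rule W_I[OF acts_v2 deriv_v2 m2])
qed

lemma Q_v1: "Q v1 = 0" and Q_v2: "Q v2 = 0"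
  by (simp_all add: Q_def time_deriv_eq[OF deriv_v1] time_deriv_eq[OF deriv_v2] lift_op_eq[OF acts_v1] lift_op_eq[OF acts_v2])

lemma Q_add: "w \<in> W \<Longrightarrow> u \<in> W \<Longrightarrow> Q (w + u) = Q w + Q u"
  and Q_scaleR: "w \<in> W \<Longrightarrow> Q (c *\<^sub>R w) = c *\<^sub>R Q w"
  by (simp_all add: Q_def W_add W_scaleR algebra_simps)

lemma deriv_pairing:
  assumes "has_weak_deriv w d"
  shows "d \<bullet> v1s = w \<bullet> v2s" "d \<bullet> v2s = - (w \<bullet> v1s)"
  using weak_deriv_trig[OF assms, of 1]
  by (simp_all add: v1s_def v2s_def inner_add_right inner_diff_right)

lemma lift_pairing:
  assumes "acts w g"
  shows "g \<bullet> v1s = - \<omega> * (w \<bullet> v2s)" "g \<bullet> v2s = \<omega> * (w \<bullet> v1s)"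
proof -
  have t: "tens \<phi> (- \<omega> *\<^sub>R bs) = - \<omega> *\<^sub>R tens \<phi> bs" "tens \<phi> (\<omega> *\<^sub>R as) = \<omega> *\<^sub>R tens \<phi> as" if "periodic_continuous \<phi>" for \<phi>
    by (rule tens_scaleR[OF that])+
  have "g \<bullet> tens \<phi> as = - \<omega> * (w \<bullet> tens \<phi> bs)" "g \<bullet> tens \<phi> bs = \<omega> * (w \<bullet> tens \<phi> as)"
    if "periodic_continuous \<phi>" for \<phi>
    using acts_inner_tens[OF assms adj(1) that] acts_inner_tens[OF assms adj(2) that] unfolding t[OF that]
    by simp_all
  then show "g \<bullet> v1s = - \<omega> * (w \<bullet> v2s)" "g \<bullet> v2s = \<omega> * (w \<bullet> v1s)"
    by (simp_all add: v1s_def v2s_def inner_add_right inner_diff_right pc algebra_simps)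
qed

text \<open>Differentiation contributes \<omega> times the other pairing and the operator
  contributes the negative of it: the formal adjoint of \<open>Q\<close> annihilates
  \<open>v1s\<close> and \<open>v2s\<close>.\<close>

lemma Q_pairing: "w \<in> W \<Longrightarrow> Q w \<bullet> v1s = 0" "w \<in> W \<Longrightarrow> Q w \<bullet> v2s = 0"
  using deriv_pairing[OF W_D(2)] lift_pairing[OF W_D(1)] by (simp_all add: Q_def inner_add_left)

text \<open>A time shift rotates the pair of pairings. A suitable angle annihilates the second one,
  and the angle \<open>pi\<close> reverses the sign of the first.\<close>

lemma shift_pairing:
  "time_shift s w \<bullet> v1s = cos s * (w \<bullet> v1s) + sin s * (w \<bullet> v2s)"
  "time_shift s w \<bullet> v2s = cos s * (w \<bullet> v2s) - sin s * (w \<bullet> v1s)"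
proof -
  have tc: "tens (\<lambda>t. cos (t - s)) h = cos s *\<^sub>R tens cos h + sin s *\<^sub>R tens sin h"
    and ts: "tens (\<lambda>t. sin (t - s)) h = cos s *\<^sub>R tens sin h - sin s *\<^sub>R tens cos h" for h :: 'h
    using tens_comb[OF pc(1,2), of "cos s" "sin s" h] tens_comb[OF pc(2,1), of "cos s" "- sin s" h]
    by (simp_all add: cos_diff sin_diff mult.commute)
  have "w \<bullet> time_shift (- s) (tens cos h) = cos s * (w \<bullet> tens cos h) + sin s * (w \<bullet> tens sin h)"
    "w \<bullet> time_shift (- s) (tens sin h) = cos s * (w \<bullet> tens sin h) - sin s * (w \<bullet> tens cos h)" for h
    by (simp_all add: time_shift_tens pc tc ts inner_add_right inner_diff_right)
  moreover have "time_shift s w \<bullet> tens \<phi> h = w \<bullet> time_shift (- s) (tens \<phi> h)" for \<phi> h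
    by (rule inner_time_shift_left)
  ultimately show "time_shift s w \<bullet> v1s = cos s * (w \<bullet> v1s) + sin s * (w \<bullet> v2s)"
    "time_shift s w \<bullet> v2s = cos s * (w \<bullet> v2s) - sin s * (w \<bullet> v1s)"
    by (simp_all add: v1s_def v2s_def inner_add_right inner_diff_right algebra_simps)
qed

lemma kernel:
  assumes w: "w \<in> W" and Q0: "Q w = 0"
  shows "\<exists>c d. w = c *\<^sub>R v1 + d *\<^sub>R v2"
proof -
  define C where "C u k = integral {-pi..pi} (\<lambda>t. cos (real k * t) *\<^sub>R rep_per_L2 u t)" for u :: "'h per_L2" and k :: nat
  define S where "S u k = integral {-pi..pi} (\<lambda>t. sin (real k * t) *\<^sub>R rep_per_L2 u t)" for u :: "'h per_L2" and k :: nat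
  have Ci: "C u k \<bullet> h = u \<bullet> tens (\<lambda>t. cos (real k * t)) h" and Si: "S u k \<bullet> h = u \<bullet> tens (\<lambda>t. sin (real k * t)) h" for u k h
    unfolding C_def S_def by (rule integral_rep_inner[OF periodic_continuous_cos], rule integral_rep_inner[OF periodic_continuous_sin])
  \<comment> \<open>\<open>C u k + \<i> S u k\<close> solves the eigenvalue equation for
    \<open>\<i> k \<omega>\<close>: closedness takes \<open>L\<close> under the integral, and
    differentiation exchanges the two coefficients up to sign and the factor
    \<open>k\<close>.\<close>
  have CS: "C u k \<in> D" "S u k \<in> D" "L (C u k) = - (\<omega> * real k) *\<^sub>R S u k" "L (S u k) = (\<omega> * real k) *\<^sub>R C u k"
    if u: "u \<in> W" "Q u = 0" for u k
  proof -
    have g: "lft u = - \<omega> *\<^sub>R time_deriv u" using u(2) by (simp add: Q_def eq_neg_iff_add_eq_0 add.commute)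
    note ac = acts_integral[OF W_D(1)[OF u(1)] periodic_continuous_cos[of k]]
    note as = acts_integral[OF W_D(1)[OF u(1)] periodic_continuous_sin[of k]]
    note wd = weak_deriv_trig[OF W_D(2)[OF u(1)], of k]
    show "C u k \<in> D" "S u k \<in> D" unfolding C_def S_def by (rule ac, rule as)
    have "L (C u k) = C (lft u) k" "L (S u k) = S (lft u) k" unfolding C_def S_def by (rule ac, rule as)
    moreover have "C (lft u) k = - (\<omega> * real k) *\<^sub>R S u k"
      by (rule vector_eqI_inner) (simp add: Ci Si g wd)
    moreover have "S (lft u) k = (\<omega> * real k) *\<^sub>R C u k"
      by (rule vector_eqI_inner) (simp add: Ci Si g wd)
    ultimately show "L (C u k) = - (\<omega> * real k) *\<^sub>R S u k" "L (S u k) = (\<omega> * real k) *\<^sub>R C u k" by simp_all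
  qed
  obtain c d where cd: "C w 1 = c *\<^sub>R a - d *\<^sub>R b" "S w 1 = c *\<^sub>R b + d *\<^sub>R a"
    using simple[OF CS(1,2)[OF w Q0, of 1]] CS(3,4)[OF w Q0, of 1] by auto
  \<comment> \<open>The factor \<open>1 / pi\<close> inverts the integral of the squared cosine; the
    minus sign at \<open>d\<close> comes from the term \<open>- tens sin a\<close> in
    \<open>v2\<close>.\<close>
  define u where "u = w - ((c / pi) *\<^sub>R v1 + (- d / pi) *\<^sub>R v2)"
  have vv: "(c / pi) *\<^sub>R v1 + (- d / pi) *\<^sub>R v2 \<in> W"
    by (intro subspace_add[OF subspace_W] subspace_scale[OF subspace_W] v1_W v2_W)
  have uW: "u \<in> W" unfolding u_def by (rule subspace_diff[OF subspace_W w vv])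
  have "Q u = Q (w + (-1) *\<^sub>R ((c / pi) *\<^sub>R v1 + (- d / pi) *\<^sub>R v2))"
    by (simp only: u_def scaleR_minus_left scaleR_one diff_conv_add_uminus)
  also have "\<dots> = Q w + (-1) *\<^sub>R ((c / pi) *\<^sub>R Q v1 + (- d / pi) *\<^sub>R Q v2)"
    by (simp only: Q_add Q_scaleR w vv v1_W v2_W subspace_scale[OF subspace_W])
  finally have Qu: "Q u = 0" by (simp add: Q0 Q_v1 Q_v2)
  have "C u 0 = 0"
    by (rule vector_eqI_inner) (use W_D(3)[OF uW] in \<open>simp add: Ci mean_value_zero_iff\<close>)
  moreover have "S u 0 = 0" by (simp add: S_def)
  moreover have "C u 1 = 0 \<and> S u 1 = 0"
  proof
    have "C u 1 = C w 1 - (c *\<^sub>R a - d *\<^sub>R b)" "S u 1 = S w 1 - (c *\<^sub>R b + d *\<^sub>R a)"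
      by (rule vector_eqI_inner, simp add: Ci Si u_def v1_def v2_def inner_add_left inner_diff_left inner_tens_tens pc trig_integrals)+
    then show "C u 1 = 0" "S u 1 = 0" using cd by simp_all
  qed
  moreover have "C u k = 0 \<and> S u k = 0" if "k \<ge> 2" for k
    by (rule nonres[OF that CS[OF uW Qu]])
  ultimately have "C u k = 0 \<and> S u k = 0" for k
    using not_less_eq_eq[of 2] by (cases k; cases "k - 1") auto
  then have "u = 0" by (intro fourier_uniqueness) (metis Ci Si inner_zero_left)+
  then show ?thesis unfolding u_def by (metis eq_iff_diff_eq_0)
qed

section \<open>Solvability conditions, projection onto the range and bounded inverse\<close>

definition "G = {f. mean_value f = 0 \<and> f \<bullet> v1s = 0 \<and> f \<bullet> v2s = 0}"
definition "W0 = {w \<in> W. w \<bullet> v1s = 0 \<and> w \<bullet> v2s = 0}"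

lemma range_subset: "w \<in> W \<Longrightarrow> Q w \<in> H_per0"
  using fredholm by (auto simp: fredholm_of_index_def Q_def)

lemma subspace_W0: "subspace W0"
  using subspace_W by (auto simp: W0_def subspace_def inner_add_left)

lemma subspace_G: "subspace G"
  by (rule subspaceI) (simp_all add: G_def mean_value_zero_iff inner_add_left)

lemma closed_G: "closed G"
  unfolding G_def mean_value_zero_iff
  by (intro closed_Collect_conj closed_Collect_all closed_Collect_eq continuous_intros)

lemma v_independent: "v1 \<noteq> v2" "independent {v1, v2}"
proof -
  show "v1 \<noteq> v2" using biorthogonal by auto
  have "v1 \<notin> span {v2}"
  proof
    assume "v1 \<in> span {v2}"
    then obtain k where "v1 = k *\<^sub>R v2" by (auto simp: span_singleton)
    then have "v1 \<bullet> v1s = k * (v2 \<bullet> v1s)" by simp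
    then show False using biorthogonal by simp
  qed
  moreover have "v2 \<noteq> 0" using biorthogonal by auto
  ultimately show "independent {v1, v2}" by (simp add: independent_insert)
qed

text \<open>By index zero a complement of the range is two-dimensional; it therefore contains elements dual to
  \<open>v1s\<close> and \<open>v2s\<close> as a basis, so that an element annihilated by both has no component in it.\<close>

lemma G_subset_range:
  assumes f: "f \<in> G" shows "\<exists>w\<in>W. Q w = f"
proof -
  have Qf: "Q = (\<lambda>w. \<omega> *\<^sub>R time_deriv w + lft w)" by (simp add: Q_def fun_eq_iff)
  obtain A B where A: "finite A" "independent A" "span A = {w \<in> W. Q w = 0}"
    and B: "finite B" "independent B" "{x + y | x y. x \<in> Q ` W \<and> y \<in> span B} = H_per0"
    and card: "(0::int) = int (card A) - int (card B)"
    using fredholm[folded Qf, unfolded fredholm_of_index_def] by (elim exE conjE) (rule that)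
  have "span A = span {v1, v2}"
  proof
    show "span A \<subseteq> span {v1, v2}"
      unfolding A(3) using kernel by (auto simp: span_insert span_singleton span_breakdown_eq) (metis add_diff_cancel_left')
    show "span {v1, v2} \<subseteq> span A"
    proof (rule span_minimal[OF _ subspace_span])
      show "{v1, v2} \<subseteq> span A" unfolding A(3) using v1_W v2_W Q_v1 Q_v2 by simp
    qed
  qed
  then have "card A = card {v1, v2}" using A(2) v_independent(2) by (metis dim_eq_card)
  then have cB: "card B = 2" using card v_independent(1) by simp
  have H: "\<exists>w b. w \<in> W \<and> b \<in> span B \<and> x = Q w + b" if "x \<in> H_per0" for x
    using that unfolding B(3)[symmetric] by blast
  \<comment> \<open>Decomposing \<open>v1\<close> and \<open>v2\<close> themselves gives elements of
    the complement with unchanged pairings, because range elements pair to zero.\<close>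
  have "v1 \<in> H_per0" "v2 \<in> H_per0" using W_D(3)[OF v1_W] W_D(3)[OF v2_W] by (auto simp: H_per0_def)
  with H obtain w1 b1 w2 b2 where 1: "w1 \<in> W" "b1 \<in> span B" "v1 = Q w1 + b1" and 2: "w2 \<in> W" "b2 \<in> span B" "v2 = Q w2 + b2"
    by metis
  have "f \<in> H_per0" using f by (simp add: G_def H_per0_def)
  with H obtain w b where wb: "w \<in> W" "b \<in> span B" "f = Q w + b" by metis
  have p: "b1 \<bullet> v1s = 1" "b1 \<bullet> v2s = 0" "b2 \<bullet> v1s = 0" "b2 \<bullet> v2s = -1"
    using biorthogonal Q_pairing[OF 1(1)] Q_pairing[OF 2(1)] 1(3) 2(3) by (simp_all add: inner_add_left)
  have ind: "independent {b1, b2}" and ne: "b1 \<noteq> b2"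
  proof -
    show "b1 \<noteq> b2" using p by auto
    have "b1 \<notin> span {b2}"
    proof
      assume "b1 \<in> span {b2}"
      then obtain k where "b1 = k *\<^sub>R b2" by (auto simp: span_singleton)
      then have "b1 \<bullet> v1s = k * (b2 \<bullet> v1s)" by simp
      then show False using p by simp
    qed
    moreover have "b2 \<noteq> 0" using p by auto
    ultimately show "independent {b1, b2}" by (simp add: independent_insert)
  qed
  \<comment> \<open>An element of \<open>B\<close> outside this span would give three independent
    vectors in a space spanned by two.\<close>
  have "span B \<subseteq> span {b1, b2}"
  proof -
    have "x \<in> span {b1, b2}" if "x \<in> B" for x
    proof (rule ccontr)
      assume x: "x \<notin> span {b1, b2}"
      have "independent (insert x {b1, b2})" by (rule independent_insertI[OF x ind])
      moreover have "insert x {b1, b2} \<subseteq> span B" using 1(2) 2(2) span_base[OF that] by simp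
      ultimately have "card {x, b1, b2} \<le> card B" using independent_span_bound[OF B(1)] by blast
      moreover have "x \<noteq> b1" "x \<noteq> b2" using x span_base[of _ "{b1, b2}"] by auto
      ultimately show False using cB ne by simp
    qed
    then show ?thesis by (intro span_minimal subspace_span) blast
  qed
  then have "b \<in> span (insert b1 {b2})" using wb(2) by blast
  then obtain k where "b - k *\<^sub>R b1 \<in> span {b2}" unfolding span_breakdown_eq ..
  then obtain l where "b - k *\<^sub>R b1 = l *\<^sub>R b2" unfolding span_singleton by auto
  then have "b = k *\<^sub>R b1 + l *\<^sub>R b2" by (simp add: algebra_simps)
  moreover have "b \<bullet> v1s = 0" "b \<bullet> v2s = 0"
    using f wb(3) Q_pairing[OF wb(1)] by (auto simp: G_def inner_add_left)
  ultimately have "b = 0" using p by (simp add: inner_add_left)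
  with wb show ?thesis by auto
qed

lemma Q_image_W0: "Q ` W0 = G"
proof
  show "Q ` W0 \<subseteq> G" using range_subset Q_pairing by (auto simp: W0_def G_def H_per0_def)
  show "G \<subseteq> Q ` W0"
  proof
    fix f assume "f \<in> G"
    then obtain w where w: "w \<in> W" "Q w = f" using G_subset_range by blast
    \<comment> \<open>Kernel elements are added to annihilate both pairings; they do not change the
      image under \<open>Q\<close>.\<close>
    define u where "u = w + ((- (w \<bullet> v1s)) *\<^sub>R v1 + (w \<bullet> v2s) *\<^sub>R v2)"
    have vv: "(- (w \<bullet> v1s)) *\<^sub>R v1 + (w \<bullet> v2s) *\<^sub>R v2 \<in> W"
      by (intro subspace_add[OF subspace_W] subspace_scale[OF subspace_W] v1_W v2_W)
    have "u \<in> W0" unfolding W0_def u_def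
      using subspace_add[OF subspace_W w(1) vv] by (simp add: inner_add_left inner_diff_left biorthogonal)
    moreover have "Q u = Q w + ((- (w \<bullet> v1s)) *\<^sub>R Q v1 + (w \<bullet> v2s) *\<^sub>R Q v2)"
      unfolding u_def by (simp only: Q_add Q_scaleR w vv v1_W v2_W subspace_scale[OF subspace_W])
    then have "Q u = f" by (simp add: Q_v1 Q_v2 w)
    ultimately show "f \<in> Q ` W0" by blast
  qed
qed

lemma Q_inj_W0: "w \<in> W0 \<Longrightarrow> Q w = 0 \<Longrightarrow> w = 0"
  using kernel[of w] biorthogonal by (auto simp: W0_def inner_add_left)

text \<open>The signs differ because \<open>v1\<close>, \<open>v2\<close> pair with \<open>v1s\<close>, \<open>v2s\<close> to \<open>1\<close> and \<open>-1\<close>.\<close>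

definition "P f = f - tens (\<lambda>_. 1) (mean_value f) - (f \<bullet> v1s) *\<^sub>R v1 + (f \<bullet> v2s) *\<^sub>R v2"

lemma mean_value_add: "mean_value (f + g) = mean_value f + mean_value (g :: 'h per_L2)"
  and mean_value_scaleR: "mean_value (c *\<^sub>R f) = c *\<^sub>R mean_value (f :: 'h per_L2)"
  by (rule vector_eqI_inner, simp add: mean_value_inner inner_add_left algebra_simps)+

lemma linear_P: "linear P"
  by (rule linearI)
     (simp_all add: P_def mean_value_add mean_value_scaleR tens_add tens_scaleR pc inner_add_left algebra_simps)

lemma P_id: "f \<in> G \<Longrightarrow> P f = f"
proof -
  assume "f \<in> G"
  moreover have "tens (\<lambda>_. 1) (0::'h) = 0" by (simp add: tens_def zero_per_L2_def)
  ultimately show ?thesis by (simp add: P_def G_def)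
qed

lemma P_H: "f \<in> H_per0 \<Longrightarrow> P f = f - (f \<bullet> v1s) *\<^sub>R v1 + (f \<bullet> v2s) *\<^sub>R v2"
  by (simp add: P_def H_per0_def tens_def zero_per_L2_def)

lemma mean_inner: "tens (\<lambda>_. 1) (mean_value f) \<bullet> tens (\<lambda>_. 1) h = f \<bullet> tens (\<lambda>_. 1) (h::'h)"
  by (simp add: inner_tens_tens[OF pc(3) pc(3), of 1 _ 1] trig_integrals[simplified] mean_value_inner)

lemma P_G: "P f \<in> G"
proof -
  have m: "tens (\<lambda>_. 1) h \<bullet> v1s = 0" "tens (\<lambda>_. 1) h \<bullet> v2s = 0" for h
    by (simp_all add: v1s_def v2s_def inner_add_right inner_diff_right inner_tens_tens pc trig_integrals)
  have v: "v1 \<bullet> tens (\<lambda>_. 1) h = 0" "v2 \<bullet> tens (\<lambda>_. 1) h = 0" for h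
    using W_D(3)[OF v1_W] W_D(3)[OF v2_W] by (auto simp: mean_value_zero_iff)
  show ?thesis
    unfolding G_def mean_value_zero_iff
    by (simp add: P_def inner_add_left inner_diff_left mean_inner v m biorthogonal)
qed

lemma bounded_P: "\<exists>C\<ge>0. \<forall>f. norm (P f) \<le> C * norm f"
proof (intro exI[of _ "2 + norm v1s * norm v1 + norm v2s * norm v2"] conjI allI)
  fix f :: "'h per_L2"
  let ?E = "tens (\<lambda>_. 1) (mean_value f)"
  \<comment> \<open>Taking the mean value is an orthogonal projection onto constants, so
    Cauchy-Schwarz bounds it by \<open>norm f\<close>.\<close>
  have "norm ?E * norm ?E = f \<bullet> ?E" using mean_inner[of f "mean_value f"] by (simp flip: power2_eq_square add: power2_norm_eq_inner)
  also have "\<dots> \<le> norm f * norm ?E" by (rule norm_cauchy_schwarz)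
  finally have E: "norm ?E \<le> norm f" by (cases "?E = 0") auto
  have "norm (P f) \<le> norm f + norm ?E + \<bar>f \<bullet> v1s\<bar> * norm v1 + \<bar>f \<bullet> v2s\<bar> * norm v2"
    unfolding P_def
    using norm_triangle_ineq[of "f - ?E - (f \<bullet> v1s) *\<^sub>R v1" "(f \<bullet> v2s) *\<^sub>R v2"]
      norm_triangle_ineq4[of "f - ?E" "(f \<bullet> v1s) *\<^sub>R v1"] norm_triangle_ineq4[of f ?E] by simp
  also have "\<dots> \<le> norm f + norm f + (norm f * norm v1s) * norm v1 + (norm f * norm v2s) * norm v2"
    by (intro add_mono mult_right_mono E Cauchy_Schwarz_ineq2 order_refl) auto
  also have "\<dots> = (2 + norm v1s * norm v1 + norm v2s * norm v2) * norm f" by (simp add: algebra_simps)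
  finally show "norm (P f) \<le> (2 + norm v1s * norm v1 + norm v2s * norm v2) * norm f" .
qed auto

text \<open>The open mapping theorem is applied to the set \<open>E\<close> of triples consisting of
  a function, its derivative and its image under the operator. \<open>E\<close> is closed in a
  product of complete types because both operations are closed, and on it \<open>Q\<close> becomes
  the bounded map \<open>T\<close>.\<close>

lemma bounded_inverse:
  obtains C where "C \<ge> 0" "\<And>w. w \<in> W0 \<Longrightarrow> norm w \<le> C * norm (Q w) \<and> norm (time_deriv w) \<le> C * norm (Q w) \<and> norm (lft w) \<le> C * norm (Q w)"
proof -
  define E where "E = {(w, time_deriv w, lft w) | w. w \<in> W0}"
  define T where "T p = \<omega> *\<^sub>R fst (snd p) + snd (snd p)" for p :: "'h per_L2 \<times> 'h per_L2 \<times> 'h per_L2"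
  have W0W: "w \<in> W0 \<Longrightarrow> w \<in> W" for w by (simp add: W0_def)
  have E: "subspace E"
  proof (rule subspaceI)
    have "time_deriv 0 = (0 :: 'h per_L2)" "lft 0 = 0" using W_scaleR(2,3)[OF zero_W, of 0] by simp_all
    then show "0 \<in> E" using subspace_0[OF subspace_W0] by (auto simp: E_def zero_prod_def intro!: exI[of _ 0])
  next
    fix p q assume "p \<in> E" "q \<in> E"
    then obtain w u where wu: "w \<in> W0" "p = (w, time_deriv w, lft w)" "u \<in> W0" "q = (u, time_deriv u, lft u)" by (auto simp: E_def)
    then have "p + q = (w + u, time_deriv (w + u), lft (w + u))" by (simp add: W_add[OF W0W W0W])
    then show "p + q \<in> E" using subspace_add[OF subspace_W0 wu(1,3)] by (auto simp: E_def)
  next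
    fix c p assume "p \<in> E"
    then obtain w where w: "w \<in> W0" "p = (w, time_deriv w, lft w)" by (auto simp: E_def)
    then have "c *\<^sub>R p = (c *\<^sub>R w, time_deriv (c *\<^sub>R w), lft (c *\<^sub>R w))" by (simp add: W_scaleR[OF W0W])
    then show "c *\<^sub>R p \<in> E" using subspace_scale[OF subspace_W0 w(1)] by (auto simp: E_def)
  qed
  have cE: "closed E"
    unfolding closed_sequential_limits
  proof (intro allI impI, elim conjE)
    fix X p assume X: "\<forall>n. X n \<in> E" and lim: "X \<longlonglongrightarrow> p"
    define Y where "Y n = fst (X n)" for n
    have Y: "Y n \<in> W0" "X n = (Y n, time_deriv (Y n), lft (Y n))" for n
      using X by (auto simp: E_def Y_def dest!: spec[of _ n])
    obtain w d g where p: "p = (w, d, g)" by (cases p) auto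
    have l: "Y \<longlonglongrightarrow> w" "(\<lambda>n. time_deriv (Y n)) \<longlonglongrightarrow> d" "(\<lambda>n. lft (Y n)) \<longlonglongrightarrow> g"
      using tendsto_fst[OF lim] tendsto_fst[OF tendsto_snd[OF lim]] tendsto_snd[OF tendsto_snd[OF lim]] Y(2) p by simp_all
    have ac: "acts w g" by (rule acts_limit[OF W_D(1)[OF W0W[OF Y(1)]] l(1,3)])
    have wd: "has_weak_deriv w d" by (rule has_weak_deriv_limit[OF W_D(2)[OF W0W[OF Y(1)]] l(1,2)])
    have "w \<in> G"
      by (rule closed_sequentially[OF closed_G _ l(1)]) (use Y(1) W_D(3) in \<open>auto simp: W0_def G_def\<close>)
    then have "w \<in> W0" using W_I[OF ac wd] by (simp add: W0_def G_def)
    then show "p \<in> E" using lift_op_eq[OF ac] time_deriv_eq[OF wd] p by (auto simp: E_def)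
  qed
  have T: "bounded_linear T" unfolding T_def
    by (intro bounded_linear_add bounded_linear_const_scaleR bounded_linear_fst_comp bounded_linear_compose[OF bounded_linear_fst bounded_linear_snd]
        bounded_linear_compose[OF bounded_linear_snd bounded_linear_snd])
  have "T ` E = Q ` W0" by (auto simp: T_def E_def Q_def image_iff) 
  then have TE: "T ` E = G" by (simp add: Q_image_W0)
  obtain C where C: "C \<ge> 0" "\<And>y. y \<in> G \<Longrightarrow> \<exists>x\<in>E. T x = y \<and> norm x \<le> C * norm y"
    using bounded_right_inverse[OF E cE subspace_G closed_G T TE] by blast
  show ?thesis
  proof (rule that[OF C(1)])
    fix w assume w: "w \<in> W0"
    then have "Q w \<in> G" using Q_image_W0 by blast
    then obtain x where x: "x \<in> E" "T x = Q w" "norm x \<le> C * norm (Q w)" using C(2) by blast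
    then obtain u where u: "u \<in> W0" "x = (u, time_deriv u, lft u)" by (auto simp: E_def)
    then have "Q u = Q w" using x(2) by (simp add: T_def Q_def)
    then have "Q (u + (-1) *\<^sub>R w) = 0"
      using Q_add[OF W0W[OF u(1)] W_scaleR(1)[OF W0W[OF w], of "-1"]] Q_scaleR[OF W0W[OF w], of "-1"] by simp
    from Q_inj_W0[OF subspace_add[OF subspace_W0 u(1) subspace_scale[OF subspace_W0 w]] this]
    have "u + (-1) *\<^sub>R w = 0" .
    then have "u = w" by simp
    moreover have "norm u \<le> norm x" "norm (time_deriv u) \<le> norm x" "norm (lft u) \<le> norm x"
      unfolding u(2)
      by (rule norm_fst_le order_trans[OF norm_fst_le norm_snd_le] order_trans[OF norm_snd_le norm_snd_le])+
    ultimately show "norm w \<le> C * norm (Q w) \<and> norm (time_deriv w) \<le> C * norm (Q w) \<and> norm (lft w) \<le> C * norm (Q w)"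
      using x(3) by auto
  qed
qed

end

section \<open>Products and powers of power series\<close>

lemma psb_bilinear:
  fixes f :: "real \<Rightarrow> 'a::banach" and g :: "real \<Rightarrow> 'b::banach" and B :: "'a \<Rightarrow> 'b \<Rightarrow> 'c::banach"
  assumes \<rho>: "\<rho> > 0" and B: "\<And>y. linear (\<lambda>x. B x y)" "\<And>x. linear (B x)" "\<And>x y. norm (B x y) \<le> K * norm x * norm y" "K \<ge> 0"
    and f: "psb \<rho> f c" and g: "psb \<rho> g d"
  shows "psb \<rho> (\<lambda>x. B (f x) (g x)) (K * c * d)"
proof -
  obtain a where a: "(\<lambda>n. norm (a n) * \<rho> ^ n) summable_on UNIV" "(\<Sum>\<^sub>\<infinity>n. norm (a n) * \<rho> ^ n) \<le> c"
    "\<And>x. \<bar>x\<bar> \<le> \<rho> \<Longrightarrow> ((\<lambda>n. x ^ n *\<^sub>R a n) has_sum f x) UNIV"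
    using f by (rule psb_coeffs) blast
  have d0: "d \<ge> 0" by (rule psb_nonneg[OF g \<rho>])
  have n: "psb \<rho> (\<lambda>x. x ^ n *\<^sub>R B (a n) (g x)) (\<rho> ^ n * (K * norm (a n) * d))" for n
    by (rule psb_shift[OF \<rho>], rule psb_linear[OF \<rho> g B(2) B(3)]) (use B(4) in simp)
  have e: "\<rho> ^ n * (K * norm (a n) * d) = K * d * (norm (a n) * \<rho> ^ n)" for n by simp
  have "psb \<rho> (\<lambda>x. B (f x) (g x)) (\<Sum>\<^sub>\<infinity>n. K * d * (norm (a n) * \<rho> ^ n))"
  proof (rule psb_infsum[OF \<rho> n[unfolded e] summable_on_cmult_right[OF a(1)]])
    fix x :: real assume x: "\<bar>x\<bar> \<le> \<rho>"
    have "bounded_linear (\<lambda>u. B u (g x))"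
      by (rule bounded_linear_intro[of _ "K * norm (g x)"])
         (use B(1)[of "g x"] B(3) in \<open>auto simp: linear_iff mult_ac\<close>)
    from has_sum_bounded_linear[OF this a(3)[OF x]]
    show "((\<lambda>n. x ^ n *\<^sub>R B (a n) (g x)) has_sum B (f x) (g x)) UNIV"
      using B(1)[of "g x"] by (simp add: o_def linear_iff)
  qed
  moreover have "(\<Sum>\<^sub>\<infinity>n. K * d * (norm (a n) * \<rho> ^ n)) \<le> K * c * d"
    unfolding infsum_cmult_right' using mult_left_mono[OF a(2), of "K * d"] B(4) d0 by (simp add: mult_ac)
  ultimately show ?thesis by (rule psb_mono)
qed

lemma psb_scaleR:
  fixes f :: "real \<Rightarrow> real" and g :: "real \<Rightarrow> 'b::banach"
  assumes "\<rho> > 0" "psb \<rho> f c" "psb \<rho> g d"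
  shows "psb \<rho> (\<lambda>x. f x *\<^sub>R g x) (c * d)"
  using psb_bilinear[OF assms(1) _ _ _ _ assms(2,3), of scaleR 1]
  by (simp add: linear_iff scaleR_add_left scaleR_add_right)

lemma psb_bilinear_diff:
  fixes f g :: "real \<Rightarrow> 'a::banach" and B :: "'a \<Rightarrow> 'a \<Rightarrow> 'c::banach"
  assumes \<rho>: "\<rho> > 0" and B: "\<And>y. linear (\<lambda>x. B x y)" "\<And>x. linear (B x)" "\<And>x y. norm (B x y) \<le> K * norm x * norm y" "K \<ge> 0"
    and f: "psb \<rho> f c" and g: "psb \<rho> g c" and fg: "psb \<rho> (\<lambda>x. f x - g x) d"
  shows "psb \<rho> (\<lambda>x. B (f x) (f x) - B (g x) (g x)) (2 * K * c * d)"
proof -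
  have "psb \<rho> (\<lambda>x. B (f x - g x) (f x) + B (g x) (f x - g x)) (K * d * c + K * c * d)"
    by (intro psb_add psb_bilinear[OF \<rho> B] \<rho> f g fg)
  moreover have "B (f x - g x) (f x) + B (g x) (f x - g x) = B (f x) (f x) - B (g x) (g x)" for x
    using linear_diff[OF B(1)] linear_diff[OF B(2)] by simp
  ultimately have "psb \<rho> (\<lambda>x. B (f x) (f x) - B (g x) (g x)) (K * d * c + K * c * d)" by simp
  moreover have "K * d * c + K * c * d = 2 * K * c * d" by simp
  ultimately show ?thesis by (simp only:)
qed

text \<open>A power is the diagonal of this multilinear map, so the multilinear estimates cover
  powers of the parameter.\<close>

lemma mlin_prod_list: "mlin m 1 (prod_list :: real list \<Rightarrow> real)"
proof (rule mlinI)
  show "linear (\<lambda>v. prod_list (us @ v # ws))" for us ws :: "real list"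
    by (simp add: linear_iff algebra_simps)
  show "norm (prod_list vs) \<le> 1 * prod_list (map norm vs)" for vs :: "real list"
    by (induction vs) (auto simp: abs_mult intro: mult_left_mono)
qed

lemma psb_power_diff:
  fixes f g :: "real \<Rightarrow> real"
  assumes "\<rho> > 0" "psb \<rho> f c" "psb \<rho> g c" "psb \<rho> (\<lambda>x. f x - g x) d"
  shows "psb \<rho> (\<lambda>x. f x ^ m - g x ^ m) (real m * c ^ (m - 1) * d)"
  using psb_mlin_diff[OF assms(1) mlin_prod_list[of m] _ assms(2-4)] by simp

lemma psb_power:
  fixes f :: "real \<Rightarrow> real"
  assumes "\<rho> > 0" "psb \<rho> f c" shows "psb \<rho> (\<lambda>x. f x ^ m) (c ^ m)"
  using psb_mlin_replicate[OF assms(1) mlin_prod_list[of m] _ assms(2)] by simp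

text \<open>Geometric majorant over all triples of degrees; each of the three indices contributes a
  factor two.\<close>

lemma has_sum_half_powers: "((\<lambda>(k, l, m). (1 / 2) ^ (k + l + m)) has_sum (8::real)) (UNIV :: (nat \<times> nat \<times> nat) set)"
proof -
  have h: "((\<lambda>n. (1 / 2) ^ n) has_sum (2::real)) UNIV"
    by (rule sums_nonneg_imp_has_sum) (use geometric_sums[of "1 / 2 :: real"] in auto)
  have prod: "((\<lambda>(n, y). (1 / 2) ^ n * g y) has_sum 2 * b) UNIV" if g: "(g has_sum b) UNIV" "\<And>y. g y \<ge> 0" for g :: "'i \<Rightarrow> real" and b
  proof -
    have inner: "((\<lambda>y. (1 / 2) ^ n * g y) has_sum (1 / 2) ^ n * b) UNIV" for n :: nat
      by (rule has_sum_cmult_right[OF g(1)])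
    have s: "(\<lambda>(n, y). (1 / 2) ^ n * g y) summable_on (UNIV \<times> UNIV)"
      by (rule summable_on_SigmaI[where g="\<lambda>n. (1 / 2) ^ n * b"])
         (use inner g(2) has_sum_imp_summable[OF has_sum_cmult_left[OF h, of b]] in auto)
    have "((\<lambda>(n, y). (1 / 2) ^ n * g y) has_sum 2 * b) (UNIV \<times> UNIV)"
      by (rule has_sum_SigmaI[OF _ has_sum_cmult_left[OF h, of b] s]) (use inner in auto)
    then show ?thesis by simp
  qed
  from prod[OF prod[OF h]] show ?thesis
    by (simp add: case_prod_unfold power_add mult.assoc)
qed

section \<open>Fixed points of rescaled power series\<close>

text \<open>\<open>e\<close> is the leading direction and \<open>z\<close> the unknown, from which
  \<open>pr\<close> extracts the correction of the argument and \<open>mu\<close> the parameter;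
  \<open>z\<close> may have further components, such as a frequency shift. By \<open>U0\<close> and
  \<open>U1\<close> every surviving term contains the argument and has total degree at least
  two.\<close>

locale scaled_series =
  fixes U :: "nat \<times> nat \<times> nat \<Rightarrow> 'v::banach list \<Rightarrow> 'f::banach" and M C :: real
    and e :: 'v and pr :: "'z::banach \<Rightarrow> 'v" and mu :: "'z \<Rightarrow> real"
  assumes M: "M \<ge> 0" and C: "C \<ge> 1" and e: "norm e \<le> 1"
    and pr: "linear pr" "\<And>z. norm (pr z) \<le> norm z" and mu: "linear mu" "\<And>z. \<bar>mu z\<bar> \<le> norm z"
    and U: "\<And>k l m. mlin (k + l) (M * C ^ (k + l + m)) (U (k, l, m))"
    and U0: "\<And>m. U (0, 0, m) [] = 0" and U1: "\<And>k l p. k + l = 1 \<Longrightarrow> U (k, l, 0) [p] = 0"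
begin

text \<open>A term of the expansion at \<open>(x (e + pr z), mu z)\<close> divided by \<open>x\<close>; the only terms of order one,
  with \<open>k + l = m = 1\<close>, have their leading part removed, so that all terms are small for small \<open>x\<close> and \<open>z\<close>.\<close>

definition "term i x z = (case i of (k, l, m) \<Rightarrow>
    x ^ (k + l - 1) *\<^sub>R mu z ^ m *\<^sub>R U (k, l, m) (replicate (k + l) (e + pr z))
    - (if k + l = 1 \<and> m = 1 then mu z *\<^sub>R U (k, l, m) [e] else 0))"

text \<open>The constant is \<open>M * ((2 * C) ^ 3 * 64)\<close>: the exponent \<open>n - 3\<close>
  in \<open>degree_bound\<close> leaves three factors \<open>2 * C\<close> uncompensated and lacks
  three factors \<open>1 / 4\<close>.\<close>

definition "K = 512 * M * C ^ 3"
definition "wt i = (case i of (k, l, m) \<Rightarrow> K * (1 / 2) ^ (k + l + m))"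

lemma K: "K \<ge> 0" using M C by (simp add: K_def)

lemma wt: "(wt has_sum 8 * K) UNIV"
  using has_sum_cmult_right[OF has_sum_half_powers, of K] by (simp add: wt_def[abs_def] case_prod_unfold mult.commute)

lemma wt_nonneg: "wt i \<ge> 0" using K by (simp add: wt_def case_prod_unfold)

text \<open>The factor \<open>real n\<close> stems from differences of monomials and is absorbed by
  \<open>2 ^ n\<close>; the \<open>2\<close> in \<open>2 * C\<close> stems from arguments of norm at
  most two. What remains is geometric with ratio
  \<open>2 * C * \<sigma> \<le> 1 / 4\<close>.\<close>

lemma degree_bound:
  assumes "0 < \<sigma>" "C * \<sigma> \<le> 1 / 8" "n \<ge> 2"
  shows "real n * (M * (2 * C) ^ n) * \<sigma> ^ (n - 3) \<le> K * (1 / 2) ^ n"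
proof -
  have nn: "real n \<le> 2 ^ n" by (simp add: less_imp_le[OF of_nat_less_two_power])
  have "(2 * C) ^ n * \<sigma> ^ (n - 3) \<le> (2 * C) ^ 3 * 64 * (1 / 4) ^ n"
  proof (cases "n = 2")
    \<comment> \<open>Here the exponent \<open>n - 3\<close> is cut off at zero, so degree two is
      estimated directly.\<close>
    case True
    have "C ^ 2 \<le> C ^ 3" using C by (intro power_increasing) auto
    moreover have "0 \<le> C ^ 3" using C by simp
    moreover have "(2 * C) ^ n * \<sigma> ^ (n - 3) = 4 * C ^ 2" "(2 * C) ^ 3 * 64 * (1 / 4) ^ n = 32 * C ^ 3"
      using True by (simp_all add: power_mult_distrib power_divide)
    ultimately show ?thesis by linarith
  next
    case False
    then obtain j where j: "n = 3 + j" using assms(3) by (metis add.commute le_Suc_ex le_antisym not_less_eq_eq numeral_2_eq_2 numeral_3_eq_3)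
    have "(2 * C) ^ n * \<sigma> ^ (n - 3) = (2 * C) ^ 3 * (2 * (C * \<sigma>)) ^ j"
      unfolding j by (simp add: power_add power_mult_distrib)
    also have "\<dots> \<le> (2 * C) ^ 3 * (1 / 4) ^ j"
      using assms(1,2) C by (intro mult_left_mono power_mono) auto
    also have "\<dots> = (2 * C) ^ 3 * 64 * (1 / 4) ^ n"
      unfolding j by (simp add: power_add power_divide)
    finally show ?thesis .
  qed
  then have "real n * (M * (2 * C) ^ n) * \<sigma> ^ (n - 3) \<le> 2 ^ n * (M * ((2 * C) ^ 3 * 64 * (1 / 4) ^ n))"
    using mult_mono[OF nn mult_left_mono[OF _ M]] C M assms(1) by (simp add: mult.assoc)
  also have "\<dots> = (M * ((2 * C) ^ 3 * 64)) * (2 ^ n * (1 / 4) ^ n)" by (simp only: mult_ac)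
  also have "(2::real) ^ n * (1 / 4) ^ n = (1 / 2) ^ n" by (simp flip: power_mult_distrib)
  also have "(M * ((2 * C) ^ 3 * 64)) * (1 / 2) ^ n = K * (1 / 2) ^ n"
    by (simp add: K_def power_mult_distrib)
  finally show ?thesis .
qed

lemma term_trivial: "k + l = 0 \<or> (k + l = 1 \<and> m = 0) \<Longrightarrow> term (k, l, m) x z = 0"
  using U0 U1 by (auto simp: term_def)

lemma psb_argument:
  assumes "\<rho> > 0" "psb \<rho> f \<sigma>" "\<sigma> \<le> 1"
  shows "psb \<rho> (\<lambda>x. e + pr (f x)) 2" "psb \<rho> (\<lambda>x. mu (f x)) \<sigma>" "psb \<rho> (\<lambda>x. pr (f x)) \<sigma>"
proof -
  show p: "psb \<rho> (\<lambda>x. pr (f x)) \<sigma>" using psb_linear[OF assms(1,2) pr(1), of 1] pr(2) by simp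
  show "psb \<rho> (\<lambda>x. mu (f x)) \<sigma>" using psb_linear[OF assms(1,2) mu(1), of 1] mu(2) by simp
  show "psb \<rho> (\<lambda>x. e + pr (f x)) 2"
    by (rule psb_mono[OF psb_add[OF assms(1) psb_const[OF assms(1) e] p]]) (use assms(3) in simp)
qed

text \<open>Each term contains one more small quantity than a difference in \<open>z\<close>
  consumes: a power of \<open>x\<close>, of \<open>mu\<close>, or a correction of the argument. This
  spare factor \<sigma> makes the sum of all terms a contraction.\<close>

lemma term_lipschitz:
  assumes \<rho>: "0 < \<rho>" "\<rho> \<le> \<sigma>" and \<sigma>: "\<sigma> \<le> 1" "C * \<sigma> \<le> 1 / 8"
    and f: "psb \<rho> f \<sigma>" and g: "psb \<rho> g \<sigma>" and d: "psb \<rho> (\<lambda>x. f x - g x) d"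
  shows "psb \<rho> (\<lambda>x. term i x (f x) - term i x (g x)) (\<sigma> * d * wt i)"
proof -
  obtain k l m where i: "i = (k, l, m)" by (cases i) auto
  define j where "j = k + l"
  define n where "n = j + m"
  note af = psb_argument[OF \<rho>(1) f \<sigma>(1)] and ag = psb_argument[OF \<rho>(1) g \<sigma>(1)]
  have d0: "d \<ge> 0" by (rule psb_nonneg[OF d \<rho>(1)])
  have \<sigma>0: "\<sigma> > 0" using \<rho> by simp
  have dpr: "psb \<rho> (\<lambda>x. pr (f x) - pr (g x)) d"
    using psb_linear[OF \<rho>(1) d pr(1), of 1] pr(2) by (simp add: linear_diff[OF pr(1)])
  then have dX: "psb \<rho> (\<lambda>x. (e + pr (f x)) - (e + pr (g x))) d" by simp
  have dmu: "psb \<rho> (\<lambda>x. mu (f x) - mu (g x)) d"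
    using psb_linear[OF \<rho>(1) d mu(1), of 1] mu(2) by (simp add: linear_diff[OF mu(1)])
  have MC: "M * C ^ q \<ge> 0" for q using M C by simp
  have ml: "mlin j (M * C ^ n) (U i)" using U[of k l m] by (simp add: i j_def n_def)
  have wi: "wt i = K * (1 / 2) ^ n" by (simp add: wt_def i n_def j_def)
  \<comment> \<open>Terms that vanish; the terms whose leading part was removed; terms with a spare
    factor \<open>x\<close> or with at least two factors \<open>mu\<close>.\<close>
  consider "j = 0 \<or> (j = 1 \<and> m = 0)" | "j = 1" "m = 1" | "j = 1 \<and> m \<ge> 2 \<or> j \<ge> 2" by linarith
  then show ?thesis
  proof cases
    case 1
    then have "term i x z = 0" for x z using term_trivial[of k l m] by (simp add: i j_def)
    then show ?thesis using psb_const[OF \<rho>(1), of 0 "\<sigma> * d * wt i"] \<sigma>0 d0 wt_nonneg by simp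
  next
    case 2
    have lin: "linear (\<lambda>v. U i [v])" using mlin_slot[of "[]" "[]" _ "U i"] ml 2 by simp
    have nU: "norm (U i [v]) \<le> M * C ^ 2 * norm v" for v using mlin_norm[OF ml, of "[v]"] 2 by (simp add: n_def power2_eq_square)
    \<comment> \<open>Without its value at \<open>e\<close> the term is bilinear in
      \<open>z\<close>, hence quadratically small.\<close>
    have t: "term i x z = mu z *\<^sub>R U i [pr z]" for x z
      using 2 linear_add[OF lin, of e "pr z"] by (simp add: term_def i j_def scaleR_add_right)
    define B where "B z z' = mu z *\<^sub>R U i [pr z']" for z z'
    have "psb \<rho> (\<lambda>x. B (f x) (f x) - B (g x) (g x)) (2 * (M * C ^ 2) * \<sigma> * d)"
    proof (rule psb_bilinear_diff[of \<rho> B, OF \<rho>(1) _ _ _ MC f g d])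
      show "linear (\<lambda>x. B x y)" for y unfolding B_def
        using mu(1) by (simp add: linear_iff scaleR_add_left)
      show "linear (B x)" for x unfolding B_def
        using pr(1) lin by (simp add: linear_iff scaleR_add_right)
      show "norm (B x y) \<le> M * C ^ 2 * norm x * norm y" for x y
      proof -
        have "norm (B x y) \<le> norm x * (M * C ^ 2 * norm y)"
          unfolding B_def norm_scaleR using mu(2)[of x] order_trans[OF nU[of "pr y"] mult_left_mono[OF pr(2) MC]]
          by (intro mult_mono) auto
        then show ?thesis by (simp add: mult_ac)
      qed
    qed
    moreover have "2 * (M * C ^ 2) * \<sigma> * d \<le> \<sigma> * d * wt i"
    proof -
      have two: "2 * (M * C ^ 2) \<le> K * (1 / 2) ^ 2"
        using degree_bound[OF \<sigma>0 \<sigma>(2), of 2] MC[of 2] by (simp add: power_mult_distrib)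
      have "wt i = K * (1 / 2) ^ 2" using wi 2 by (simp add: n_def power2_eq_square)
      then have "\<sigma> * d * (2 * (M * C ^ 2)) \<le> \<sigma> * d * wt i"
        using mult_left_mono[OF two, of "\<sigma> * d"] \<sigma>0 d0 by simp
      then show ?thesis by (simp add: mult_ac)
    qed
    ultimately show ?thesis unfolding t B_def[symmetric] by (rule psb_mono)
  next
    case 3
    then have n2: "n \<ge> 2" by (auto simp: n_def)
    have t: "term i x z = x ^ (j - 1) *\<^sub>R (mu z ^ m *\<^sub>R U i (replicate j (e + pr z)))" for x z
      using 3 by (auto simp: term_def i j_def)
    have Uf: "psb \<rho> (\<lambda>x. U i (replicate j (e + pr (f x)))) (M * C ^ n * 2 ^ j)"
      by (rule psb_mlin_replicate[OF \<rho>(1) ml MC af(1)])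
    have Ud: "psb \<rho> (\<lambda>x. U i (replicate j (e + pr (f x))) - U i (replicate j (e + pr (g x)))) (M * C ^ n * (real j * 2 ^ (j - 1) * d))"
      by (rule psb_mlin_diff[OF \<rho>(1) ml MC af(1) ag(1) dX])
    \<comment> \<open>Product rule for differences: first the power of \<open>mu\<close> is changed,
      then the argument of \<open>U i\<close>.\<close>
    have "psb \<rho> (\<lambda>x. x ^ (j - 1) *\<^sub>R ((mu (f x) ^ m - mu (g x) ^ m) *\<^sub>R U i (replicate j (e + pr (f x)))
        + mu (g x) ^ m *\<^sub>R (U i (replicate j (e + pr (f x))) - U i (replicate j (e + pr (g x))))))
      (\<rho> ^ (j - 1) * ((real m * \<sigma> ^ (m - 1) * d) * (M * C ^ n * 2 ^ j) + \<sigma> ^ m * (M * C ^ n * (real j * 2 ^ (j - 1) * d))))"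
      by (intro psb_shift psb_add psb_scaleR psb_power_diff psb_power \<rho>(1) af(2) ag(2) dmu Uf Ud)
    moreover have "\<rho> ^ (j - 1) * ((real m * \<sigma> ^ (m - 1) * d) * (M * C ^ n * 2 ^ j) + \<sigma> ^ m * (M * C ^ n * (real j * 2 ^ (j - 1) * d)))
      \<le> \<sigma> * d * wt i"
    proof -
      have l1: "\<sigma> ^ p \<le> \<sigma> ^ q" if "q \<le> p" for p q using that \<sigma>0 \<sigma>(1) by (intro power_decreasing) auto
      \<comment> \<open>Taking a difference of powers of \<open>mu\<close> uses up one small factor.
        The remaining \<open>n - 2\<close> provide the \<open>n - 3\<close> needed by
        \<open>degree_bound\<close> and one for the contraction.\<close>
      have e1: "real m * (\<sigma> ^ (j - 1) * \<sigma> ^ (m - 1)) \<le> real m * \<sigma> ^ Suc (n - 3)"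
      proof (cases "m = 0")
        case False
        then have "Suc (n - 3) \<le> (j - 1) + (m - 1)" using 3 by (auto simp: n_def)
        from l1[OF this] show ?thesis by (intro mult_left_mono) (auto simp: power_add)
      qed simp
      have e2: "\<sigma> ^ (j - 1) * \<sigma> ^ m \<le> \<sigma> ^ Suc (n - 3)"
      proof -
        have "Suc (n - 3) \<le> (j - 1) + m" using 3 by (auto simp: n_def)
        from l1[OF this] show ?thesis by (simp add: power_add)
      qed
      have p2: "(2::real) ^ (j - 1) \<le> 2 ^ n" "(2::real) ^ j \<le> 2 ^ n" by (auto intro!: power_increasing simp: n_def)
      have "\<rho> ^ (j - 1) * ((real m * \<sigma> ^ (m - 1) * d) * (M * C ^ n * 2 ^ j) + \<sigma> ^ m * (M * C ^ n * (real j * 2 ^ (j - 1) * d)))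
        \<le> \<sigma> ^ (j - 1) * ((real m * \<sigma> ^ (m - 1) * d) * (M * C ^ n * 2 ^ n) + \<sigma> ^ m * (M * C ^ n * (real j * 2 ^ n * d)))"
      proof (rule mult_mono[OF power_mono[OF \<rho>(2) less_imp_le[OF \<rho>(1)]] add_mono])
        show "(real m * \<sigma> ^ (m - 1) * d) * (M * C ^ n * 2 ^ j) \<le> (real m * \<sigma> ^ (m - 1) * d) * (M * C ^ n * 2 ^ n)"
          by (rule mult_left_mono[OF mult_left_mono[OF p2(2) MC]]) (use \<sigma>0 d0 in simp)
        show "\<sigma> ^ m * (M * C ^ n * (real j * 2 ^ (j - 1) * d)) \<le> \<sigma> ^ m * (M * C ^ n * (real j * 2 ^ n * d))"
          by (rule mult_left_mono[OF mult_left_mono[OF mult_right_mono[OF mult_left_mono[OF p2(1)] d0] MC]]) (use \<sigma>0 in simp_all)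
        show "0 \<le> (real m * \<sigma> ^ (m - 1) * d) * (M * C ^ n * 2 ^ j) + \<sigma> ^ m * (M * C ^ n * (real j * 2 ^ (j - 1) * d))"
          by (intro add_nonneg_nonneg mult_nonneg_nonneg[OF _ mult_nonneg_nonneg[OF MC]]) (use \<sigma>0 d0 in simp_all)
      qed (use \<sigma>0 in simp)
      also have "\<dots> = (real m * (\<sigma> ^ (j - 1) * \<sigma> ^ (m - 1)) + real j * (\<sigma> ^ (j - 1) * \<sigma> ^ m)) * (d * (M * C ^ n * 2 ^ n))"
        by (simp add: algebra_simps)
      also have "\<dots> \<le> (real m * \<sigma> ^ Suc (n - 3) + real j * \<sigma> ^ Suc (n - 3)) * (d * (M * C ^ n * 2 ^ n))"
        using d0 MC[of n] by (intro mult_right_mono add_mono e1 mult_left_mono[OF e2]) auto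
      also have "\<dots> = \<sigma> * d * (real n * (M * (2 * C) ^ n) * \<sigma> ^ (n - 3))"
        by (simp add: n_def algebra_simps power_mult_distrib)
      also have "\<dots> \<le> \<sigma> * d * wt i"
        unfolding wi using \<sigma>0 d0 by (intro mult_left_mono degree_bound[OF \<sigma>0 \<sigma>(2) n2]) auto
      finally show ?thesis .
    qed
    moreover have "x ^ (j - 1) *\<^sub>R ((mu (f x) ^ m - mu (g x) ^ m) *\<^sub>R U i (replicate j (e + pr (f x)))
        + mu (g x) ^ m *\<^sub>R (U i (replicate j (e + pr (f x))) - U i (replicate j (e + pr (g x))))) = term i x (f x) - term i x (g x)" for x
      unfolding t by (simp add: algebra_simps)
    ultimately show ?thesis using psb_mono by simp
  qed
qed

text \<open>At \<open>z = 0\<close> the parameter vanishes, so only terms with \<open>m = 0\<close>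
  and at least two arguments survive; even after division by \<open>x\<close> these keep a factor
  \<open>x\<close>.\<close>

lemma term_at_zero:
  assumes \<rho>: "0 < \<rho>" "\<rho> \<le> \<sigma>" and \<sigma>: "C * \<sigma> \<le> 1 / 8"
  shows "psb \<rho> (\<lambda>x. term i x 0) (\<rho> * wt i)"
proof -
  obtain k l m where i: "i = (k, l, m)" by (cases i) auto
  define j where "j = k + l"
  have \<sigma>0: "\<sigma> > 0" using \<rho> by simp
  show ?thesis
  proof (cases "m = 0 \<and> j \<ge> 2")
    case False
    then have "m \<noteq> 0 \<or> j = 0 \<or> j = 1 \<and> m = 0" by auto
    then have "term i x 0 = 0" for x
      using term_trivial[of k l m x 0] linear_0[OF mu(1)] by (auto simp: term_def i j_def power_0_left)
    then show ?thesis using psb_const[OF \<rho>(1), of 0 "\<rho> * wt i"] \<rho>(1) wt_nonneg by simp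
  next
    case True
    have t: "term i x 0 = x ^ (j - 1) *\<^sub>R U i (replicate j e)" for x
      using True linear_0[OF pr(1)] by (auto simp: term_def i j_def)
    have ml: "mlin j (M * C ^ j) (U i)" using U[of k l m] True by (simp add: i j_def)
    have "prod_list (replicate j (norm e)) \<le> 1" using e by (simp add: power_le_one)
    then have "norm (U i (replicate j e)) \<le> M * C ^ j"
      using mlin_norm[OF ml, of "replicate j e"] M C by (simp add: mult_left_le order_trans)
    from psb_shift[OF \<rho>(1) psb_const[OF \<rho>(1) this], of "j - 1"]
    have "psb \<rho> (\<lambda>x. term i x 0) (\<rho> ^ (j - 1) * (M * C ^ j))" by (simp add: t)
    moreover have "\<rho> ^ (j - 1) * (M * C ^ j) \<le> \<rho> * wt i"
    proof -
      have "\<rho> ^ (j - 1) = \<rho> * \<rho> ^ (j - 2)" using True by (metis Suc_diff_Suc Suc_1 numeral_2_eq_2 power_Suc Suc_le_lessD diff_Suc_1 One_nat_def)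
      also have "\<dots> \<le> \<rho> * \<sigma> ^ (j - 2)" using \<rho> by (intro mult_left_mono power_mono) auto
      also have "\<sigma> ^ (j - 2) \<le> \<sigma> ^ (j - 3)"
      proof (rule power_decreasing)
        have "1 * \<sigma> \<le> C * \<sigma>" using \<sigma>0 C by (intro mult_right_mono) auto
        then show "\<sigma> \<le> 1" using \<sigma> by simp
      qed (use \<sigma>0 in auto)
      finally have "\<rho> ^ (j - 1) * (M * C ^ j) \<le> \<rho> * \<sigma> ^ (j - 3) * (M * C ^ j)"
        using \<rho> M C by (intro mult_right_mono) auto
      also have "\<dots> \<le> \<rho> * (real j * (M * (2 * C) ^ j) * \<sigma> ^ (j - 3))"
      proof -
        have "M * C ^ j \<le> real j * (M * (2 * C) ^ j)"
        proof -
          have "C ^ j \<le> (2 * C) ^ j" using C by (intro power_mono) auto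
          from mult_left_mono[OF this M] have "M * C ^ j \<le> 1 * (M * (2 * C) ^ j)" by simp
          also have "\<dots> \<le> real j * (M * (2 * C) ^ j)" using True M C by (intro mult_right_mono) auto
          finally show ?thesis .
        qed
        then have "(\<rho> * \<sigma> ^ (j - 3)) * (M * C ^ j) \<le> (\<rho> * \<sigma> ^ (j - 3)) * (real j * (M * (2 * C) ^ j))"
          using \<rho> \<sigma>0 by (intro mult_left_mono) auto
        then show ?thesis by (simp add: mult_ac)
      qed
      also have "\<dots> \<le> \<rho> * wt i"
        using True \<rho>(1) degree_bound[OF \<sigma>0 \<sigma>, of j] by (intro mult_left_mono) (auto simp: wt_def i j_def)
      finally show ?thesis .
    qed
    ultimately show ?thesis by (rule psb_mono)
  qed
qed

definition "series x z = (\<Sum>\<^sub>\<infinity>i. term i x z)"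

lemma term_has_sum:
  assumes "0 < \<sigma>" "\<sigma> \<le> 1" "C * \<sigma> \<le> 1 / 8" "\<bar>x\<bar> \<le> \<sigma>" "norm z \<le> \<sigma>"
  shows "((\<lambda>i. term i x z) has_sum series x z) UNIV"
proof -
  have z: "norm (term i x z - term i x 0) \<le> \<sigma> * norm z * wt i" for i
    using psb_norm_le[OF term_lipschitz[OF assms(1) order_refl assms(2,3) psb_const[OF assms(1,5)] psb_const[OF assms(1), of 0]
        psb_const[OF assms(1) order_refl], of i] assms(4)] assms(1) by simp
  have 0: "norm (term i x 0) \<le> \<sigma> * wt i" for i
    by (rule psb_norm_le[OF term_at_zero[OF assms(1) order_refl assms(3)] assms(4)])
  have "norm (term i x z) \<le> (\<sigma> * norm z + \<sigma>) * wt i" for i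
    using norm_triangle_ineq[of "term i x z - term i x 0" "term i x 0"] z[of i] 0[of i] by (simp add: distrib_right)
  then have "(\<lambda>i. norm (term i x z)) summable_on UNIV"
    by (intro summable_on_comparison_test[OF summable_on_cmult_right[OF has_sum_imp_summable[OF wt], of "\<sigma> * norm z + \<sigma>"]]) auto
  from abs_summable_summable[OF this] show ?thesis unfolding series_def by (rule has_sum_infsum)
qed

text \<open>The radius \<open>r\<close> is chosen first, so that the series and the quadratic term
  together contract by one half. Only then is \<rho> chosen, small compared with \<open>r\<close>,
  so that the value at zero stays below \<open>r / 2\<close>.\<close>

theorem fixed_point:
  fixes \<Lambda> :: "'f \<Rightarrow> 'z" and B :: "'z \<Rightarrow> 'z \<Rightarrow> 'z"
  assumes \<Lambda>: "linear \<Lambda>" "\<And>y. norm (\<Lambda> y) \<le> A * norm y"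
    and B: "\<And>y. linear (\<lambda>x. B x y)" "\<And>x. linear (B x)" "\<And>x y. norm (B x y) \<le> b * norm x * norm y"
    and r0: "r0 > 0"
  obtains r \<rho> f where "0 < \<rho>" "\<rho> \<le> r" "r \<le> r0" "psb \<rho> f r"
    "\<And>x. \<bar>x\<bar> \<le> \<rho> \<Longrightarrow> f x = \<Lambda> (series x (f x)) + B (f x) (f x)"
    "\<And>x z. \<bar>x\<bar> \<le> \<rho> \<Longrightarrow> norm z \<le> r \<Longrightarrow> z = \<Lambda> (series x z) + B z z \<Longrightarrow> z = f x"
    "\<And>x z. \<bar>x\<bar> \<le> \<rho> \<Longrightarrow> norm z \<le> r \<Longrightarrow> ((\<lambda>i. term i x z) has_sum series x z) UNIV"
proof -
  define A' where "A' = \<bar>A\<bar> + 1"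
  define b' where "b' = \<bar>b\<bar>"
  have A': "norm (\<Lambda> y) \<le> A' * norm y" "A' > 0" for y
    using order_trans[OF \<Lambda>(2) mult_right_mono[of A A' "norm y"]] by (auto simp: A'_def)
  have b': "norm (B x y) \<le> b' * norm x * norm y" "b' \<ge> 0" for x y
    using order_trans[OF B(3)[unfolded mult.assoc] mult_right_mono[of b b' "norm x * norm y"]] by (auto simp: b'_def mult.assoc)
  \<comment> \<open>\<open>8 * K\<close> is the sum of all weights \<open>wt\<close>,
    \<open>2 * b'\<close> accounts for differences of the quadratic term, and the added one allows
    division by \<open>c\<close>.\<close>
  define c where "c = A' * (8 * K) + 2 * b' + 1"
  have c: "c \<ge> 1" unfolding c_def using A'(2) K b'(2) by (simp add: add_nonneg_nonneg)
  define r where "r = min (min r0 1) (min (1 / (8 * C)) (1 / (2 * c)))"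
  have r: "r > 0" "r \<le> 1" "r \<le> r0" "C * r \<le> 1 / 8" "c * r \<le> 1 / 2"
  proof -
    show "r > 0" "r \<le> 1" "r \<le> r0" using r0 C c by (auto simp: r_def)
    have "r \<le> 1 / (8 * C)" "r \<le> 1 / (2 * c)" by (auto simp: r_def)
    then show "C * r \<le> 1 / 8" "c * r \<le> 1 / 2" using C c by (auto simp: field_simps)
  qed
  define \<rho> where "\<rho> = r / (2 * c)"
  have \<rho>: "\<rho> > 0" "\<rho> \<le> r" "c * \<rho> = r / 2" using r(1) c by (auto simp: \<rho>_def field_simps)
  have hs: "((\<lambda>i. term i x z) has_sum series x z) UNIV" if "\<bar>x\<bar> \<le> \<rho>" "norm z \<le> r" for x z
    by (rule term_has_sum[OF r(1,2,4) _ that(2)]) (use that(1) \<rho>(2) in simp)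
  define \<Psi> where "\<Psi> x z = \<Lambda> (series x z) + B z z" for x z
  have zero: "psb \<rho> (\<lambda>x. \<Psi> x 0) (r / 2)"
  proof -
    have "psb \<rho> (\<lambda>x. series x 0) (\<Sum>\<^sub>\<infinity>i. \<rho> * wt i)"
      by (rule psb_infsum[OF \<rho>(1) term_at_zero[OF \<rho>(1,2) r(4)] summable_on_cmult_right[OF has_sum_imp_summable[OF wt]] hs])
         (use r in auto)
    then have "psb \<rho> (\<lambda>x. series x 0) (\<rho> * (8 * K))" by (simp add: infsum_cmult_right' infsumI[OF wt])
    from psb_linear[OF \<rho>(1) this \<Lambda>(1) A'(1)] A'(2)
    have "psb \<rho> (\<lambda>x. \<Lambda> (series x 0)) (A' * (\<rho> * (8 * K)))" by simp
    moreover have "A' * (\<rho> * (8 * K)) \<le> c * \<rho>"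
      unfolding c_def using \<rho>(1) b'(2) by (simp add: algebra_simps)
    ultimately show ?thesis
      unfolding \<Psi>_def \<rho>(3) using linear_0[OF B(2)] by (auto intro: psb_mono)
  qed
  have lip: "psb \<rho> (\<lambda>x. \<Psi> x (f x) - \<Psi> x (g x)) (d / 2)"
    if f: "psb \<rho> f r" and g: "psb \<rho> g r" and d: "psb \<rho> (\<lambda>x. f x - g x) d" for f g d
  proof -
    have d0: "d \<ge> 0" by (rule psb_nonneg[OF d \<rho>(1)])
    have "psb \<rho> (\<lambda>x. series x (f x) - series x (g x)) (\<Sum>\<^sub>\<infinity>i. r * d * wt i)"
    proof (rule psb_infsum[OF \<rho>(1) term_lipschitz[OF \<rho>(1,2) r(2,4) f g d] summable_on_cmult_right[OF has_sum_imp_summable[OF wt]]])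
      fix x assume x: "\<bar>x\<bar> \<le> \<rho>"
      show "((\<lambda>i. term i x (f x) - term i x (g x)) has_sum series x (f x) - series x (g x)) UNIV"
        using has_sum_add[OF hs[OF x psb_norm_le[OF f x]] has_sum_scaleR[OF hs[OF x psb_norm_le[OF g x]], of "-1"]] by simp
    qed
    then have "psb \<rho> (\<lambda>x. series x (f x) - series x (g x)) (r * d * (8 * K))" by (simp add: infsum_cmult_right' infsumI[OF wt])
    from psb_linear[OF \<rho>(1) this \<Lambda>(1) A'(1)] A'(2)
    have "psb \<rho> (\<lambda>x. \<Lambda> (series x (f x)) - \<Lambda> (series x (g x))) (A' * (r * d * (8 * K)))" by (simp add: linear_diff[OF \<Lambda>(1)])
    from psb_add[OF \<rho>(1) this psb_bilinear_diff[of \<rho> B, OF \<rho>(1) B(1,2) b' f g d]]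
    have "psb \<rho> (\<lambda>x. \<Psi> x (f x) - \<Psi> x (g x)) (A' * (r * d * (8 * K)) + 2 * b' * r * d)"
      by (simp add: \<Psi>_def algebra_simps)
    moreover have "A' * (r * d * (8 * K)) + 2 * b' * r * d \<le> d / 2"
    proof -
      have "A' * (r * d * (8 * K)) + 2 * b' * r * d \<le> (c * r) * d"
        unfolding c_def using r(1) d0 by (simp add: algebra_simps)
      also have "\<dots> \<le> 1 / 2 * d" by (rule mult_right_mono[OF r(5) d0])
      finally show ?thesis by simp
    qed
    ultimately show ?thesis by (rule psb_mono)
  qed
  obtain f where f: "psb \<rho> f r" "\<And>x. \<bar>x\<bar> \<le> \<rho> \<Longrightarrow> f x = \<Psi> x (f x)"
    "\<And>x z. \<bar>x\<bar> \<le> \<rho> \<Longrightarrow> norm z \<le> r \<Longrightarrow> z = \<Psi> x z \<Longrightarrow> z = f x"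
    using psb_fixed_point[of \<rho> \<Psi> r, OF \<rho>(1) zero lip] by blast
  show ?thesis
    by (rule that[OF \<rho>(1,2) r(3) f[unfolded \<Psi>_def] hs])
qed

end

section \<open>Reduction to the scaled fixed point equation\<close>

lemma mlin_scaleR: "mlin k K T \<Longrightarrow> mlin k (\<bar>c\<bar> * K) (\<lambda>vs. c *\<^sub>R T vs)"
proof (induction k arbitrary: K T)
  case 0
  then show ?case by (simp add: mult_left_mono)
next
  case (Suc k)
  have "linear (\<lambda>v. c *\<^sub>R T (v # vs))" if "length vs = k" for vs
    using Suc.prems that by (simp add: linear_compose_scale_right)
  moreover have "mlin k (\<bar>c\<bar> * K * norm v) (\<lambda>vs. c *\<^sub>R T (v # vs))" for v
    using Suc.IH[of "K * norm v" "\<lambda>vs. T (v # vs)"] Suc.prems by (simp add: mult.assoc)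
  ultimately show ?case by simp
qed

lemma mlin_Pair:
  assumes "mlin k K T" "mlin k K' T'" shows "mlin k (K + K') (\<lambda>ps. (T ps, T' ps))"
proof (rule mlinI)
  fix us ws :: "'a list" assume "Suc (length us + length ws) = k"
  then have "linear (\<lambda>v. T (us @ v # ws))" "linear (\<lambda>v. T' (us @ v # ws))"
    using mlin_slot[of us ws K T] mlin_slot[of us ws K' T'] assms by (simp_all del: mlin.simps)
  then show "linear (\<lambda>v. (T (us @ v # ws), T' (us @ v # ws)))" by (simp add: linear_iff)
next
  fix vs :: "'a list" assume l: "length vs = k"
  have "norm (T vs, T' vs) \<le> norm (T vs) + norm (T' vs)" by (rule norm_Pair_le)
  then show "norm (T vs, T' vs) \<le> (K + K') * prod_list (map norm vs)"
    using mlin_norm[OF assms(1) l] mlin_norm[OF assms(2) l] by (simp add: distrib_right)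
qed

lemma prod_list_map_le:
  fixes f g :: "'a \<Rightarrow> real"
  assumes "\<And>x. x \<in> set xs \<Longrightarrow> 0 \<le> f x \<and> f x \<le> c * g x"
  shows "0 \<le> prod_list (map f xs) \<and> prod_list (map f xs) \<le> c ^ length xs * prod_list (map g xs)"
  using assms
proof (induction xs)
  case (Cons x xs)
  have "f x * prod_list (map f xs) \<le> (c * g x) * (c ^ length xs * prod_list (map g xs))"
    using Cons by (intro mult_mono) (auto intro: order_trans)
  then show ?case using Cons by (simp add: mult_ac)
qed simp

text \<open>The constant in \<open>bounded_multilinear\<close> carries no sign. Passing to its
  absolute value needs nonnegative products, hence the condition on \<open>nrm\<close>.\<close>

lemma bounded_multilinear_bound:
  fixes T :: "'x::real_normed_vector list \<Rightarrow> 'w::real_vector list \<Rightarrow> 'y::real_normed_vector"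
  assumes "bounded_multilinear k l E nrm F T"
  obtains K where "K \<ge> 0" "\<And>vs ws. length vs = k \<Longrightarrow> length ws = l \<Longrightarrow> set ws \<subseteq> E \<Longrightarrow>
    (\<And>w. w \<in> set ws \<Longrightarrow> nrm w \<ge> 0) \<Longrightarrow> norm (T vs ws) \<le> K * prod_list (map norm vs) * prod_list (map nrm ws)"
proof -
  obtain K where K: "\<forall>vs ws. length vs = k \<and> length ws = l \<and> set ws \<subseteq> E \<longrightarrow>
        norm (T vs ws) \<le> K * prod_list (map norm vs) * prod_list (map nrm ws)"
    using assms unfolding bounded_multilinear_def by (elim conjE exE) (rule that)
  show ?thesis
  proof (rule that[of "\<bar>K\<bar>"])
    fix vs :: "'x list" and ws assume a: "length vs = k" "length ws = l" "set ws \<subseteq> E" "\<And>w. w \<in> set ws \<Longrightarrow> nrm w \<ge> 0"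
    have "prod_list (map norm vs) \<ge> 0" by (induction vs) auto
    moreover have "prod_list (map nrm ws) \<ge> 0" using a(4) by (induction ws) auto
    ultimately have "K * prod_list (map norm vs) * prod_list (map nrm ws) \<le> \<bar>K\<bar> * prod_list (map norm vs) * prod_list (map nrm ws)"
      by (intro mult_right_mono) auto
    with K a(1-3) show "norm (T vs ws) \<le> \<bar>K\<bar> * prod_list (map norm vs) * prod_list (map nrm ws)" by force
  qed simp
qed

text \<open>A map of \<open>k\<close> arguments in one space and \<open>l\<close> in another becomes
  a map of \<open>k + l\<close> arguments in one normed type, read through \<open>\<alpha>\<close>
  in the first \<open>k\<close> places and through \<open>\<kappa>\<close> in the others. The subset
  \<open>E\<close> with its own norm disappears, and mixed diagonals become diagonals.\<close>

lemma bounded_multilinear_pullback: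
  fixes T :: "'x::real_normed_vector list \<Rightarrow> 'w::real_vector list \<Rightarrow> 'y::real_normed_vector"
    and \<alpha> :: "'v::real_normed_vector \<Rightarrow> 'x" and \<kappa> :: "'v \<Rightarrow> 'w"
  assumes T: "bounded_multilinear k l E nrm F T"
    and \<alpha>: "linear \<alpha>" "\<And>p. norm (\<alpha> p) \<le> norm p"
    and \<kappa>: "linear \<kappa>" "\<And>p. \<kappa> p \<in> E" "\<And>p. 0 \<le> nrm (\<kappa> p)" "\<And>p. nrm (\<kappa> p) \<le> c * norm p" and c: "c \<ge> 0"
  shows "\<exists>K. mlin (k + l) K (\<lambda>ps. T (map \<alpha> (take k ps)) (map \<kappa> (drop k ps)))"
proof -
  have lin1: "T (vs[i := a *\<^sub>R x + b *\<^sub>R y]) ws = a *\<^sub>R T (vs[i := x]) ws + b *\<^sub>R T (vs[i := y]) ws"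
    if "length vs = k" "length ws = l" "set ws \<subseteq> E" "i < k" for vs ws i a b x y
    using T that unfolding bounded_multilinear_def by blast
  have lin2: "T vs (ws[i := a *\<^sub>R x + b *\<^sub>R y]) = a *\<^sub>R T vs (ws[i := x]) + b *\<^sub>R T vs (ws[i := y])"
    if "length vs = k" "length ws = l" "set ws \<subseteq> E" "i < l" "x \<in> E" "y \<in> E" for vs ws i a b x y
    using T that unfolding bounded_multilinear_def by blast
  obtain K where K: "K \<ge> 0" "\<And>vs ws. length vs = k \<Longrightarrow> length ws = l \<Longrightarrow> set ws \<subseteq> E \<Longrightarrow>
    (\<And>w. w \<in> set ws \<Longrightarrow> nrm w \<ge> 0) \<Longrightarrow> norm (T vs ws) \<le> K * prod_list (map norm vs) * prod_list (map nrm ws)"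
    using bounded_multilinear_bound[OF T] by blast
  have "mlin (k + l) (K * c ^ l) (\<lambda>ps. T (map \<alpha> (take k ps)) (map \<kappa> (drop k ps)))"
  proof (rule mlinI)
    fix us ws :: "'v list" assume len: "Suc (length us + length ws) = k + l"
    \<comment> \<open>The lists with zero in the free slot serve as templates: the free argument
      enters by a list update, the form in which multilinearity is given.\<close>
    define A0 where "A0 = map \<alpha> (take k (us @ 0 # ws))"
    define B0 where "B0 = map \<kappa> (drop k (us @ 0 # ws))"
    have AB: "length A0 = k" "length B0 = l" "set B0 \<subseteq> E"
      using len \<kappa>(2) by (auto simp: A0_def B0_def)
    show "linear (\<lambda>v. T (map \<alpha> (take k (us @ v # ws))) (map \<kappa> (drop k (us @ v # ws))))"
    proof (cases "length us < k")
      case True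
      have t: "map \<alpha> (take k (us @ v # ws)) = A0[length us := \<alpha> v]" "map \<kappa> (drop k (us @ v # ws)) = B0" for v
        using True unfolding A0_def B0_def by (simp_all add: take_Cons' drop_Cons' list_update_append)
      show ?thesis
        unfolding t
        using lin1[OF AB True, of 1 "\<alpha> _" 1 "\<alpha> _"] lin1[OF AB True, of _ "\<alpha> _" 0 "\<alpha> _"]
        by (intro linearI) (simp_all add: linear_add[OF \<alpha>(1)] linear_scale[OF \<alpha>(1)])
    next
      case False
      then have F: "length us - k < l" using len by simp
      have t: "map \<kappa> (drop k (us @ v # ws)) = B0[length us - k := \<kappa> v]" "map \<alpha> (take k (us @ v # ws)) = A0" for v
        using False unfolding A0_def B0_def by (simp_all add: list_update_append)
      show ?thesis
        unfolding t
        using lin2[OF AB F \<kappa>(2) \<kappa>(2), of 1 _ 1] lin2[OF AB F \<kappa>(2) \<kappa>(2), of _ _ 0]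
        by (intro linearI) (simp_all add: linear_add[OF \<kappa>(1)] linear_scale[OF \<kappa>(1)])
    qed
  next
    fix ps :: "'v list" assume len: "length ps = k + l"
    have "norm (T (map \<alpha> (take k ps)) (map \<kappa> (drop k ps)))
      \<le> K * prod_list (map norm (map \<alpha> (take k ps))) * prod_list (map nrm (map \<kappa> (drop k ps)))"
      by (rule K(2)) (use len \<kappa> in auto)
    also have "\<dots> \<le> K * (1 ^ length (take k ps) * prod_list (map norm (take k ps))) * (c ^ length (drop k ps) * prod_list (map norm (drop k ps)))"
      unfolding map_map
      using prod_list_map_le[of "take k ps" "norm \<circ> \<alpha>" 1 norm] prod_list_map_le[of "drop k ps" "nrm \<circ> \<kappa>" c norm] \<alpha>(2) \<kappa>(3,4) K(1)
      by (intro mult_mono) (auto intro!: mult_nonneg_nonneg intro: order_trans)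
    also have "\<dots> = K * c ^ l * (prod_list (map norm (take k ps)) * prod_list (map norm (drop k ps)))"
      using len by simp
    also have "prod_list (map norm (take k ps)) * prod_list (map norm (drop k ps)) = prod_list (map norm ps)"
      unfolding prod_list.append[symmetric] map_append[symmetric] append_take_drop_id ..
    finally show "norm (T (map \<alpha> (take k ps)) (map \<kappa> (drop k ps))) \<le> K * c ^ l * prod_list (map norm ps)" .
  qed
  then show ?thesis by blast
qed

lemma has_sum_Pair:
  fixes f :: "'i \<Rightarrow> 'a::real_normed_vector" and g :: "'i \<Rightarrow> 'b::real_normed_vector"
  assumes "(f has_sum a) I" "(g has_sum b) I"
  shows "((\<lambda>i. (f i, g i)) has_sum (a, b)) I"
proof -
  have "bounded_linear (\<lambda>x::'a. (x, 0::'b))" "bounded_linear (\<lambda>x::'b. (0::'a, x))"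
    by (auto intro!: bounded_linear_intro[of _ 1])
  from has_sum_add[OF has_sum_bounded_linear[OF this(1) assms(1)] has_sum_bounded_linear[OF this(2) assms(2)]]
  show ?thesis by (simp add: o_def)
qed

lemma symmetrized_scaleR: "symmetrized k (\<lambda>ps. c *\<^sub>R T ps) = (\<lambda>ps. c *\<^sub>R symmetrized k T ps)"
  by (rule ext) (simp add: symmetrized_def scaleR_sum_right)

locale bifurcation = hopf D L a b as bs \<omega> "W_per0_norm L \<theta>"
  for D :: "'h::{real_inner, complete_space} set" and L a b as bs \<omega> \<theta> +
  fixes L1 :: "'x::banach \<Rightarrow> 'y::banach" and Li
    and N :: "'x \<Rightarrow> 'h per_L2 \<Rightarrow> real \<Rightarrow> 'y \<times> 'h per_L2"
    and R :: "nat \<Rightarrow> nat \<Rightarrow> nat \<Rightarrow> 'x list \<Rightarrow> 'h per_L2 list \<Rightarrow> 'y"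
    and S :: "nat \<Rightarrow> nat \<Rightarrow> nat \<Rightarrow> 'x list \<Rightarrow> 'h per_L2 list \<Rightarrow> 'h per_L2"
    and \<delta> :: real
  assumes L1: "bounded_linear L1" and Li: "bounded_linear Li" "\<And>x. Li (L1 x) = x" "\<And>y. L1 (Li y) = y"
    and \<theta>: "- \<theta> \<in> resolvent_set D L"
    and N_range: "\<And>v w \<mu>. w \<in> W_per0 D L \<Longrightarrow> snd (N v w \<mu>) \<in> H_per0"
    and R_ml: "\<And>k l m. bounded_multilinear k l (W_per0 D L) (W_per0_norm L \<theta>) UNIV (R k l m)"
    and S_ml: "\<And>k l m. bounded_multilinear k l (W_per0 D L) (W_per0_norm L \<theta>) H_per0 (S k l m)"
    and \<delta>: "\<delta> > 0"
    and expansion: "\<And>v w \<mu>. w \<in> W_per0 D L \<Longrightarrow> norm v + W_per0_norm L \<theta> w + \<bar>\<mu>\<bar> < \<delta> \<Longrightarrow>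
             abs_convergent_expansion R v w \<mu> (fst (N v w \<mu>)) \<and>
             abs_convergent_expansion S v w \<mu> (snd (N v w \<mu>))"
    and vanishing: "\<And>k l m. k + l + m \<le> 1 \<Longrightarrow>
             multilinear_zero k l (W_per0 D L) (R k l m) \<and> multilinear_zero k l (W_per0 D L) (S k l m)"
          "multilinear_zero 0 1 (W_per0 D L) (R 0 1 1)"
          "\<And>m. m \<ge> 2 \<Longrightarrow>
             multilinear_zero 0 0 (W_per0 D L) (R 0 0 m) \<and> multilinear_zero 0 0 (W_per0 D L) (S 0 0 m)"
    and transversal: "S 0 1 1 [] [v1] \<bullet> v1s \<noteq> 0"
begin

abbreviation "nrm \<equiv> W_per0_norm L \<theta>"

text \<open>Solution operator for \<open>Q\<close> on the complement \<open>W0\<close> of the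
  kernel. Composition with \<open>P\<close> makes it linear and bounded on the whole type, and not
  only on \<open>G\<close>.\<close>

definition "J f = (THE w. w \<in> W0 \<and> Q w = P f)"

lemma W0_W: "w \<in> W0 \<Longrightarrow> w \<in> W" by (simp add: W0_def)

lemma Q_inj: "w \<in> W0 \<Longrightarrow> u \<in> W0 \<Longrightarrow> Q w = Q u \<Longrightarrow> w = u"
proof -
  assume wu: "w \<in> W0" "u \<in> W0" "Q w = Q u"
  have "Q (w + (-1) *\<^sub>R u) = 0"
    using Q_add[OF W0_W[OF wu(1)] W_scaleR(1)[OF W0_W[OF wu(2)], of "-1"]] Q_scaleR[OF W0_W[OF wu(2)], of "-1"] wu(3) by simp
  from Q_inj_W0[OF subspace_add[OF subspace_W0 wu(1) subspace_scale[OF subspace_W0 wu(2)]] this]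
  show ?thesis by simp
qed

lemma J: "J f \<in> W0" "Q (J f) = P f"
proof -
  have "P f \<in> Q ` W0" unfolding Q_image_W0 by (rule P_G)
  then obtain w where w: "w \<in> W0" "Q w = P f" by (metis imageE)
  have "J f = w" unfolding J_def
  proof (rule the_equality)
    fix u assume "u \<in> W0 \<and> Q u = P f"
    then show "u = w" using Q_inj[of u w] w by simp
  qed (use w in simp)
  with w show "J f \<in> W0" "Q (J f) = P f" by simp_all
qed

lemma J_eq: "w \<in> W0 \<Longrightarrow> Q w = P f \<Longrightarrow> J f = w"
  using Q_inj[OF J(1)] J(2) by simp

lemma linear_J: "linear J"
proof (rule linearI)
  fix f g c
  show "J (f + g) = J f + J g"
    by (rule J_eq) (simp_all add: subspace_add[OF subspace_W0] J Q_add W0_W linear_add[OF linear_P])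
  show "J (c *\<^sub>R f) = c *\<^sub>R J f"
    by (rule J_eq) (simp_all add: subspace_scale[OF subspace_W0] J Q_scaleR W0_W linear_scale[OF linear_P])
qed

lemma bounded_J:
  obtains C where "C \<ge> 0" "\<And>f. nrm (J f) \<le> C * norm f" "\<And>f. norm (time_deriv (J f)) \<le> C * norm f"
proof -
  obtain CQ where CQ: "CQ \<ge> 0" "\<And>w. w \<in> W0 \<Longrightarrow> norm w \<le> CQ * norm (Q w) \<and> norm (time_deriv w) \<le> CQ * norm (Q w) \<and> norm (lft w) \<le> CQ * norm (Q w)"
    using bounded_inverse by blast
  obtain CP where CP: "CP \<ge> 0" "\<And>f. norm (P f) \<le> CP * norm f" using bounded_P by blast
  define t where "t = \<bar>Re \<theta>\<bar> + \<bar>Im \<theta>\<bar>"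
  have t: "t \<ge> 0" by (simp add: t_def)
  have q: "CQ * norm (Q (J f)) \<le> CQ * CP * norm f" for f
    using mult_left_mono[OF CP(2)[of f] CQ(1)] J(2) by (simp add: mult.assoc)
  show ?thesis
  proof (rule that[of "(2 + t) * (CQ * CP)"])
    show "(2 + t) * (CQ * CP) \<ge> 0" using CQ CP t by simp
    fix f
    note b = CQ(2)[OF J(1)[of f]]
    have n: "norm (J f) \<le> CQ * CP * norm f" "norm (time_deriv (J f)) \<le> CQ * CP * norm f" "norm (lft (J f)) \<le> CQ * CP * norm f"
      using b q[of f] by linarith+
    have "nrm (J f) \<le> norm (lft (J f)) + t * norm (J f) + norm (time_deriv (J f))"
      using W_norm_upper[OF W0_W[OF J(1)]] by (simp add: t_def)
    also have "\<dots> \<le> CQ * CP * norm f + t * (CQ * CP * norm f) + CQ * CP * norm f"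
      using n t by (intro add_mono mult_left_mono) auto
    finally show "nrm (J f) \<le> (2 + t) * (CQ * CP) * norm f" by (simp add: algebra_simps)
    have "0 \<le> CQ * CP * norm f" using CQ CP by simp
    then have "CQ * CP * norm f \<le> (2 + t) * (CQ * CP * norm f)" using t mult_right_mono[of 1 "2 + t"] by fastforce
    then show "norm (time_deriv (J f)) \<le> (2 + t) * (CQ * CP) * norm f" using n(2) by (simp add: mult.assoc)
  qed
qed

text \<open>Chart for the functions in \<open>W\<close> with \<open>w \<bullet> v2s = 0\<close>: the
  middle coordinate is \<open>Q w\<close>, the last one the amplitude
  \<open>w \<bullet> v1s\<close>. The first coordinate, belonging to \<open>v\<close>, is carried
  along so that a single variable holds both unknowns.\<close>

definition \<kappa> :: "'x \<times> 'h per_L2 \<times> real \<Rightarrow> 'h per_L2" where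
  "\<kappa> p = J (fst (snd p)) + snd (snd p) *\<^sub>R v1"

lemma linear_\<kappa>: "linear \<kappa>"
  by (rule linearI) (simp_all add: \<kappa>_def linear_add[OF linear_J] linear_scale[OF linear_J] algebra_simps)

lemma \<kappa>_W: "\<kappa> p \<in> W"
  unfolding \<kappa>_def by (intro subspace_add[OF subspace_W] subspace_scale[OF subspace_W] W0_W J v1_W)

lemma \<kappa>_inner: "\<kappa> p \<bullet> v1s = snd (snd p)" "\<kappa> p \<bullet> v2s = 0"
  using J(1)[of "fst (snd p)"] by (simp_all add: \<kappa>_def W0_def inner_add_left biorthogonal)

lemma Q_\<kappa>: "Q (\<kappa> p) = P (fst (snd p))"
  using Q_add[OF W0_W[OF J(1)] W_scaleR(1)[OF v1_W]] by (simp add: \<kappa>_def Q_scaleR v1_W Q_v1 J)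

lemma time_deriv_\<kappa>: "time_deriv (\<kappa> p) = time_deriv (J (fst (snd p))) + snd (snd p) *\<^sub>R v2"
  by (simp add: \<kappa>_def W_add W_scaleR W0_W J v1_W time_deriv_eq[OF deriv_v1])

lemma bounded_\<kappa>:
  obtains C where "C \<ge> 0" "\<And>p. 0 \<le> nrm (\<kappa> p)" "\<And>p. nrm (\<kappa> p) \<le> C * norm p" "\<And>p. norm (time_deriv (\<kappa> p)) \<le> C * norm p"
proof -
  obtain CJ where CJ: "CJ \<ge> 0" "\<And>f. nrm (J f) \<le> CJ * norm f" "\<And>f. norm (time_deriv (J f)) \<le> CJ * norm f"
    using bounded_J by blast
  obtain KW where KW: "KW > 0" "\<And>w. w \<in> W \<Longrightarrow> norm w \<le> KW * nrm w" "\<And>w. w \<in> W \<Longrightarrow> norm (lft w) \<le> KW * nrm w"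
    "\<And>w. w \<in> W \<Longrightarrow> norm (time_deriv w) \<le> KW * nrm w" using W_norm_lower[OF \<theta>] by blast
  define t where "t = \<bar>Re \<theta>\<bar> + \<bar>Im \<theta>\<bar>"
  have t: "t \<ge> 0" by (simp add: t_def)
  define c where "c = (2 + t) * KW"
  have c0: "c \<ge> 0" using t KW by (simp add: c_def)
  define d where "d = norm (lft v1) + t * norm v1 + norm v2"
  have d0: "d \<ge> 0" using t by (simp add: d_def)
  have p: "norm (fst (snd p)) \<le> norm p" "\<bar>snd (snd p)\<bar> \<le> norm p" for p :: "'x \<times> 'h per_L2 \<times> real"
    using norm_snd_le[of "snd p" "fst p"] norm_fst_le[of "fst (snd p)" "snd (snd p)"] norm_snd_le[of "snd (snd p)" "fst (snd p)"]
    by (auto intro: order_trans)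
  have main: "norm (lft (\<kappa> p)) \<le> (KW * CJ + d) * norm p \<and> norm (\<kappa> p) * t \<le> (t * (KW * CJ) + d) * norm p \<and> norm (time_deriv (\<kappa> p)) \<le> (KW * CJ + d) * norm p" for p
  proof -
    let ?f = "fst (snd p)" and ?\<alpha> = "snd (snd p)"
    note JW = W0_W[OF J(1)[of ?f]]
    have k: "KW * nrm (J ?f) \<le> KW * CJ * norm p"
      using mult_left_mono[OF order_trans[OF CJ(2) mult_left_mono[OF p(1) CJ(1)]], of KW] KW(1) by (simp add: mult.assoc)
    have dd: "\<bar>?\<alpha>\<bar> * norm (lft v1) \<le> d * norm p" "\<bar>?\<alpha>\<bar> * (t * norm v1) \<le> d * norm p" "\<bar>?\<alpha>\<bar> * norm v2 \<le> d * norm p"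
      using mult_mono[OF p(2), of _ d] t by (simp_all add: d_def mult.commute[of _ "norm p"])
    have "lft (\<kappa> p) = lft (J ?f) + ?\<alpha> *\<^sub>R lft v1" by (simp add: \<kappa>_def W_add W_scaleR JW v1_W)
    then have 1: "norm (lft (\<kappa> p)) \<le> KW * CJ * norm p + d * norm p"
      using norm_triangle_ineq[of "lft (J ?f)" "?\<alpha> *\<^sub>R lft v1"] KW(3)[OF JW] k dd(1) by simp
    have 3: "norm (time_deriv (\<kappa> p)) \<le> KW * CJ * norm p + d * norm p"
      unfolding time_deriv_\<kappa> using norm_triangle_ineq[of "time_deriv (J ?f)" "?\<alpha> *\<^sub>R v2"] KW(4)[OF JW] k dd(3) by simp
    have "norm (\<kappa> p) \<le> KW * CJ * norm p + \<bar>?\<alpha>\<bar> * norm v1"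
      unfolding \<kappa>_def using norm_triangle_ineq[of "J ?f" "?\<alpha> *\<^sub>R v1"] KW(2)[OF JW] k by simp
    from mult_right_mono[OF this t] have 2: "norm (\<kappa> p) * t \<le> t * (KW * CJ) * norm p + d * norm p"
      using dd(2) by (simp add: algebra_simps)
    from 1 2 3 show ?thesis by (simp add: distrib_right)
  qed
  show ?thesis
  proof (rule that[of "(2 + t) * (KW * CJ) + 3 * d"])
    show "(2 + t) * (KW * CJ) + 3 * d \<ge> 0" using t KW CJ d0 by simp
    fix p
    show "0 \<le> nrm (\<kappa> p)" by (rule W_norm_sq(2)[OF \<kappa>_W])
    have "nrm (\<kappa> p) \<le> norm (lft (\<kappa> p)) + norm (\<kappa> p) * t + norm (time_deriv (\<kappa> p))"
      using W_norm_upper[OF \<kappa>_W[of p], of \<theta>] by (simp add: t_def mult.commute)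
    also have "\<dots> \<le> (KW * CJ + d) * norm p + (t * (KW * CJ) + d) * norm p + (KW * CJ + d) * norm p"
      using main[of p] by linarith
    finally show "nrm (\<kappa> p) \<le> ((2 + t) * (KW * CJ) + 3 * d) * norm p" by (simp add: algebra_simps)
    have "0 \<le> KW * CJ" "0 \<le> t * (KW * CJ)" using t KW(1) CJ(1) by simp_all
    then have "KW * CJ + d \<le> (2 + t) * (KW * CJ) + 3 * d"
      using d0 unfolding distrib_right by linarith
    from mult_right_mono[OF this norm_ge_zero[of p]] main[of p]
    show "norm (time_deriv (\<kappa> p)) \<le> ((2 + t) * (KW * CJ) + 3 * d) * norm p" by linarith
  qed
qed

section \<open>Expansion and uniform bounds in the chart\<close>

definition U :: "nat \<times> nat \<times> nat \<Rightarrow> ('x \<times> 'h per_L2 \<times> real) list \<Rightarrow> 'y \<times> 'h per_L2" where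
  "U i = (case i of (k, l, m) \<Rightarrow> symmetrized (k + l)
     (\<lambda>ps. (R k l m (map fst (take k ps)) (map \<kappa> (drop k ps)), S k l m (map fst (take k ps)) (map \<kappa> (drop k ps)))))"

text \<open>The symmetrization in \<open>U\<close> is invisible on diagonals, the only values that
  enter the expansion.\<close>

lemma U_replicate:
  "U (k, l, m) (replicate (k + l) p) = (R k l m (replicate k (fst p)) (replicate l (\<kappa> p)), S k l m (replicate k (fst p)) (replicate l (\<kappa> p)))"
  by (simp add: U_def symmetrized_replicate)

definition "tR p \<mu> i = (case i of (k, l, m) \<Rightarrow> \<mu> ^ m *\<^sub>R R k l m (replicate k (fst p)) (replicate l (\<kappa> p)))"
definition "tS p \<mu> i = (case i of (k, l, m) \<Rightarrow> \<mu> ^ m *\<^sub>R S k l m (replicate k (fst p)) (replicate l (\<kappa> p)))"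

lemma U_expansion:
  obtains \<delta>1 where "\<delta>1 > 0" "\<And>p \<mu>. norm p < \<delta>1 \<Longrightarrow> \<bar>\<mu>\<bar> < \<delta>1 \<Longrightarrow>
     ((\<lambda>(k, l, m). \<mu> ^ m *\<^sub>R U (k, l, m) (replicate (k + l) p)) has_sum N (fst p) (\<kappa> p) \<mu>) UNIV"
   "\<And>p \<mu>. norm p < \<delta>1 \<Longrightarrow> \<bar>\<mu>\<bar> < \<delta>1 \<Longrightarrow> (\<lambda>i. norm (tR p \<mu> i)) summable_on UNIV \<and> (\<lambda>i. norm (tS p \<mu> i)) summable_on UNIV"
proof -
  obtain C where C: "C \<ge> 0" "\<And>p. 0 \<le> nrm (\<kappa> p)" "\<And>p. nrm (\<kappa> p) \<le> C * norm p"
    by (rule bounded_\<kappa>) (rule that)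
  \<comment> \<open>The three summands of the smallness condition in \<open>expansion\<close> are
    then below \<open>\<delta>1\<close>, \<open>C * \<delta>1\<close> and
    \<open>\<delta>1\<close>.\<close>
  define \<delta>1 where "\<delta>1 = \<delta> / (2 + C)"
  have small: "norm (fst p) + nrm (\<kappa> p) + \<bar>\<mu>\<bar> < \<delta>" if "norm p < \<delta>1" "\<bar>\<mu>\<bar> < \<delta>1" for p \<mu>
  proof -
    have "norm (fst p) \<le> norm p" using norm_fst_le[of "fst p" "snd p"] by simp
    moreover have "C * norm p \<le> C * \<delta>1" using that C(1) by (intro mult_left_mono) auto
    ultimately have "norm (fst p) + nrm (\<kappa> p) + \<bar>\<mu>\<bar> < \<delta>1 + C * \<delta>1 + \<delta>1"
      using that C(3)[of p] by linarith
    also have "\<dots> = \<delta>1 * (2 + C)" by (simp add: algebra_simps)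
    also have "\<dots> = \<delta>" using C(1) by (simp add: \<delta>1_def)
    finally show ?thesis .
  qed
  show ?thesis
  proof (rule that[of \<delta>1])
    show "\<delta>1 > 0" using \<delta> C(1) by (simp add: \<delta>1_def)
    fix p :: "'x \<times> 'h per_L2 \<times> real" and \<mu> assume "norm p < \<delta>1" "\<bar>\<mu>\<bar> < \<delta>1"
    from expansion[OF \<kappa>_W small[OF this]]
    have ex: "(tR p \<mu> has_sum fst (N (fst p) (\<kappa> p) \<mu>)) UNIV" "(tS p \<mu> has_sum snd (N (fst p) (\<kappa> p) \<mu>)) UNIV"
      and ab: "(\<lambda>i. norm (tR p \<mu> i)) summable_on UNIV \<and> (\<lambda>i. norm (tS p \<mu> i)) summable_on UNIV"
      unfolding abs_convergent_expansion_def tR_def[abs_def] tS_def[abs_def] by simp_all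
    from has_sum_Pair[OF ex]
    show "((\<lambda>(k, l, m). \<mu> ^ m *\<^sub>R U (k, l, m) (replicate (k + l) p)) has_sum N (fst p) (\<kappa> p) \<mu>) UNIV"
      by (simp add: U_replicate tR_def tS_def case_prod_unfold)
    show "(\<lambda>i. norm (tR p \<mu> i)) summable_on UNIV \<and> (\<lambda>i. norm (tS p \<mu> i)) summable_on UNIV"
      by (rule ab)
  qed
qed

text \<open>Absolute convergence at the single parameter value \<open>\<mu>0\<close> bounds the
  weighted diagonals over all degrees at each point, which is the input of
  \<open>uniform_symmetrization\<close>. Undoing the weight \<open>\<mu>0 ^ m\<close> costs a
  geometric factor in \<open>m\<close>.\<close>

lemma U_bound:
  obtains M C where "M \<ge> 0" "C \<ge> 1" "\<And>k l m. mlin (k + l) (M * C ^ (k + l + m)) (U (k, l, m))"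
proof -
  obtain \<delta>1 where \<delta>1: "\<delta>1 > 0" "\<And>p \<mu>. norm p < \<delta>1 \<Longrightarrow> \<bar>\<mu>\<bar> < \<delta>1 \<Longrightarrow> (\<lambda>i. norm (tR p \<mu> i)) summable_on UNIV \<and> (\<lambda>i. norm (tS p \<mu> i)) summable_on UNIV"
    by (rule U_expansion) (rule that)
  obtain c where c: "c \<ge> 0" "\<And>p. 0 \<le> nrm (\<kappa> p)" "\<And>p. nrm (\<kappa> p) \<le> c * norm p"
    by (rule bounded_\<kappa>) (rule that)
  define \<mu>0 where "\<mu>0 = \<delta>1 / 2"
  have \<mu>0: "\<mu>0 > 0" "\<bar>\<mu>0\<bar> < \<delta>1" using \<delta>1 by (auto simp: \<mu>0_def)
  define T where "T i ps = (case i of (k, l, m) \<Rightarrow> (R k l m (map fst (take k ps)) (map \<kappa> (drop k ps)), S k l m (map fst (take k ps)) (map \<kappa> (drop k ps))))"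
    for i and ps :: "('x \<times> 'h per_L2 \<times> real) list"
  define dg where "dg i = (case i of (k, l, m) \<Rightarrow> k + l)" for i :: "nat \<times> nat \<times> nat"
  define T' where "T' i ps = \<mu>0 ^ snd (snd i) *\<^sub>R T i ps" for i ps
  have nf: "norm (fst p) \<le> norm p" for p :: "'x \<times> 'h per_L2 \<times> real" using norm_fst_le[of "fst p" "snd p"] by simp
  have "\<exists>K. mlin (dg i) K (T' i)" for i
  proof -
    obtain k l m where i: "i = (k, l, m)" by (cases i) auto
    obtain K1 K2 where "mlin (k + l) K1 (\<lambda>ps. R k l m (map fst (take k ps)) (map \<kappa> (drop k ps)))"
      "mlin (k + l) K2 (\<lambda>ps. S k l m (map fst (take k ps)) (map \<kappa> (drop k ps)))"
      using bounded_multilinear_pullback[OF R_ml linear_fst nf linear_\<kappa> \<kappa>_W c(2,3,1)]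
        bounded_multilinear_pullback[OF S_ml linear_fst nf linear_\<kappa> \<kappa>_W c(2,3,1)] by blast
    from mlin_scaleR[OF mlin_Pair[OF this], of "\<mu>0 ^ m"] show ?thesis
      unfolding T'_def T_def dg_def i by auto
  qed
  then obtain Kf where Kf: "\<And>i. mlin (dg i) (Kf i) (T' i)" by metis
  have bdd: "\<exists>B. \<forall>i. norm (T' i (replicate (dg i) p)) \<le> B" if p: "norm p < \<delta>1" for p
  proof -
    define f1 f2 where "f1 = tR p \<mu>0" and "f2 = tS p \<mu>0"
    have s: "(\<lambda>i. norm (f1 i)) summable_on UNIV" "(\<lambda>i. norm (f2 i)) summable_on UNIV"
      using \<delta>1(2)[OF p \<mu>0(2)] unfolding f1_def f2_def by blast+
    have le: "f i \<le> infsum f UNIV" if "f summable_on UNIV" "\<And>i. f i \<ge> 0" for f :: "nat \<times> nat \<times> nat \<Rightarrow> real" and i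
      using finite_sum_le_infsum[OF that(1), of "{i}"] that(2) by simp
    have "norm (T' i (replicate (dg i) p)) \<le> infsum (\<lambda>i. norm (f1 i)) UNIV + infsum (\<lambda>i. norm (f2 i)) UNIV" for i
    proof -
      have "T' i (replicate (dg i) p) = (f1 i, f2 i)"
        by (cases i) (simp add: T'_def T_def dg_def f1_def f2_def tR_def tS_def)
      then show ?thesis
        using norm_Pair_le[of "f1 i" "f2 i"] le[OF s(1), of i] le[OF s(2), of i] by simp
    qed
    then show ?thesis by blast
  qed
  obtain M C where MC: "M > 0" "C > 0" "\<And>i. mlin (dg i) (M * C ^ dg i) (symmetrized (dg i) (T' i))"
    using uniform_symmetrization[OF Kf \<delta>1(1) bdd] by blast
  \<comment> \<open>One rate for the total degree: it dominates \<open>C\<close> in the arguments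
    and \<open>1 / \<mu>0\<close> in the parameter, and is at least one.\<close>
  define C' where "C' = max 1 (max C (1 / \<mu>0))"
  show ?thesis
  proof (rule that[of M C'])
    fix k l m
    have "mlin (k + l) (\<bar>(1 / \<mu>0) ^ m\<bar> * (M * C ^ (k + l))) (\<lambda>ps. (1 / \<mu>0) ^ m *\<^sub>R symmetrized (k + l) (T' (k, l, m)) ps)"
      using mlin_scaleR[OF MC(3)[of "(k, l, m)"], of "(1 / \<mu>0) ^ m"] by (simp add: dg_def)
    moreover have "(\<lambda>ps. (1 / \<mu>0) ^ m *\<^sub>R symmetrized (k + l) (T' (k, l, m)) ps) = U (k, l, m)"
    proof -
      have "T' (k, l, m) = (\<lambda>ps. \<mu>0 ^ m *\<^sub>R T (k, l, m) ps)" by (simp add: T'_def fun_eq_iff)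
      then have "symmetrized (k + l) (T' (k, l, m)) = (\<lambda>ps. \<mu>0 ^ m *\<^sub>R symmetrized (k + l) (T (k, l, m)) ps)"
        by (simp only: symmetrized_scaleR)
      moreover have "U (k, l, m) = symmetrized (k + l) (T (k, l, m))" by (simp add: U_def T_def[abs_def])
      ultimately show ?thesis using \<mu>0(1) by (simp add: power_one_over)
    qed
    moreover have "\<bar>(1 / \<mu>0) ^ m\<bar> * (M * C ^ (k + l)) \<le> M * C' ^ (k + l + m)"
    proof -
      have "(1 / \<mu>0) ^ m \<le> C' ^ m" "C ^ (k + l) \<le> C' ^ (k + l)"
        using \<mu>0(1) MC(2) by (auto intro!: power_mono simp: C'_def)
      then have "(1 / \<mu>0) ^ m * C ^ (k + l) \<le> C' ^ m * C' ^ (k + l)"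
        using \<mu>0(1) MC(2) by (intro mult_mono) (auto simp: C'_def)
      from mult_left_mono[OF this less_imp_le[OF MC(1)]] show ?thesis
        using \<mu>0(1) by (simp add: power_add mult_ac)
    qed
    ultimately show "mlin (k + l) (M * C' ^ (k + l + m)) (U (k, l, m))" using mlin_mono by metis
  qed (use MC(1) in \<open>auto simp: C'_def\<close>)
qed

definition "s = S 0 1 1 [] [v1]"
definition e0 :: "'x \<times> 'h per_L2 \<times> real" where "e0 = (0, 0, 1)"

lemma \<kappa>_e0: "\<kappa> e0 = v1" by (simp add: \<kappa>_def e0_def linear_0[OF linear_J])

lemma U_vanish: "U (0, 0, m) [] = 0" "k + l = 1 \<Longrightarrow> U (k, l, 0) [p] = 0"
proof -
  have "multilinear_zero 0 0 (W_per0 D L) (R 0 0 m) \<and> multilinear_zero 0 0 (W_per0 D L) (S 0 0 m)"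
    using vanishing(1)[of 0 0 m] vanishing(3)[of m] by (cases "m \<ge> 2") auto
  then show "U (0, 0, m) [] = 0"
    using U_replicate[of 0 0 m] by (simp add: multilinear_zero_def zero_prod_def)
  assume kl: "k + l = 1"
  then have "multilinear_zero k l (W_per0 D L) (R k l 0) \<and> multilinear_zero k l (W_per0 D L) (S k l 0)"
    by (intro vanishing(1)) simp
  moreover have "set (replicate l (\<kappa> p)) \<subseteq> W" using \<kappa>_W[of p] by auto
  ultimately have "R k l 0 (replicate k (fst p)) (replicate l (\<kappa> p)) = 0" "S k l 0 (replicate k (fst p)) (replicate l (\<kappa> p)) = 0"
    unfolding multilinear_zero_def by (metis length_replicate)+
  then show "U (k, l, 0) [p] = 0"
    using U_replicate[of k l 0 p] kl by (simp add: zero_prod_def)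
qed

text \<open>Of the terms linear in the argument and in the parameter only the transversality term
  contributes at leading order: \<open>e0\<close> has no component in the first space, and the first
  component of the other term vanishes by hypothesis.\<close>

lemma U_e0: "U (1, 0, 1) [e0] = 0" "U (0, 1, 1) [e0] = (0, s)"
proof -
  have z: "T [0] [] = 0" if "bounded_multilinear 1 0 E nr F T" for T :: "'x list \<Rightarrow> 'h per_L2 list \<Rightarrow> 'q::real_normed_vector" and E nr F
  proof (rule bounded_multilinear_bound[OF that])
    fix K assume a: "\<And>vs ws. length vs = 1 \<Longrightarrow> length ws = 0 \<Longrightarrow> set ws \<subseteq> E \<Longrightarrow>
      (\<And>w. w \<in> set ws \<Longrightarrow> nr w \<ge> 0) \<Longrightarrow> norm (T vs ws) \<le> K * prod_list (map norm vs) * prod_list (map nr ws)"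
    from a[of "[0]" "[]"] show "T [0] [] = 0" by simp
  qed
  show "U (1, 0, 1) [e0] = 0"
    using U_replicate[of 1 0 1 e0] z[OF R_ml, of 1] z[OF S_ml, of 1] by (simp add: e0_def zero_prod_def)
  have "R 0 1 1 [] [v1] = 0" using vanishing(2) v1_W by (simp add: multilinear_zero_def)
  then show "U (0, 1, 1) [e0] = (0, s)"
    using U_replicate[of 0 1 1 e0] by (simp add: \<kappa>_e0 s_def)
qed

section \<open>The scaled system and its fixed point form\<close>

definition "c0 = s \<bullet> v1s"

lemma c0: "c0 \<noteq> 0" using transversal by (simp add: c0_def s_def)

text \<open>The unknown \<open>z\<close> consists of the scaled \<open>v\<close>, the scaled image
  under \<open>Q\<close>, the frequency shift and the parameter. The amplitude coordinate of
  \<open>pr z\<close> is zero because \<open>e0\<close> already carries it.\<close>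

definition pr :: "'x \<times> 'h per_L2 \<times> real \<times> real \<Rightarrow> 'x \<times> 'h per_L2 \<times> real" where "pr z = (fst z, fst (snd z), 0)"
definition om :: "'x \<times> 'h per_L2 \<times> real \<times> real \<Rightarrow> real" where "om z = fst (snd (snd z))"
definition mu :: "'x \<times> 'h per_L2 \<times> real \<times> real \<Rightarrow> real" where "mu z = snd (snd (snd z))"

text \<open>Inverse of the linear part of the scaled system in the unknowns \<open>v\<close>, \<open>Q w\<close>, frequency shift
  and parameter; the last two solve the equations obtained by pairing with \<open>v2s\<close> and \<open>v1s\<close>;
  \<open>Bi\<close> is the quadratic term produced by the frequency shift.\<close>

definition \<Lambda> :: "'y \<times> 'h per_L2 \<Rightarrow> 'x \<times> 'h per_L2 \<times> real \<times> real" where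
  "\<Lambda> q = (Li (fst q), P (snd q) - ((snd q \<bullet> v1s) / c0) *\<^sub>R P s,
     - (snd q \<bullet> v2s) + (snd q \<bullet> v1s) * (s \<bullet> v2s) / c0, - (snd q \<bullet> v1s) / c0)"

definition Bi :: "'x \<times> 'h per_L2 \<times> real \<times> real \<Rightarrow> 'x \<times> 'h per_L2 \<times> real \<times> real \<Rightarrow> 'x \<times> 'h per_L2 \<times> real \<times> real" where
  "Bi z z' = (0, - om z *\<^sub>R P (time_deriv (J (fst (snd z')))), 0, 0)"

definition arg :: "real \<Rightarrow> 'x \<times> 'h per_L2 \<times> real \<times> real \<Rightarrow> 'x \<times> 'h per_L2 \<times> real" where
  "arg \<epsilon> z = \<epsilon> *\<^sub>R (e0 + pr z)"

lemma P_v2: "P v2 = 0"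
  using P_H[of v2] W_D(3)[OF v2_W] by (simp add: H_per0_def biorthogonal)

lemma deriv_J_pairing: "time_deriv (J f) \<bullet> v1s = 0" "time_deriv (J f) \<bullet> v2s = 0" "time_deriv (J f) \<in> G"
proof -
  have wd: "has_weak_deriv (J f) (time_deriv (J f))" by (rule W_D(2)[OF W0_W[OF J(1)]])
  show 1: "time_deriv (J f) \<bullet> v1s = 0" and 2: "time_deriv (J f) \<bullet> v2s = 0"
    using deriv_pairing[OF wd] J(1)[of f] by (simp_all add: W0_def)
  show "time_deriv (J f) \<in> G" using 1 2 mean_value_weak_deriv[OF wd] by (simp add: G_def)
qed

text \<open>The last two components of the fixed point equation give back the solvability conditions
  \<open>snd q \<bullet> v1s = 0\<close> and \<open>snd q \<bullet> v2s = - om z\<close>; under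
  these the projected equation is the full one.\<close>

lemma fixed_point_imp_system:
  assumes z: "z = \<Lambda> (q - (0, mu z *\<^sub>R s)) + Bi z z" and q: "snd q \<in> H_per0"
  shows "L1 (fst z) = fst q" "P (fst (snd z)) + om z *\<^sub>R (time_deriv (J (fst (snd z))) + v2) = snd q"
proof -
  obtain y g o' m where zz: "z = (y, g, o', m)" by (cases z) auto
  let ?q = "snd q - m *\<^sub>R s"
  have y: "y = Li (fst q)" using arg_cong[OF z, of fst] by (simp add: zz \<Lambda>_def Bi_def mu_def)
  have g: "g = P ?q - ((?q \<bullet> v1s) / c0) *\<^sub>R P s - o' *\<^sub>R P (time_deriv (J g))"
    using arg_cong[OF z, of "\<lambda>z. fst (snd z)"] by (simp add: zz \<Lambda>_def Bi_def mu_def om_def)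
  have o': "o' = - (?q \<bullet> v2s) + (?q \<bullet> v1s) * (s \<bullet> v2s) / c0"
    using arg_cong[OF z, of "\<lambda>z. fst (snd (snd z))"] by (simp add: zz \<Lambda>_def Bi_def mu_def)
  have m: "m = - (?q \<bullet> v1s) / c0"
    using arg_cong[OF z, of "\<lambda>z. snd (snd (snd z))"] by (simp add: zz \<Lambda>_def Bi_def mu_def)
  show "L1 (fst z) = fst q" by (simp add: zz y Li)
  have q1: "?q \<bullet> v1s = - m * c0" using m c0 by (simp add: field_simps)
  then have s1: "snd q \<bullet> v1s = 0" by (simp add: inner_diff_left c0_def)
  have s2: "o' = - (snd q \<bullet> v2s)" using o' c0 unfolding q1 by (simp add: inner_diff_left)
  have d: "P (time_deriv (J g)) = time_deriv (J g)" by (rule P_id[OF deriv_J_pairing(3)])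
  have "P ?q = P (snd q) - m *\<^sub>R P s" by (simp add: linear_diff[OF linear_P] linear_scale[OF linear_P])
  then have g2: "g = P (snd q) - o' *\<^sub>R time_deriv (J g)"
    using g c0 unfolding q1 d by simp
  have Pg: "P g = g"
  proof (rule P_id)
    have "P (snd q) - o' *\<^sub>R time_deriv (J g) \<in> G"
      by (intro subspace_diff[OF subspace_G] subspace_scale[OF subspace_G] P_G deriv_J_pairing)
    then show "g \<in> G" using g2 by simp
  qed
  have "P g + o' *\<^sub>R time_deriv (J g) = P (snd q)" unfolding Pg using g2 by (metis diff_add_cancel)
  moreover have "P (snd q) = snd q - o' *\<^sub>R v2"
    unfolding P_H[OF q] s1 s2 by simp
  ultimately show "P (fst (snd z)) + om z *\<^sub>R (time_deriv (J (fst (snd z))) + v2) = snd q"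
    by (simp add: zz om_def scaleR_add_right algebra_simps)
qed

text \<open>The number \<open>m\<close> is free: what \<open>\<Lambda>\<close> loses by subtracting
  \<open>m *\<^sub>R s\<close> from the second component is returned through its last three
  components.\<close>

lemma system_imp_fixed_point:
  assumes y: "L1 y = fst q" and g: "g \<in> G" and eq: "g + o' *\<^sub>R (time_deriv (J g) + v2) = snd q"
  shows "(y, g, o', m) = \<Lambda> (q - (0, m *\<^sub>R s)) + Bi (y, g, o', m) (y, g, o', m)"
proof -
  have q1: "snd q \<bullet> v1s = 0" and q2: "snd q \<bullet> v2s = - o'"
    using g unfolding eq[symmetric] by (simp_all add: G_def inner_add_left deriv_J_pairing biorthogonal)
  have "P (snd q) = g + o' *\<^sub>R time_deriv (J g)"
    unfolding eq[symmetric]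
    by (simp add: linear_add[OF linear_P] linear_scale[OF linear_P] P_id[OF g] P_id[OF deriv_J_pairing(3)] P_v2)
  then have "P (snd q - m *\<^sub>R s) = g + o' *\<^sub>R time_deriv (J g) - m *\<^sub>R P s"
    by (simp add: linear_diff[OF linear_P] linear_scale[OF linear_P])
  moreover have "Li (fst q) = y" using y Li(2)[of y] by simp
  moreover have "(snd q - m *\<^sub>R s) \<bullet> v1s = - m * c0" "(snd q - m *\<^sub>R s) \<bullet> v2s = - o' - m * (s \<bullet> v2s)"
    using q1 q2 by (simp_all add: inner_diff_left c0_def)
  ultimately show ?thesis
    using c0 by (simp add: \<Lambda>_def Bi_def om_def P_id[OF deriv_J_pairing(3)])
qed

text \<open>The left-hand sides are homogeneous in \<epsilon> because \<open>arg\<close> is. The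
  part of the frequency equal to \<omega> goes into \<open>Q\<close>, so only the shift remains
  visible; it acts on \<open>v2\<close>, the derivative of the leading direction, as well.\<close>

lemma system_scaled:
  fixes \<epsilon> :: real and z :: "'x \<times> 'h per_L2 \<times> real \<times> real"
  assumes \<epsilon>: "\<epsilon> \<noteq> 0"
  defines "v \<equiv> fst (arg \<epsilon> z)" and "w \<equiv> \<kappa> (arg \<epsilon> z)"
  shows "solves_system L1 D L N v w (\<omega> + om z) \<mu> \<longleftrightarrow>
    L1 (fst z) = fst ((1 / \<epsilon>) *\<^sub>R N v w \<mu>) \<and>
    P (fst (snd z)) + om z *\<^sub>R (time_deriv (J (fst (snd z))) + v2) = snd ((1 / \<epsilon>) *\<^sub>R N v w \<mu>)"
proof -
  have v: "v = \<epsilon> *\<^sub>R fst z" by (simp add: v_def arg_def e0_def pr_def)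
  have a: "fst (snd (arg \<epsilon> z)) = \<epsilon> *\<^sub>R fst (snd z)" "snd (snd (arg \<epsilon> z)) = \<epsilon>" by (simp_all add: arg_def e0_def pr_def)
  have td: "time_deriv w = \<epsilon> *\<^sub>R (time_deriv (J (fst (snd z))) + v2)"
    unfolding w_def time_deriv_\<kappa> a linear_scale[OF linear_J] W_scaleR(3)[OF W0_W[OF J(1)]] by (simp add: scaleR_add_right)
  have "(\<omega> + om z) *\<^sub>R time_deriv w + lft w = Q w + om z *\<^sub>R time_deriv w"
    by (simp add: Q_def scaleR_add_left)
  also have "\<dots> = \<epsilon> *\<^sub>R (P (fst (snd z)) + om z *\<^sub>R (time_deriv (J (fst (snd z))) + v2))"
    unfolding td unfolding w_def Q_\<kappa> a linear_scale[OF linear_P] by (simp add: algebra_simps)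
  finally have e: "(\<omega> + om z) *\<^sub>R time_deriv w + lft w = \<epsilon> *\<^sub>R (P (fst (snd z)) + om z *\<^sub>R (time_deriv (J (fst (snd z))) + v2))" .
  have L: "L1 v = \<epsilon> *\<^sub>R L1 (fst z)" unfolding v using L1 by (simp add: linear_simps(5))
  have sc: "\<epsilon> *\<^sub>R X = Y \<longleftrightarrow> X = (1 / \<epsilon>) *\<^sub>R Y" for X Y :: "'q::real_vector"
    using \<epsilon> by auto
  show ?thesis unfolding solves_system_def e L sc by simp
qed

end

section \<open>The bifurcating branch\<close>

text \<open>Recentering supplies a series about every point of the interval, and the bounded linear
  \<open>T\<close> carries it into the subset \<open>E\<close> with its own norm.\<close>

lemma psb_analytic_family:
  fixes f :: "real \<Rightarrow> 'a::banach" and T :: "'a \<Rightarrow> 'b::real_vector"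
  assumes f: "psb \<rho> f c" and r: "r \<le> \<rho>"
    and T: "linear T" "\<And>x. T x \<in> E" "\<And>x. 0 \<le> nrm (T x)" "\<And>x. nrm (T x) \<le> K * norm x"
  shows "analytic_family E nrm {-r<..<r} (\<lambda>x. T (f x))"
  unfolding analytic_family_def
proof
  fix x0 :: real assume "x0 \<in> {-r<..<r}"
  then have x0: "\<bar>x0\<bar> < \<rho>" using r by auto
  obtain a where a: "\<And>h. \<bar>h\<bar> \<le> \<rho> - \<bar>x0\<bar> \<Longrightarrow> ((\<lambda>n. h ^ n *\<^sub>R a n) has_sum f (x0 + h)) UNIV"
    using psb_recenter[OF f x0] by (rule psb_coeffs) blast
  show "\<exists>a r'. r' > 0 \<and> (\<forall>n. a n \<in> E) \<and>
        (\<forall>x\<in>{-r<..<r}. \<bar>x - x0\<bar> < r' \<longrightarrow> T (f x) \<in> E \<and>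
           (\<lambda>n. nrm (T (f x) - (\<Sum>k<n. (x - x0) ^ k *\<^sub>R a k))) \<longlonglongrightarrow> 0)"
  proof (intro exI[of _ "\<lambda>n. T (a n)"] exI[of _ "\<rho> - \<bar>x0\<bar>"] conjI allI ballI impI T(2))
    show "\<rho> - \<bar>x0\<bar> > 0" using x0 by simp
    fix x assume "\<bar>x - x0\<bar> < \<rho> - \<bar>x0\<bar>"
    then have "((\<lambda>n. (x - x0) ^ n *\<^sub>R a n) has_sum f x) UNIV" using a[of "x - x0"] by simp
    then have "(\<lambda>n. \<Sum>k<n. (x - x0) ^ k *\<^sub>R a k) \<longlonglongrightarrow> f x"
      using has_sum_imp_sums unfolding sums_def by blast
    then have "(\<lambda>n. norm (f x - (\<Sum>k<n. (x - x0) ^ k *\<^sub>R a k))) \<longlonglongrightarrow> norm (f x - f x)"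
      by (intro tendsto_intros)
    then have lim: "(\<lambda>n. K * norm (f x - (\<Sum>k<n. (x - x0) ^ k *\<^sub>R a k))) \<longlonglongrightarrow> 0"
      by (simp add: tendsto_mult_right_zero)
    have e: "T (f x) - (\<Sum>k<n. (x - x0) ^ k *\<^sub>R T (a k)) = T (f x - (\<Sum>k<n. (x - x0) ^ k *\<^sub>R a k))" for n
      by (simp add: linear_diff[OF T(1)] linear_sum[OF T(1)] linear_scale[OF T(1)])
    show "(\<lambda>n. nrm (T (f x) - (\<Sum>k<n. (x - x0) ^ k *\<^sub>R T (a k)))) \<longlonglongrightarrow> 0"
      unfolding e by (rule tendsto_sandwich[OF _ _ tendsto_const lim]) (use T(3,4) in auto)
  qed
qed

text \<open>The constant terms cancel, and every higher power of \<open>x\<close> yields at least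
  one factor \<open>\<bar>x\<bar> / \<rho>\<close>.\<close>

lemma psb_lipschitz_at_0:
  fixes f :: "real \<Rightarrow> 'a::banach"
  assumes \<rho>: "\<rho> > 0" and f: "psb \<rho> f c" and x: "\<bar>x\<bar> \<le> \<rho>"
  shows "norm (f x - f 0) \<le> \<bar>x\<bar> / \<rho> * c"
proof -
  obtain a where a: "(\<lambda>n. norm (a n) * \<rho> ^ n) summable_on UNIV" "(\<Sum>\<^sub>\<infinity>n. norm (a n) * \<rho> ^ n) \<le> c"
    "\<And>x. \<bar>x\<bar> \<le> \<rho> \<Longrightarrow> ((\<lambda>n. x ^ n *\<^sub>R a n) has_sum f x) UNIV"
    using f by (rule psb_coeffs) blast
  have "((\<lambda>n. x ^ n *\<^sub>R a n + (-1) *\<^sub>R (0 ^ n *\<^sub>R a n)) has_sum f x + (-1) *\<^sub>R f 0) UNIV"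
    by (intro has_sum_add has_sum_scaleR a(3)) (use x \<rho> in auto)
  moreover have "norm (x ^ n *\<^sub>R a n + (-1) *\<^sub>R (0 ^ n *\<^sub>R a n)) \<le> \<bar>x\<bar> / \<rho> * (norm (a n) * \<rho> ^ n)" for n
  proof (cases n)
    case (Suc k)
    have "\<bar>x\<bar> * \<bar>x\<bar> ^ k * norm (a n) \<le> \<bar>x\<bar> * \<rho> ^ k * norm (a n)"
      using x by (intro mult_right_mono mult_left_mono power_mono) auto
    then show ?thesis using \<rho> Suc by (simp add: abs_mult power_abs mult_ac)
  qed (use \<rho> in simp)
  ultimately have "norm (f x + (-1) *\<^sub>R f 0) \<le> (\<Sum>\<^sub>\<infinity>n. \<bar>x\<bar> / \<rho> * (norm (a n) * \<rho> ^ n))"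
    by (rule norm_infsum_le[OF _ has_sum_infsum[OF summable_on_cmult_right[OF a(1)]]])
  also have "\<dots> \<le> \<bar>x\<bar> / \<rho> * c"
    unfolding infsum_cmult_right' using a(2) \<rho> by (intro mult_left_mono) auto
  finally show ?thesis by simp
qed

lemma psb_tendsto:
  fixes f :: "real \<Rightarrow> 'a::banach"
  assumes \<rho>: "\<rho> > 0" and f: "psb \<rho> f c"
  shows "(f \<longlongrightarrow> f 0) (at 0)"
proof (rule LIM_zero_cancel, rule Lim_null_comparison)
  have "\<forall>\<^sub>F x in at 0. \<bar>x\<bar> < \<rho>"
    using \<rho> by (auto simp: eventually_at intro!: exI[of _ \<rho>])
  then show "\<forall>\<^sub>F x in at 0. norm (f x - f 0) \<le> \<bar>x\<bar> / \<rho> * c"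
    by eventually_elim (rule psb_lipschitz_at_0[OF \<rho> f], simp)
  have "((\<lambda>x. \<bar>x\<bar> / \<rho> * c) \<longlongrightarrow> \<bar>0\<bar> / \<rho> * c) (at 0)" by (intro tendsto_intros) (use \<rho> in simp)
  then show "((\<lambda>x. \<bar>x\<bar> / \<rho> * c) \<longlongrightarrow> 0) (at 0)" by simp
qed

context bifurcation
begin

lemma norm_pr: "norm (pr z) \<le> norm z"
  unfolding pr_def norm_prod_def[of z] norm_prod_def[of "snd z"] norm_Pair
  by (intro real_sqrt_le_mono) (auto simp: real_sqrt_le_mono)

lemma abs_mu: "\<bar>mu z\<bar> \<le> norm z" and abs_om: "\<bar>om z\<bar> \<le> norm z"
  and norm_g: "norm (fst (snd z)) \<le> norm z" for z :: "'x \<times> 'h per_L2 \<times> real \<times> real"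
proof -
  have 1: "norm (snd z) \<le> norm z" using norm_snd_le[of "snd z" "fst z"] by simp
  have 2: "norm (snd (snd z)) \<le> norm (snd z)" using norm_snd_le[of "snd (snd z)" "fst (snd z)"] by simp
  show "\<bar>mu z\<bar> \<le> norm z" using 1 2 norm_snd_le[of "snd (snd (snd z))" "fst (snd (snd z))"] by (simp add: mu_def)
  show "\<bar>om z\<bar> \<le> norm z" using 1 2 norm_fst_le[of "fst (snd (snd z))" "snd (snd (snd z))"] by (simp add: om_def)
  show "norm (fst (snd z)) \<le> norm z" using 1 norm_fst_le[of "fst (snd z)" "snd (snd z)"] by simp
qed

lemma linear_pr: "linear pr" and linear_mu: "linear mu" and linear_om: "linear om"
  by (auto simp: linear_iff pr_def mu_def om_def)

lemma norm_e0: "norm e0 = 1" by (simp add: e0_def norm_Pair)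

lemma scaled_series_U: obtains M C where "scaled_series U M C e0 pr mu"
proof -
  obtain M C where MC: "M \<ge> 0" "C \<ge> 1" "\<And>k l m. mlin (k + l) (M * C ^ (k + l + m)) (U (k, l, m))"
    by (rule U_bound) (rule that)
  have "scaled_series U M C e0 pr mu"
    by (rule scaled_series.intro[OF MC(1,2) eq_refl[OF norm_e0] linear_pr norm_pr linear_mu abs_mu MC(3) U_vanish(1)])
      (rule U_vanish(2))
  then show ?thesis by (rule that)
qed

text \<open>The expansion divided by \<epsilon> differs from the family \<open>term\<close> at the
  indices \<open>(1, 0, 1)\<close> and \<open>(0, 1, 1)\<close> only; the parts removed there form
  the finitely supported family \<open>b\<close>, whose sum is read off from
  \<open>U_e0\<close>.\<close>

lemma scaled_sum_eq:
  assumes sc: "scaled_series U M C e0 pr mu" and \<epsilon>: "\<epsilon> \<noteq> 0"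
    and ex: "((\<lambda>(k, l, m). mu z ^ m *\<^sub>R U (k, l, m) (replicate (k + l) (arg \<epsilon> z))) has_sum n) UNIV"
    and hs: "((\<lambda>i. scaled_series.term U e0 pr mu i \<epsilon> z) has_sum g) UNIV"
  shows "g = (1 / \<epsilon>) *\<^sub>R n - (0, mu z *\<^sub>R s)"
proof -
  interpret scaled_series U M C e0 pr mu by (rule sc)
  define b where "b = (\<lambda>(k, l, m). if k + l = 1 \<and> m = 1 then mu z *\<^sub>R U (k, l, m) [e0] else 0)"
  have "(b has_sum (0, mu z *\<^sub>R s)) UNIV"
  proof (rule has_sum_finite_neutralI[of "{(1, 0, 1), (0, 1, 1)}"])
    show "b x = 0" if x: "x \<in> UNIV - {(1, 0, 1), (0, 1, 1)}" for x
    proof -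
      obtain k l m where "x = (k, l, m)" by (cases x) auto
      with x show ?thesis by (auto simp: b_def add_is_1)
    qed
    show "(0, mu z *\<^sub>R s) = sum b {(1, 0, 1), (0, 1, 1)}"
      using U_e0 by (simp add: b_def zero_prod_def)
  qed auto
  from has_sum_add[OF has_sum_scaleR[OF ex, of "1 / \<epsilon>"] has_sum_scaleR[OF this, of "-1"]]
  have "((\<lambda>i. (1 / \<epsilon>) *\<^sub>R (case i of (k, l, m) \<Rightarrow> mu z ^ m *\<^sub>R U (k, l, m) (replicate (k + l) (arg \<epsilon> z))) + (-1) *\<^sub>R b i)
     has_sum (1 / \<epsilon>) *\<^sub>R n + (-1) *\<^sub>R (0, mu z *\<^sub>R s)) UNIV" .
  moreover have "(1 / \<epsilon>) *\<^sub>R (case i of (k, l, m) \<Rightarrow> mu z ^ m *\<^sub>R U (k, l, m) (replicate (k + l) (arg \<epsilon> z))) + (-1) *\<^sub>R b i = term i \<epsilon> z" for i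
  proof -
    obtain k l m where i: "i = (k, l, m)" by (cases i) auto
    have "U (k, l, m) (replicate (k + l) (arg \<epsilon> z)) = \<epsilon> ^ (k + l) *\<^sub>R U (k, l, m) (replicate (k + l) (e0 + pr z))"
      unfolding arg_def by (rule mlin_replicate_scale[OF U])
    moreover have "(1 / \<epsilon>) *\<^sub>R (mu z ^ m *\<^sub>R \<epsilon> ^ (k + l) *\<^sub>R u) = \<epsilon> ^ (k + l - 1) *\<^sub>R mu z ^ m *\<^sub>R u"
      if kl: "k + l \<noteq> 0" for u :: "'y \<times> 'h per_L2"
    proof -
      obtain j where j: "k + l = Suc j" using kl by (cases "k + l") auto
      show ?thesis unfolding j scaleR_scaleR
        by (rule arg_cong[of _ _ "\<lambda>c. c *\<^sub>R u"]) (use \<epsilon> in simp)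
    qed
    moreover have "U (k, l, m) (replicate (k + l) (e0 + pr z)) = 0" if "k + l = 0" using that U0 by simp
    ultimately show ?thesis unfolding term_def b_def i by (cases "k + l = 0") simp_all
  qed
  ultimately have "((\<lambda>i. term i \<epsilon> z) has_sum (1 / \<epsilon>) *\<^sub>R n + (-1) *\<^sub>R (0, mu z *\<^sub>R s)) UNIV" by simp
  from has_sum_unique[OF hs this] show ?thesis by simp
qed

text \<open>This serves uniqueness. Terms free of the argument vanish, which provides one factor
  \<open>norm p\<close>; total degree at least two provides a second small factor.\<close>

lemma N_quadratic:
  obtains B \<eta> where "B \<ge> 0" "\<eta> > 0" "\<And>p \<mu>. norm p + \<bar>\<mu>\<bar> < \<eta> \<Longrightarrow> norm (N (fst p) (\<kappa> p) \<mu>) \<le> B * (norm p + \<bar>\<mu>\<bar>) * norm p"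
proof -
  obtain \<delta>1 where \<delta>1: "\<delta>1 > 0" "\<And>p \<mu>. norm p < \<delta>1 \<Longrightarrow> \<bar>\<mu>\<bar> < \<delta>1 \<Longrightarrow>
     ((\<lambda>(k, l, m). \<mu> ^ m *\<^sub>R U (k, l, m) (replicate (k + l) p)) has_sum N (fst p) (\<kappa> p) \<mu>) UNIV"
    by (rule U_expansion) (rule that)
  obtain M C where MC: "M \<ge> 0" "C \<ge> 1" "\<And>k l m. mlin (k + l) (M * C ^ (k + l + m)) (U (k, l, m))"
    by (rule U_bound) (rule that)
  show ?thesis
  proof (rule that[of "32 * M * C ^ 2" "min \<delta>1 (1 / (2 * C))"])
    show "0 \<le> 32 * M * C ^ 2" "min \<delta>1 (1 / (2 * C)) > 0" using MC \<delta>1(1) by auto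
    fix p :: "'x \<times> 'h per_L2 \<times> real" and \<mu> assume a: "norm p + \<bar>\<mu>\<bar> < min \<delta>1 (1 / (2 * C))"
    define h where "h = norm p + \<bar>\<mu>\<bar>"
    have h: "h \<ge> 0" "norm p \<le> h" "\<bar>\<mu>\<bar> \<le> h" "C * h \<le> 1 / 2"
      using a MC(2) by (auto simp: h_def field_simps)
    have small: "norm p < \<delta>1" "\<bar>\<mu>\<bar> < \<delta>1" using a norm_ge_zero[of p] abs_ge_zero[of \<mu>] by linarith+
    have ex: "((\<lambda>(k, l, m). \<mu> ^ m *\<^sub>R U (k, l, m) (replicate (k + l) p)) has_sum N (fst p) (\<kappa> p) \<mu>) UNIV"
      by (rule \<delta>1(2)[OF small])
    \<comment> \<open>Degree two is split off and the rest is geometric with ratio one half; the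
      \<open>4\<close> restores the two halves missing in the exponent. Summation over all indices
      then multiplies by eight, which gives \<open>32\<close>.\<close>
    have le: "norm (case i of (k, l, m) \<Rightarrow> \<mu> ^ m *\<^sub>R U (k, l, m) (replicate (k + l) p))
      \<le> (4 * M * C ^ 2 * h * norm p) * (case i of (k, l, m) \<Rightarrow> (1 / 2) ^ (k + l + m))" for i
    proof -
      obtain k l m where i: "i = (k, l, m)" by (cases i) auto
      have R0: "0 \<le> (4 * M * C ^ 2 * h * norm p) * (1 / 2) ^ (k + l + m)" using MC h by simp
      consider "k + l = 0" | "k + l = 1 \<and> m = 0" | j q where "k + l = Suc j" "j + m = Suc q"
        by (metis One_nat_def add_is_0 not0_implies_Suc)
      then show ?thesis
      proof cases
        case 1
        then show ?thesis using R0 by (simp add: i U_vanish)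
      next
        case 2
        then have "U (k, l, m) (replicate (k + l) p) = 0" using U_vanish(2)[of k l p] by simp
        then show ?thesis using R0 by (simp add: i)
      next
        case 3
        have "norm (U (k, l, m) (replicate (k + l) p)) \<le> M * C ^ (k + l + m) * norm p ^ (k + l)"
          using mlin_norm[OF MC(3), of "replicate (k + l) p" k l m] by simp
        then have "norm (\<mu> ^ m *\<^sub>R U (k, l, m) (replicate (k + l) p)) \<le> \<bar>\<mu>\<bar> ^ m * (M * C ^ (k + l + m) * norm p ^ (k + l))"
          by (simp add: power_abs mult_left_mono)
        also have "\<dots> = (M * C ^ (k + l + m) * norm p) * (\<bar>\<mu>\<bar> ^ m * norm p ^ j)" using 3 by simp
        also have "\<dots> \<le> (M * C ^ (k + l + m) * norm p) * (h ^ m * h ^ j)"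
          using h MC by (intro mult_left_mono mult_mono power_mono) auto
        also have "h ^ m * h ^ j = h * h ^ q" using 3(2) by (metis add.commute power_Suc power_add)
        also have "(M * C ^ (k + l + m) * norm p) * (h * h ^ q) = (M * C ^ 2 * h * norm p) * (C * h) ^ q"
        proof -
          have "k + l + m = 2 + q" using 3 by simp
          then show ?thesis by (simp add: power_add power_mult_distrib power2_eq_square)
        qed
        also have "\<dots> \<le> (M * C ^ 2 * h * norm p) * (1 / 2) ^ q"
          using h MC by (intro mult_left_mono power_mono) auto
        also have "\<dots> = (4 * M * C ^ 2 * h * norm p) * (1 / 2) ^ (k + l + m)"
        proof -
          have "k + l + m = 2 + q" using 3 by simp
          then show ?thesis by (simp add: power_add power2_eq_square)
        qed
        finally show ?thesis by (simp add: i)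
      qed
    qed
    have "norm (N (fst p) (\<kappa> p) \<mu>) \<le> (4 * M * C ^ 2 * h * norm p) * 8"
      by (rule norm_infsum_le[OF ex has_sum_cmult_right[OF has_sum_half_powers] le])
    then show "norm (N (fst p) (\<kappa> p) \<mu>) \<le> 32 * M * C ^ 2 * (norm p + \<bar>\<mu>\<bar>) * norm p"
      by (simp add: h_def)
  qed
qed

lemma bounded_linear_\<Lambda>: "linear \<Lambda>" "\<exists>A. \<forall>q. norm (\<Lambda> q) \<le> A * norm q"
proof -
  interpret Li: bounded_linear Li by (rule Li(1))
  show "linear \<Lambda>"
    by (rule linearI)
       (simp_all add: \<Lambda>_def Li.add Li.scaleR linear_add[OF linear_P] linear_scale[OF linear_P] inner_add_left
         add_divide_distrib diff_divide_distrib algebra_simps)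
  obtain KL where KL: "KL \<ge> 0" "\<And>x. norm (Li x) \<le> norm x * KL" using Li.nonneg_bounded by blast
  obtain CP where CP: "CP \<ge> 0" "\<And>f. norm (P f) \<le> CP * norm f" using bounded_P by blast
  define a1 where "a1 = norm v1s / \<bar>c0\<bar>"
  have a1: "a1 \<ge> 0" by (simp add: a1_def)
  have "norm (\<Lambda> q) \<le> (KL + (CP + a1 * norm (P s)) + (norm v2s + a1 * \<bar>s \<bullet> v2s\<bar>) + a1) * norm q" for q
  proof -
    have n: "norm (fst q) \<le> norm q" "norm (snd q) \<le> norm q"
      using norm_fst_le[of "fst q" "snd q"] norm_snd_le[of "snd q" "fst q"] by auto
    have i: "\<bar>snd q \<bullet> v1s\<bar> / \<bar>c0\<bar> \<le> a1 * norm q" "\<bar>snd q \<bullet> v2s\<bar> \<le> norm v2s * norm q"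
    proof -
      have "\<bar>snd q \<bullet> v1s\<bar> \<le> norm q * norm v1s"
        using Cauchy_Schwarz_ineq2[of "snd q" v1s] mult_right_mono[OF n(2), of "norm v1s"] by simp
      from divide_right_mono[OF this, of "\<bar>c0\<bar>"] show "\<bar>snd q \<bullet> v1s\<bar> / \<bar>c0\<bar> \<le> a1 * norm q"
        by (simp add: a1_def mult.commute)
      show "\<bar>snd q \<bullet> v2s\<bar> \<le> norm v2s * norm q"
        using Cauchy_Schwarz_ineq2[of "snd q" v2s] mult_right_mono[OF n(2), of "norm v2s"] by (simp add: mult.commute)
    qed
    have 1: "norm (Li (fst q)) \<le> KL * norm q"
      using KL(2)[of "fst q"] mult_right_mono[OF n(1) KL(1)] by (simp add: mult.commute)
    have 2: "norm (P (snd q) - ((snd q \<bullet> v1s) / c0) *\<^sub>R P s) \<le> (CP + a1 * norm (P s)) * norm q"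
      using norm_triangle_ineq4[of "P (snd q)" "((snd q \<bullet> v1s) / c0) *\<^sub>R P s"] CP(2)[of "snd q"]
        mult_left_mono[OF n(2) CP(1)] mult_right_mono[OF i(1), of "norm (P s)"] by (simp add: algebra_simps)
    have 3: "\<bar>- (snd q \<bullet> v2s) + (snd q \<bullet> v1s) * (s \<bullet> v2s) / c0\<bar> \<le> (norm v2s + a1 * \<bar>s \<bullet> v2s\<bar>) * norm q"
      using abs_triangle_ineq[of "- (snd q \<bullet> v2s)" "(snd q \<bullet> v1s) * (s \<bullet> v2s) / c0"] i(2)
        mult_right_mono[OF i(1), of "\<bar>s \<bullet> v2s\<bar>"] by (simp add: abs_mult algebra_simps)
    have 4: "\<bar>- (snd q \<bullet> v1s) / c0\<bar> \<le> a1 * norm q" using i(1) by simp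
    have "norm (\<Lambda> q) \<le> norm (Li (fst q)) + (norm (P (snd q) - ((snd q \<bullet> v1s) / c0) *\<^sub>R P s)
      + (\<bar>- (snd q \<bullet> v2s) + (snd q \<bullet> v1s) * (s \<bullet> v2s) / c0\<bar> + \<bar>- (snd q \<bullet> v1s) / c0\<bar>))"
      unfolding \<Lambda>_def real_norm_def[symmetric]
      by (intro order_trans[OF norm_Pair_le] add_left_mono) (rule order_refl)
    with 1 2 3 4 show ?thesis by (simp add: distrib_right)
  qed
  then show "\<exists>A. \<forall>q. norm (\<Lambda> q) \<le> A * norm q" by blast
qed

lemma bounded_bilinear_Bi: "linear (\<lambda>x. Bi x y)" "linear (Bi x)" "\<exists>b. \<forall>x y. norm (Bi x y) \<le> b * norm x * norm y"
proof -
  have td: "time_deriv (J (f + g)) = time_deriv (J f) + time_deriv (J g)" "time_deriv (J (c *\<^sub>R f)) = c *\<^sub>R time_deriv (J f)" for f g c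
    by (simp_all add: linear_add[OF linear_J] linear_scale[OF linear_J] W_add W_scaleR W0_W J)
  show "linear (\<lambda>x. Bi x y)"
    by (rule linearI) (simp_all add: Bi_def om_def algebra_simps)
  show "linear (Bi x)"
    by (rule linearI) (simp_all add: Bi_def td linear_add[OF linear_P] linear_scale[OF linear_P] algebra_simps)
  obtain CP where CP: "CP \<ge> 0" "\<And>f. norm (P f) \<le> CP * norm f" using bounded_P by blast
  obtain CJ where CJ: "CJ \<ge> 0" "\<And>f. norm (time_deriv (J f)) \<le> CJ * norm f" by (rule bounded_J) (rule that)
  have "norm (Bi x y) \<le> (CP * CJ) * norm x * norm y" for x y
  proof -
    have "norm (P (time_deriv (J (fst (snd y))))) \<le> CP * (CJ * norm y)"
      using order_trans[OF CP(2) mult_left_mono[OF order_trans[OF CJ(2) mult_left_mono[OF norm_g CJ(1)]] CP(1)]] .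
    then have "\<bar>om x\<bar> * norm (P (time_deriv (J (fst (snd y))))) \<le> norm x * (CP * (CJ * norm y))"
      using abs_om[of x] CP(1) CJ(1) by (intro mult_mono) auto
    then show ?thesis by (simp add: Bi_def norm_Pair mult_ac)
  qed
  then show "\<exists>b. \<forall>x y. norm (Bi x y) \<le> b * norm x * norm y" by blast
qed

text \<open>The fixed point theorem sees only solutions that already have the scaled form. For an
  arbitrary small solution with \<open>w \<bullet> v2s = 0\<close> the quadratic bound on
  \<open>N\<close> shows that \<open>norm p\<close> is at most twice its amplitude, so division by
  the amplitude lands in the ball where fixed points are unique.\<close>

lemma branch:
  obtains \<rho> r f where "0 < \<rho>" "psb \<rho> f r" "f 0 = 0"
    "\<And>\<epsilon>. \<bar>\<epsilon>\<bar> \<le> \<rho> \<Longrightarrow> \<omega> + om (f \<epsilon>) > 0 \<and>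
       solves_system L1 D L N (fst (arg \<epsilon> (f \<epsilon>))) (\<kappa> (arg \<epsilon> (f \<epsilon>))) (\<omega> + om (f \<epsilon>)) (mu (f \<epsilon>))"
    "\<And>r'. r' > 0 \<Longrightarrow> \<exists>\<eta>>0. \<forall>z w \<omega>' \<mu>'. w \<in> W \<and> w \<bullet> v2s = 0 \<and>
        norm z + nrm w + \<bar>\<omega>' - \<omega>\<bar> + \<bar>\<mu>'\<bar> < \<eta> \<and> (z, w) \<noteq> (0, 0) \<and> solves_system L1 D L N z w \<omega>' \<mu>' \<longrightarrow>
        \<bar>w \<bullet> v1s\<bar> < r' \<and> z = fst (arg (w \<bullet> v1s) (f (w \<bullet> v1s))) \<and> w = \<kappa> (arg (w \<bullet> v1s) (f (w \<bullet> v1s)))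
          \<and> \<omega>' = \<omega> + om (f (w \<bullet> v1s)) \<and> \<mu>' = mu (f (w \<bullet> v1s))"
proof -
  obtain M C where sc: "scaled_series U M C e0 pr mu" by (rule scaled_series_U)
  interpret scaled_series U M C e0 pr mu by (rule sc)
  obtain \<delta>1 where \<delta>1: "\<delta>1 > 0" "\<And>p \<mu>. norm p < \<delta>1 \<Longrightarrow> \<bar>\<mu>\<bar> < \<delta>1 \<Longrightarrow>
     ((\<lambda>(k, l, m). \<mu> ^ m *\<^sub>R U (k, l, m) (replicate (k + l) p)) has_sum N (fst p) (\<kappa> p) \<mu>) UNIV"
    by (rule U_expansion) (rule that)
  obtain B \<eta>0 where B: "B \<ge> 0" "\<eta>0 > 0" "\<And>p \<mu>. norm p + \<bar>\<mu>\<bar> < \<eta>0 \<Longrightarrow> norm (N (fst p) (\<kappa> p) \<mu>) \<le> B * (norm p + \<bar>\<mu>\<bar>) * norm p"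
    by (rule N_quadratic) (rule that)
  obtain A where A: "\<And>q. norm (\<Lambda> q) \<le> A * norm q" using bounded_linear_\<Lambda>(2) by blast
  obtain b where b: "\<And>x y. norm (Bi x y) \<le> b * norm x * norm y" using bounded_bilinear_Bi(3) by blast
  \<comment> \<open>\<open>\<omega> / 2\<close> keeps the frequency positive;
    \<open>\<delta>1 / 3\<close> keeps \<open>arg \<epsilon> z\<close>, of norm at most
    \<open>2 * r\<close>, in the domain of the expansion.\<close>
  define r0 where "r0 = min (min 1 (\<omega> / 2)) (min (\<delta>1 / 3) (\<eta>0 / 2))"
  have r0: "r0 > 0" "r0 \<le> 1" "r0 \<le> \<omega> / 2" "r0 \<le> \<delta>1 / 3" "r0 \<le> \<eta>0 / 2"
    using \<omega> \<delta>1(1) B(2) by (auto simp: r0_def)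
  obtain r \<rho> f where f: "0 < \<rho>" "\<rho> \<le> r" "r \<le> r0" "psb \<rho> f r"
    "\<And>x. \<bar>x\<bar> \<le> \<rho> \<Longrightarrow> f x = \<Lambda> (series x (f x)) + Bi (f x) (f x)"
    "\<And>x z. \<bar>x\<bar> \<le> \<rho> \<Longrightarrow> norm z \<le> r \<Longrightarrow> z = \<Lambda> (series x z) + Bi z z \<Longrightarrow> z = f x"
    "\<And>x z. \<bar>x\<bar> \<le> \<rho> \<Longrightarrow> norm z \<le> r \<Longrightarrow> ((\<lambda>i. term i x z) has_sum series x z) UNIV"
    by (rule fixed_point[OF bounded_linear_\<Lambda>(1) A bounded_bilinear_Bi(1,2) b r0(1)]) (rule that)
  have sum_eq: "series \<epsilon> z = (1 / \<epsilon>) *\<^sub>R N (fst (arg \<epsilon> z)) (\<kappa> (arg \<epsilon> z)) (mu z) - (0, mu z *\<^sub>R s)"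
    if \<epsilon>: "\<epsilon> \<noteq> 0" "\<bar>\<epsilon>\<bar> \<le> \<rho>" and z: "norm z \<le> r" for \<epsilon> z
  proof (rule scaled_sum_eq[OF sc \<epsilon>(1) _ f(7)[OF \<epsilon>(2) z]], rule \<delta>1(2))
    have "norm (e0 + pr z) \<le> 2"
      using norm_triangle_ineq[of e0 "pr z"] norm_e0 norm_pr[of z] z f(3) r0(2) by simp
    then have "norm (arg \<epsilon> z) \<le> r * 2"
      unfolding arg_def norm_scaleR using \<epsilon>(2) f(2) by (intro mult_mono) auto
    then show "norm (arg \<epsilon> z) < \<delta>1" using f(3) r0(1,4) \<delta>1(1) by linarith
    show "\<bar>mu z\<bar> < \<delta>1" using abs_mu[of z] z f(3) r0(4) \<delta>1(1) by linarith
  qed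
  have fn: "norm (f \<epsilon>) \<le> r" if "\<bar>\<epsilon>\<bar> \<le> \<rho>" for \<epsilon> by (rule psb_norm_le[OF f(4) that])
  \<comment> \<open>At \<epsilon> = 0 every term vanishes for \<open>z = 0\<close>, so zero is the
    fixed point there; this yields the limits of frequency and parameter.\<close>
  have f0: "f 0 = 0"
  proof -
    have "term i 0 0 = 0" for i
    proof -
      obtain k l m where i: "i = (k, l, m)" by (cases i) auto
      have "U (k, l, 0) (replicate (k + l) p) = 0" if "k + l \<le> 1" for p
      proof (cases "k + l = 0")
        case False
        then have "k + l = 1" using that by linarith
        then show ?thesis using U1 by simp
      qed (use U0[of 0] in simp)
      then show ?thesis using linear_0[OF linear_mu] by (auto simp: i term_def power_0_left)
    qed
    then have "series 0 0 = 0" by (simp add: series_def)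
    then have "0 = \<Lambda> (series 0 0) + Bi 0 0"
      using linear_0[OF bounded_linear_\<Lambda>(1)] linear_0[OF bounded_bilinear_Bi(2)] by simp
    from f(6)[OF _ _ this] show ?thesis using f(1,2) by simp
  qed
  \<comment> \<open>Needed for \<epsilon> = 0, where the equation divided by \<epsilon> carries no
    information and the member of the family is the trivial solution.\<close>
  have N0: "N 0 0 \<mu> = 0" if "\<bar>\<mu>\<bar> < \<eta>0" for \<mu>
    using B(3)[of 0 \<mu>] that linear_0[OF linear_\<kappa>] by simp
  show ?thesis
  proof (rule that[OF f(1) f(4) f0])
    fix \<epsilon> assume \<epsilon>: "\<bar>\<epsilon>\<bar> \<le> \<rho>"
    have "\<bar>om (f \<epsilon>)\<bar> \<le> \<omega> / 2" using abs_om[of "f \<epsilon>"] fn[OF \<epsilon>] f(3) r0(3) by simp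
    then have pos: "\<omega> + om (f \<epsilon>) > 0" using \<omega> by linarith
    show "\<omega> + om (f \<epsilon>) > 0 \<and> solves_system L1 D L N (fst (arg \<epsilon> (f \<epsilon>))) (\<kappa> (arg \<epsilon> (f \<epsilon>))) (\<omega> + om (f \<epsilon>)) (mu (f \<epsilon>))"
    proof (cases "\<epsilon> = 0")
      case True
      have "time_deriv 0 = (0 :: 'h per_L2)" "lft 0 = 0" using W_scaleR(2,3)[OF zero_W, of 0] by simp_all
      moreover have "L1 0 = 0" using linear_0[OF bounded_linear.linear[OF L1]] .
      ultimately show ?thesis
        using True pos N0[of 0] B(2) linear_0[OF linear_\<kappa>] linear_0[OF linear_mu] f0
        by (simp add: arg_def solves_system_def)
    next
      case False
      let ?z = "f \<epsilon>"
      let ?q = "(1 / \<epsilon>) *\<^sub>R N (fst (arg \<epsilon> ?z)) (\<kappa> (arg \<epsilon> ?z)) (mu ?z)"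
      have "snd ?q \<in> H_per0"
        using subspace_scale[OF subspace_H_per0 N_range[OF \<kappa>_W]] by simp
      moreover have "?z = \<Lambda> (?q - (0, mu ?z *\<^sub>R s)) + Bi ?z ?z"
        using f(5)[OF \<epsilon>] sum_eq[OF False \<epsilon> fn[OF \<epsilon>]] by simp
      ultimately show ?thesis
        using fixed_point_imp_system[of ?z ?q] pos unfolding system_scaled[OF False] by blast
    qed
  next
    fix r' :: real assume r': "r' > 0"
    obtain KL where KL: "KL \<ge> 0" "\<And>x. norm (Li x) \<le> norm x * KL" using bounded_linear.nonneg_bounded[OF Li(1)] by blast
    obtain KW where KW: "KW > 0" "\<And>w. w \<in> W \<Longrightarrow> norm w \<le> KW * nrm w" "\<And>w. w \<in> W \<Longrightarrow> norm (lft w) \<le> KW * nrm w"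
      "\<And>w. w \<in> W \<Longrightarrow> norm (time_deriv w) \<le> KW * nrm w" using W_norm_lower[OF \<theta>] by blast
    obtain Ck where Ck: "Ck \<ge> 0" "\<And>p. norm (time_deriv (\<kappa> p)) \<le> Ck * norm p" by (rule bounded_\<kappa>) (rule that)
    \<comment> \<open>\<open>c1\<close> compares the norm of the coordinates \<open>p\<close> with
      the norms of \<open>z\<close> and \<open>w\<close> in the original spaces.\<close>
    define c1 where "c1 = 1 + (\<omega> + 1) * KW + KW * norm v1s"
    have c1: "c1 \<ge> 1" using \<omega> KW(1) by (simp add: c1_def)
    \<comment> \<open>\<open>c2 * \<eta>\<close> is to bound \<open>norm z + norm (Q w)\<close>
      relative to \<open>norm p\<close>: the first summand comes from inverting \<open>L1\<close>,
      the second from the nonlinearity and the frequency shift.\<close>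
    define c2 where "c2 = KL * (B * (c1 + 1)) + (B * (c1 + 1) + Ck)"
    have c2: "c2 \<ge> 0" using KL(1) B(1) Ck(1) c1 by (simp add: c2_def)
    \<comment> \<open>In this order the bounds ensure that the quadratic estimate applies, that half
      of \<open>norm p\<close> can be absorbed, that the amplitude lies in the required interval,
      and that the scaled unknown has norm at most \<open>r\<close>.\<close>
    define \<eta> where "\<eta> = min (min (\<eta>0 / (c1 + 1)) (1 / (2 * (c2 + 1)))) (min (min r' \<rho> / c1) (r / (2 * c2 + 2)))"
    have \<eta>: "\<eta> > 0" using B(2) c1 c2 r' f(1,2) by (auto simp: \<eta>_def intro!: divide_pos_pos)
    have \<eta>1: "(c1 + 1) * \<eta> \<le> \<eta>0"
    proof -
      have "\<eta> \<le> \<eta>0 / (c1 + 1)" by (simp add: \<eta>_def)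
      then show ?thesis using c1 by (simp add: pos_le_divide_eq mult.commute)
    qed
    have \<eta>2: "c2 * \<eta> \<le> 1 / 2"
    proof -
      have "\<eta> \<le> 1 / (2 * (c2 + 1))" by (simp add: \<eta>_def)
      then have "\<eta> * (2 * (c2 + 1)) \<le> 1" using c2 by (simp add: pos_le_divide_eq)
      then show ?thesis using \<eta> by (simp add: algebra_simps)
    qed
    have \<eta>3: "c1 * \<eta> \<le> min r' \<rho>"
    proof -
      have "\<eta> \<le> min r' \<rho> / c1" unfolding \<eta>_def by (meson min.cobounded1 min.cobounded2 order_trans)
      then show ?thesis using c1 by (simp add: pos_le_divide_eq mult.commute)
    qed
    have \<eta>4: "(2 * c2 + 2) * \<eta> \<le> r"
    proof -
      have "\<eta> \<le> r / (2 * c2 + 2)" unfolding \<eta>_def by (meson min.cobounded1 min.cobounded2 order_trans)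
      then show ?thesis using c2 by (simp add: pos_le_divide_eq mult.commute)
    qed
    show "\<exists>\<eta>>0. \<forall>z w \<omega>' \<mu>'. w \<in> W \<and> w \<bullet> v2s = 0 \<and>
        norm z + nrm w + \<bar>\<omega>' - \<omega>\<bar> + \<bar>\<mu>'\<bar> < \<eta> \<and> (z, w) \<noteq> (0, 0) \<and> solves_system L1 D L N z w \<omega>' \<mu>' \<longrightarrow>
        \<bar>w \<bullet> v1s\<bar> < r' \<and> z = fst (arg (w \<bullet> v1s) (f (w \<bullet> v1s))) \<and> w = \<kappa> (arg (w \<bullet> v1s) (f (w \<bullet> v1s)))
          \<and> \<omega>' = \<omega> + om (f (w \<bullet> v1s)) \<and> \<mu>' = mu (f (w \<bullet> v1s))"
    proof (rule exI[of _ \<eta>], rule conjI[OF \<eta>], intro allI impI, elim conjE)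
      fix z w \<omega>' \<mu>'
      assume w: "w \<in> W" and w2: "w \<bullet> v2s = 0" and small: "norm z + nrm w + \<bar>\<omega>' - \<omega>\<bar> + \<bar>\<mu>'\<bar> < \<eta>"
        and nz: "(z, w) \<noteq> (0, 0)" and sol: "solves_system L1 D L N z w \<omega>' \<mu>'"
      define \<epsilon> where "\<epsilon> = w \<bullet> v1s"
      define p where "p = (z, Q w, \<epsilon>)"
      have nw: "nrm w \<ge> 0" by (rule W_norm_sq(2)[OF w])
      have sm: "norm z \<le> \<eta>" "nrm w < \<eta>" "\<bar>\<omega>' - \<omega>\<bar> \<le> \<eta>" "\<bar>\<mu>'\<bar> \<le> \<eta>"
        using small nw norm_ge_zero[of z] abs_ge_zero[of "\<omega>' - \<omega>"] abs_ge_zero[of \<mu>'] by linarith+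
      have QG: "Q w \<in> G" using range_subset[OF w] Q_pairing[OF w] by (simp add: G_def H_per0_def)
      have "\<kappa> p = J (Q w) + \<epsilon> *\<^sub>R v1" by (simp add: p_def \<kappa>_def)
      moreover have "J (Q w) = w + (- \<epsilon>) *\<^sub>R v1"
      proof (rule J_eq)
        show "w + (- \<epsilon>) *\<^sub>R v1 \<in> W0"
          using subspace_add[OF subspace_W w subspace_scale[OF subspace_W v1_W, of "- \<epsilon>"]] w2
          by (simp add: W0_def inner_diff_left biorthogonal \<epsilon>_def)
        show "Q (w + (- \<epsilon>) *\<^sub>R v1) = P (Q w)"
          using Q_add[OF w W_scaleR(1)[OF v1_W, of "- \<epsilon>"]] Q_scaleR[OF v1_W, of "- \<epsilon>"] by (simp add: Q_v1 P_id[OF QG])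
      qed
      ultimately have \<kappa>p: "\<kappa> p = w" by simp
      note wb = KW(2-4)[OF w]
      have kw: "KW * nrm w \<ge> 0" using KW(1) nw by simp
      have "norm (Q w) \<le> \<omega> * norm (time_deriv w) + norm (lft w)"
        unfolding Q_def using norm_triangle_ineq[of "\<omega> *\<^sub>R time_deriv w" "lft w"] \<omega> by simp
      also have "\<dots> \<le> \<omega> * (KW * nrm w) + KW * nrm w"
        using wb \<omega> by (intro add_mono mult_left_mono) auto
      finally have qb: "norm (Q w) \<le> (\<omega> + 1) * KW * nrm w" by (simp add: algebra_simps)
      have eb: "\<bar>\<epsilon>\<bar> \<le> KW * norm v1s * nrm w"
        using Cauchy_Schwarz_ineq2[of w v1s] mult_right_mono[OF wb(1), of "norm v1s"] by (simp add: \<epsilon>_def mult_ac)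
      have np: "norm p \<le> norm z + (norm (Q w) + \<bar>\<epsilon>\<bar>)"
        unfolding p_def using norm_Pair_le[of z "(Q w, \<epsilon>)"] norm_Pair_le[of "Q w" \<epsilon>] by simp
      have c1w: "norm (Q w) + \<bar>\<epsilon>\<bar> \<le> (c1 - 1) * nrm w"
        using qb eb unfolding c1_def by (simp add: algebra_simps)
      have "(c1 - 1) * nrm w \<le> (c1 - 1) * (norm z + nrm w)" using c1 by (intro mult_left_mono) auto
      moreover have "(c1 - 1) * nrm w + nrm w + (c1 - 1) * norm z + norm z = c1 * (norm z + nrm w)"
        by (simp add: algebra_simps)
      moreover have "0 \<le> (c1 - 1) * norm z" using c1 by simp
      ultimately have p1: "norm p \<le> c1 * (norm z + nrm w)" using np c1w nw by linarith
      have zw: "norm z + nrm w < \<eta>" "norm z + nrm w + \<bar>\<mu>'\<bar> < \<eta>" using small by linarith+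
      have c1\<eta>: "c1 * (norm z + nrm w) < c1 * \<eta>" using zw(1) c1 by simp
      have "\<bar>\<epsilon>\<bar> \<le> norm p" unfolding p_def
        using norm_snd_le[of "snd (z, Q w, \<epsilon>)" z] norm_snd_le[of \<epsilon> "Q w"] by simp
      then have \<epsilon>r: "\<bar>\<epsilon>\<bar> < r'" and \<epsilon>\<rho>: "\<bar>\<epsilon>\<bar> \<le> \<rho>" using p1 c1\<eta> \<eta>3 by auto
      have h\<eta>: "norm p + \<bar>\<mu>'\<bar> < (c1 + 1) * \<eta>"
        using p1 c1\<eta> sm(4) by (simp add: distrib_right)
      have "norm (N z w \<mu>') \<le> B * (norm p + \<bar>\<mu>'\<bar>) * norm p"
        using B(3)[of p \<mu>'] h\<eta> \<eta>1 \<kappa>p by (simp add: p_def)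
      also have "\<dots> \<le> B * ((c1 + 1) * \<eta>) * norm p"
        using h\<eta> B(1) by (intro mult_right_mono mult_left_mono) auto
      finally have Nb: "norm (N z w \<mu>') \<le> B * (c1 + 1) * \<eta> * norm p" by (simp add: mult.assoc)
      have N12: "norm (fst (N z w \<mu>')) \<le> norm (N z w \<mu>')" "norm (snd (N z w \<mu>')) \<le> norm (N z w \<mu>')"
        using norm_fst_le[of "fst (N z w \<mu>')" "snd (N z w \<mu>')"] norm_snd_le[of "snd (N z w \<mu>')" "fst (N z w \<mu>')"] by simp_all
      have sol': "L1 z = fst (N z w \<mu>')" "\<omega>' *\<^sub>R time_deriv w + lft w = snd (N z w \<mu>')"
        using sol by (simp_all add: solves_system_def)
      have "z = Li (fst (N z w \<mu>'))" using sol'(1) Li(2)[of z] by simp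
      then have "norm z \<le> norm (fst (N z w \<mu>')) * KL" using KL(2)[of "fst (N z w \<mu>')"] by simp
      also have "\<dots> \<le> (B * (c1 + 1) * \<eta> * norm p) * KL"
        using N12(1) Nb KL(1) by (intro mult_right_mono) auto
      finally have zb: "norm z \<le> KL * (B * (c1 + 1)) * \<eta> * norm p" by (simp add: mult_ac)
      have "Q w = snd (N z w \<mu>') - (\<omega>' - \<omega>) *\<^sub>R time_deriv w"
        unfolding sol'(2)[symmetric] Q_def by (simp add: algebra_simps)
      then have "norm (Q w) \<le> norm (snd (N z w \<mu>')) + \<bar>\<omega>' - \<omega>\<bar> * norm (time_deriv w)"
        using norm_triangle_ineq4[of "snd (N z w \<mu>')" "(\<omega>' - \<omega>) *\<^sub>R time_deriv w"] by simp
      moreover have "\<bar>\<omega>' - \<omega>\<bar> * norm (time_deriv w) \<le> \<eta> * (Ck * norm p)"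
        using Ck(2)[of p] sm(3) \<eta> unfolding \<kappa>p by (intro mult_mono) auto
      ultimately have "norm (Q w) \<le> B * (c1 + 1) * \<eta> * norm p + \<eta> * (Ck * norm p)"
        using N12(2) Nb by linarith
      with zb have zq: "norm z + norm (Q w) \<le> c2 * \<eta> * norm p"
        unfolding c2_def by (simp add: algebra_simps)
      also have "\<dots> \<le> 1 / 2 * norm p" using \<eta>2 by (intro mult_right_mono) auto
      \<comment> \<open>In \<open>norm p \<le> norm z + norm (Q w) + \<bar>\<epsilon>\<bar>\<close>
        the first two terms are absorbed as half of the left-hand side.\<close>
      finally have p\<epsilon>: "norm p \<le> 2 * \<bar>\<epsilon>\<bar>" using np by simp
      \<comment> \<open>By the bound just obtained a small solution of zero amplitude is trivial, so
        the division below is legitimate.\<close>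
      have \<epsilon>0: "\<epsilon> \<noteq> 0"
      proof
        assume "\<epsilon> = 0"
        then have "p = 0" using p\<epsilon> by simp
        moreover from this have "w = 0" using \<kappa>p linear_0[OF linear_\<kappa>] by simp
        ultimately show False using nz by (simp add: p_def zero_prod_def)
      qed
      define zz where "zz = ((1 / \<epsilon>) *\<^sub>R z, (1 / \<epsilon>) *\<^sub>R Q w, \<omega>' - \<omega>, \<mu>')"
      have az: "arg \<epsilon> zz = p" using \<epsilon>0 by (simp add: arg_def zz_def e0_def pr_def p_def)
      have zzs: "om zz = \<omega>' - \<omega>" "mu zz = \<mu>'" by (simp_all add: zz_def om_def mu_def)
      have "norm zz \<le> norm z / \<bar>\<epsilon>\<bar> + (norm (Q w) / \<bar>\<epsilon>\<bar> + (\<bar>\<omega>' - \<omega>\<bar> + \<bar>\<mu>'\<bar>))"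
        unfolding zz_def
        using norm_Pair_le[of "(1 / \<epsilon>) *\<^sub>R z" "((1 / \<epsilon>) *\<^sub>R Q w, \<omega>' - \<omega>, \<mu>')"]
          norm_Pair_le[of "(1 / \<epsilon>) *\<^sub>R Q w" "(\<omega>' - \<omega>, \<mu>')"] norm_Pair_le[of "\<omega>' - \<omega>" \<mu>'] by simp
      also have "\<dots> = (norm z + norm (Q w)) / \<bar>\<epsilon>\<bar> + (\<bar>\<omega>' - \<omega>\<bar> + \<bar>\<mu>'\<bar>)" by (simp add: add_divide_distrib)
      also have "\<dots> \<le> 2 * c2 * \<eta> + (\<eta> + \<eta>)"
      proof (intro add_mono sm)
        have "c2 * \<eta> * norm p \<le> c2 * \<eta> * (2 * \<bar>\<epsilon>\<bar>)" using p\<epsilon> c2 \<eta> by (intro mult_left_mono) auto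
        then have "norm z + norm (Q w) \<le> 2 * c2 * \<eta> * \<bar>\<epsilon>\<bar>" using zq by simp
        then show "(norm z + norm (Q w)) / \<bar>\<epsilon>\<bar> \<le> 2 * c2 * \<eta>" using \<epsilon>0 by (simp add: pos_divide_le_eq)
      qed
      also have "\<dots> \<le> r" using \<eta>4 by (simp add: algebra_simps)
      finally have zzr: "norm zz \<le> r" .
      let ?q = "(1 / \<epsilon>) *\<^sub>R N z w \<mu>'"
      have fz: "fst (arg \<epsilon> zz) = z" "\<kappa> (arg \<epsilon> zz) = w" unfolding az \<kappa>p by (simp_all add: p_def)
      have gG: "fst (snd zz) \<in> G" using subspace_scale[OF subspace_G QG] by (simp add: zz_def)
      have "solves_system L1 D L N z w (\<omega> + om zz) \<mu>'" using sol by (simp add: zzs)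
      from this[unfolded system_scaled[OF \<epsilon>0, of zz \<mu>', unfolded fz P_id[OF gG]]]
      have s12: "L1 (fst zz) = fst ?q" "fst (snd zz) + om zz *\<^sub>R (time_deriv (J (fst (snd zz))) + v2) = snd ?q" by simp_all
      have zze: "(fst zz, fst (snd zz), om zz, \<mu>') = zz" by (simp add: zz_def om_def)
      have "zz = \<Lambda> (?q - (0, \<mu>' *\<^sub>R s)) + Bi zz zz"
        using system_imp_fixed_point[OF s12(1) gG s12(2), of \<mu>'] unfolding zze .
      then have "zz = \<Lambda> (series \<epsilon> zz) + Bi zz zz"
        unfolding sum_eq[OF \<epsilon>0 \<epsilon>\<rho> zzr] fz zzs .
      then have zf: "zz = f \<epsilon>" by (rule f(6)[OF \<epsilon>\<rho> zzr])
      have "z = fst (arg \<epsilon> (f \<epsilon>)) \<and> w = \<kappa> (arg \<epsilon> (f \<epsilon>)) \<and> \<omega>' = \<omega> + om (f \<epsilon>) \<and> \<mu>' = mu (f \<epsilon>)"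
        using fz zzs unfolding zf by auto
      with \<epsilon>r show "\<bar>w \<bullet> v1s\<bar> < r' \<and> z = fst (arg (w \<bullet> v1s) (f (w \<bullet> v1s))) \<and> w = \<kappa> (arg (w \<bullet> v1s) (f (w \<bullet> v1s)))
          \<and> \<omega>' = \<omega> + om (f (w \<bullet> v1s)) \<and> \<mu>' = mu (f (w \<bullet> v1s))" unfolding \<epsilon>_def by (rule conjI)
    qed
  qed
qed

end

text \<open>The lowest nonvanishing coefficient decides the sign, since the tail is smaller by a
  factor of order \<open>x\<close>.\<close>

lemma psb_sign_near_0:
  fixes m :: "real \<Rightarrow> real"
  assumes \<rho>: "\<rho> > 0" and m: "psb \<rho> m c"
  obtains r where "r > 0" "(\<forall>x. 0 < x \<and> x < r \<longrightarrow> m x = 0) \<or> (\<forall>x. 0 < x \<and> x < r \<longrightarrow> m x > 0) \<or> (\<forall>x. 0 < x \<and> x < r \<longrightarrow> m x < 0)"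
proof -
  obtain a where a: "(\<lambda>n. norm (a n) * \<rho> ^ n) summable_on UNIV" "(\<Sum>\<^sub>\<infinity>n. norm (a n) * \<rho> ^ n) \<le> c"
    "\<And>x. \<bar>x\<bar> \<le> \<rho> \<Longrightarrow> ((\<lambda>n. x ^ n *\<^sub>R a n) has_sum m x) UNIV"
    using m by (rule psb_coeffs) blast
  show ?thesis
  proof (cases "\<forall>n. a n = 0")
    case True
    have "m x = 0" if "0 < x \<and> x < \<rho>" for x
      using has_sum_unique[OF a(3)[of x] has_sum_0[of UNIV]] True that by simp
    then show ?thesis using that[OF \<rho>] by blast
  next
    case False
    define n where "n = (LEAST n. a n \<noteq> 0)"
    have n: "a n \<noteq> 0" unfolding n_def using LeastI_ex[of "\<lambda>n. a n \<noteq> 0"] False by blast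
    have below: "a k = 0" if "k < n" for k using not_less_Least[of k "\<lambda>n. a n \<noteq> 0"] that unfolding n_def by blast
    have c: "c \<ge> 0" by (rule psb_nonneg[OF m \<rho>])
    have est: "\<bar>m x - x ^ n * a n\<bar> \<le> x ^ n * (x * (c / \<rho> ^ Suc n))" if x: "0 < x" "x < \<rho>" for x
    proof -
      \<comment> \<open>Adding \<open>b\<close> cancels the leading term within the family, so only
        exponents from \<open>Suc n\<close> on remain.\<close>
      define b where "b k = (if k = n then - (x ^ n * a n) else 0)" for k
      have "(b has_sum - (x ^ n * a n)) UNIV"
        by (rule has_sum_finite_neutralI[of "{n}"]) (auto simp: b_def)
      from has_sum_add[OF a(3)[of x] this] have hs: "((\<lambda>k. x ^ k *\<^sub>R a k + b k) has_sum m x + - (x ^ n * a n)) UNIV"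
        using x by simp
      have le: "norm (x ^ k *\<^sub>R a k + b k) \<le> (x / \<rho>) ^ Suc n * (norm (a k) * \<rho> ^ k)" for k
      proof (cases "k \<le> n")
        case True
        then have "x ^ k *\<^sub>R a k + b k = 0" using below[of k] by (cases "k = n") (simp_all add: b_def)
        then show ?thesis using x by simp
      next
        case False
        then obtain j where k: "k = Suc n + j" using less_imp_Suc_add[of n k] by auto
        have "x ^ j \<le> \<rho> ^ j" using x by (intro power_mono) auto
        then have "x ^ Suc n * x ^ j * \<bar>a k\<bar> \<le> x ^ Suc n * \<rho> ^ j * \<bar>a k\<bar>"
          using x by (intro mult_right_mono mult_left_mono) auto
        moreover have "(x / \<rho>) ^ Suc n * \<rho> ^ k = x ^ Suc n * \<rho> ^ j"
          unfolding k using \<rho> by (simp add: power_add power_divide)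
        then have "(x / \<rho>) ^ Suc n * (norm (a k) * \<rho> ^ k) = x ^ Suc n * \<rho> ^ j * \<bar>a k\<bar>"
          by (metis mult.assoc mult.commute real_norm_def)
        moreover have "norm (x ^ k *\<^sub>R a k + b k) = x ^ Suc n * x ^ j * \<bar>a k\<bar>"
          using False x by (simp add: b_def k abs_mult power_add)
        ultimately show ?thesis by linarith
      qed
      have "norm (m x + - (x ^ n * a n)) \<le> (\<Sum>\<^sub>\<infinity>k. (x / \<rho>) ^ Suc n * (norm (a k) * \<rho> ^ k))"
        by (rule norm_infsum_le[OF hs has_sum_infsum[OF summable_on_cmult_right[OF a(1)]] le])
      also have "\<dots> \<le> (x / \<rho>) ^ Suc n * c"
        unfolding infsum_cmult_right' using a(2) x by (intro mult_left_mono) auto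
      finally show ?thesis using \<rho> by (simp add: power_divide field_simps)
    qed
    define d where "d = c / \<rho> ^ Suc n"
    have d: "d \<ge> 0" using c \<rho> by (simp add: d_def)
    \<comment> \<open>Below \<open>\<bar>a n\<bar> / (d + 1)\<close> the tail is smaller than the
      leading term; the added one guards against \<open>d = 0\<close>.\<close>
    define r where "r = min \<rho> (\<bar>a n\<bar> / (d + 1))"
    have r: "r > 0" using \<rho> n d by (simp add: r_def)
    have close: "\<bar>m x - x ^ n * a n\<bar> < x ^ n * \<bar>a n\<bar>" if x: "0 < x" "x < r" for x
    proof -
      have "x < \<bar>a n\<bar> / (d + 1)" using x by (simp add: r_def)
      then have "x * (d + 1) < \<bar>a n\<bar>" using d by (simp add: pos_less_divide_eq)
      then have "x * d < \<bar>a n\<bar>" using x by (simp add: distrib_left)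
      then have "x ^ n * (x * d) < x ^ n * \<bar>a n\<bar>" using x by simp
      with est[of x] x show ?thesis by (simp add: d_def r_def)
    qed
    show ?thesis
    proof (cases "a n > 0")
      case True
      have "m x > 0" if "0 < x \<and> x < r" for x
        using close[of x] that True unfolding abs_of_pos[OF True] by linarith
      then show ?thesis using that[OF r] by blast
    next
      case False
      then have neg: "a n < 0" using n by simp
      have "m x < 0" if "0 < x \<and> x < r" for x
        using close[of x] that unfolding abs_of_neg[OF neg] mult_minus_right by linarith
      then show ?thesis using that[OF r] by blast
    qed
  qed
qed

text \<open>The polar angle of \<open>Complex A B\<close> has this property.\<close>

lemma cancelling_angle:
  fixes A B :: real obtains a where "cos a * B - sin a * A = 0"
proof -
  define z where "z = Complex A B"
  have "A = cmod z * cos (Arg z)" "B = cmod z * sin (Arg z)"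
    using arg_cong[OF rcis_cmod_Arg[of z], of Re] arg_cong[OF rcis_cmod_Arg[of z], of Im] by (simp_all add: z_def)
  then have "cos (Arg z) * B - sin (Arg z) * A = cos (Arg z) * (cmod z * sin (Arg z)) - sin (Arg z) * (cmod z * cos (Arg z))"
    by simp
  then show ?thesis by (intro that[of "Arg z"]) simp
qed

section \<open>Phase shifts, parity and the direction of bifurcation\<close>

context bifurcation
begin

lemma nrm_time_shift: "w \<in> W \<Longrightarrow> nrm (time_shift t w) = nrm w"
proof -
  assume w: "w \<in> W"
  note S = W_time_shift[OF w, of t]
  have "(nrm (time_shift t w))\<^sup>2 = (nrm w)\<^sup>2"
    unfolding W_norm_sq(1)[OF S(1)] W_norm_sq(1)[OF w] S(2,3)
    by (simp only: time_shift_scaleR[symmetric] time_shift_add[symmetric] norm_time_shift)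
  then show ?thesis using W_norm_sq(2)[OF S(1)] W_norm_sq(2)[OF w] by (simp add: power2_eq_iff_nonneg)
qed

text \<open>The uniqueness part of \<open>branch\<close> presupposes
  \<open>w \<bullet> v2s = 0\<close>. Equivariance under time shifts brings an arbitrary solution
  into this position without changing its norm, frequency or parameter.\<close>

theorem bifurcating_branch:
  assumes aut: "\<And>v w \<mu> t. w \<in> W \<Longrightarrow> N v (time_shift t w) \<mu> = (fst (N v w \<mu>), time_shift t (snd (N v w \<mu>)))"
  shows "\<exists>r>0. \<exists>v w om' \<mu>.
    (analytic_family UNIV norm {-r<..<r} v \<and>
     analytic_family W nrm {-r<..<r} w \<and>
     analytic_family UNIV abs {-r<..<r} om' \<and>
     analytic_family UNIV abs {-r<..<r} \<mu> \<and>
     (\<forall>\<epsilon>\<in>{-r<..<r}.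
        w \<epsilon> \<in> W \<and> om' \<epsilon> > 0 \<and>
        solves_system L1 D L N (v \<epsilon>) (w \<epsilon>) (om' \<epsilon>) (\<mu> \<epsilon>) \<and>
        w \<epsilon> \<bullet> v1s = \<epsilon> \<and> w \<epsilon> \<bullet> v2s = 0) \<and>
     (v \<longlongrightarrow> 0) (at 0) \<and>
     ((\<lambda>\<epsilon>. nrm (w \<epsilon> - \<epsilon> *\<^sub>R v1)) \<longlongrightarrow> 0) (at 0) \<and>
     (om' \<longlongrightarrow> \<omega>) (at 0) \<and> (\<mu> \<longlongrightarrow> 0) (at 0)) \<and>
    (\<exists>\<eta>>0. \<forall>z s \<omega>' \<mu>'.
        s \<in> W \<and> \<omega>' > 0 \<and>
        norm z + nrm s + \<bar>\<omega>' - \<omega>\<bar> + \<bar>\<mu>'\<bar> < \<eta> \<and>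
        (z, s) \<noteq> (0, 0) \<and> solves_system L1 D L N z s \<omega>' \<mu>' \<longrightarrow>
        (\<exists>a. \<exists>\<epsilon>\<in>{-r<..<r}. \<epsilon> = time_shift a s \<bullet> v1s \<and>
           z = v \<epsilon> \<and> time_shift a s = w \<epsilon> \<and> \<omega>' = om' \<epsilon> \<and> \<mu>' = \<mu> \<epsilon>)) \<and>
    (\<forall>\<epsilon>\<in>{-r<..<r}. om' \<epsilon> = om' (- \<epsilon>) \<and> \<mu> \<epsilon> = \<mu> (- \<epsilon>)) \<and>
    ((\<forall>\<epsilon>\<in>{-r<..<r}. \<mu> \<epsilon> = 0) \<or>
     subcritical {-r<..<r} \<mu> \<or> supercritical {-r<..<r} \<mu>)"
proof -
  have shifted: "solves_system L1 D L N z (time_shift t w) \<omega>' \<mu>'" if w: "w \<in> W" and sol: "solves_system L1 D L N z w \<omega>' \<mu>'" for z t w \<omega>' \<mu>'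
  proof -
    have "\<omega>' *\<^sub>R time_deriv w + lft w = snd (N z w \<mu>')" "L1 z = fst (N z w \<mu>')" using sol by (simp_all add: solves_system_def)
    then show ?thesis
      by (simp add: solves_system_def aut[OF w] W_time_shift[OF w] time_shift_scaleR[symmetric] time_shift_add[symmetric])
  qed
  obtain \<rho> c f where \<rho>: "0 < \<rho>" and f: "psb \<rho> f c" "f 0 = 0"
    "\<And>\<epsilon>. \<bar>\<epsilon>\<bar> \<le> \<rho> \<Longrightarrow> \<omega> + om (f \<epsilon>) > 0 \<and>
       solves_system L1 D L N (fst (arg \<epsilon> (f \<epsilon>))) (\<kappa> (arg \<epsilon> (f \<epsilon>))) (\<omega> + om (f \<epsilon>)) (mu (f \<epsilon>))"
    and uniq: "\<And>r'. r' > 0 \<Longrightarrow> \<exists>\<eta>>0. \<forall>z w \<omega>' \<mu>'. w \<in> W \<and> w \<bullet> v2s = 0 \<and>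
        norm z + nrm w + \<bar>\<omega>' - \<omega>\<bar> + \<bar>\<mu>'\<bar> < \<eta> \<and> (z, w) \<noteq> (0, 0) \<and> solves_system L1 D L N z w \<omega>' \<mu>' \<longrightarrow>
        \<bar>w \<bullet> v1s\<bar> < r' \<and> z = fst (arg (w \<bullet> v1s) (f (w \<bullet> v1s))) \<and> w = \<kappa> (arg (w \<bullet> v1s) (f (w \<bullet> v1s)))
          \<and> \<omega>' = \<omega> + om (f (w \<bullet> v1s)) \<and> \<mu>' = mu (f (w \<bullet> v1s))"
    by (rule branch) (rule that)
  define F where "F \<epsilon> = arg \<epsilon> (f \<epsilon>)" for \<epsilon>
  define v where "v \<epsilon> = fst (F \<epsilon>)" for \<epsilon>
  define w where "w \<epsilon> = \<kappa> (F \<epsilon>)" for \<epsilon>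
  define om' where "om' \<epsilon> = \<omega> + om (f \<epsilon>)" for \<epsilon>
  define \<mu> where "\<mu> \<epsilon> = mu (f \<epsilon>)" for \<epsilon>
  have sF: "snd (snd (F \<epsilon>)) = \<epsilon>" for \<epsilon> by (simp add: F_def arg_def e0_def pr_def)
  have pair: "w \<epsilon> \<bullet> v1s = \<epsilon>" "w \<epsilon> \<bullet> v2s = 0" "w \<epsilon> \<in> W" for \<epsilon>
    by (simp_all add: w_def \<kappa>_inner sF \<kappa>_W)
  have sol: "solves_system L1 D L N (v \<epsilon>) (w \<epsilon>) (om' \<epsilon>) (\<mu> \<epsilon>)" "om' \<epsilon> > 0" if "\<bar>\<epsilon>\<bar> \<le> \<rho>" for \<epsilon>
    using f(3)[OF that] by (simp_all add: v_def w_def om'_def \<mu>_def F_def)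
  obtain Ck where Ck: "Ck \<ge> 0" "\<And>p. 0 \<le> nrm (\<kappa> p)" "\<And>p. nrm (\<kappa> p) \<le> Ck * norm p" by (rule bounded_\<kappa>) (rule that)
  obtain CJ where CJ: "CJ \<ge> 0" "\<And>g. nrm (J g) \<le> CJ * norm g" by (rule bounded_J) (rule that)
  have "psb \<rho> (\<lambda>\<epsilon>. \<epsilon> ^ 1 *\<^sub>R (e0 + pr (f \<epsilon>))) (\<rho> ^ 1 * (1 + 1 * c))"
    by (intro psb_shift psb_add psb_const psb_linear f(1) \<rho> linear_pr) (simp_all add: norm_e0 norm_pr)
  then have F: "psb \<rho> F (\<rho> * (1 + c))" by (simp add: F_def[abs_def] arg_def)
  have mu_psb: "psb \<rho> \<mu> c"
    using psb_linear[OF \<rho> f(1) linear_mu, of 1] abs_mu by (simp add: \<mu>_def[abs_def])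
  have om_psb: "psb \<rho> om' (\<omega> + 1 * c)"
    unfolding om'_def[abs_def] using \<omega> abs_om
    by (intro psb_add psb_const psb_linear f(1) \<rho> linear_om) simp_all
  have F0: "F 0 = 0" by (simp add: F_def arg_def)
  have nF: "norm (F \<epsilon>) \<le> \<bar>\<epsilon>\<bar> * (1 + c)" if "\<bar>\<epsilon>\<bar> \<le> \<rho>" for \<epsilon>
    using psb_lipschitz_at_0[OF \<rho> F that] F0 \<rho> by simp
  have nf: "norm (f \<epsilon>) \<le> \<bar>\<epsilon>\<bar> * (c / \<rho>)" if "\<bar>\<epsilon>\<bar> \<le> \<rho>" for \<epsilon>
    using psb_lipschitz_at_0[OF \<rho> f(1) that] f(2) by simp
  have cpos: "c \<ge> 0" by (rule psb_nonneg[OF f(1) \<rho>])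
  define K where "K = (1 + c) + Ck * (1 + c) + 2 * (c / \<rho>)"
  have K: "K \<ge> 0" using cpos Ck(1) \<rho> by (simp add: K_def)
  \<comment> \<open>The neighborhood of uniqueness is measured in the original norms. This linear
    bound puts the members of the branch, and their time shifts, inside it for small
    \<epsilon>.\<close>
  have small: "norm (v \<epsilon>) + nrm (w \<epsilon>) + \<bar>om' \<epsilon> - \<omega>\<bar> + \<bar>\<mu> \<epsilon>\<bar> \<le> \<bar>\<epsilon>\<bar> * K" if \<epsilon>: "\<bar>\<epsilon>\<bar> \<le> \<rho>" for \<epsilon>
  proof -
    have "norm (v \<epsilon>) \<le> norm (F \<epsilon>)" using norm_fst_le[of "fst (F \<epsilon>)" "snd (F \<epsilon>)"] by (simp add: v_def)
    moreover have "nrm (w \<epsilon>) \<le> Ck * (\<bar>\<epsilon>\<bar> * (1 + c))"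
      unfolding w_def by (rule order_trans[OF Ck(3) mult_left_mono[OF nF[OF \<epsilon>] Ck(1)]])
    moreover have "\<bar>om' \<epsilon> - \<omega>\<bar> \<le> norm (f \<epsilon>)" "\<bar>\<mu> \<epsilon>\<bar> \<le> norm (f \<epsilon>)"
      using abs_om[of "f \<epsilon>"] abs_mu[of "f \<epsilon>"] by (simp_all add: om'_def \<mu>_def)
    ultimately have "norm (v \<epsilon>) + nrm (w \<epsilon>) + \<bar>om' \<epsilon> - \<omega>\<bar> + \<bar>\<mu> \<epsilon>\<bar>
      \<le> \<bar>\<epsilon>\<bar> * (1 + c) + Ck * (\<bar>\<epsilon>\<bar> * (1 + c)) + \<bar>\<epsilon>\<bar> * (c / \<rho>) + \<bar>\<epsilon>\<bar> * (c / \<rho>)"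
      using nF[OF \<epsilon>] nf[OF \<epsilon>] by linarith
    also have "\<dots> = \<bar>\<epsilon>\<bar> * K" by (simp add: K_def algebra_simps)
    finally show ?thesis .
  qed
  \<comment> \<open>Any radius serves here: parity uses only that the shifted solution is the member
    of the family at its own amplitude.\<close>
  obtain \<eta>1 where \<eta>1: "\<eta>1 > 0" "\<forall>z w \<omega>' \<mu>'. w \<in> W \<and> w \<bullet> v2s = 0 \<and>
        norm z + nrm w + \<bar>\<omega>' - \<omega>\<bar> + \<bar>\<mu>'\<bar> < \<eta>1 \<and> (z, w) \<noteq> (0, 0) \<and> solves_system L1 D L N z w \<omega>' \<mu>' \<longrightarrow>
        \<bar>w \<bullet> v1s\<bar> < 1 \<and> z = fst (arg (w \<bullet> v1s) (f (w \<bullet> v1s))) \<and> w = \<kappa> (arg (w \<bullet> v1s) (f (w \<bullet> v1s)))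
          \<and> \<omega>' = \<omega> + om (f (w \<bullet> v1s)) \<and> \<mu>' = mu (f (w \<bullet> v1s))"
    using uniq[OF zero_less_one] by (elim exE conjE) (rule that)
  define r1 where "r1 = \<eta>1 / (K + 1)"
  have r1: "r1 > 0" using \<eta>1(1) K by (simp add: r1_def)
  have even: "om' \<epsilon> = om' (- \<epsilon>) \<and> \<mu> \<epsilon> = \<mu> (- \<epsilon>)" if \<epsilon>: "\<bar>\<epsilon>\<bar> \<le> \<rho>" "\<bar>\<epsilon>\<bar> < r1" for \<epsilon>
  proof (cases "\<epsilon> = 0")
    case False
    let ?w = "time_shift pi (w \<epsilon>)"
    have sp: "?w \<bullet> v1s = - \<epsilon>" "?w \<bullet> v2s = 0" by (simp_all add: shift_pairing pair)
    have "\<bar>\<epsilon>\<bar> * (K + 1) < \<eta>1" using \<epsilon>(2) K by (simp add: r1_def pos_less_divide_eq)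
    then have "\<bar>\<epsilon>\<bar> * K < \<eta>1" by (simp add: distrib_left)
    then have "norm (v \<epsilon>) + nrm ?w + \<bar>om' \<epsilon> - \<omega>\<bar> + \<bar>\<mu> \<epsilon>\<bar> < \<eta>1"
      using small[OF \<epsilon>(1)] by (simp add: nrm_time_shift[OF pair(3)])
    moreover have "(v \<epsilon>, ?w) \<noteq> (0, 0)" using sp(1) False by auto
    ultimately have "om' \<epsilon> = \<omega> + om (f (?w \<bullet> v1s)) \<and> \<mu> \<epsilon> = mu (f (?w \<bullet> v1s))"
      using \<eta>1(2)[rule_format, of ?w "v \<epsilon>" "om' \<epsilon>" "\<mu> \<epsilon>"] sp(2) W_time_shift(1)[OF pair(3)] shifted[OF pair(3) sol(1)[OF \<epsilon>(1)]]
      by blast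
    then show ?thesis unfolding sp(1) by (simp add: om'_def \<mu>_def)
  qed simp
  obtain r2 where r2: "r2 > 0" "(\<forall>x. 0 < x \<and> x < r2 \<longrightarrow> \<mu> x = 0) \<or> (\<forall>x. 0 < x \<and> x < r2 \<longrightarrow> \<mu> x > 0) \<or> (\<forall>x. 0 < x \<and> x < r2 \<longrightarrow> \<mu> x < 0)"
    by (rule psb_sign_near_0[OF \<rho> mu_psb]) (rule that)
  \<comment> \<open>Within this radius the series converge, parity holds, and the sign of
    \<open>\<mu>\<close> does not change among positive amplitudes.\<close>
  define r where "r = min \<rho> (min r1 r2)"
  have r: "r > 0" "r \<le> \<rho>" "r \<le> r1" "r \<le> r2" using \<rho> r1 r2(1) by (auto simp: r_def)
  have in_r: "\<bar>\<epsilon>\<bar> \<le> \<rho>" "\<bar>\<epsilon>\<bar> < r1" "\<bar>\<epsilon>\<bar> < r2" if "\<epsilon> \<in> {-r<..<r}" for \<epsilon> using that r by auto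
  have \<mu>0: "\<mu> 0 = 0" using f(2) linear_0[OF linear_mu] by (simp add: \<mu>_def)
  \<comment> \<open>Uniqueness is invoked again with the final \<open>r\<close>, so that amplitudes
    of nearby solutions fall into the interval of the family.\<close>
  obtain \<eta> where \<eta>: "\<eta> > 0" "\<forall>z w \<omega>' \<mu>'. w \<in> W \<and> w \<bullet> v2s = 0 \<and>
        norm z + nrm w + \<bar>\<omega>' - \<omega>\<bar> + \<bar>\<mu>'\<bar> < \<eta> \<and> (z, w) \<noteq> (0, 0) \<and> solves_system L1 D L N z w \<omega>' \<mu>' \<longrightarrow>
        \<bar>w \<bullet> v1s\<bar> < r \<and> z = fst (arg (w \<bullet> v1s) (f (w \<bullet> v1s))) \<and> w = \<kappa> (arg (w \<bullet> v1s) (f (w \<bullet> v1s)))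
          \<and> \<omega>' = \<omega> + om (f (w \<bullet> v1s)) \<and> \<mu>' = mu (f (w \<bullet> v1s))"
    using uniq[OF r(1)] by (elim exE conjE) (rule that)
  have "analytic_family UNIV norm {-r<..<r} v"
    unfolding v_def[abs_def]
    by (rule psb_analytic_family[OF F r(2) linear_fst, of _ _ 1])
       (simp_all add: norm_fst_le[of "fst p" "snd p" for p, unfolded prod.collapse])
  moreover have "analytic_family W nrm {-r<..<r} w"
    unfolding w_def[abs_def] by (rule psb_analytic_family[OF F r(2) linear_\<kappa> \<kappa>_W Ck(2,3)])
  moreover have "analytic_family UNIV abs {-r<..<r} om'"
    by (rule psb_analytic_family[OF om_psb r(2) linear_id[unfolded id_def], of _ _ 1]) simp_all
  moreover have "analytic_family UNIV abs {-r<..<r} \<mu>"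
    by (rule psb_analytic_family[OF mu_psb r(2) linear_id[unfolded id_def], of _ _ 1]) simp_all
  moreover have "\<forall>\<epsilon>\<in>{-r<..<r}. w \<epsilon> \<in> W \<and> om' \<epsilon> > 0 \<and> solves_system L1 D L N (v \<epsilon>) (w \<epsilon>) (om' \<epsilon>) (\<mu> \<epsilon>) \<and>
        w \<epsilon> \<bullet> v1s = \<epsilon> \<and> w \<epsilon> \<bullet> v2s = 0"
    using sol pair in_r(1) by blast
  moreover have limF: "(F \<longlongrightarrow> 0) (at 0)" using psb_tendsto[OF \<rho> F] F0 by simp
  then have "(v \<longlongrightarrow> 0) (at 0)" unfolding v_def[abs_def] using tendsto_fst[OF limF] by simp
  moreover have "((\<lambda>\<epsilon>. nrm (w \<epsilon> - \<epsilon> *\<^sub>R v1)) \<longlongrightarrow> 0) (at 0)"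
  proof (rule tendsto_sandwich[OF _ _ tendsto_const])
    have e: "w \<epsilon> - \<epsilon> *\<^sub>R v1 = J (fst (snd (F \<epsilon>)))" for \<epsilon> by (simp add: w_def \<kappa>_def sF)
    show "\<forall>\<^sub>F \<epsilon> in at 0. 0 \<le> nrm (w \<epsilon> - \<epsilon> *\<^sub>R v1)"
      unfolding e using W_norm_sq(2)[OF W0_W[OF J(1)]] by simp
    show "\<forall>\<^sub>F \<epsilon> in at 0. nrm (w \<epsilon> - \<epsilon> *\<^sub>R v1) \<le> CJ * norm (fst (snd (F \<epsilon>)))"
      unfolding e using CJ(2) by simp
    show "((\<lambda>\<epsilon>. CJ * norm (fst (snd (F \<epsilon>)))) \<longlongrightarrow> 0) (at 0)"
      using tendsto_mult_left[OF tendsto_norm[OF tendsto_fst[OF tendsto_snd[OF limF]]], of CJ] by simp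
  qed
  moreover have "(om' \<longlongrightarrow> \<omega>) (at 0)" using psb_tendsto[OF \<rho> om_psb] f(2) linear_0[OF linear_om] by (simp add: om'_def)
  moreover have "(\<mu> \<longlongrightarrow> 0) (at 0)" using psb_tendsto[OF \<rho> mu_psb] \<mu>0 by simp
  moreover have "\<exists>\<eta>>0. \<forall>z s \<omega>' \<mu>'.
        s \<in> W \<and> \<omega>' > 0 \<and> norm z + nrm s + \<bar>\<omega>' - \<omega>\<bar> + \<bar>\<mu>'\<bar> < \<eta> \<and>
        (z, s) \<noteq> (0, 0) \<and> solves_system L1 D L N z s \<omega>' \<mu>' \<longrightarrow>
        (\<exists>a. \<exists>\<epsilon>\<in>{-r<..<r}. \<epsilon> = time_shift a s \<bullet> v1s \<and>
           z = v \<epsilon> \<and> time_shift a s = w \<epsilon> \<and> \<omega>' = om' \<epsilon> \<and> \<mu>' = \<mu> \<epsilon>)"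
  proof (rule exI[of _ \<eta>], rule conjI[OF \<eta>(1)], intro allI impI, elim conjE)
    fix z s \<omega>' \<mu>'
    assume s: "s \<in> W" "norm z + nrm s + \<bar>\<omega>' - \<omega>\<bar> + \<bar>\<mu>'\<bar> < \<eta>" "(z, s) \<noteq> (0, 0)" "solves_system L1 D L N z s \<omega>' \<mu>'"
    obtain a where a: "cos a * (s \<bullet> v2s) - sin a * (s \<bullet> v1s) = 0" by (rule cancelling_angle)
    let ?s = "time_shift a s"
    have "(z, ?s) \<noteq> (0, 0)" using s(3) norm_time_shift[of a s] by auto
    moreover have "norm z + nrm ?s + \<bar>\<omega>' - \<omega>\<bar> + \<bar>\<mu>'\<bar> < \<eta>" using s(2) by (simp add: nrm_time_shift[OF s(1)])
    moreover have "?s \<bullet> v2s = 0" using a by (simp add: shift_pairing)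
    ultimately have "\<bar>?s \<bullet> v1s\<bar> < r \<and> z = v (?s \<bullet> v1s) \<and> ?s = w (?s \<bullet> v1s) \<and> \<omega>' = om' (?s \<bullet> v1s) \<and> \<mu>' = \<mu> (?s \<bullet> v1s)"
      using \<eta>(2)[rule_format, of ?s z \<omega>' \<mu>'] W_time_shift(1)[OF s(1)] shifted[OF s(1,4)]
      unfolding v_def w_def om'_def \<mu>_def F_def by blast
    moreover from this have "?s \<bullet> v1s \<in> {-r<..<r}" by auto
    ultimately show "\<exists>a. \<exists>\<epsilon>\<in>{-r<..<r}. \<epsilon> = time_shift a s \<bullet> v1s \<and>
           z = v \<epsilon> \<and> time_shift a s = w \<epsilon> \<and> \<omega>' = om' \<epsilon> \<and> \<mu>' = \<mu> \<epsilon>"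
      by (intro exI[of _ a] bexI[of _ "?s \<bullet> v1s"] conjI refl) blast+
  qed
  moreover have "\<forall>\<epsilon>\<in>{-r<..<r}. om' \<epsilon> = om' (- \<epsilon>) \<and> \<mu> \<epsilon> = \<mu> (- \<epsilon>)"
    using even in_r by blast
  moreover have "(\<forall>\<epsilon>\<in>{-r<..<r}. \<mu> \<epsilon> = 0) \<or> subcritical {-r<..<r} \<mu> \<or> supercritical {-r<..<r} \<mu>"
  proof -
    \<comment> \<open>Parity transfers the sign from positive to negative amplitudes, which excludes
      a two-sided bifurcation.\<close>
    have ab: "\<mu> \<epsilon> = \<mu> \<bar>\<epsilon>\<bar>" if "\<epsilon> \<in> {-r<..<r}" for \<epsilon>
      using even[OF in_r(1,2)[OF that]] by (cases "\<epsilon> \<ge> 0") auto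
    consider "\<forall>x. 0 < x \<and> x < r2 \<longrightarrow> \<mu> x = 0" | "\<forall>x. 0 < x \<and> x < r2 \<longrightarrow> \<mu> x > 0" | "\<forall>x. 0 < x \<and> x < r2 \<longrightarrow> \<mu> x < 0"
      using r2(2) by blast
    then show ?thesis
    proof cases
      case 1
      have "\<mu> \<epsilon> = 0" if "\<epsilon> \<in> {-r<..<r}" for \<epsilon>
        using ab[OF that] 1[rule_format, of "\<bar>\<epsilon>\<bar>"] in_r(3)[OF that] \<mu>0 by (cases "\<epsilon> = 0") auto
      then show ?thesis by blast
    next
      case 2
      have "\<mu> \<epsilon> > 0" if "\<epsilon> \<in> {-r<..<r}" "\<epsilon> \<noteq> 0" for \<epsilon>
        using ab[OF that(1)] 2[rule_format, of "\<bar>\<epsilon>\<bar>"] in_r(3)[OF that(1)] that(2) by simp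
      then show ?thesis unfolding supercritical_def by blast
    next
      case 3
      have "\<mu> \<epsilon> < 0" if "\<epsilon> \<in> {-r<..<r}" "\<epsilon> \<noteq> 0" for \<epsilon>
        using ab[OF that(1)] 3[rule_format, of "\<bar>\<epsilon>\<bar>"] in_r(3)[OF that(1)] that(2) by simp
      then show ?thesis unfolding subcritical_def by blast
    qed
  qed
  ultimately show ?thesis
    by - (rule exI[of _ r], rule conjI[OF r(1)], rule exI[of _ v], rule exI[of _ w], rule exI[of _ om'], rule exI[of _ \<mu>],
        intro conjI; assumption)
qed

end

section \<open>Complex spectral hypotheses in real form, and the conclusion\<close>

theorem theorem3p1:
  fixes L1 :: "'x::banach \<Rightarrow> 'y::banach"
    and D :: "'h::{real_inner, complete_space} set" and L2 :: "'h \<Rightarrow> 'h"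
    and \<theta> \<nu>0 :: complex and \<omega>0 :: real
    and N :: "'x \<Rightarrow> 'h per_L2 \<Rightarrow> real \<Rightarrow> 'y \<times> 'h per_L2"
    and R :: "nat \<Rightarrow> nat \<Rightarrow> nat \<Rightarrow> 'x list \<Rightarrow> 'h per_L2 list \<Rightarrow> 'y"
    and S :: "nat \<Rightarrow> nat \<Rightarrow> nat \<Rightarrow> 'x list \<Rightarrow> 'h per_L2 list \<Rightarrow> 'h per_L2"
    and \<delta> :: real and v0 v0s :: "'h \<times> 'h" and v1 v1s v2s :: "'h per_L2"
  assumes L1: "bounded_linear L1"
    and L2: "densely_defined_closed D L2"
    and \<theta>: "- \<theta> \<in> resolvent_set D L2"
    and N_range: "\<And>v w \<mu>. w \<in> W_per0 D L2 \<Longrightarrow> snd (N v w \<mu>) \<in> H_per0"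
    and N_autonomous: "\<And>v w \<mu> s. w \<in> W_per0 D L2 \<Longrightarrow>
          N v (time_shift s w) \<mu> = (fst (N v w \<mu>), time_shift s (snd (N v w \<mu>)))"
    and H1: "\<exists>L1inv. homeomorphism UNIV UNIV L1 L1inv"
    and \<nu>0: "\<nu>0 = \<i> * of_real \<omega>0" "\<omega>0 > 0"
    and H2: "\<nu>0 \<in> spectrum D L2" "simple_eigenvalue D L2 \<nu>0"
          "\<And>k::int. k \<ge> 2 \<Longrightarrow> of_int k * \<nu>0 \<notin> spectrum D L2"
    and H3: "fredholm_of_index (W_per0 D L2) (W_per0_norm L2 \<theta>) H_per0
          (\<lambda>w. \<omega>0 *\<^sub>R time_deriv w + lift_op D L2 w) 0"
    and H4_multilinear:
          "\<And>k l m. bounded_multilinear k l (W_per0 D L2) (W_per0_norm L2 \<theta>) UNIV (R k l m)"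
          "\<And>k l m. bounded_multilinear k l (W_per0 D L2) (W_per0_norm L2 \<theta>) H_per0 (S k l m)"
    and H4_expansion: "\<delta> > 0"
          "\<And>v w \<mu>. w \<in> W_per0 D L2 \<Longrightarrow> norm v + W_per0_norm L2 \<theta> w + \<bar>\<mu>\<bar> < \<delta> \<Longrightarrow>
             abs_convergent_expansion R v w \<mu> (fst (N v w \<mu>)) \<and>
             abs_convergent_expansion S v w \<mu> (snd (N v w \<mu>))"
    and H4_vanishing:
          "\<And>k l m. k + l + m \<le> 1 \<Longrightarrow>
             multilinear_zero k l (W_per0 D L2) (R k l m) \<and> multilinear_zero k l (W_per0 D L2) (S k l m)"
          "multilinear_zero 0 1 (W_per0 D L2) (R 0 1 1)"
          "\<And>m. m \<ge> 2 \<Longrightarrow>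
             multilinear_zero 0 0 (W_per0 D L2) (R 0 0 m) \<and> multilinear_zero 0 0 (W_per0 D L2) (S 0 0 m)"
    and v0: "unique_normalized_eigenvector D L2 \<nu>0 v0"
    and v0s: "v0s \<in> cnull (adjoint_domain D L2) (adjoint_op D L2) \<nu>0"
          "cbilinear v0s v0 = of_real (1 / pi)"
    and v1: "v1 = abs_per_L2 (\<lambda>t. fst (cscale (exp (- \<i> * of_real t)) v0))"
    and v1s: "v1s = abs_per_L2 (\<lambda>t. fst (cscale (exp (\<i> * of_real t)) v0s))"
    and v2s: "v2s = abs_per_L2 (\<lambda>t. snd (cscale (exp (\<i> * of_real t)) v0s))"
    and transversality: "S 0 1 1 [] [v1] \<bullet> v1s \<noteq> 0"
  shows "\<exists>r>0. \<exists>v w \<omega> \<mu>.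
    \<comment> \<open>existence\<close>
    (analytic_family UNIV norm {-r<..<r} v \<and>
     analytic_family (W_per0 D L2) (W_per0_norm L2 \<theta>) {-r<..<r} w \<and>
     analytic_family UNIV abs {-r<..<r} \<omega> \<and>
     analytic_family UNIV abs {-r<..<r} \<mu> \<and>
     (\<forall>\<epsilon>\<in>{-r<..<r}.
        w \<epsilon> \<in> W_per0 D L2 \<and> \<omega> \<epsilon> > 0 \<and>
        solves_system L1 D L2 N (v \<epsilon>) (w \<epsilon>) (\<omega> \<epsilon>) (\<mu> \<epsilon>) \<and>
        w \<epsilon> \<bullet> v1s = \<epsilon> \<and> w \<epsilon> \<bullet> v2s = 0) \<and>
     (v \<longlongrightarrow> 0) (at 0) \<and>
     ((\<lambda>\<epsilon>. W_per0_norm L2 \<theta> (w \<epsilon> - \<epsilon> *\<^sub>R v1)) \<longlongrightarrow> 0) (at 0) \<and>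
     (\<omega> \<longlongrightarrow> \<omega>0) (at 0) \<and> (\<mu> \<longlongrightarrow> 0) (at 0)) \<and>
    \<comment> \<open>uniqueness\<close>
    (\<exists>\<eta>>0. \<forall>z s \<omega>' \<mu>'.
        s \<in> W_per0 D L2 \<and> \<omega>' > 0 \<and>
        norm z + W_per0_norm L2 \<theta> s + \<bar>\<omega>' - \<omega>0\<bar> + \<bar>\<mu>'\<bar> < \<eta> \<and>
        (z, s) \<noteq> (0, 0) \<and> solves_system L1 D L2 N z s \<omega>' \<mu>' \<longrightarrow>
        (\<exists>a. \<exists>\<epsilon>\<in>{-r<..<r}. \<epsilon> = time_shift a s \<bullet> v1s \<and>
           z = v \<epsilon> \<and> time_shift a s = w \<epsilon> \<and> \<omega>' = \<omega> \<epsilon> \<and> \<mu>' = \<mu> \<epsilon>)) \<and>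
    \<comment> \<open>parity\<close>
    (\<forall>\<epsilon>\<in>{-r<..<r}. \<omega> \<epsilon> = \<omega> (- \<epsilon>) \<and> \<mu> \<epsilon> = \<mu> (- \<epsilon>)) \<and>
    ((\<forall>\<epsilon>\<in>{-r<..<r}. \<mu> \<epsilon> = 0) \<or>
     subcritical {-r<..<r} \<mu> \<or> supercritical {-r<..<r} \<mu>)"
proof -
  obtain a b as bs where ab: "v0 = (a, b)" "v0s = (as, bs)" by (metis surj_pair)
  interpret closed_operator D L2 by unfold_locales (rule L2)
  have Re\<nu>: "Re \<nu>0 = 0" "Im \<nu>0 = \<omega>0" by (simp_all add: \<nu>0)
  \<comment> \<open>The complex eigenvalue equation split into real and imaginary part, for an
    arbitrary operator so that it covers \<open>L2\<close> and its adjoint.\<close>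
  have null: "(x, y) \<in> cnull E T \<nu>0 \<longleftrightarrow> x \<in> E \<and> y \<in> E \<and> T x = - \<omega>0 *\<^sub>R y \<and> T y = \<omega>0 *\<^sub>R x" for E x y and T :: "'h \<Rightarrow> 'h"
    by (simp add: cnull_def cshifted_def cscale_def Re\<nu> zero_prod_def eq_neg_iff_add_eq_0)
  have v0n: "(a, b) \<in> cnull D L2 \<nu>0" "norm (a, b) = 1"
    "\<And>u. u \<in> cnull D L2 \<nu>0 \<Longrightarrow> norm u = 1 \<Longrightarrow> \<exists>c. cmod c = 1 \<and> u = cscale c (a, b)"
    using v0 by (auto simp: unique_normalized_eigenvector_def ab)
  have eig: "a \<in> D" "b \<in> D" "L2 a = - \<omega>0 *\<^sub>R b" "L2 b = \<omega>0 *\<^sub>R a" using v0n(1) by (simp_all add: null)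
  have vs: "as \<in> adjoint_domain D L2" "bs \<in> adjoint_domain D L2" "adjoint_op D L2 as = - \<omega>0 *\<^sub>R bs" "adjoint_op D L2 bs = \<omega>0 *\<^sub>R as"
    using v0s(1) by (simp_all add: null ab)
  have nrml: "a \<bullet> as - b \<bullet> bs = 1 / pi" "a \<bullet> bs + b \<bullet> as = 0"
    using v0s(2) by (simp_all add: ab cbilinear_def complex_eq_iff inner_commute)
  \<comment> \<open>A nonzero null vector is scaled to norm one and compared with the normalized
    eigenvector; the unimodular factor times the norm supplies \<open>c\<close> and
    \<open>d\<close>.\<close>
  have simple: "\<exists>c d. x = c *\<^sub>R a - d *\<^sub>R b \<and> y = c *\<^sub>R b + d *\<^sub>R a"
    if x: "x \<in> D" "y \<in> D" "L2 x = - \<omega>0 *\<^sub>R y" "L2 y = \<omega>0 *\<^sub>R x" for x y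
  proof (cases "(x, y) = (0, 0)")
    case True
    then show ?thesis by (intro exI[of _ 0]) simp
  next
    case False
    define n where "n = norm (x, y)"
    have n: "n > 0" using False by (simp add: n_def zero_prod_def)
    have "((1 / n) *\<^sub>R x, (1 / n) *\<^sub>R y) \<in> cnull D L2 \<nu>0"
      unfolding null using x subspace_scale[OF subspace_D] by (simp add: L_scaleR)
    moreover have "norm ((1 / n) *\<^sub>R x, (1 / n) *\<^sub>R y) = 1"
      using n norm_scaleR[of "1 / n" "(x, y)"] by (simp add: n_def)
    ultimately obtain c where "((1 / n) *\<^sub>R x, (1 / n) *\<^sub>R y) = cscale c (a, b)" using v0n(3) by blast
    then have "(1 / n) *\<^sub>R x = Re c *\<^sub>R a - Im c *\<^sub>R b" "(1 / n) *\<^sub>R y = Re c *\<^sub>R b + Im c *\<^sub>R a"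
      by (simp_all add: cscale_def)
    from arg_cong[OF this(1), of "scaleR n"] arg_cong[OF this(2), of "scaleR n"] n
    have "x = (n * Re c) *\<^sub>R a - (n * Im c) *\<^sub>R b \<and> y = (n * Re c) *\<^sub>R b + (n * Im c) *\<^sub>R a"
      by (simp add: scaleR_diff_right scaleR_add_right)
    then show ?thesis by blast
  qed
  \<comment> \<open>Outside the spectrum the shifted operator is injective, and
    \<open>(x, y)\<close> has the same image as zero.\<close>
  have nonres: "x = 0 \<and> y = 0"
    if k: "k \<ge> 2" and x: "x \<in> D" "y \<in> D" "L2 x = - (\<omega>0 * real k) *\<^sub>R y" "L2 y = (\<omega>0 * real k) *\<^sub>R x" for k :: nat and x y
  proof -
    have "of_int (int k) * \<nu>0 \<notin> spectrum D L2" by (rule H2(3)) (use k in simp)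
    then have inj: "inj_on (cshifted L2 (of_int (int k) * \<nu>0)) (D \<times> D)"
      by (simp add: spectrum_def resolvent_set_def bij_betw_def)
    have "cshifted L2 (of_int (int k) * \<nu>0) (x, y) = cshifted L2 (of_int (int k) * \<nu>0) (0, 0)"
      using x by (simp add: cshifted_def cscale_def Re\<nu> L_0 mult.commute)
    from inj_onD[OF inj this] x(1,2) subspace_0[OF subspace_D] show ?thesis by simp
  qed
  interpret hopf D L2 a b as bs \<omega>0 "W_per0_norm L2 \<theta>"
    by unfold_locales
      (fact \<nu>0(2) eig nrml simple nonres H3 | simp add: adjoint_op_eq vs)+
  have e: "Re (exp (\<i> * of_real t)) = cos t" "Im (exp (\<i> * of_real t)) = sin t"
    "Re (exp (- \<i> * of_real t)) = cos t" "Im (exp (- \<i> * of_real t)) = - sin t" for t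
    by (simp_all add: Re_exp Im_exp)
  have vv: "local.v1 = v1" "local.v1s = v1s" "local.v2s = v2s"
  proof -
    show "local.v1 = v1"
      unfolding v1 v1_def ab cscale_def fst_conv snd_conv e abs_per_L2_tens[OF pc(1,2), symmetric] by simp
    have u: "- tens sin bs = tens sin (- bs)" using tens_scaleR[OF pc(2), of "-1" bs] by simp
    show "local.v1s = v1s"
      unfolding v1s v1s_def ab cscale_def fst_conv snd_conv e diff_conv_add_uminus[of "tens cos as"] u
        abs_per_L2_tens[OF pc(1,2), symmetric] by simp
    show "local.v2s = v2s"
      unfolding v2s v2s_def ab cscale_def fst_conv snd_conv e abs_per_L2_tens[OF pc(1,2), symmetric] by simp
  qed
  obtain Li where hom: "homeomorphism UNIV UNIV L1 Li" using H1 by blast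
  have inv: "Li (L1 x) = x" "L1 (Li y) = y" for x y
    using hom by (simp_all add: homeomorphism_def)
  interpret L1: bounded_linear L1 by (rule L1)
  have "linear Li"
  proof (rule linearI)
    fix x y r
    show "Li (x + y) = Li x + Li y" by (metis L1.add inv)
    show "Li (r *\<^sub>R x) = r *\<^sub>R Li x" by (metis L1.scaleR inv)
  qed
  then interpret Li: linear Li .
  \<comment> \<open>The homeomorphism makes the inverse continuous at zero; scaling vectors into the
    corresponding ball turns this into a norm bound.\<close>
  have Li: "bounded_linear Li"
  proof -
    have "isCont Li 0" using hom by (simp add: homeomorphism_def continuous_on_eq_continuous_at)
    then obtain d where d: "d > 0" "\<And>y. norm y < d \<Longrightarrow> norm (Li y) < 1"
      unfolding LIM_eq isCont_def by (metis Li.zero diff_zero norm_zero zero_less_one)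
    show ?thesis
    proof (rule bounded_linear_intro[OF Li.add Li.scale])
      fix y
      show "norm (Li y) \<le> norm y * (2 / d)"
      proof (cases "y = 0")
        case False
        define t where "t = d / (2 * norm y)"
        have t: "t > 0" "norm (t *\<^sub>R y) < d" using d(1) False by (simp_all add: t_def)
        have "t * norm (Li y) < 1" using d(2)[OF t(2)] t(1) by (simp add: Li.scale)
        then have "norm (Li y) < 1 / t" using t(1) by (simp add: pos_less_divide_eq mult.commute)
        then show ?thesis by (simp add: t_def mult.commute)
      qed (simp add: Li.zero)
    qed
  qed
  interpret bifurcation D L2 a b as bs \<omega>0 \<theta> L1 Li N R S \<delta>
    by (rule bifurcation.intro[OF hopf_axioms], rule bifurcation_axioms.intro)
      (fact L1 Li inv \<theta> N_range H4_multilinear H4_expansion H4_vanishing transversality[folded vv])+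
  show ?thesis
    using bifurcating_branch[OF N_autonomous] unfolding vv .
qed

end
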